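(* The functors $\mathcal{R}\otimes_R(-)$ and $\mathcal{R}'\otimes_R(-)$ of tensoring with the bimodule complexes $\mathcal{R}$ and $\mathcal{R}'$ are mutually inverse (up to isomorphism of functors) functors on the homotopy category of complexes of graded $R$-modules.
   Context: Let $\mathbf{k}$ be a commutative ring and $R=\mathbf{k}\langle x_1,x_2\rangle/(x_1x_2+x_2x_1)$, graded with $\deg x_1=\deg x_2=2$. Let $s$ be the $\mathbf{k}$-algebra automorphism of $R$ with $s(x_1)=-x_2$, $s(x_2)=-x_1$. The odd Demazure operator is the $\mathbf{k}$-linear map $\partial:R\to R$ with $\partial(1)=0$, $\partial(x_1)=\partial(x_2)=1$ and $\partial(fg)=\partial(f)g+s(f)\partial(g)$. Let $R^s=\ker\partial\subset R$, a graded subring stable under $s$, generated by $x_1-x_2$ and $x_1x_2$. Let $\underline{R}^s$ be the graded $R^s$-bimodule free of rank one on either side on a generator $\underline{1}^s$ of degree $0$, with $f\,\underline{1}^s=\underline{1}^s\,s(f)$ for $f\in R^s$. Grading shift: $M\{n\}_i=M_{i-n}$. Define graded $R$-bimodules $$B=R\otimes_{R^s}R\{-1\},\qquad \underline{B}=R\otimes_{R^s}\underline{R}^s\otimes_{R^s}R\{-1\}.$$ Let $m:B\to R\{-1\}$ be the degree-preserving bimodule map $f\otimes g\mapsto fg$, and let $\underline{\Delta}:R\{1\}\to\underline{B}$ be the degree-preserving bimodule map with $$\underline{\Delta}(1)=-x_2\otimes\underline{1}^s\otimes 1-1\otimes\underline{1}^s\otimes x_1 .$$ The odd Rouquier complexes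 are the two-term complexes of graded $R$-bimodules $$\mathcal{R}:\ 0\to B\xrightarrow{\,m\,}R\{-1\}\to 0,\qquad \mathcal{R}':\ 0\to R\{1\}\xrightarrow{\,\underline{\Delta}\,}\underline{B}\to 0,$$ with $B$ and $\underline{B}$ placed in cohomological degree $0$. Graded $R$-modules are graded left $R$-modules with degree-zero maps. *)

theory Defs
  imports "HOL-Algebra.Module" "HOL-Algebra.QuotRing" "HOL-Algebra.Free_Abelian_Groups"
begin

section \<open>Graded rings, modules and bimodules\<close>

text \<open>
  Rings are not assumed commutative, so the locale \<^locale>\<open>module\<close> of HOL-Algebra does not apply;
  only its record type is reused. That record inherits the fields \<^const>\<open>mult\<close> and \<^const>\<open>one\<close>
  from rings; they carry no meaning for modules.
\<close>

record 'r gring = "'r ring" +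
  deg_part :: "int \<Rightarrow> 'r set"

record ('r, 'm) gmod = "('r, 'm) module" +
  gr_part :: "int \<Rightarrow> 'm set"

record ('r, 'm) gbimod = "('r, 'm) gmod" +
  rsmult :: "'m \<Rightarrow> 'r \<Rightarrow> 'm"

locale left_module = R?: ring R + M?: abelian_group M
  for R (structure) and M (structure) +
  assumes smult_closed: "\<lbrakk>a \<in> carrier R; x \<in> carrier M\<rbrakk> \<Longrightarrow> a \<odot>\<^bsub>M\<^esub> x \<in> carrier M"
    and smult_l_distr: "\<lbrakk>a \<in> carrier R; b \<in> carrier R; x \<in> carrier M\<rbrakk> \<Longrightarrow>
      (a \<oplus>\<^bsub>R\<^esub> b) \<odot>\<^bsub>M\<^esub> x = a \<odot>\<^bsub>M\<^esub> x \<oplus>\<^bsub>M\<^esub> b \<odot>\<^bsub>M\<^esub> x"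
    and smult_r_distr: "\<lbrakk>a \<in> carrier R; x \<in> carrier M; y \<in> carrier M\<rbrakk> \<Longrightarrow>
      a \<odot>\<^bsub>M\<^esub> (x \<oplus>\<^bsub>M\<^esub> y) = a \<odot>\<^bsub>M\<^esub> x \<oplus>\<^bsub>M\<^esub> a \<odot>\<^bsub>M\<^esub> y"
    and smult_assoc: "\<lbrakk>a \<in> carrier R; b \<in> carrier R; x \<in> carrier M\<rbrakk> \<Longrightarrow>
      (a \<otimes>\<^bsub>R\<^esub> b) \<odot>\<^bsub>M\<^esub> x = a \<odot>\<^bsub>M\<^esub> (b \<odot>\<^bsub>M\<^esub> x)"
    and smult_one: "x \<in> carrier M \<Longrightarrow> \<one>\<^bsub>R\<^esub> \<odot>\<^bsub>M\<^esub> x = x"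

text \<open>The last assumption says that the module is the internal direct sum of its graded parts.\<close>

locale graded_left_module = left_module R M
  for R :: "('r, 'x) gring_scheme" (structure) and M :: "('r, 'm, 'y) gmod_scheme" (structure) +
  assumes gr_part_subgroup: "\<And>i. additive_subgroup (gr_part M i) M"
    and gr_part_smult: "\<And>i j a x. \<lbrakk>a \<in> deg_part R i; x \<in> gr_part M j\<rbrakk> \<Longrightarrow>
      a \<odot>\<^bsub>M\<^esub> x \<in> gr_part M (i + j)"
    and gr_part_direct_sum: "\<And>x. x \<in> carrier M \<Longrightarrow>
      \<exists>!c. (\<forall>i. c i \<in> gr_part M i) \<and> finite {i. c i \<noteq> \<zero>\<^bsub>M\<^esub>} \<and>
           x = (\<Oplus>\<^bsub>M\<^esub>i\<in>{i. c i \<noteq> \<zero>\<^bsub>M\<^esub>}. c i)"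

definition gmod_hom ::
  "('r, 'x) gring_scheme \<Rightarrow> ('r, 'm, 'y) gmod_scheme \<Rightarrow> ('r, 'n, 'z) gmod_scheme \<Rightarrow> ('m \<Rightarrow> 'n) set" where
  "gmod_hom R M N = {f \<in> carrier M \<rightarrow> carrier N.
     (\<forall>x\<in>carrier M. \<forall>y\<in>carrier M. f (x \<oplus>\<^bsub>M\<^esub> y) = f x \<oplus>\<^bsub>N\<^esub> f y) \<and>
     (\<forall>a\<in>carrier R. \<forall>x\<in>carrier M. f (a \<odot>\<^bsub>M\<^esub> x) = a \<odot>\<^bsub>N\<^esub> f x) \<and>
     (\<forall>i. f ` gr_part M i \<subseteq> gr_part N i)}"

definition gbimod_hom ::
  "('r, 'x) gring_scheme \<Rightarrow> ('r, 'm, 'y) gbimod_scheme \<Rightarrow> ('r, 'n, 'z) gbimod_scheme \<Rightarrow> ('m \<Rightarrow> 'n) set" where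
  "gbimod_hom R M N = {f \<in> gmod_hom R M N.
     \<forall>x\<in>carrier M. \<forall>a\<in>carrier R. f (rsmult M x a) = rsmult N (f x) a}"

definition gr_shift :: "int \<Rightarrow> ('r, 'm, 'y) gmod_scheme \<Rightarrow> ('r, 'm, 'y) gmod_scheme" where
  "gr_shift n M = M\<lparr>gr_part := (\<lambda>i. gr_part M (i - n))\<rparr>"

definition regular_bimod :: "('r, 'x) gring_scheme \<Rightarrow> ('r, 'r) gbimod" where
  "regular_bimod R = \<lparr>carrier = carrier R, mult = mult R, one = one R, ring.zero = ring.zero R, add = add R,
     smult = mult R, gr_part = deg_part R, rsmult = mult R\<rparr>"

definition gmod_sum :: "('r, 'm, 'y) gmod_scheme \<Rightarrow> ('r, 'n, 'z) gmod_scheme \<Rightarrow> ('r, 'm \<times> 'n) gmod" where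
  "gmod_sum M N = \<lparr>carrier = carrier M \<times> carrier N, mult = undefined, one = undefined,
     ring.zero = (\<zero>\<^bsub>M\<^esub>, \<zero>\<^bsub>N\<^esub>),
     add = (\<lambda>(x, y) (x', y'). (x \<oplus>\<^bsub>M\<^esub> x', y \<oplus>\<^bsub>N\<^esub> y')),
     smult = (\<lambda>a (x, y). (a \<odot>\<^bsub>M\<^esub> x, a \<odot>\<^bsub>N\<^esub> y)),
     gr_part = (\<lambda>i. gr_part M i \<times> gr_part N i)\<rparr>"


section \<open>Tensor products over a noncommutative ring\<close>

definition tensor_free ::
  "('r, 'm, 'y) gbimod_scheme \<Rightarrow> ('r, 'n, 'z) gmod_scheme \<Rightarrow> ('m \<times> 'n \<Rightarrow>\<^sub>0 int) monoid" where
  "tensor_free M N = free_Abelian_group (carrier M \<times> carrier N)"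

definition tensor_relators ::
  "('r, 'x) gring_scheme \<Rightarrow> ('r, 'm, 'y) gbimod_scheme \<Rightarrow> ('r, 'n, 'z) gmod_scheme \<Rightarrow> ('m \<times> 'n \<Rightarrow>\<^sub>0 int) set" where
  "tensor_relators A M N =
     {frag_of (x \<oplus>\<^bsub>M\<^esub> x', y) - frag_of (x, y) - frag_of (x', y) | x x' y.
        x \<in> carrier M \<and> x' \<in> carrier M \<and> y \<in> carrier N} \<union>
     {frag_of (x, y \<oplus>\<^bsub>N\<^esub> y') - frag_of (x, y) - frag_of (x, y') | x y y'.
        x \<in> carrier M \<and> y \<in> carrier N \<and> y' \<in> carrier N} \<union>
     {frag_of (rsmult M x a, y) - frag_of (x, a \<odot>\<^bsub>N\<^esub> y) | x a y.
        x \<in> carrier M \<and> a \<in> carrier A \<and> y \<in> carrier N}"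

definition tensor_null ::
  "('r, 'x) gring_scheme \<Rightarrow> ('r, 'm, 'y) gbimod_scheme \<Rightarrow> ('r, 'n, 'z) gmod_scheme \<Rightarrow> ('m \<times> 'n \<Rightarrow>\<^sub>0 int) set" where
  "tensor_null A M N = generate (tensor_free M N) (tensor_relators A M N)"

definition tensor_group ::
  "('r, 'x) gring_scheme \<Rightarrow> ('r, 'm, 'y) gbimod_scheme \<Rightarrow> ('r, 'n, 'z) gmod_scheme \<Rightarrow> ('m \<times> 'n \<Rightarrow>\<^sub>0 int) set monoid" where
  "tensor_group A M N = tensor_free M N Mod tensor_null A M N"

definition tensor_class ::
  "('r, 'x) gring_scheme \<Rightarrow> ('r, 'm, 'y) gbimod_scheme \<Rightarrow> ('r, 'n, 'z) gmod_scheme \<Rightarrow>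
   ('m \<times> 'n \<Rightarrow>\<^sub>0 int) \<Rightarrow> ('m \<times> 'n \<Rightarrow>\<^sub>0 int) set" where
  "tensor_class A M N p = tensor_null A M N #>\<^bsub>tensor_free M N\<^esub> p"

definition pure_tensor ::
  "('r, 'x) gring_scheme \<Rightarrow> ('r, 'm, 'y) gbimod_scheme \<Rightarrow> ('r, 'n, 'z) gmod_scheme \<Rightarrow>
   'm \<Rightarrow> 'n \<Rightarrow> ('m \<times> 'n \<Rightarrow>\<^sub>0 int) set" where
  "pure_tensor A M N x y = tensor_class A M N (frag_of (x, y))"

text \<open>
  The map on cosets induced by \<open>(x, y) \<mapsto> f x \<otimes> g y\<close>. When \<open>f\<close> and \<open>g\<close> are compatible with
  the relators, all representatives \<open>p\<close> of \<open>X\<close> give the same coset, and the union is that coset.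
\<close>

definition tensor_map ::
  "('r, 'x) gring_scheme \<Rightarrow> ('r, 'm, 'y) gbimod_scheme \<Rightarrow> ('r, 'n, 'z) gmod_scheme \<Rightarrow>
   ('m0 \<Rightarrow> 'm) \<Rightarrow> ('n0 \<Rightarrow> 'n) \<Rightarrow> ('m0 \<times> 'n0 \<Rightarrow>\<^sub>0 int) set \<Rightarrow> ('m \<times> 'n \<Rightarrow>\<^sub>0 int) set" where
  "tensor_map A M N f g X =
     (\<Union>p\<in>X. tensor_class A M N (frag_extend (\<lambda>(x, y). frag_of (f x, g y)) p))"

definition tensor_mod ::
  "('r, 'x) gring_scheme \<Rightarrow> ('r, 'm, 'y) gbimod_scheme \<Rightarrow> ('r, 'n, 'z) gmod_scheme \<Rightarrow>
   ('r, ('m \<times> 'n \<Rightarrow>\<^sub>0 int) set) gmod" where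
  "tensor_mod A M N = \<lparr>carrier = carrier (tensor_group A M N), mult = undefined, one = undefined,
     ring.zero = one (tensor_group A M N), add = mult (tensor_group A M N),
     smult = (\<lambda>a. tensor_map A M N (\<lambda>x. a \<odot>\<^bsub>M\<^esub> x) (\<lambda>y. y)),
     gr_part = (\<lambda>n. generate (tensor_group A M N)
        {pure_tensor A M N x y | x y i j. x \<in> gr_part M i \<and> y \<in> gr_part N j \<and> i + j = n})\<rparr>"

definition tensor_bimod ::
  "('r, 'x) gring_scheme \<Rightarrow> ('r, 'm, 'y) gbimod_scheme \<Rightarrow> ('r, 'n, 'z) gbimod_scheme \<Rightarrow>
   ('r, ('m \<times> 'n \<Rightarrow>\<^sub>0 int) set) gbimod" where
  "tensor_bimod A M N = gmod.extend (tensor_mod A M N)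
     (gbimod.fields (\<lambda>X a. tensor_map A M N (\<lambda>x. x) (\<lambda>y. rsmult N y a) X))"


section \<open>The homotopy category of complexes of graded modules\<close>

text \<open>
  Objects are unbounded cochain complexes of graded left modules whose carriers are subsets of a
  type. Hom sets are defined between complexes over possibly different carrier types, because
  tensoring changes the carrier type.
\<close>

record ('r, 'm) cpx =
  ob :: "int \<Rightarrow> ('r, 'm) gmod"
  diff :: "int \<Rightarrow> 'm \<Rightarrow> 'm"

definition is_cpx :: "('r, 'x) gring_scheme \<Rightarrow> ('r, 'm) cpx \<Rightarrow> bool" where
  "is_cpx R X \<longleftrightarrow> (\<forall>n. graded_left_module R (ob X n) \<and>
     diff X n \<in> gmod_hom R (ob X n) (ob X (n + 1)) \<and>
     (\<forall>x\<in>carrier (ob X n). diff X (n + 1) (diff X n x) = \<zero>\<^bsub>ob X (n + 1 + 1)\<^esub>))"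

definition chain_maps ::
  "('r, 'x) gring_scheme \<Rightarrow> ('r, 'a) cpx \<Rightarrow> ('r, 'b) cpx \<Rightarrow> (int \<Rightarrow> 'a \<Rightarrow> 'b) set" where
  "chain_maps R X Y = {f. \<forall>n. f n \<in> gmod_hom R (ob X n) (ob Y n) \<and>
     (\<forall>x\<in>carrier (ob X n). f (n + 1) (diff X n x) = diff Y n (f n x))}"

definition homotopic_maps ::
  "('r, 'x) gring_scheme \<Rightarrow> ('r, 'a) cpx \<Rightarrow> ('r, 'b) cpx \<Rightarrow> (int \<Rightarrow> 'a \<Rightarrow> 'b) \<Rightarrow> (int \<Rightarrow> 'a \<Rightarrow> 'b) \<Rightarrow> bool" where
  "homotopic_maps R X Y f g \<longleftrightarrow> (\<exists>h.
     (\<forall>n. h n \<in> gmod_hom R (ob X n) (ob Y (n - 1))) \<and>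
     (\<forall>n. \<forall>x\<in>carrier (ob X n). f n x =
        g n x \<oplus>\<^bsub>ob Y n\<^esub> (diff Y (n - 1) (h n x) \<oplus>\<^bsub>ob Y n\<^esub> h (n + 1) (diff X n x))))"

definition homotopy_rel ::
  "('r, 'x) gring_scheme \<Rightarrow> ('r, 'a) cpx \<Rightarrow> ('r, 'b) cpx \<Rightarrow> (int \<Rightarrow> 'a \<Rightarrow> 'b) rel" where
  "homotopy_rel R X Y =
     {(f, g). f \<in> chain_maps R X Y \<and> g \<in> chain_maps R X Y \<and> homotopic_maps R X Y f g}"

definition Khom ::
  "('r, 'x) gring_scheme \<Rightarrow> ('r, 'a) cpx \<Rightarrow> ('r, 'b) cpx \<Rightarrow> (int \<Rightarrow> 'a \<Rightarrow> 'b) set set" where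
  "Khom R X Y = chain_maps R X Y // homotopy_rel R X Y"

definition Kid :: "('r, 'x) gring_scheme \<Rightarrow> ('r, 'a) cpx \<Rightarrow> (int \<Rightarrow> 'a \<Rightarrow> 'a) set" where
  "Kid R X = homotopy_rel R X X `` {\<lambda>n x. x}"

definition Kcomp ::
  "('r, 'x) gring_scheme \<Rightarrow> ('r, 'a) cpx \<Rightarrow> ('r, 'c) cpx \<Rightarrow>
   (int \<Rightarrow> 'b \<Rightarrow> 'c) set \<Rightarrow> (int \<Rightarrow> 'a \<Rightarrow> 'b) set \<Rightarrow> (int \<Rightarrow> 'a \<Rightarrow> 'c) set" where
  "Kcomp R X Z \<psi> \<phi> = (\<Union>g\<in>\<psi>. \<Union>f\<in>\<phi>. homotopy_rel R X Z `` {\<lambda>n. g n \<circ> f n})"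

definition Kiso ::
  "('r, 'x) gring_scheme \<Rightarrow> ('r, 'a) cpx \<Rightarrow> ('r, 'b) cpx \<Rightarrow> (int \<Rightarrow> 'a \<Rightarrow> 'b) set \<Rightarrow> bool" where
  "Kiso R X Y \<phi> \<longleftrightarrow> \<phi> \<in> Khom R X Y \<and>
     (\<exists>\<psi>\<in>Khom R Y X. Kcomp R X X \<psi> \<phi> = Kid R X \<and> Kcomp R Y Y \<phi> \<psi> = Kid R Y)"

record ('r, 'a, 'b) kfunctor =
  fob :: "('r, 'a) cpx \<Rightarrow> ('r, 'b) cpx"
  fmor :: "('r, 'a) cpx \<Rightarrow> ('r, 'a) cpx \<Rightarrow> (int \<Rightarrow> 'a \<Rightarrow> 'a) set \<Rightarrow> (int \<Rightarrow> 'b \<Rightarrow> 'b) set"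

definition is_kfunctor :: "('r, 'x) gring_scheme \<Rightarrow> ('r, 'a, 'b) kfunctor \<Rightarrow> bool" where
  "is_kfunctor R F \<longleftrightarrow>
     (\<forall>X. is_cpx R X \<longrightarrow> is_cpx R (fob F X)) \<and>
     (\<forall>X Y \<phi>. is_cpx R X \<and> is_cpx R Y \<and> \<phi> \<in> Khom R X Y \<longrightarrow>
        fmor F X Y \<phi> \<in> Khom R (fob F X) (fob F Y)) \<and>
     (\<forall>X. is_cpx R X \<longrightarrow> fmor F X X (Kid R X) = Kid R (fob F X)) \<and>
     (\<forall>X Y Z \<phi> \<psi>. is_cpx R X \<and> is_cpx R Y \<and> is_cpx R Z \<and> \<phi> \<in> Khom R X Y \<and> \<psi> \<in> Khom R Y Z \<longrightarrow>
        fmor F X Z (Kcomp R X Z \<psi> \<phi>) =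
        Kcomp R (fob F X) (fob F Z) (fmor F Y Z \<psi>) (fmor F X Y \<phi>))"

definition kfunctor_id :: "('r, 'a, 'a) kfunctor" where
  "kfunctor_id = \<lparr>fob = (\<lambda>X. X), fmor = (\<lambda>X Y \<phi>. \<phi>)\<rparr>"

definition kfunctor_comp ::
  "('r, 'b, 'c) kfunctor \<Rightarrow> ('r, 'a, 'b) kfunctor \<Rightarrow> ('r, 'a, 'c) kfunctor" where
  "kfunctor_comp G F = \<lparr>fob = (\<lambda>X. fob G (fob F X)),
     fmor = (\<lambda>X Y \<phi>. fmor G (fob F X) (fob F Y) (fmor F X Y \<phi>))\<rparr>"

definition kfunctors_isomorphic ::
  "('r, 'x) gring_scheme \<Rightarrow> ('r, 'a, 'b) kfunctor \<Rightarrow> ('r, 'a, 'c) kfunctor \<Rightarrow> bool" where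
  "kfunctors_isomorphic R F G \<longleftrightarrow> (\<exists>\<eta>.
     (\<forall>X. is_cpx R X \<longrightarrow> Kiso R (fob F X) (fob G X) (\<eta> X)) \<and>
     (\<forall>X Y \<phi>. is_cpx R X \<and> is_cpx R Y \<and> \<phi> \<in> Khom R X Y \<longrightarrow>
        Kcomp R (fob F X) (fob G Y) (\<eta> Y) (fmor F X Y \<phi>) =
        Kcomp R (fob F X) (fob G Y) (fmor G X Y \<phi>) (\<eta> X)))"


section \<open>Tensoring with a two-term complex of bimodules\<close>

text \<open>
  The complex \<open>0 \<rightarrow> P \<rightarrow> Q \<rightarrow> 0\<close> with \<open>P\<close> in cohomological degree \<open>fst_deg\<close>
  and \<open>Q\<close> in degree \<open>fst_deg + 1\<close>.
\<close>

record ('r, 'p, 'q) two_term =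
  fst_deg :: int
  fst_bimod :: "('r, 'p) gbimod"
  snd_bimod :: "('r, 'q) gbimod"
  two_map :: "'p \<Rightarrow> 'q"

definition signed :: "('m, 'y) ring_scheme \<Rightarrow> int \<Rightarrow> 'm \<Rightarrow> 'm" where
  "signed M i x = (if even i then x else \<ominus>\<^bsub>M\<^esub> x)"

text \<open>
  The total complex of the tensor product. With \<open>p = fst_deg T\<close>, its degree \<open>n\<close> term is
  \<open>P \<otimes> X\<^sup>n\<^sup>-\<^sup>p \<oplus> Q \<otimes> X\<^sup>n\<^sup>-\<^sup>p\<^sup>-\<^sup>1\<close> (all other summands vanish), and its differential is given by
  \<open>d (t \<otimes> x) = d t \<otimes> x + (-1)\<^sup>i t \<otimes> d x\<close> for \<open>t\<close> of cohomological degree \<open>i\<close>.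
\<close>

definition tensor_cpx ::
  "('r, 'x) gring_scheme \<Rightarrow> ('r, 'p, 'q) two_term \<Rightarrow> ('r, 'm) cpx \<Rightarrow>
   ('r, ('p \<times> 'm \<Rightarrow>\<^sub>0 int) set \<times> ('q \<times> 'm \<Rightarrow>\<^sub>0 int) set) cpx" where
  "tensor_cpx R T X = (let p = fst_deg T; P = fst_bimod T; Q = snd_bimod T in
     \<lparr>ob = (\<lambda>n. gmod_sum (tensor_mod R P (ob X (n - p))) (tensor_mod R Q (ob X (n - p - 1)))),
      diff = (\<lambda>n (u, v).
        (signed (tensor_mod R P (ob X (n + 1 - p))) p
           (tensor_map R P (ob X (n + 1 - p)) (\<lambda>t. t) (diff X (n - p)) u),
         tensor_map R Q (ob X (n - p)) (two_map T) (\<lambda>x. x) u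
         \<oplus>\<^bsub>tensor_mod R Q (ob X (n - p))\<^esub>
         signed (tensor_mod R Q (ob X (n - p))) (p + 1)
           (tensor_map R Q (ob X (n - p)) (\<lambda>t. t) (diff X (n - p - 1)) v)))\<rparr>)"

definition tensor_chain_map ::
  "('r, 'x) gring_scheme \<Rightarrow> ('r, 'p, 'q) two_term \<Rightarrow> ('r, 'm) cpx \<Rightarrow> (int \<Rightarrow> 'm \<Rightarrow> 'm) \<Rightarrow>
   int \<Rightarrow> ('p \<times> 'm \<Rightarrow>\<^sub>0 int) set \<times> ('q \<times> 'm \<Rightarrow>\<^sub>0 int) set \<Rightarrow>
     ('p \<times> 'm \<Rightarrow>\<^sub>0 int) set \<times> ('q \<times> 'm \<Rightarrow>\<^sub>0 int) set" where
  "tensor_chain_map R T Y f = (let p = fst_deg T; P = fst_bimod T; Q = snd_bimod T in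
     (\<lambda>n (u, v). (tensor_map R P (ob Y (n - p)) (\<lambda>t. t) (f (n - p)) u,
                  tensor_map R Q (ob Y (n - p - 1)) (\<lambda>t. t) (f (n - p - 1)) v)))"

definition tensor_functor ::
  "('r, 'x) gring_scheme \<Rightarrow> ('r, 'p, 'q) two_term \<Rightarrow>
   ('r, 'm, ('p \<times> 'm \<Rightarrow>\<^sub>0 int) set \<times> ('q \<times> 'm \<Rightarrow>\<^sub>0 int) set) kfunctor" where
  "tensor_functor R T = \<lparr>fob = tensor_cpx R T,
     fmor = (\<lambda>X Y \<phi>. \<Union>f\<in>\<phi>.
       homotopy_rel R (tensor_cpx R T X) (tensor_cpx R T Y) `` {tensor_chain_map R T Y f})\<rparr>"


section \<open>The ring of odd polynomials in two variables and the odd Demazure operator\<close>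

datatype gen = X1 | X2

text \<open>The free algebra on two generators: finitely supported functions on words.\<close>

definition free_alg :: "('k, 'z) ring_scheme \<Rightarrow> (gen list \<Rightarrow> 'k) ring" where
  "free_alg k = \<lparr>carrier = {f. (\<forall>w. f w \<in> carrier k) \<and> finite {w. f w \<noteq> \<zero>\<^bsub>k\<^esub>}},
     mult = (\<lambda>f g w. \<Oplus>\<^bsub>k\<^esub>i\<in>{..length w}. f (take i w) \<otimes>\<^bsub>k\<^esub> g (drop i w)),
     one = (\<lambda>w. if w = [] then \<one>\<^bsub>k\<^esub> else \<zero>\<^bsub>k\<^esub>),
     ring.zero = (\<lambda>w. \<zero>\<^bsub>k\<^esub>),
     add = (\<lambda>f g w. f w \<oplus>\<^bsub>k\<^esub> g w)\<rparr>"

definition free_gen :: "('k, 'z) ring_scheme \<Rightarrow> gen \<Rightarrow> gen list \<Rightarrow> 'k" where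
  "free_gen k g = (\<lambda>w. if w = [g] then \<one>\<^bsub>k\<^esub> else \<zero>\<^bsub>k\<^esub>)"

definition odd_ideal :: "('k, 'z) ring_scheme \<Rightarrow> (gen list \<Rightarrow> 'k) set" where
  "odd_ideal k = Idl\<^bsub>free_alg k\<^esub>
     {free_gen k X1 \<otimes>\<^bsub>free_alg k\<^esub> free_gen k X2 \<oplus>\<^bsub>free_alg k\<^esub> free_gen k X2 \<otimes>\<^bsub>free_alg k\<^esub> free_gen k X1}"

type_synonym 'k odd_poly = "(gen list \<Rightarrow> 'k) set"

definition odd_R :: "('k, 'z) ring_scheme \<Rightarrow> 'k odd_poly gring" where
  "odd_R k = ring.extend (free_alg k Quot odd_ideal k)
     (gring.fields (\<lambda>i. {odd_ideal k +>\<^bsub>free_alg k\<^esub> f | f.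
        f \<in> carrier (free_alg k) \<and> (\<forall>w. f w \<noteq> \<zero>\<^bsub>k\<^esub> \<longrightarrow> 2 * int (length w) = i)}))"

definition odd_x :: "('k, 'z) ring_scheme \<Rightarrow> gen \<Rightarrow> 'k odd_poly" where
  "odd_x k g = odd_ideal k +>\<^bsub>free_alg k\<^esub> free_gen k g"

definition odd_const :: "('k, 'z) ring_scheme \<Rightarrow> 'k \<Rightarrow> 'k odd_poly" where
  "odd_const k a = odd_ideal k +>\<^bsub>free_alg k\<^esub> (\<lambda>w. if w = [] then a else \<zero>\<^bsub>k\<^esub>)"

definition odd_s :: "('k, 'z) ring_scheme \<Rightarrow> 'k odd_poly \<Rightarrow> 'k odd_poly" where
  "odd_s k = (THE s. s \<in> extensional (carrier (odd_R k)) \<and> s \<in> ring_iso (odd_R k) (odd_R k) \<and>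
     (\<forall>a\<in>carrier k. s (odd_const k a) = odd_const k a) \<and>
     s (odd_x k X1) = \<ominus>\<^bsub>odd_R k\<^esub> odd_x k X2 \<and>
     s (odd_x k X2) = \<ominus>\<^bsub>odd_R k\<^esub> odd_x k X1)"

definition odd_demazure :: "('k, 'z) ring_scheme \<Rightarrow> 'k odd_poly \<Rightarrow> 'k odd_poly" where
  "odd_demazure k = (THE D. D \<in> carrier (odd_R k) \<rightarrow>\<^sub>E carrier (odd_R k) \<and>
     (\<forall>f\<in>carrier (odd_R k). \<forall>g\<in>carrier (odd_R k).
        D (f \<oplus>\<^bsub>odd_R k\<^esub> g) = D f \<oplus>\<^bsub>odd_R k\<^esub> D g) \<and>
     (\<forall>a\<in>carrier k. \<forall>f\<in>carrier (odd_R k).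
        D (odd_const k a \<otimes>\<^bsub>odd_R k\<^esub> f) = odd_const k a \<otimes>\<^bsub>odd_R k\<^esub> D f) \<and>
     D \<one>\<^bsub>odd_R k\<^esub> = \<zero>\<^bsub>odd_R k\<^esub> \<and>
     D (odd_x k X1) = \<one>\<^bsub>odd_R k\<^esub> \<and> D (odd_x k X2) = \<one>\<^bsub>odd_R k\<^esub> \<and>
     (\<forall>f\<in>carrier (odd_R k). \<forall>g\<in>carrier (odd_R k).
        D (f \<otimes>\<^bsub>odd_R k\<^esub> g) = D f \<otimes>\<^bsub>odd_R k\<^esub> g \<oplus>\<^bsub>odd_R k\<^esub> odd_s k f \<otimes>\<^bsub>odd_R k\<^esub> D g))"

definition odd_Rs :: "('k, 'z) ring_scheme \<Rightarrow> 'k odd_poly gring" where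
  "odd_Rs k = (odd_R k)
     \<lparr>carrier := {f \<in> carrier (odd_R k). odd_demazure k f = \<zero>\<^bsub>odd_R k\<^esub>},
      deg_part := (\<lambda>i. {f \<in> deg_part (odd_R k) i. odd_demazure k f = \<zero>\<^bsub>odd_R k\<^esub>})\<rparr>"

text \<open>
  The twisted bimodule: \<open>g\<close> in the carrier stands for \<open>1\<^sup>s g\<close>, where \<open>1\<^sup>s\<close> is the generator. So the
  right action is multiplication, the left action is forced by \<open>f 1\<^sup>s = 1\<^sup>s s(f)\<close>, and \<open>1\<^sup>s\<close> itself is
  the unit of the ring.
\<close>

definition odd_Rs_twisted :: "('k, 'z) ring_scheme \<Rightarrow> ('k odd_poly, 'k odd_poly) gbimod" where
  "odd_Rs_twisted k =
     (regular_bimod (odd_Rs k))\<lparr>smult := (\<lambda>f g. odd_s k f \<otimes>\<^bsub>odd_Rs k\<^esub> g)\<rparr>"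


section \<open>The odd Rouquier complexes\<close>

abbreviation odd_R_bimod :: "('k, 'z) ring_scheme \<Rightarrow> ('k odd_poly, 'k odd_poly) gbimod" where
  "odd_R_bimod k \<equiv> regular_bimod (odd_R k)"

type_synonym 'k odd_B_elt = "('k odd_poly \<times> 'k odd_poly \<Rightarrow>\<^sub>0 int) set"
type_synonym 'k odd_B_tw_elt = "('k odd_B_elt \<times> 'k odd_poly \<Rightarrow>\<^sub>0 int) set"

definition odd_B :: "('k, 'z) ring_scheme \<Rightarrow> ('k odd_poly, 'k odd_B_elt) gbimod" where
  "odd_B k = gr_shift (-1) (tensor_bimod (odd_Rs k) (odd_R_bimod k) (odd_R_bimod k))"

definition odd_B_pure :: "('k, 'z) ring_scheme \<Rightarrow> 'k odd_poly \<Rightarrow> 'k odd_poly \<Rightarrow> 'k odd_B_elt" where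
  "odd_B_pure k f g = pure_tensor (odd_Rs k) (odd_R_bimod k) (odd_R_bimod k) f g"

definition odd_B_tw :: "('k, 'z) ring_scheme \<Rightarrow> ('k odd_poly, 'k odd_B_tw_elt) gbimod" where
  "odd_B_tw k = gr_shift (-1) (tensor_bimod (odd_Rs k)
     (tensor_bimod (odd_Rs k) (odd_R_bimod k) (odd_Rs_twisted k)) (odd_R_bimod k))"

definition odd_B_tw_pure ::
  "('k, 'z) ring_scheme \<Rightarrow> 'k odd_poly \<Rightarrow> 'k odd_poly \<Rightarrow> 'k odd_poly \<Rightarrow> 'k odd_B_tw_elt" where
  "odd_B_tw_pure k f c g = pure_tensor (odd_Rs k)
     (tensor_bimod (odd_Rs k) (odd_R_bimod k) (odd_Rs_twisted k)) (odd_R_bimod k)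
     (pure_tensor (odd_Rs k) (odd_R_bimod k) (odd_Rs_twisted k) f c) g"

definition odd_m :: "('k, 'z) ring_scheme \<Rightarrow> 'k odd_B_elt \<Rightarrow> 'k odd_poly" where
  "odd_m k = (THE m. m \<in> extensional (carrier (odd_B k)) \<and>
     m \<in> gbimod_hom (odd_R k) (odd_B k) (gr_shift (-1) (odd_R_bimod k)) \<and>
     (\<forall>f\<in>carrier (odd_R k). \<forall>g\<in>carrier (odd_R k). m (odd_B_pure k f g) = f \<otimes>\<^bsub>odd_R k\<^esub> g))"

definition odd_Delta :: "('k, 'z) ring_scheme \<Rightarrow> 'k odd_poly \<Rightarrow> 'k odd_B_tw_elt" where
  "odd_Delta k = (THE D. D \<in> extensional (carrier (odd_R k)) \<and>
     D \<in> gbimod_hom (odd_R k) (gr_shift 1 (odd_R_bimod k)) (odd_B_tw k) \<and>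
     D \<one>\<^bsub>odd_R k\<^esub> =
       (\<ominus>\<^bsub>odd_B_tw k\<^esub> odd_B_tw_pure k (odd_x k X2) \<one>\<^bsub>odd_R k\<^esub> \<one>\<^bsub>odd_R k\<^esub>)
       \<ominus>\<^bsub>odd_B_tw k\<^esub> odd_B_tw_pure k \<one>\<^bsub>odd_R k\<^esub> \<one>\<^bsub>odd_R k\<^esub> (odd_x k X1))"

definition rouquier ::
  "('k, 'z) ring_scheme \<Rightarrow> ('k odd_poly, 'k odd_B_elt, 'k odd_poly) two_term" where
  "rouquier k = \<lparr>fst_deg = 0, fst_bimod = odd_B k,
     snd_bimod = gr_shift (-1) (odd_R_bimod k), two_map = odd_m k\<rparr>"

definition rouquier' ::
  "('k, 'z) ring_scheme \<Rightarrow> ('k odd_poly, 'k odd_poly, 'k odd_B_tw_elt) two_term" where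
  "rouquier' k = \<lparr>fst_deg = -1, fst_bimod = gr_shift 1 (odd_R_bimod k),
     snd_bimod = odd_B_tw k, two_map = odd_Delta k\<rparr>"

end

theory Submission
  imports Defs
begin

text \<open>
  Everything is reduced to explicit matrices. The operators \<open>s\<close> and \<open>\<partial>\<close> satisfy \<open>\<partial>(f g) = \<partial>(f) g + s(f) \<partial>(g)\<close>,
  so \<open>f\<close> acts on pairs by the triangular matrix with rows \<open>(f, 0)\<close> and \<open>(\<partial> f, s f)\<close>, and this is an action of
  the ring \<open>R\<close>. For every \<open>f\<close> both \<open>\<partial> f\<close> and \<open>f - x\<^sub>1 \<partial> f\<close> lie in \<open>R\<^sup>s\<close>, whence
  \<open>f \<otimes> g = (1 \<otimes> 1) f g + (x\<^sub>1 \<otimes> 1 - 1 \<otimes> x\<^sub>1) \<partial>(f) g\<close> in the tensor product over \<open>R\<^sup>s\<close>. Hence \<open>B\<close> is free as a right module on the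
  two elements \<open>1 \<otimes> 1\<close> and \<open>x\<^sub>1 \<otimes> 1 - 1 \<otimes> x\<^sub>1\<close>, the left action being given by those matrices
  (\<open>B_triangular_basis\<close>). The twisted bimodule is free on \<open>1 \<otimes> 1 \<otimes> 1\<close> and \<open>\<Delta>(1)\<close>, with the matrices of \<open>s f\<close> in
  place of those of \<open>f\<close> (\<open>Btw_triangular_basis\<close>). The coordinates are well-defined maps on the tensor product, and the
  expansion above is checked on pure tensors, so that this holds over every commutative ring.

  In these coordinates \<open>B \<otimes> M\<close> and the twisted analogue consist of pairs \<open>(w, m)\<close> of elements of \<open>M\<close>; the bimodule
  map \<open>B \<rightarrow> R\<close> becomes \<open>(w, m) \<mapsto> w\<close> and \<open>\<Delta>\<close> becomes \<open>m \<mapsto> (0, m)\<close> (\<open>odd_m_coords\<close>, \<open>odd_Delta_coords\<close>). So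
  \<open>\<R> \<otimes> X\<close> is isomorphic to the complex \<open>cone X\<close> of triples \<open>((w, m), v)\<close> with differential
  \<open>((d w, d m), w - d v)\<close>, and \<open>\<R>' \<otimes> X\<close> to the complex \<open>cocone X\<close> of triples \<open>(u, (w, m))\<close> with differential
  \<open>(- d u, (d w, d m + u))\<close>.

  Both composites are therefore complexes of nine copies of \<open>X\<close>, in which four pairs of copies cancel. The
  deformation retraction to the remaining copy can be written down: a unit, a counit and a homotopy whose entries
  are all \<open>0\<close>, \<open>1\<close> and \<open>-1\<close> (\<open>homotopy_l\<close>, \<open>homotopy_r\<close>). Linearity over \<open>R\<close> comes from the cancellation of the
  off-diagonal terms \<open>\<partial>\<close>, by \<open>\<partial> s = - s \<partial>\<close>, \<open>\<partial> \<partial> = 0\<close> and \<open>s s = 1\<close>. The counits commute with maps of complexes, so they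
  define isomorphisms of functors on the homotopy category (\<open>inverse_kfunctor_retractI\<close>).
\<close>

section \<open>Tensor products\<close>

lemma (in abelian_group) eq_minus_iff:
  assumes "a \<in> carrier G" "b \<in> carrier G" "c \<in> carrier G"
  shows "c = a \<ominus> b \<longleftrightarrow> a = c \<oplus> b"
  using assms by (auto simp: minus_eq a_assoc r_neg l_neg)

lemma (in abelian_group) eq_if_minus_zero:
  assumes "a \<in> carrier G" "b \<in> carrier G" "a \<ominus> b = \<zero>"
  shows "a = b"
  using assms eq_minus_iff[of a b \<zero>] by auto

lemma (in abelian_group) a_inv_zero: "\<ominus> \<zero> = \<zero>"
  by (rule minus_equality) simp_all

text \<open>
  Sums over carriers are normalized by the laws of a commutative semigroup, which leave opposite summands apart.
  The following rules remove such a pair when one or two summands stand between its members.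
\<close>

lemma (in abelian_group) cancel_between:
  assumes "f \<in> carrier G" "a \<in> carrier G" "b \<in> carrier G"
  shows "f \<oplus> (a \<oplus> (\<ominus> f \<oplus> b)) = a \<oplus> b"
proof -
  have "f \<oplus> (a \<oplus> (\<ominus> f \<oplus> b)) = a \<oplus> (f \<oplus> (\<ominus> f \<oplus> b))" using assms by (simp add: a_lcomm)
  thus ?thesis using assms by (simp add: r_neg2)
qed

lemma (in abelian_group) cancel_between2:
  "\<lbrakk>x \<in> carrier G; y \<in> carrier G; w \<in> carrier G; z \<in> carrier G\<rbrakk> \<Longrightarrow> x \<oplus> (y \<oplus> (w \<oplus> (\<ominus> x \<oplus> z))) = y \<oplus> (w \<oplus> z)"
  using cancel_between[of x "y \<oplus> w" z] by (simp add: a_assoc)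

lemma (in abelian_group) cancel_end:
  "\<lbrakk>x \<in> carrier G; y \<in> carrier G\<rbrakk> \<Longrightarrow> x \<oplus> (y \<oplus> \<ominus> x) = y"
  using cancel_between[of x y \<zero>] by simp

lemma (in abelian_group) cancel_end2:
  "\<lbrakk>x \<in> carrier G; y \<in> carrier G; w \<in> carrier G\<rbrakk> \<Longrightarrow> x \<oplus> (y \<oplus> (w \<oplus> \<ominus> x)) = y \<oplus> w"
  using cancel_between2[of x y w \<zero>] by simp

locale tensor_pair = M?: abelian_group M + N?: abelian_group N
  for A :: "('r, 'x) gring_scheme" and M :: "('r, 'm, 'y) gbimod_scheme" (structure)
    and N :: "('r, 'n, 'z) gmod_scheme" (structure) +
  assumes right_closed: "\<lbrakk>x \<in> carrier M; a \<in> carrier A\<rbrakk> \<Longrightarrow> rsmult M x a \<in> carrier M"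
    and left_closed: "\<lbrakk>a \<in> carrier A; y \<in> carrier N\<rbrakk> \<Longrightarrow> a \<odot>\<^bsub>N\<^esub> y \<in> carrier N"
begin

abbreviation "F \<equiv> tensor_free M N"
abbreviation "Z \<equiv> tensor_null A M N"
abbreviation "T \<equiv> tensor_mod A M N"
abbreviation "pure \<equiv> pure_tensor A M N"

lemma free_simps [simp]:
  "carrier F = {c. Poly_Mapping.keys c \<subseteq> carrier M \<times> carrier N}"
  "\<one>\<^bsub>F\<^esub> = 0" "p \<otimes>\<^bsub>F\<^esub> q = p + q"
  by (auto simp: tensor_free_def)

lemma free_comm_group: "comm_group F"
  unfolding tensor_free_def by (rule abelian_free_Abelian_group)

lemma frag_of_closed: "\<lbrakk>x \<in> carrier M; y \<in> carrier N\<rbrakk> \<Longrightarrow> frag_of (x, y) \<in> carrier F"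
  by auto

lemma free_minus_closed: "\<lbrakk>p \<in> carrier F; q \<in> carrier F\<rbrakk> \<Longrightarrow> p - q \<in> carrier F"
  using keys_diff[of p q] by auto

lemma relators_closed: "tensor_relators A M N \<subseteq> carrier F"
proof -
  have two: "frag_of z - frag_of z' \<in> carrier F"
    if "z \<in> carrier M \<times> carrier N" "z' \<in> carrier M \<times> carrier N" for z z'
    using that by (cases z; cases z') (blast intro: free_minus_closed frag_of_closed)
  have three: "frag_of z - frag_of z' - frag_of z'' \<in> carrier F"
    if "z \<in> carrier M \<times> carrier N" "z' \<in> carrier M \<times> carrier N" "z'' \<in> carrier M \<times> carrier N" for z z' z''
    using two that by (cases z'') (blast intro: free_minus_closed frag_of_closed)
  show ?thesis
    unfolding tensor_relators_def
    by (intro Un_least subsetI; elim CollectE exE conjE; hypsubst; intro two three)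
      (simp_all add: right_closed left_closed)
qed

lemma relatorsI:
  "\<lbrakk>x \<in> carrier M; x' \<in> carrier M; y \<in> carrier N\<rbrakk> \<Longrightarrow>
     frag_of (x \<oplus>\<^bsub>M\<^esub> x', y) - frag_of (x, y) - frag_of (x', y) \<in> tensor_relators A M N"
  "\<lbrakk>x \<in> carrier M; y \<in> carrier N; y' \<in> carrier N\<rbrakk> \<Longrightarrow>
     frag_of (x, y \<oplus>\<^bsub>N\<^esub> y') - frag_of (x, y) - frag_of (x, y') \<in> tensor_relators A M N"
  "\<lbrakk>x \<in> carrier M; a \<in> carrier A; y \<in> carrier N\<rbrakk> \<Longrightarrow>
     frag_of (rsmult M x a, y) - frag_of (x, a \<odot>\<^bsub>N\<^esub> y) \<in> tensor_relators A M N"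
  unfolding tensor_relators_def by blast+

lemma null_subgroup: "subgroup Z F"
  unfolding tensor_null_def
  by (rule group.generate_is_subgroup) (use free_comm_group relators_closed comm_group.axioms in auto)

lemma null_normal: "Z \<lhd> F"
  using comm_group.normal_iff_subgroup[OF free_comm_group] null_subgroup by auto

lemma tensor_comm_group: "comm_group (tensor_group A M N)"
  unfolding tensor_group_def
  by (rule comm_group.abelian_FactGroup[OF free_comm_group null_subgroup])

lemma tensor_simps:
  "carrier T = carrier (tensor_group A M N)"
  "\<zero>\<^bsub>T\<^esub> = \<one>\<^bsub>tensor_group A M N\<^esub>"
  "X \<oplus>\<^bsub>T\<^esub> Y = X \<otimes>\<^bsub>tensor_group A M N\<^esub> Y"
  "a \<odot>\<^bsub>T\<^esub> X = tensor_map A M N (\<lambda>x. a \<odot>\<^bsub>M\<^esub> x) (\<lambda>y. y) X"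
  "gr_part T n = generate (tensor_group A M N)
        {pure_tensor A M N x y | x y i j. x \<in> gr_part M i \<and> y \<in> gr_part N j \<and> i + j = n}"
  by (simp_all add: tensor_mod_def)

lemma tensor_abelian_group: "abelian_group T"
proof -
  interpret G: comm_group "tensor_group A M N" by (rule tensor_comm_group)
  show ?thesis
    by (rule abelian_groupI) (simp_all add: tensor_simps G.m_ac Bex_def[symmetric] G.l_inv_ex)
qed

sublocale T: abelian_group T
  by (rule tensor_abelian_group)

abbreviation "cls \<equiv> tensor_class A M N"

lemma cls_hom: "cls \<in> hom F (tensor_group A M N)"
  unfolding tensor_class_def tensor_group_def
  by (rule normal.r_coset_hom_Mod[OF null_normal])

lemma cls_closed: "p \<in> carrier F \<Longrightarrow> cls p \<in> carrier T"
  using cls_hom by (auto simp: tensor_simps hom_def)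

lemma cls_add: "\<lbrakk>p \<in> carrier F; q \<in> carrier F\<rbrakk> \<Longrightarrow> cls (p + q) = cls p \<oplus>\<^bsub>T\<^esub> cls q"
  using cls_hom by (auto simp: tensor_simps hom_def)

lemma cls_zero: "cls 0 = \<zero>\<^bsub>T\<^esub>"
  using hom_one[OF cls_hom] free_comm_group tensor_comm_group
  by (auto simp: tensor_simps comm_group_def)

lemma cls_diff: "\<lbrakk>p \<in> carrier F; q \<in> carrier F\<rbrakk> \<Longrightarrow> cls (p - q) = cls p \<ominus>\<^bsub>T\<^esub> cls q"
  using cls_add[of "p - q" q] T.eq_minus_iff[of "cls p" "cls q" "cls (p - q)"]
    cls_closed[of p] cls_closed[of q] cls_closed[of "p - q"] free_minus_closed[of p q]
  by (simp del: free_simps)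

lemma cls_surj: "X \<in> carrier T \<Longrightarrow> \<exists>p\<in>carrier F. X = cls p"
  unfolding tensor_simps tensor_group_def carrier_FactGroup tensor_class_def by auto

lemma cls_relator: "p \<in> tensor_relators A M N \<Longrightarrow> cls p = \<zero>\<^bsub>T\<^esub>"
proof -
  assume "p \<in> tensor_relators A M N"
  hence "p \<in> Z" unfolding tensor_null_def by (rule generate.incl)
  hence "Z #>\<^bsub>F\<^esub> p = Z"
    using subgroup.rcos_const[OF null_subgroup] free_comm_group comm_group.axioms by blast
  thus ?thesis
    by (simp add: tensor_class_def tensor_simps tensor_group_def)
qed

text \<open>
  The map \<^const>\<open>tensor_map\<close> is a union over the representatives of a class, so each representative has to be shown
  to give the same value.
\<close>

lemma cls_mem: "\<lbrakk>p \<in> carrier F; q \<in> cls p\<rbrakk> \<Longrightarrow> q \<in> carrier F \<and> cls q = cls p"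
  unfolding tensor_class_def
proof -
  interpret F: comm_group F by (rule free_comm_group)
  assume "p \<in> carrier F" and q: "q \<in> Z #>\<^bsub>F\<^esub> p"
  thus "q \<in> carrier F \<and> Z #>\<^bsub>F\<^esub> q = Z #>\<^bsub>F\<^esub> p"
    using F.r_coset_subset_G[OF subgroup.subset[OF null_subgroup], of p]
      F.repr_independence[OF q _ null_subgroup] by blast
qed

lemma cls_self: "p \<in> carrier F \<Longrightarrow> p \<in> cls p"
  unfolding tensor_class_def
  using group.rcos_self[OF comm_group.axioms(2)[OF free_comm_group] _ null_subgroup] by simp

lemma pure_closed [simp, intro]: "\<lbrakk>x \<in> carrier M; y \<in> carrier N\<rbrakk> \<Longrightarrow> pure x y \<in> carrier T"
  unfolding pure_tensor_def using frag_of_closed cls_closed by blast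

lemma pure_add_left:
  assumes "x \<in> carrier M" "x' \<in> carrier M" "y \<in> carrier N"
  shows "pure (x \<oplus>\<^bsub>M\<^esub> x') y = pure x y \<oplus>\<^bsub>T\<^esub> pure x' y"
proof -
  have c: "frag_of (x \<oplus>\<^bsub>M\<^esub> x', y) \<in> carrier F" "frag_of (x, y) \<in> carrier F" "frag_of (x', y) \<in> carrier F"
    using assms by auto
  have "cls (frag_of (x \<oplus>\<^bsub>M\<^esub> x', y) - frag_of (x, y) - frag_of (x', y)) = \<zero>\<^bsub>T\<^esub>"
    using assms by (intro cls_relator relatorsI)
  hence "(pure (x \<oplus>\<^bsub>M\<^esub> x') y \<ominus>\<^bsub>T\<^esub> pure x y) \<ominus>\<^bsub>T\<^esub> pure x' y = \<zero>\<^bsub>T\<^esub>"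
    using c by (simp add: cls_diff free_minus_closed pure_tensor_def del: free_simps)
  thus ?thesis
    using assms T.eq_minus_iff[of "pure (x \<oplus>\<^bsub>M\<^esub> x') y" "pure x y" "pure x' y"]
      T.eq_if_minus_zero[of "pure (x \<oplus>\<^bsub>M\<^esub> x') y \<ominus>\<^bsub>T\<^esub> pure x y" "pure x' y"]
    by (simp add: T.a_comm)
qed

lemma pure_add_right:
  assumes "x \<in> carrier M" "y \<in> carrier N" "y' \<in> carrier N"
  shows "pure x (y \<oplus>\<^bsub>N\<^esub> y') = pure x y \<oplus>\<^bsub>T\<^esub> pure x y'"
proof -
  have c: "frag_of (x, y \<oplus>\<^bsub>N\<^esub> y') \<in> carrier F" "frag_of (x, y) \<in> carrier F" "frag_of (x, y') \<in> carrier F"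
    using assms by auto
  have "cls (frag_of (x, y \<oplus>\<^bsub>N\<^esub> y') - frag_of (x, y) - frag_of (x, y')) = \<zero>\<^bsub>T\<^esub>"
    using assms by (intro cls_relator relatorsI)
  hence "(pure x (y \<oplus>\<^bsub>N\<^esub> y') \<ominus>\<^bsub>T\<^esub> pure x y) \<ominus>\<^bsub>T\<^esub> pure x y' = \<zero>\<^bsub>T\<^esub>"
    using c by (simp add: cls_diff free_minus_closed pure_tensor_def del: free_simps)
  thus ?thesis
    using assms T.eq_minus_iff[of "pure x (y \<oplus>\<^bsub>N\<^esub> y')" "pure x y" "pure x y'"]
      T.eq_if_minus_zero[of "pure x (y \<oplus>\<^bsub>N\<^esub> y') \<ominus>\<^bsub>T\<^esub> pure x y" "pure x y'"]
    by (simp add: T.a_comm)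
qed

lemma pure_balanced:
  assumes "x \<in> carrier M" "a \<in> carrier A" "y \<in> carrier N"
  shows "pure (rsmult M x a) y = pure x (a \<odot>\<^bsub>N\<^esub> y)"
proof -
  have c: "frag_of (rsmult M x a, y) \<in> carrier F" "frag_of (x, a \<odot>\<^bsub>N\<^esub> y) \<in> carrier F"
    using assms right_closed left_closed by auto
  have "cls (frag_of (rsmult M x a, y) - frag_of (x, a \<odot>\<^bsub>N\<^esub> y)) = \<zero>\<^bsub>T\<^esub>"
    using assms by (intro cls_relator relatorsI)
  thus ?thesis
    using c T.eq_if_minus_zero[OF cls_closed[OF c(1)] cls_closed[OF c(2)]]
    by (simp add: cls_diff pure_tensor_def del: free_simps)
qed

lemma pure_zero_left: "y \<in> carrier N \<Longrightarrow> pure \<zero>\<^bsub>M\<^esub> y = \<zero>\<^bsub>T\<^esub>"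
  using pure_add_left[of "\<zero>\<^bsub>M\<^esub>" "\<zero>\<^bsub>M\<^esub>" y] by (simp add: T.add.l_cancel_one')

lemma pure_zero_right: "x \<in> carrier M \<Longrightarrow> pure x \<zero>\<^bsub>N\<^esub> = \<zero>\<^bsub>T\<^esub>"
  using pure_add_right[of x "\<zero>\<^bsub>N\<^esub>" "\<zero>\<^bsub>N\<^esub>"] by (simp add: T.add.l_cancel_one')

lemma pure_minus_left: "\<lbrakk>x \<in> carrier M; y \<in> carrier N\<rbrakk> \<Longrightarrow> pure (\<ominus>\<^bsub>M\<^esub> x) y = \<ominus>\<^bsub>T\<^esub> pure x y"
  using pure_add_left[of "\<ominus>\<^bsub>M\<^esub> x" x y]
    T.minus_equality[of "pure (\<ominus>\<^bsub>M\<^esub> x) y" "pure x y"]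
  by (simp add: M.l_neg pure_zero_left)

lemma pure_minus_right: "\<lbrakk>x \<in> carrier M; y \<in> carrier N\<rbrakk> \<Longrightarrow> pure x (\<ominus>\<^bsub>N\<^esub> y) = \<ominus>\<^bsub>T\<^esub> pure x y"
  using pure_add_right[of x "\<ominus>\<^bsub>N\<^esub> y" y]
    T.minus_equality[of "pure x (\<ominus>\<^bsub>N\<^esub> y)" "pure x y"]
  by (simp add: N.l_neg pure_zero_right)

lemma tensor_induct [consumes 1, case_names zero pure add]:
  assumes "X \<in> carrier T" and "Q \<zero>\<^bsub>T\<^esub>"
    and pure: "\<And>x y. \<lbrakk>x \<in> carrier M; y \<in> carrier N\<rbrakk> \<Longrightarrow> Q (pure x y)"
    and add: "\<And>X Y. \<lbrakk>X \<in> carrier T; Y \<in> carrier T; Q X; Q Y\<rbrakk> \<Longrightarrow> Q (X \<oplus>\<^bsub>T\<^esub> Y)"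
  shows "Q X"
proof -
  obtain p where p: "p \<in> carrier F" "X = cls p"
    using cls_surj assms(1) by blast
  from p(1) have "Poly_Mapping.keys p \<subseteq> carrier M \<times> carrier N" by simp
  \<comment> \<open>Induction on the free group proceeds by differences, hence the additional claim about the negative.\<close>
  hence "p \<in> carrier F \<and> Q (cls p) \<and> Q (\<ominus>\<^bsub>T\<^esub> (cls p))"
  proof (induction rule: frag_induction)
    case zero
    have e: "\<ominus>\<^bsub>T\<^esub> \<zero>\<^bsub>T\<^esub> = \<zero>\<^bsub>T\<^esub>" by (rule T.minus_equality) simp_all
    have "0 \<in> carrier F" by simp
    then show ?case using assms(2) unfolding cls_zero e by blast
  next
    case (one z)
    obtain x y where z: "z = (x, y)" "x \<in> carrier M" "y \<in> carrier N" using one by auto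
    show ?case
      using pure[of x y] pure[of "\<ominus>\<^bsub>M\<^esub> x" y] z
      by (auto simp: pure_minus_left) (simp_all add: pure_tensor_def)
  next
    case (diff a b)
    have c: "cls a \<in> carrier T" "cls b \<in> carrier T" using diff cls_closed by blast+
    have e: "cls (a - b) = cls a \<oplus>\<^bsub>T\<^esub> \<ominus>\<^bsub>T\<^esub> cls b"
      using diff by (simp add: cls_diff T.minus_eq del: free_simps)
    have "\<ominus>\<^bsub>T\<^esub> (cls (a - b)) = \<ominus>\<^bsub>T\<^esub> cls a \<oplus>\<^bsub>T\<^esub> cls b"
      unfolding e using c by (simp add: T.minus_add)
    with e show ?case
      using add c diff free_minus_closed[of a b] by auto
  qed
  thus ?thesis using p by simp
qed

text \<open>
  Pure tensors generate the tensor product, so an identity between additive maps needs to be checked on them only.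
  This rule carries nearly all computations in tensor products below.
\<close>

lemma additive_eq:
  assumes "X \<in> carrier T" "abelian_group K" 
    and f: "f \<in> carrier T \<rightarrow> carrier K" "\<And>X Y. \<lbrakk>X \<in> carrier T; Y \<in> carrier T\<rbrakk> \<Longrightarrow> f (X \<oplus>\<^bsub>T\<^esub> Y) = f X \<oplus>\<^bsub>K\<^esub> f Y"
    and g: "g \<in> carrier T \<rightarrow> carrier K" "\<And>X Y. \<lbrakk>X \<in> carrier T; Y \<in> carrier T\<rbrakk> \<Longrightarrow> g (X \<oplus>\<^bsub>T\<^esub> Y) = g X \<oplus>\<^bsub>K\<^esub> g Y"
    and pure: "\<And>x y. \<lbrakk>x \<in> carrier M; y \<in> carrier N\<rbrakk> \<Longrightarrow> f (pure x y) = g (pure x y)"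
  shows "f X = g X"
  using assms(1)
proof (induction rule: tensor_induct)
  case zero
  interpret K: abelian_group K by fact
  have "f \<zero>\<^bsub>T\<^esub> = \<zero>\<^bsub>K\<^esub>" using f(2)[of "\<zero>\<^bsub>T\<^esub>" "\<zero>\<^bsub>T\<^esub>"] f(1)
    by (simp add: Pi_iff K.add.l_cancel_one')
  moreover have "g \<zero>\<^bsub>T\<^esub> = \<zero>\<^bsub>K\<^esub>" using g(2)[of "\<zero>\<^bsub>T\<^esub>" "\<zero>\<^bsub>T\<^esub>"] g(1)
    by (simp add: Pi_iff K.add.l_cancel_one')
  ultimately show ?case by simp
qed (auto simp: f g pure)

text \<open>
  The homomorphism on the free abelian group determined by \<open>\<beta>\<close> annihilates the three kinds of relators, so it factors
  through the quotient.
\<close>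

lemma tensor_universal:
  assumes "abelian_group K"
    and closed: "\<And>x y. \<lbrakk>x \<in> carrier M; y \<in> carrier N\<rbrakk> \<Longrightarrow> \<beta> x y \<in> carrier K"
    and left: "\<And>x x' y. \<lbrakk>x \<in> carrier M; x' \<in> carrier M; y \<in> carrier N\<rbrakk> \<Longrightarrow> \<beta> (x \<oplus>\<^bsub>M\<^esub> x') y = \<beta> x y \<oplus>\<^bsub>K\<^esub> \<beta> x' y"
    and right: "\<And>x y y'. \<lbrakk>x \<in> carrier M; y \<in> carrier N; y' \<in> carrier N\<rbrakk> \<Longrightarrow> \<beta> x (y \<oplus>\<^bsub>N\<^esub> y') = \<beta> x y \<oplus>\<^bsub>K\<^esub> \<beta> x y'"
    and bal: "\<And>x a y. \<lbrakk>x \<in> carrier M; a \<in> carrier A; y \<in> carrier N\<rbrakk> \<Longrightarrow> \<beta> (rsmult M x a) y = \<beta> x (a \<odot>\<^bsub>N\<^esub> y)"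
  obtains h where "h \<in> carrier T \<rightarrow> carrier K"
    "\<And>X Y. \<lbrakk>X \<in> carrier T; Y \<in> carrier T\<rbrakk> \<Longrightarrow> h (X \<oplus>\<^bsub>T\<^esub> Y) = h X \<oplus>\<^bsub>K\<^esub> h Y"
    "\<And>x y. \<lbrakk>x \<in> carrier M; y \<in> carrier N\<rbrakk> \<Longrightarrow> h (pure x y) = \<beta> x y"
proof -
  interpret K: abelian_group K by fact
  interpret FG: comm_group F by (rule free_comm_group)
  have sub: "(\<lambda>z. \<beta> (fst z) (snd z)) ` (carrier M \<times> carrier N) \<subseteq> carrier (add_monoid K)"
    using closed by auto
  obtain h where h: "h \<in> hom F (add_monoid K)"
    "\<And>z. z \<in> carrier M \<times> carrier N \<Longrightarrow> h (frag_of z) = \<beta> (fst z) (snd z)"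
    unfolding tensor_free_def
    by (rule comm_group.free_Abelian_group_universal[OF K.a_comm_group sub]) blast
  interpret h: group_hom F "add_monoid K" h
    using h(1) by unfold_locales
  have hd: "h (p - q) = h p \<oplus>\<^bsub>K\<^esub> \<ominus>\<^bsub>K\<^esub> h q" if "p \<in> carrier F" "q \<in> carrier F" for p q
  proof -
    have "h p = h (p - q) \<oplus>\<^bsub>K\<^esub> h q"
      using h.hom_mult[of "p - q" q] that free_minus_closed[OF that] by (simp del: free_simps(1))
    moreover have "h (p - q) \<in> carrier K" "h q \<in> carrier K"
      using h.hom_closed free_minus_closed[OF that] that by auto
    ultimately show ?thesis by (simp add: K.add.m_assoc K.r_neg)
  qed
  have fc: "frag_of z \<in> carrier F" if "z \<in> carrier M \<times> carrier N" for z
    using that by simp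
  have hd2: "h (frag_of z - frag_of z') = h (frag_of z) \<oplus>\<^bsub>K\<^esub> \<ominus>\<^bsub>K\<^esub> h (frag_of z')"
    if "z \<in> carrier M \<times> carrier N" "z' \<in> carrier M \<times> carrier N" for z z'
    by (rule hd[OF fc[OF that(1)] fc[OF that(2)]])
  have hd3: "h (frag_of z - frag_of z' - frag_of z'') =
      h (frag_of z) \<oplus>\<^bsub>K\<^esub> \<ominus>\<^bsub>K\<^esub> h (frag_of z') \<oplus>\<^bsub>K\<^esub> \<ominus>\<^bsub>K\<^esub> h (frag_of z'')"
    if "z \<in> carrier M \<times> carrier N" "z' \<in> carrier M \<times> carrier N" "z'' \<in> carrier M \<times> carrier N" for z z' z''
    using hd[OF free_minus_closed[OF fc[OF that(1)] fc[OF that(2)]] fc[OF that(3)]] hd2[OF that(1,2)] by simp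
  have hf: "h (frag_of (x, y)) = \<beta> x y" if "x \<in> carrier M" "y \<in> carrier N" for x y
    using h(2)[of "(x, y)"] that by auto
  have l: "h (frag_of (x \<oplus>\<^bsub>M\<^esub> x', y) - frag_of (x, y) - frag_of (x', y)) = \<zero>\<^bsub>K\<^esub>"
    if "x \<in> carrier M" "x' \<in> carrier M" "y \<in> carrier N" for x x' y
  proof -
    have "h (frag_of (x \<oplus>\<^bsub>M\<^esub> x', y) - frag_of (x, y) - frag_of (x', y))
        = (\<beta> x y \<oplus>\<^bsub>K\<^esub> \<beta> x' y \<oplus>\<^bsub>K\<^esub> \<ominus>\<^bsub>K\<^esub> \<beta> x y) \<oplus>\<^bsub>K\<^esub> \<ominus>\<^bsub>K\<^esub> \<beta> x' y"
      using that by (subst hd3) (simp_all add: hf left)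
    thus ?thesis using closed[of x y] closed[of x' y] that by (simp add: K.a_ac K.r_neg K.r_neg1 K.r_neg2)
  qed
  have r: "h (frag_of (x, y \<oplus>\<^bsub>N\<^esub> y') - frag_of (x, y) - frag_of (x, y')) = \<zero>\<^bsub>K\<^esub>"
    if "x \<in> carrier M" "y \<in> carrier N" "y' \<in> carrier N" for x y y'
  proof -
    have "h (frag_of (x, y \<oplus>\<^bsub>N\<^esub> y') - frag_of (x, y) - frag_of (x, y'))
        = (\<beta> x y \<oplus>\<^bsub>K\<^esub> \<beta> x y' \<oplus>\<^bsub>K\<^esub> \<ominus>\<^bsub>K\<^esub> \<beta> x y) \<oplus>\<^bsub>K\<^esub> \<ominus>\<^bsub>K\<^esub> \<beta> x y'"
      using that by (subst hd3) (simp_all add: hf right)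
    thus ?thesis using closed[of x y] closed[of x y'] that by (simp add: K.a_ac K.r_neg K.r_neg1 K.r_neg2)
  qed
  have b: "h (frag_of (rsmult M x a, y) - frag_of (x, a \<odot>\<^bsub>N\<^esub> y)) = \<zero>\<^bsub>K\<^esub>"
    if "x \<in> carrier M" "a \<in> carrier A" "y \<in> carrier N" for x a y
  proof -
    have "h (frag_of (rsmult M x a, y) - frag_of (x, a \<odot>\<^bsub>N\<^esub> y))
        = \<beta> x (a \<odot>\<^bsub>N\<^esub> y) \<oplus>\<^bsub>K\<^esub> \<ominus>\<^bsub>K\<^esub> \<beta> x (a \<odot>\<^bsub>N\<^esub> y)"
      using that by (subst hd2) (simp_all add: hf bal right_closed left_closed)
    thus ?thesis using closed[of x "a \<odot>\<^bsub>N\<^esub> y"] left_closed that by (simp add: K.r_neg)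
  qed
  have k: "tensor_relators A M N \<subseteq> kernel F (add_monoid K) h"
  proof
    fix p assume "p \<in> tensor_relators A M N"
    hence "h p = \<zero>\<^bsub>K\<^esub>"
      unfolding tensor_relators_def
      by (elim UnE CollectE exE conjE; hypsubst; intro l r b)
    thus "p \<in> kernel F (add_monoid K) h"
      using \<open>p \<in> tensor_relators A M N\<close> relators_closed by (auto simp: kernel_def)
  qed
  have "Z \<subseteq> kernel F (add_monoid K) h"
    unfolding tensor_null_def
    using FG.generate_subgroup_incl[OF k h.subgroup_kernel] .
  then obtain g where g: "g \<in> hom (F Mod Z) (add_monoid K)" "\<And>p. p \<in> carrier F \<Longrightarrow> g (Z #>\<^bsub>F\<^esub> p) = h p"
    using h.FactGroup_universal_kernel[OF null_normal] by blast
  show thesis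
  proof (rule that)
    show "g \<in> carrier T \<rightarrow> carrier K"
      using g(1) by (auto simp: hom_def tensor_simps tensor_group_def)
    show "g (X \<oplus>\<^bsub>T\<^esub> Y) = g X \<oplus>\<^bsub>K\<^esub> g Y" if "X \<in> carrier T" "Y \<in> carrier T" for X Y
      using g(1) that by (auto simp: hom_def tensor_simps tensor_group_def)
    show "g (pure x y) = \<beta> x y" if "x \<in> carrier M" "y \<in> carrier N" for x y
      using g(2)[of "frag_of (x, y)"] that by (simp add: pure_tensor_def tensor_class_def hf)
  qed
qed

end

text \<open>
  The universal property gives a homomorphism with the prescribed values on pure tensors. It coincides with
  \<^const>\<open>tensor_map\<close>, because the expression under the union takes its value at every representative. Balancedness is
  required of the composite with the target, which covers the left action, the right action and pairs of module maps alike.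
\<close>

lemma tensor_map:
  fixes M0 :: "('r0, 'm0, 'y0) gbimod_scheme" and N0 :: "('r0, 'n0, 'z0) gmod_scheme"
    and M :: "('r, 'm, 'y) gbimod_scheme" and N :: "('r, 'n, 'z) gmod_scheme"
    and A0 :: "('r0, 'x0) gring_scheme" and A :: "('r, 'x) gring_scheme"
  assumes "tensor_pair A0 M0 N0" "tensor_pair A M N"
    and f: "f \<in> carrier M0 \<rightarrow> carrier M" "\<And>x x'. \<lbrakk>x \<in> carrier M0; x' \<in> carrier M0\<rbrakk> \<Longrightarrow> f (x \<oplus>\<^bsub>M0\<^esub> x') = f x \<oplus>\<^bsub>M\<^esub> f x'"
    and g: "g \<in> carrier N0 \<rightarrow> carrier N" "\<And>y y'. \<lbrakk>y \<in> carrier N0; y' \<in> carrier N0\<rbrakk> \<Longrightarrow> g (y \<oplus>\<^bsub>N0\<^esub> y') = g y \<oplus>\<^bsub>N\<^esub> g y'"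
    and bal: "\<And>x a y. \<lbrakk>x \<in> carrier M0; a \<in> carrier A0; y \<in> carrier N0\<rbrakk> \<Longrightarrow>
      pure_tensor A M N (f (rsmult M0 x a)) (g y) = pure_tensor A M N (f x) (g (a \<odot>\<^bsub>N0\<^esub> y))"
  shows tensor_map_pure: "\<And>x y. \<lbrakk>x \<in> carrier M0; y \<in> carrier N0\<rbrakk> \<Longrightarrow>
      tensor_map A M N f g (pure_tensor A0 M0 N0 x y) = pure_tensor A M N (f x) (g y)"
    and tensor_map_closed: "tensor_map A M N f g \<in> carrier (tensor_mod A0 M0 N0) \<rightarrow> carrier (tensor_mod A M N)"
    and tensor_map_add: "\<And>X Y. \<lbrakk>X \<in> carrier (tensor_mod A0 M0 N0); Y \<in> carrier (tensor_mod A0 M0 N0)\<rbrakk> \<Longrightarrow>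
      tensor_map A M N f g (X \<oplus>\<^bsub>tensor_mod A0 M0 N0\<^esub> Y) =
      tensor_map A M N f g X \<oplus>\<^bsub>tensor_mod A M N\<^esub> tensor_map A M N f g Y"
proof -
  interpret S: tensor_pair A0 M0 N0 by fact
  interpret T: tensor_pair A M N by fact
  obtain h where h: "h \<in> carrier S.T \<rightarrow> carrier T.T"
    "\<And>X Y. \<lbrakk>X \<in> carrier S.T; Y \<in> carrier S.T\<rbrakk> \<Longrightarrow> h (X \<oplus>\<^bsub>S.T\<^esub> Y) = h X \<oplus>\<^bsub>T.T\<^esub> h Y"
    "\<And>x y. \<lbrakk>x \<in> carrier M0; y \<in> carrier N0\<rbrakk> \<Longrightarrow> h (S.pure x y) = T.pure (f x) (g y)"
    by (rule S.tensor_universal[OF T.tensor_abelian_group, of "\<lambda>x y. T.pure (f x) (g y)"])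
      (use f g bal in \<open>auto simp: T.pure_add_left T.pure_add_right Pi_iff\<close>)
  have cls: "T.cls (frag_extend (\<lambda>(x, y). frag_of (f x, g y)) p) = h (S.cls p) \<and>
      frag_extend (\<lambda>(x, y). frag_of (f x, g y)) p \<in> carrier T.F \<and> p \<in> carrier S.F"
    if "p \<in> carrier S.F" for p
  proof -
    have "Poly_Mapping.keys p \<subseteq> carrier M0 \<times> carrier N0" using that by simp
    thus ?thesis
    proof (induction rule: frag_induction)
      case zero
      have "h \<zero>\<^bsub>S.T\<^esub> = \<zero>\<^bsub>T.T\<^esub>" using h(2)[of "\<zero>\<^bsub>S.T\<^esub>" "\<zero>\<^bsub>S.T\<^esub>"] h(1)
        by (simp add: Pi_iff T.T.add.l_cancel_one')
      then show ?case by (simp add: T.cls_zero S.cls_zero)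
    next
      case (one z)
      obtain x y where z: "z = (x, y)" "x \<in> carrier M0" "y \<in> carrier N0" using one by auto
      then show ?case using h(3)[of x y] f(1) g(1) by (auto simp: pure_tensor_def)
    next
      case (diff a b)
      have c: "S.cls a \<in> carrier S.T" "S.cls b \<in> carrier S.T" "S.cls (a - b) \<in> carrier S.T"
        using diff S.cls_closed S.free_minus_closed by blast+
      have "h (S.cls a) = h (S.cls (a - b)) \<oplus>\<^bsub>T.T\<^esub> h (S.cls b)"
        using h(2)[of "S.cls (a - b)" "S.cls b"] c S.cls_add[of "a - b" b] S.free_minus_closed[of a b] diff
        by simp
      hence "h (S.cls (a - b)) = h (S.cls a) \<ominus>\<^bsub>T.T\<^esub> h (S.cls b)"
        using c T.T.eq_minus_iff[of "h (S.cls a)" "h (S.cls b)" "h (S.cls (a - b))"]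
          funcset_mem[OF h(1)] by blast
      then show ?case
        using diff T.free_minus_closed S.free_minus_closed
        by (simp add: frag_extend_diff T.cls_diff del: T.free_simps S.free_simps)
    qed
  qed
  have eq: "tensor_map A M N f g X = h X" if X: "X \<in> carrier S.T" for X
  proof -
    obtain p where p: "p \<in> carrier S.F" "X = S.cls p" using S.cls_surj[OF X] by blast
    have "T.cls (frag_extend (\<lambda>(x, y). frag_of (f x, g y)) q) = h X" if "q \<in> X" for q
      using S.cls_mem[OF p(1)] that p(2) cls[of q] by auto
    moreover have "p \<in> X" using S.cls_self p by simp
    ultimately show ?thesis unfolding tensor_map_def by auto
  qed
  show "\<And>x y. \<lbrakk>x \<in> carrier M0; y \<in> carrier N0\<rbrakk> \<Longrightarrow>
      tensor_map A M N f g (pure_tensor A0 M0 N0 x y) = pure_tensor A M N (f x) (g y)"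
    using eq h by auto
  show "tensor_map A M N f g \<in> carrier (tensor_mod A0 M0 N0) \<rightarrow> carrier (tensor_mod A M N)"
    using eq h by auto
  show "\<And>X Y. \<lbrakk>X \<in> carrier (tensor_mod A0 M0 N0); Y \<in> carrier (tensor_mod A0 M0 N0)\<rbrakk> \<Longrightarrow>
      tensor_map A M N f g (X \<oplus>\<^bsub>tensor_mod A0 M0 N0\<^esub> Y) =
      tensor_map A M N f g X \<oplus>\<^bsub>tensor_mod A M N\<^esub> tensor_map A M N f g Y"
    using eq h by auto
qed

section \<open>Graded modules, bimodules and their tensor products\<close>

text \<open>
  A graded module without the requirement that it be the direct sum of its graded parts. Tensor products inherit all
  these axioms from their factors; the direct sum decomposition is proved separately, from a basis of the bimodule.
\<close>

locale pregraded_module = left_module R M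
  for R :: "('r, 'x) gring_scheme" (structure) and M :: "('r, 'm, 'y) gmod_scheme" (structure) +
  assumes gr_part_subgroup: "\<And>i. additive_subgroup (gr_part M i) M"
    and gr_part_smult: "\<And>i j a x. \<lbrakk>a \<in> deg_part R i; x \<in> gr_part M j\<rbrakk> \<Longrightarrow>
      a \<odot>\<^bsub>M\<^esub> x \<in> gr_part M (i + j)"
begin

lemma gr_part_closed: "x \<in> gr_part M i \<Longrightarrow> x \<in> carrier M"
  using additive_subgroup.a_Hcarr[OF gr_part_subgroup] .

lemma gr_part_add: "\<lbrakk>x \<in> gr_part M i; y \<in> gr_part M i\<rbrakk> \<Longrightarrow> x \<oplus>\<^bsub>M\<^esub> y \<in> gr_part M i"
  using additive_subgroup.a_closed[OF gr_part_subgroup] .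

lemma gr_part_zero: "\<zero>\<^bsub>M\<^esub> \<in> gr_part M i"
  using additive_subgroup.zero_closed[OF gr_part_subgroup] .

lemma gr_part_minus: "x \<in> gr_part M i \<Longrightarrow> \<ominus>\<^bsub>M\<^esub> x \<in> gr_part M i"
  using additive_subgroup.a_inv_closed[OF gr_part_subgroup] M.abelian_group_axioms by blast

lemma smult_zero_right: "a \<in> carrier R \<Longrightarrow> a \<odot>\<^bsub>M\<^esub> \<zero>\<^bsub>M\<^esub> = \<zero>\<^bsub>M\<^esub>"
  using smult_r_distr[of a "\<zero>\<^bsub>M\<^esub>" "\<zero>\<^bsub>M\<^esub>"] smult_closed[of a "\<zero>\<^bsub>M\<^esub>"]
  by (simp add: M.add.l_cancel_one')

lemma smult_zero_left: "x \<in> carrier M \<Longrightarrow> \<zero>\<^bsub>R\<^esub> \<odot>\<^bsub>M\<^esub> x = \<zero>\<^bsub>M\<^esub>"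
  using smult_l_distr[of "\<zero>\<^bsub>R\<^esub>" "\<zero>\<^bsub>R\<^esub>" x] smult_closed[of "\<zero>\<^bsub>R\<^esub>" x]
  by (simp add: M.add.l_cancel_one')

lemma smult_minus_right: "\<lbrakk>a \<in> carrier R; x \<in> carrier M\<rbrakk> \<Longrightarrow> a \<odot>\<^bsub>M\<^esub> (\<ominus>\<^bsub>M\<^esub> x) = \<ominus>\<^bsub>M\<^esub> (a \<odot>\<^bsub>M\<^esub> x)"
  using smult_r_distr[of a "\<ominus>\<^bsub>M\<^esub> x" x] smult_closed[of a "\<ominus>\<^bsub>M\<^esub> x"] smult_closed[of a x]
    M.minus_equality[of "a \<odot>\<^bsub>M\<^esub> (\<ominus>\<^bsub>M\<^esub> x)" "a \<odot>\<^bsub>M\<^esub> x"]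
  by (simp add: M.l_neg smult_zero_right)

lemma smult_minus_left: "\<lbrakk>a \<in> carrier R; x \<in> carrier M\<rbrakk> \<Longrightarrow> (\<ominus>\<^bsub>R\<^esub> a) \<odot>\<^bsub>M\<^esub> x = \<ominus>\<^bsub>M\<^esub> (a \<odot>\<^bsub>M\<^esub> x)"
  using smult_l_distr[of "\<ominus>\<^bsub>R\<^esub> a" a x] smult_closed[of "\<ominus>\<^bsub>R\<^esub> a" x] smult_closed[of a x]
    M.minus_equality[of "(\<ominus>\<^bsub>R\<^esub> a) \<odot>\<^bsub>M\<^esub> x" "a \<odot>\<^bsub>M\<^esub> x"]
  by (simp add: R.l_neg smult_zero_left)

end

lemma pregraded_moduleI:
  assumes "ring R" "abelian_group M"
    and "\<And>a x. \<lbrakk>a \<in> carrier R; x \<in> carrier M\<rbrakk> \<Longrightarrow> a \<odot>\<^bsub>M\<^esub> x \<in> carrier M"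
    and "\<And>a b x. \<lbrakk>a \<in> carrier R; b \<in> carrier R; x \<in> carrier M\<rbrakk> \<Longrightarrow>
      (a \<oplus>\<^bsub>R\<^esub> b) \<odot>\<^bsub>M\<^esub> x = a \<odot>\<^bsub>M\<^esub> x \<oplus>\<^bsub>M\<^esub> b \<odot>\<^bsub>M\<^esub> x"
    and "\<And>a x y. \<lbrakk>a \<in> carrier R; x \<in> carrier M; y \<in> carrier M\<rbrakk> \<Longrightarrow>
      a \<odot>\<^bsub>M\<^esub> (x \<oplus>\<^bsub>M\<^esub> y) = a \<odot>\<^bsub>M\<^esub> x \<oplus>\<^bsub>M\<^esub> a \<odot>\<^bsub>M\<^esub> y"
    and "\<And>a b x. \<lbrakk>a \<in> carrier R; b \<in> carrier R; x \<in> carrier M\<rbrakk> \<Longrightarrow>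
      (a \<otimes>\<^bsub>R\<^esub> b) \<odot>\<^bsub>M\<^esub> x = a \<odot>\<^bsub>M\<^esub> (b \<odot>\<^bsub>M\<^esub> x)"
    and "\<And>x. x \<in> carrier M \<Longrightarrow> \<one>\<^bsub>R\<^esub> \<odot>\<^bsub>M\<^esub> x = x"
    and "\<And>i. additive_subgroup (gr_part M i) M"
    and "\<And>i j a x. \<lbrakk>a \<in> deg_part R i; x \<in> gr_part M j\<rbrakk> \<Longrightarrow> a \<odot>\<^bsub>M\<^esub> x \<in> gr_part M (i + j)"
  shows "pregraded_module R M"
  unfolding pregraded_module_def pregraded_module_axioms_def left_module_def left_module_axioms_def
  using assms by blast

lemma graded_is_pregraded: "graded_left_module R M \<Longrightarrow> pregraded_module R M"
  by (simp add: graded_left_module_def graded_left_module_axioms_def pregraded_module_def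
      pregraded_module_axioms_def)

text \<open>
  The left and the right scalars may form different rings on the same type, as for \<open>R\<close> considered as a bimodule over
  \<open>R\<close> and its subring \<open>R\<^sup>s\<close>.
\<close>

locale graded_bimodule = pregraded_module R P + A?: ring A
  for R :: "('r, 'x) gring_scheme" (structure) and A :: "('r, 'x') gring_scheme"
    and P :: "('r, 'p, 'y) gbimod_scheme" (structure) +
  assumes rsmult_closed: "\<lbrakk>x \<in> carrier P; a \<in> carrier A\<rbrakk> \<Longrightarrow> rsmult P x a \<in> carrier P"
    and rsmult_l_distr: "\<lbrakk>x \<in> carrier P; y \<in> carrier P; a \<in> carrier A\<rbrakk> \<Longrightarrow>
      rsmult P (x \<oplus>\<^bsub>P\<^esub> y) a = rsmult P x a \<oplus>\<^bsub>P\<^esub> rsmult P y a"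
    and rsmult_r_distr: "\<lbrakk>x \<in> carrier P; a \<in> carrier A; b \<in> carrier A\<rbrakk> \<Longrightarrow>
      rsmult P x (a \<oplus>\<^bsub>A\<^esub> b) = rsmult P x a \<oplus>\<^bsub>P\<^esub> rsmult P x b"
    and rsmult_assoc: "\<lbrakk>x \<in> carrier P; a \<in> carrier A; b \<in> carrier A\<rbrakk> \<Longrightarrow>
      rsmult P (rsmult P x a) b = rsmult P x (a \<otimes>\<^bsub>A\<^esub> b)"
    and rsmult_one: "x \<in> carrier P \<Longrightarrow> rsmult P x \<one>\<^bsub>A\<^esub> = x"
    and smult_rsmult: "\<lbrakk>a \<in> carrier R; x \<in> carrier P; b \<in> carrier A\<rbrakk> \<Longrightarrow>
      rsmult P (a \<odot>\<^bsub>P\<^esub> x) b = a \<odot>\<^bsub>P\<^esub> rsmult P x b"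
    and gr_part_rsmult: "\<And>i j a x. \<lbrakk>x \<in> gr_part P i; a \<in> deg_part A j\<rbrakk> \<Longrightarrow>
      rsmult P x a \<in> gr_part P (i + j)"
    and deg_part_left: "a \<in> deg_part R i \<Longrightarrow> a \<in> carrier R"
    and deg_part_right: "a \<in> deg_part A i \<Longrightarrow> a \<in> carrier A"

lemma graded_bimodule_tensor_pair:
  assumes "graded_bimodule R A P" "pregraded_module A N"
  shows "tensor_pair A P N"
proof -
  interpret P: graded_bimodule R A P by fact
  interpret N: pregraded_module A N by fact
  show ?thesis by unfold_locales (auto simp: P.rsmult_closed N.smult_closed)
qed

subsection \<open>Transport of the axioms along equality of the relevant fields\<close>

lemma abelian_group_cong:
  assumes "abelian_group M" "carrier M' = carrier M" "\<zero>\<^bsub>M'\<^esub> = \<zero>\<^bsub>M\<^esub>" "add M' = add M"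
  shows "abelian_group M'"
proof -
  interpret M: abelian_group M by fact
  show ?thesis
    by (rule abelian_groupI) (auto simp: assms(2-) M.a_ac intro: M.add.l_inv_ex)
qed

lemma a_inv_cong:
  assumes "carrier M' = carrier M" "\<zero>\<^bsub>M'\<^esub> = \<zero>\<^bsub>M\<^esub>" "add M' = add M"
  shows "\<ominus>\<^bsub>M'\<^esub> x = \<ominus>\<^bsub>M\<^esub> x"
  using assms by (simp add: a_inv_def m_inv_def)

lemma additive_subgroup_iff:
  assumes "abelian_group M"
  shows "additive_subgroup H M \<longleftrightarrow> H \<subseteq> carrier M \<and> \<zero>\<^bsub>M\<^esub> \<in> H \<and>
    (\<forall>x\<in>H. \<forall>y\<in>H. x \<oplus>\<^bsub>M\<^esub> y \<in> H) \<and> (\<forall>x\<in>H. \<ominus>\<^bsub>M\<^esub> x \<in> H)"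
proof -
  interpret M: abelian_group M by fact
  show ?thesis
    by (auto simp: additive_subgroup_def subgroup_def a_inv_def)
qed

lemma additive_subgroup_cong:
  assumes "abelian_group M" "carrier M' = carrier M" "\<zero>\<^bsub>M'\<^esub> = \<zero>\<^bsub>M\<^esub>" "add M' = add M"
    and "additive_subgroup H M"
  shows "additive_subgroup H M'"
  using assms abelian_group_cong[OF assms(1-4)] additive_subgroup_iff[OF assms(1), of H]
    additive_subgroup_iff[of M' H] by (simp add: a_inv_cong[OF assms(2-4)])

lemma pregraded_module_cong:
  assumes "pregraded_module R M" and c: "carrier M' = carrier M" "\<zero>\<^bsub>M'\<^esub> = \<zero>\<^bsub>M\<^esub>" "add M' = add M"
    "smult M' = smult M" and gr: "gr_part M' = (\<lambda>i. gr_part M (i - n))"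
  shows "pregraded_module R M'"
proof -
  interpret M: pregraded_module R M by fact
  show ?thesis
  proof (rule pregraded_moduleI)
    show "ring R" by (rule M.R.ring_axioms)
    show "abelian_group M'" by (rule abelian_group_cong[OF M.M.abelian_group_axioms c(1-3)])
    show "additive_subgroup (gr_part M' i) M'" for i
      using additive_subgroup_cong[OF M.M.abelian_group_axioms c(1-3) M.gr_part_subgroup] gr by simp
    show "a \<odot>\<^bsub>M'\<^esub> x \<in> gr_part M' (i + j)" if "a \<in> deg_part R i" "x \<in> gr_part M' j" for i j a x
      using M.gr_part_smult[of a i x "j - n"] that by (simp add: gr c algebra_simps)
  qed (simp_all add: c M.smult_closed M.smult_l_distr M.smult_r_distr M.smult_assoc M.smult_one)
qed

lemma gr_shift_simps [simp]:
  "carrier (gr_shift n M) = carrier M" "\<zero>\<^bsub>gr_shift n M\<^esub> = \<zero>\<^bsub>M\<^esub>" "add (gr_shift n M) = add M"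
  "smult (gr_shift n M) = smult M" "gr_part (gr_shift n M) i = gr_part M (i - n)"
  by (simp_all add: gr_shift_def)

lemma rsmult_gr_shift [simp]: "rsmult (gr_shift n P) = rsmult (P :: ('r, 'p, 'y) gbimod_scheme)"
  by (simp add: gr_shift_def)

lemma a_inv_gr_shift [simp]: "\<ominus>\<^bsub>gr_shift n M\<^esub> x = \<ominus>\<^bsub>M\<^esub> x"
  by (rule a_inv_cong) simp_all

lemma pregraded_gr_shift: "pregraded_module R M \<Longrightarrow> pregraded_module R (gr_shift n M)"
  by (rule pregraded_module_cong[where n = n]) auto

lemma graded_bimodule_gr_shift:
  assumes "graded_bimodule R A P"
  shows "graded_bimodule R A (gr_shift n P)"
proof -
  interpret P: graded_bimodule R A P by fact
  interpret S: pregraded_module R "gr_shift n P"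
    by (rule pregraded_gr_shift) (rule P.pregraded_module_axioms)
  show ?thesis
  proof unfold_locales
    show "rsmult (gr_shift n P) x a \<in> gr_part (gr_shift n P) (i + j)"
      if "x \<in> gr_part (gr_shift n P) i" "a \<in> deg_part A j" for i j a x
      using P.gr_part_rsmult[of x "i - n" a j] that by (simp add: algebra_simps)
  qed (simp_all add: P.rsmult_closed P.rsmult_l_distr P.rsmult_r_distr P.rsmult_assoc P.rsmult_one
      P.smult_rsmult P.deg_part_left P.deg_part_right)
qed

subsection \<open>Homomorphisms\<close>

lemma gmod_homI:
  assumes "\<And>x. x \<in> carrier M \<Longrightarrow> f x \<in> carrier N"
    and "\<And>x y. \<lbrakk>x \<in> carrier M; y \<in> carrier M\<rbrakk> \<Longrightarrow> f (x \<oplus>\<^bsub>M\<^esub> y) = f x \<oplus>\<^bsub>N\<^esub> f y"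
    and "\<And>a x. \<lbrakk>a \<in> carrier R; x \<in> carrier M\<rbrakk> \<Longrightarrow> f (a \<odot>\<^bsub>M\<^esub> x) = a \<odot>\<^bsub>N\<^esub> f x"
    and "\<And>i x. x \<in> gr_part M i \<Longrightarrow> f x \<in> gr_part N i"
  shows "f \<in> gmod_hom R M N"
  using assms by (auto simp: gmod_hom_def)

lemma gmod_homD:
  assumes "f \<in> gmod_hom R M N"
  shows "x \<in> carrier M \<Longrightarrow> f x \<in> carrier N"
    and "\<lbrakk>x \<in> carrier M; y \<in> carrier M\<rbrakk> \<Longrightarrow> f (x \<oplus>\<^bsub>M\<^esub> y) = f x \<oplus>\<^bsub>N\<^esub> f y"
    and "\<lbrakk>a \<in> carrier R; x \<in> carrier M\<rbrakk> \<Longrightarrow> f (a \<odot>\<^bsub>M\<^esub> x) = a \<odot>\<^bsub>N\<^esub> f x"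
    and "x \<in> gr_part M i \<Longrightarrow> f x \<in> gr_part N i"
  using assms by (auto simp: gmod_hom_def image_subset_iff)

lemma additive_zero:
  assumes "abelian_group M" "abelian_group N" "f \<zero>\<^bsub>M\<^esub> \<in> carrier N"
    and "f (\<zero>\<^bsub>M\<^esub> \<oplus>\<^bsub>M\<^esub> \<zero>\<^bsub>M\<^esub>) = f \<zero>\<^bsub>M\<^esub> \<oplus>\<^bsub>N\<^esub> f \<zero>\<^bsub>M\<^esub>"
  shows "f \<zero>\<^bsub>M\<^esub> = \<zero>\<^bsub>N\<^esub>"
proof -
  interpret M: abelian_group M by fact
  interpret N: abelian_group N by fact
  show ?thesis using assms(3,4) by (simp add: N.add.l_cancel_one')
qed

lemma gmod_hom_zero:
  assumes "f \<in> gmod_hom R M N" "abelian_group M" "abelian_group N"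
  shows "f \<zero>\<^bsub>M\<^esub> = \<zero>\<^bsub>N\<^esub>"
proof -
  interpret M: abelian_group M by fact
  show ?thesis
    by (rule additive_zero[OF assms(2,3)]) (simp_all add: gmod_homD[OF assms(1)] del: M.r_zero M.l_zero)
qed

lemma gmod_hom_minus:
  assumes f: "f \<in> gmod_hom R M N" and "abelian_group M" "abelian_group N" "x \<in> carrier M"
  shows "f (\<ominus>\<^bsub>M\<^esub> x) = \<ominus>\<^bsub>N\<^esub> f x"
proof -
  interpret M: abelian_group M by fact
  interpret N: abelian_group N by fact
  have "f (\<ominus>\<^bsub>M\<^esub> x) \<oplus>\<^bsub>N\<^esub> f x = f (\<ominus>\<^bsub>M\<^esub> x \<oplus>\<^bsub>M\<^esub> x)"
    using assms(4) by (intro gmod_homD(2)[OF f, symmetric]) auto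
  also have "\<dots> = \<zero>\<^bsub>N\<^esub>"
    using assms(4) gmod_hom_zero[OF assms(1-3)] by (simp add: M.l_neg)
  finally show ?thesis
    using N.minus_equality[of "f (\<ominus>\<^bsub>M\<^esub> x)" "f x"] gmod_homD(1)[OF f] assms(4) by simp
qed

lemma gmod_hom_comp:
  "\<lbrakk>f \<in> gmod_hom R M N; g \<in> gmod_hom R N K\<rbrakk> \<Longrightarrow> g \<circ> f \<in> gmod_hom R M K"
  by (rule gmod_homI) (simp_all add: gmod_homD)

lemma gmod_hom_ident: "(\<lambda>x. x) \<in> gmod_hom R M M"
  by (simp add: gmod_hom_def)

lemma gmod_hom_zero_map: "pregraded_module R N \<Longrightarrow> (\<lambda>x. \<zero>\<^bsub>N\<^esub>) \<in> gmod_hom R M N"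
proof -
  assume "pregraded_module R N"
  then interpret N: pregraded_module R N .
  show ?thesis by (rule gmod_homI) (simp_all add: N.smult_zero_right N.gr_part_zero)
qed

lemma gmod_hom_add_map:
  assumes "pregraded_module R N" and f: "f \<in> gmod_hom R M N" and g: "g \<in> gmod_hom R M N"
  shows "(\<lambda>x. f x \<oplus>\<^bsub>N\<^esub> g x) \<in> gmod_hom R M N"
proof -
  interpret N: pregraded_module R N by fact
  note D = gmod_homD[OF f] gmod_homD[OF g]
  show ?thesis by (rule gmod_homI) (simp_all add: D N.smult_r_distr N.gr_part_add N.M.a_ac)
qed

lemma gmod_hom_minus_map:
  assumes "pregraded_module R N" and f: "f \<in> gmod_hom R M N"
  shows "(\<lambda>x. \<ominus>\<^bsub>N\<^esub> f x) \<in> gmod_hom R M N"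
proof -
  interpret N: pregraded_module R N by fact
  note D = gmod_homD[OF f]
  show ?thesis
    by (rule gmod_homI) (simp_all add: D N.smult_minus_right N.gr_part_minus N.M.minus_add)
qed

definition bimod_hom ::
  "('r, 'x) gring_scheme \<Rightarrow> ('r, 'x') gring_scheme \<Rightarrow> ('r, 'm, 'y) gbimod_scheme \<Rightarrow>
   ('r, 'n, 'z) gbimod_scheme \<Rightarrow> ('m \<Rightarrow> 'n) set" where
  "bimod_hom R A M N = {f \<in> gmod_hom R M N.
     \<forall>x\<in>carrier M. \<forall>a\<in>carrier A. f (rsmult M x a) = rsmult N (f x) a}"

lemma bimod_hom_ident: "(\<lambda>x. x) \<in> bimod_hom R A M M"
  by (simp add: bimod_hom_def gmod_hom_ident)

lemma gbimod_hom_eq: "gbimod_hom R M N = bimod_hom R R M N"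
  by (simp add: gbimod_hom_def bimod_hom_def)

subsection \<open>The grading of a tensor product\<close>

context tensor_pair
begin

lemma minus_tensor_group: "X \<in> carrier T \<Longrightarrow> inv\<^bsub>tensor_group A M N\<^esub> X = \<ominus>\<^bsub>T\<^esub> X"
  by (simp add: a_inv_def m_inv_def tensor_simps)

lemma gr_part_subset:
  assumes "\<And>i. gr_part M i \<subseteq> carrier M" "\<And>i. gr_part N i \<subseteq> carrier N"
  shows "{pure x y | x y i j. x \<in> gr_part M i \<and> y \<in> gr_part N j \<and> i + j = n} \<subseteq> carrier T"
  using pure_closed assms by fast

lemma tensor_gr_part_subgroup:
  assumes "\<And>i. gr_part M i \<subseteq> carrier M" "\<And>i. gr_part N i \<subseteq> carrier N"
  shows "additive_subgroup (gr_part T n) T"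
proof -
  interpret G: comm_group "tensor_group A M N" by (rule tensor_comm_group)
  have "subgroup (gr_part T n) (tensor_group A M N)"
    unfolding tensor_simps using gr_part_subset[OF assms, of n]
    by (intro G.generate_is_subgroup) (simp add: tensor_simps)
  then interpret S: subgroup "gr_part T n" "tensor_group A M N" .
  have sub: "gr_part T n \<subseteq> carrier T" using S.subset by (simp add: tensor_simps(1))
  show ?thesis
    unfolding additive_subgroup_iff[OF tensor_abelian_group]
  proof (intro conjI ballI)
    show "\<ominus>\<^bsub>T\<^esub> x \<in> gr_part T n" if "x \<in> gr_part T n" for x
      using S.m_inv_closed[OF that] minus_tensor_group[of x] subsetD[OF sub that] by simp
  qed (use sub S.one_closed S.m_closed in \<open>simp_all only: tensor_simps(2,3)\<close>)
qed

lemma gr_part_pure: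
  assumes "x \<in> gr_part M i" "y \<in> gr_part N j"
  shows "pure x y \<in> gr_part T (i + j)"
  unfolding tensor_simps by (rule generate.incl) (use assms in blast)

lemma gr_part_image:
  assumes "abelian_group K" "additive_subgroup H K"
    and sub: "\<And>i. gr_part M i \<subseteq> carrier M" "\<And>i. gr_part N i \<subseteq> carrier N"
    and f: "f \<in> carrier T \<rightarrow> carrier K" "\<And>X Y. \<lbrakk>X \<in> carrier T; Y \<in> carrier T\<rbrakk> \<Longrightarrow> f (X \<oplus>\<^bsub>T\<^esub> Y) = f X \<oplus>\<^bsub>K\<^esub> f Y"
    and p: "\<And>x y i j. \<lbrakk>x \<in> gr_part M i; y \<in> gr_part N j; i + j = n\<rbrakk> \<Longrightarrow> f (pure x y) \<in> H"
    and "X \<in> gr_part T n"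
  shows "f X \<in> H"
proof -
  interpret G: comm_group "tensor_group A M N" by (rule tensor_comm_group)
  interpret K: abelian_group K by fact
  interpret H: additive_subgroup H K by fact
  have f0: "f \<zero>\<^bsub>T\<^esub> = \<zero>\<^bsub>K\<^esub>"
    by (rule additive_zero[OF tensor_abelian_group assms(1)]) (use f(1) f(2)[OF T.zero_closed T.zero_closed] in \<open>simp_all add: Pi_iff\<close>)
  have fm: "f (\<ominus>\<^bsub>T\<^esub> X) = \<ominus>\<^bsub>K\<^esub> f X" if "X \<in> carrier T" for X
    using f(2)[of "\<ominus>\<^bsub>T\<^esub> X" X] f(1) K.minus_equality[of "f (\<ominus>\<^bsub>T\<^esub> X)" "f X"] that
    by (simp add: T.l_neg f0 Pi_iff)
  from \<open>X \<in> gr_part T n\<close> have "X \<in> carrier T \<and> f X \<in> H"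
    unfolding tensor_simps(5)
  proof (induction rule: generate.induct)
    case one
    then show ?case using f0 T.zero_closed H.zero_closed by (simp add: tensor_simps)
  next
    case (incl h)
    then show ?case using gr_part_subset[OF sub, of n] p by fast
  next
    case (inv h)
    hence "h \<in> carrier T" "f h \<in> H" using gr_part_subset[OF sub, of n] p by fast+
    then show ?case
      using fm H.a_inv_closed minus_tensor_group[of h] by simp
  next
    case (eng h1 h2)
    then show ?case
      using f(2)[of h1 h2] T.a_closed[of h1 h2] H.a_closed by (simp add: tensor_simps(3))
  qed
  thus ?thesis by simp
qed

end

subsection \<open>The left action on a tensor product\<close>

locale bimodule_tensor = P: graded_bimodule R A P + N: pregraded_module A N
  for R :: "('r, 'x) gring_scheme" and A :: "('r, 'x') gring_scheme"
    and P :: "('r, 'p, 'y) gbimod_scheme" and N :: "('r, 'n, 'z) gmod_scheme"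
begin

sublocale tensor_pair A P N
  by (rule graded_bimodule_tensor_pair[OF P.graded_bimodule_axioms N.pregraded_module_axioms])

lemma
  assumes "a \<in> carrier R"
  shows smult_pure: "\<lbrakk>x \<in> carrier P; y \<in> carrier N\<rbrakk> \<Longrightarrow> a \<odot>\<^bsub>T\<^esub> pure x y = pure (a \<odot>\<^bsub>P\<^esub> x) y"
    and smult_tensor_closed: "X \<in> carrier T \<Longrightarrow> a \<odot>\<^bsub>T\<^esub> X \<in> carrier T"
    and smult_tensor_add: "\<lbrakk>X \<in> carrier T; Y \<in> carrier T\<rbrakk> \<Longrightarrow> a \<odot>\<^bsub>T\<^esub> (X \<oplus>\<^bsub>T\<^esub> Y) = a \<odot>\<^bsub>T\<^esub> X \<oplus>\<^bsub>T\<^esub> a \<odot>\<^bsub>T\<^esub> Y"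
proof -
  have h: "(\<lambda>x. a \<odot>\<^bsub>P\<^esub> x) \<in> carrier P \<rightarrow> carrier P"
    "\<And>x x'. \<lbrakk>x \<in> carrier P; x' \<in> carrier P\<rbrakk> \<Longrightarrow> a \<odot>\<^bsub>P\<^esub> (x \<oplus>\<^bsub>P\<^esub> x') = a \<odot>\<^bsub>P\<^esub> x \<oplus>\<^bsub>P\<^esub> a \<odot>\<^bsub>P\<^esub> x'"
    "(\<lambda>y. y) \<in> carrier N \<rightarrow> carrier N"
    "\<And>x b y. \<lbrakk>x \<in> carrier P; b \<in> carrier A; y \<in> carrier N\<rbrakk> \<Longrightarrow>
      pure (a \<odot>\<^bsub>P\<^esub> rsmult P x b) y = pure (a \<odot>\<^bsub>P\<^esub> x) (b \<odot>\<^bsub>N\<^esub> y)"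
    using assms by (auto simp: P.smult_closed P.smult_r_distr P.smult_rsmult[symmetric] pure_balanced)
  note tm = tensor_map[OF tensor_pair_axioms tensor_pair_axioms h(1,2,3) refl h(4)]
  show "\<lbrakk>x \<in> carrier P; y \<in> carrier N\<rbrakk> \<Longrightarrow> a \<odot>\<^bsub>T\<^esub> pure x y = pure (a \<odot>\<^bsub>P\<^esub> x) y"
    unfolding tensor_simps(4) by (rule tm(1)) auto
  show "X \<in> carrier T \<Longrightarrow> a \<odot>\<^bsub>T\<^esub> X \<in> carrier T"
    unfolding tensor_simps(4) by (rule funcset_mem[OF tm(2)]) auto
  show "\<lbrakk>X \<in> carrier T; Y \<in> carrier T\<rbrakk> \<Longrightarrow> a \<odot>\<^bsub>T\<^esub> (X \<oplus>\<^bsub>T\<^esub> Y) = a \<odot>\<^bsub>T\<^esub> X \<oplus>\<^bsub>T\<^esub> a \<odot>\<^bsub>T\<^esub> Y"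
    unfolding tensor_simps(4) by (rule tm(3)) auto
qed

lemma gr_sub: "gr_part P i \<subseteq> carrier P" "gr_part N i \<subseteq> carrier N"
  using P.gr_part_closed N.gr_part_closed by auto

lemma tensor_pregraded: "pregraded_module R T"
proof (rule pregraded_moduleI)
  show "ring R" by (rule P.R.ring_axioms)
  show "abelian_group T" by (rule tensor_abelian_group)
  show "additive_subgroup (gr_part T i) T" for i
    by (rule tensor_gr_part_subgroup[OF gr_sub])
  fix a b X assume a: "a \<in> carrier R" "b \<in> carrier R" and X: "X \<in> carrier T"
  have ab: "a \<oplus>\<^bsub>R\<^esub> b \<in> carrier R" "a \<otimes>\<^bsub>R\<^esub> b \<in> carrier R" using a by auto
  show "(a \<oplus>\<^bsub>R\<^esub> b) \<odot>\<^bsub>T\<^esub> X = a \<odot>\<^bsub>T\<^esub> X \<oplus>\<^bsub>T\<^esub> b \<odot>\<^bsub>T\<^esub> X"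
    by (rule additive_eq[OF X tensor_abelian_group])
      (use a ab in \<open>simp_all add: smult_tensor_closed smult_tensor_add smult_pure P.smult_l_distr
        P.smult_closed pure_add_left T.a_ac\<close>)
  show "(a \<otimes>\<^bsub>R\<^esub> b) \<odot>\<^bsub>T\<^esub> X = a \<odot>\<^bsub>T\<^esub> (b \<odot>\<^bsub>T\<^esub> X)"
    by (rule additive_eq[OF X tensor_abelian_group])
      (use a ab in \<open>simp_all add: smult_tensor_closed smult_tensor_add smult_pure P.smult_assoc
        P.smult_closed\<close>)
next
  show "\<one>\<^bsub>R\<^esub> \<odot>\<^bsub>T\<^esub> X = X" if X: "X \<in> carrier T" for X
    by (rule additive_eq[OF X tensor_abelian_group])
      (simp_all add: smult_tensor_closed smult_tensor_add smult_pure P.smult_one)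
  show "a \<odot>\<^bsub>T\<^esub> X \<in> gr_part T (i + j)" if "a \<in> deg_part R i" "X \<in> gr_part T j" for i j a X
  proof (rule gr_part_image[OF tensor_abelian_group tensor_gr_part_subgroup[OF gr_sub] gr_sub _ _ _ that(2)])
    have a: "a \<in> carrier R" using P.deg_part_left[OF that(1)] .
    show "a \<odot>\<^bsub>T\<^esub> pure x y \<in> gr_part T (i + j)"
      if "x \<in> gr_part P k" "y \<in> gr_part N l" "k + l = j" for x y k l
      using smult_pure[OF a, of x y] gr_part_pure[OF P.gr_part_smult[OF \<open>a \<in> deg_part R i\<close> that(1)] that(2)]
        P.gr_part_closed[OF that(1)] N.gr_part_closed[OF that(2)] that(3) by (simp add: add.assoc)
  qed (use P.deg_part_left[OF that(1)] in \<open>simp_all add: smult_tensor_closed smult_tensor_add\<close>)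
qed (simp_all add: smult_tensor_closed smult_tensor_add)

end

subsection \<open>Functoriality\<close>

lemma bimod_homD:
  assumes "f \<in> bimod_hom R A M N"
  shows "f \<in> gmod_hom R M N"
    and "\<lbrakk>x \<in> carrier M; a \<in> carrier A\<rbrakk> \<Longrightarrow> f (rsmult M x a) = rsmult N (f x) a"
  using assms by (auto simp: bimod_hom_def)

lemma
  assumes "bimodule_tensor R A P N" "bimodule_tensor R A P' N'"
    and f: "f \<in> bimod_hom R A P P'" and g: "g \<in> gmod_hom A N N'"
  shows tensor_map_hom: "tensor_map A P' N' f g \<in> gmod_hom R (tensor_mod A P N) (tensor_mod A P' N')"
    and tensor_map_hom_pure: "\<And>x y. \<lbrakk>x \<in> carrier P; y \<in> carrier N\<rbrakk> \<Longrightarrow>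
      tensor_map A P' N' f g (pure_tensor A P N x y) = pure_tensor A P' N' (f x) (g y)"
proof -
  interpret S: bimodule_tensor R A P N by fact
  interpret T: bimodule_tensor R A P' N' by fact
  note fD = gmod_homD[OF bimod_homD(1)[OF f]] bimod_homD(2)[OF f]
  note gD = gmod_homD[OF g]
  have h: "f \<in> carrier P \<rightarrow> carrier P'" "g \<in> carrier N \<rightarrow> carrier N'"
    "\<And>x a y. \<lbrakk>x \<in> carrier P; a \<in> carrier A; y \<in> carrier N\<rbrakk> \<Longrightarrow>
      T.pure (f (rsmult P x a)) (g y) = T.pure (f x) (g (a \<odot>\<^bsub>N\<^esub> y))"
    using fD gD by (simp_all add: T.pure_balanced)
  note tm = tensor_map[OF S.tensor_pair_axioms T.tensor_pair_axioms h(1) fD(2) h(2) gD(2) h(3)]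
  show pure: "tensor_map A P' N' f g (S.pure x y) = T.pure (f x) (g y)"
    if "x \<in> carrier P" "y \<in> carrier N" for x y
    by (rule tm(1)) (use that in auto)
  have cl: "tensor_map A P' N' f g \<in> carrier S.T \<rightarrow> carrier T.T" by (rule tm(2)) auto
  have ad: "tensor_map A P' N' f g (X \<oplus>\<^bsub>S.T\<^esub> Y) = tensor_map A P' N' f g X \<oplus>\<^bsub>T.T\<^esub> tensor_map A P' N' f g Y"
    if "X \<in> carrier S.T" "Y \<in> carrier S.T" for X Y
    by (rule tm(3)) (use that in auto)
  show "tensor_map A P' N' f g \<in> gmod_hom R S.T T.T"
  proof (rule gmod_homI)
    show "tensor_map A P' N' f g X \<in> carrier T.T" if "X \<in> carrier S.T" for X
      using cl that by auto
    show "tensor_map A P' N' f g (a \<odot>\<^bsub>S.T\<^esub> X) = a \<odot>\<^bsub>T.T\<^esub> tensor_map A P' N' f g X"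
      if a: "a \<in> carrier R" and X: "X \<in> carrier S.T" for a X
      by (rule S.additive_eq[OF X T.tensor_abelian_group])
        (use a cl in \<open>simp_all add: Pi_iff ad S.smult_tensor_closed S.smult_tensor_add T.smult_tensor_closed
          T.smult_tensor_add S.smult_pure T.smult_pure pure S.P.smult_closed fD gD\<close>)
    show "tensor_map A P' N' f g X \<in> gr_part T.T i" if "X \<in> gr_part S.T i" for i X
    proof (rule S.gr_part_image[OF T.tensor_abelian_group T.tensor_gr_part_subgroup[OF T.gr_sub]
          S.gr_sub cl ad _ that])
      show "tensor_map A P' N' f g (S.pure x y) \<in> gr_part T.T i"
        if "x \<in> gr_part P k" "y \<in> gr_part N l" "k + l = i" for x y k l
        using T.gr_part_pure[OF fD(4)[OF that(1)] gD(4)[OF that(2)]] that(3)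
          pure[OF S.P.gr_part_closed[OF that(1)] S.N.gr_part_closed[OF that(2)]] by simp
    qed
  qed (rule ad)
qed

lemma (in bimodule_tensor) hom_eqI:
  assumes "f \<in> gmod_hom R T K" "g \<in> gmod_hom R T K" "abelian_group K" "X \<in> carrier T"
    and "\<And>x y. \<lbrakk>x \<in> carrier P; y \<in> carrier N\<rbrakk> \<Longrightarrow> f (pure x y) = g (pure x y)"
  shows "f X = g X"
  by (rule additive_eq[OF assms(4,3)]) (use assms in \<open>simp_all add: gmod_homD\<close>)

lemma tensor_map_comp:
  assumes t: "bimodule_tensor R A P N" "bimodule_tensor R A P' N'" "bimodule_tensor R A P'' N''"
    and f: "f \<in> bimod_hom R A P P'" "f' \<in> bimod_hom R A P' P''"
    and g: "g \<in> gmod_hom A N N'" "g' \<in> gmod_hom A N' N''"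
    and X: "X \<in> carrier (tensor_mod A P N)"
  shows "tensor_map A P'' N'' f' g' (tensor_map A P' N' f g X) =
    tensor_map A P'' N'' (\<lambda>x. f' (f x)) (\<lambda>y. g' (g y)) X"
proof -
  interpret S: bimodule_tensor R A P N by fact
  interpret T: bimodule_tensor R A P'' N'' by fact
  have ff: "(\<lambda>x. f' (f x)) \<in> bimod_hom R A P P''"
    using f gmod_hom_comp[of f R P P' f' P''] gmod_homD(1)[of f R P P'] by (auto simp: bimod_hom_def comp_def)
  have gg: "(\<lambda>x. g' (g x)) \<in> gmod_hom A N N''"
    using gmod_hom_comp[OF g] by (simp add: comp_def)
  have "(tensor_map A P'' N'' f' g' \<circ> tensor_map A P' N' f g) X = tensor_map A P'' N'' (\<lambda>x. f' (f x)) (\<lambda>y. g' (g y)) X"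
  proof (rule S.hom_eqI[OF _ _ T.tensor_abelian_group X])
    show "tensor_map A P'' N'' f' g' \<circ> tensor_map A P' N' f g \<in> gmod_hom R S.T T.T"
      by (rule gmod_hom_comp[OF tensor_map_hom[OF t(1,2) f(1) g(1)] tensor_map_hom[OF t(2,3) f(2) g(2)]])
    show "tensor_map A P'' N'' (\<lambda>x. f' (f x)) (\<lambda>y. g' (g y)) \<in> gmod_hom R S.T T.T"
      by (rule tensor_map_hom[OF t(1,3) ff gg])
    show "(tensor_map A P'' N'' f' g' \<circ> tensor_map A P' N' f g) (S.pure x y)
        = tensor_map A P'' N'' (\<lambda>x. f' (f x)) (\<lambda>y. g' (g y)) (S.pure x y)"
      if "x \<in> carrier P" "y \<in> carrier N" for x y
      using that gmod_homD(1)[OF bimod_homD(1)[OF f(1)]] gmod_homD(1)[OF g(1)]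
      by (simp add: tensor_map_hom_pure[OF t(1,2) f(1) g(1)] tensor_map_hom_pure[OF t(2,3) f(2) g(2)]
          tensor_map_hom_pure[OF t(1,3) ff gg])
  qed
  thus ?thesis by simp
qed

lemma tensor_map_cong:
  assumes t: "bimodule_tensor R A P N" "bimodule_tensor R A P' N'"
    and f: "f \<in> bimod_hom R A P P'" "f' \<in> bimod_hom R A P P'"
    and g: "g \<in> gmod_hom A N N'" "g' \<in> gmod_hom A N N'"
    and eq: "\<And>x. x \<in> carrier P \<Longrightarrow> f x = f' x" "\<And>y. y \<in> carrier N \<Longrightarrow> g y = g' y"
    and X: "X \<in> carrier (tensor_mod A P N)"
  shows "tensor_map A P' N' f g X = tensor_map A P' N' f' g' X"
proof -
  interpret S: bimodule_tensor R A P N by fact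
  interpret T: bimodule_tensor R A P' N' by fact
  show ?thesis
    by (rule S.hom_eqI[OF tensor_map_hom[OF t f(1) g(1)] tensor_map_hom[OF t f(2) g(2)]
          T.tensor_abelian_group X])
      (simp add: tensor_map_hom_pure[OF t f(1) g(1)] tensor_map_hom_pure[OF t f(2) g(2)] eq)
qed

lemma tensor_map_ident:
  assumes t: "bimodule_tensor R A P N" and f: "f \<in> bimod_hom R A P P" and g: "g \<in> gmod_hom A N N"
    and eq: "\<And>x. x \<in> carrier P \<Longrightarrow> f x = x" "\<And>y. y \<in> carrier N \<Longrightarrow> g y = y"
    and X: "X \<in> carrier (tensor_mod A P N)"
  shows "tensor_map A P N f g X = X"
proof -
  interpret S: bimodule_tensor R A P N by fact
  show ?thesis
    by (rule S.hom_eqI[OF tensor_map_hom[OF t t f g] gmod_hom_ident S.tensor_abelian_group X])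
      (simp add: tensor_map_hom_pure[OF t t f g] eq)
qed

lemma tensor_map_right_add:
  assumes t: "bimodule_tensor R A P N" "bimodule_tensor R A P' N'"
    and f: "f \<in> bimod_hom R A P P'" and g: "g \<in> gmod_hom A N N'" "g' \<in> gmod_hom A N N'"
    and X: "X \<in> carrier (tensor_mod A P N)"
  shows "tensor_map A P' N' f (\<lambda>y. g y \<oplus>\<^bsub>N'\<^esub> g' y) X =
    tensor_map A P' N' f g X \<oplus>\<^bsub>tensor_mod A P' N'\<^esub> tensor_map A P' N' f g' X"
proof -
  interpret S: bimodule_tensor R A P N by fact
  interpret T: bimodule_tensor R A P' N' by fact
  have gg: "(\<lambda>y. g y \<oplus>\<^bsub>N'\<^esub> g' y) \<in> gmod_hom A N N'"
    by (rule gmod_hom_add_map[OF T.N.pregraded_module_axioms g])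
  show ?thesis
    by (rule S.hom_eqI[OF tensor_map_hom[OF t f gg]
          gmod_hom_add_map[OF T.tensor_pregraded tensor_map_hom[OF t f g(1)] tensor_map_hom[OF t f g(2)]]
          T.tensor_abelian_group X])
      (simp add: tensor_map_hom_pure[OF t f g(1)] tensor_map_hom_pure[OF t f g(2)] tensor_map_hom_pure[OF t f gg]
        T.pure_add_right gmod_homD(1)[OF bimod_homD(1)[OF f]] gmod_homD(1)[OF g(1)] gmod_homD(1)[OF g(2)])
qed

lemma tensor_map_right_zero:
  assumes t: "bimodule_tensor R A P N" "bimodule_tensor R A P' N'"
    and f: "f \<in> bimod_hom R A P P'" and X: "X \<in> carrier (tensor_mod A P N)"
  shows "tensor_map A P' N' f (\<lambda>y. \<zero>\<^bsub>N'\<^esub>) X = \<zero>\<^bsub>tensor_mod A P' N'\<^esub>"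
proof -
  interpret S: bimodule_tensor R A P N by fact
  interpret T: bimodule_tensor R A P' N' by fact
  have gg: "(\<lambda>y. \<zero>\<^bsub>N'\<^esub>) \<in> gmod_hom A N N'"
    by (rule gmod_hom_zero_map[OF T.N.pregraded_module_axioms])
  show ?thesis
    by (rule S.hom_eqI[OF tensor_map_hom[OF t f gg] gmod_hom_zero_map[OF T.tensor_pregraded]
          T.tensor_abelian_group X])
      (simp add: tensor_map_hom_pure[OF t f gg] T.pure_zero_right gmod_homD(1)[OF bimod_homD(1)[OF f]])
qed

subsection \<open>Tensor products of bimodules\<close>

lemma tensor_bimod_simps [simp]:
  "carrier (tensor_bimod A M N) = carrier (tensor_mod A M N)"
  "\<zero>\<^bsub>tensor_bimod A M N\<^esub> = \<zero>\<^bsub>tensor_mod A M N\<^esub>"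
  "add (tensor_bimod A M N) = add (tensor_mod A M N)"
  "smult (tensor_bimod A M N) = smult (tensor_mod A M N)"
  "gr_part (tensor_bimod A M N) = gr_part (tensor_mod A M N)"
  "rsmult (tensor_bimod A M N) X a = tensor_map A M N (\<lambda>x. x) (\<lambda>y. rsmult N y a) X"
  by (simp_all add: tensor_bimod_def gmod.defs gbimod.defs)

lemma tensor_graded_bimodule:
  assumes "graded_bimodule R A P" "graded_bimodule A C N"
  shows "graded_bimodule R C (tensor_bimod A P N)"
    and tensor_rsmult_pure: "\<And>x y c. \<lbrakk>x \<in> carrier P; y \<in> carrier N; c \<in> carrier C\<rbrakk> \<Longrightarrow>
      rsmult (tensor_bimod A P N) (pure_tensor A P N x y) c = pure_tensor A P N x (rsmult N y c)"
proof -
  interpret P: graded_bimodule R A P by fact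
  interpret N: graded_bimodule A C N by fact
  interpret bimodule_tensor R A P N ..
  have r:
    "rsmult (tensor_bimod A P N) (pure x y) c = pure x (rsmult N y c)"
    "rsmult (tensor_bimod A P N) X c \<in> carrier T"
    "rsmult (tensor_bimod A P N) (X \<oplus>\<^bsub>T\<^esub> Y) c = rsmult (tensor_bimod A P N) X c \<oplus>\<^bsub>T\<^esub> rsmult (tensor_bimod A P N) Y c"
    if c: "c \<in> carrier C" and "x \<in> carrier P" "y \<in> carrier N" "X \<in> carrier T" "Y \<in> carrier T"
    for x y X Y c
  proof -
    have h: "(\<lambda>x. x) \<in> carrier P \<rightarrow> carrier P" "(\<lambda>y. rsmult N y c) \<in> carrier N \<rightarrow> carrier N"
      "\<And>y y'. \<lbrakk>y \<in> carrier N; y' \<in> carrier N\<rbrakk> \<Longrightarrow> rsmult N (y \<oplus>\<^bsub>N\<^esub> y') c = rsmult N y c \<oplus>\<^bsub>N\<^esub> rsmult N y' c"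
      "\<And>x a y. \<lbrakk>x \<in> carrier P; a \<in> carrier A; y \<in> carrier N\<rbrakk> \<Longrightarrow>
        pure (rsmult P x a) (rsmult N y c) = pure x (rsmult N (a \<odot>\<^bsub>N\<^esub> y) c)"
      using c by (auto simp: N.rsmult_closed N.rsmult_l_distr N.smult_rsmult pure_balanced)
    note tm = tensor_map[OF tensor_pair_axioms tensor_pair_axioms h(1) refl h(2,3,4)]
    show "rsmult (tensor_bimod A P N) (pure x y) c = pure x (rsmult N y c)"
      unfolding tensor_bimod_simps by (rule tm(1)) (use that in auto)
    show "rsmult (tensor_bimod A P N) X c \<in> carrier T"
      unfolding tensor_bimod_simps by (rule funcset_mem[OF tm(2)]) (use that in auto)
    show "rsmult (tensor_bimod A P N) (X \<oplus>\<^bsub>T\<^esub> Y) c = rsmult (tensor_bimod A P N) X c \<oplus>\<^bsub>T\<^esub> rsmult (tensor_bimod A P N) Y c"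
      unfolding tensor_bimod_simps by (rule tm(3)) (use that in auto)
  qed
  have rpure: "rsmult (tensor_bimod A P N) (pure x y) c = pure x (rsmult N y c)"
    if "c \<in> carrier C" "x \<in> carrier P" "y \<in> carrier N" for x y c
    by (rule r(1)[OF that T.zero_closed T.zero_closed])
  have rcl: "rsmult (tensor_bimod A P N) X c \<in> carrier T"
    if "c \<in> carrier C" "X \<in> carrier T" for X c
    by (rule r(2)[OF that(1) P.M.zero_closed N.M.zero_closed that(2) T.zero_closed])
  have radd: "rsmult (tensor_bimod A P N) (X \<oplus>\<^bsub>T\<^esub> Y) c = rsmult (tensor_bimod A P N) X c \<oplus>\<^bsub>T\<^esub> rsmult (tensor_bimod A P N) Y c"
    if "c \<in> carrier C" "X \<in> carrier T" "Y \<in> carrier T" for X Y c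
    by (rule r(3)[OF that(1) P.M.zero_closed N.M.zero_closed that(2,3)])
  show "\<And>x y c. \<lbrakk>x \<in> carrier P; y \<in> carrier N; c \<in> carrier C\<rbrakk> \<Longrightarrow>
      rsmult (tensor_bimod A P N) (pure x y) c = pure x (rsmult N y c)"
    by (rule rpure)
  have pg: "pregraded_module R (tensor_bimod A P N)"
    by (rule pregraded_module_cong[OF tensor_pregraded, where n = 0]) simp_all
  note S = smult_tensor_closed smult_tensor_add smult_pure rpure rcl radd
  show "graded_bimodule R C (tensor_bimod A P N)"
    unfolding graded_bimodule_def graded_bimodule_axioms_def
  proof (intro conjI allI impI, goal_cases)
    case 1 show ?case by (rule pg)
  next
    case 2 show ?case by (rule N.A.ring_axioms)
  next
    case (3 X c)
    then show ?case using rcl by (simp del: tensor_bimod_simps(6))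
  next
    case (4 X Y c)
    then show ?case using radd by (simp del: tensor_bimod_simps(6))
  next
    case (5 X a b)
    hence X: "X \<in> carrier T" by simp
    have c: "a \<oplus>\<^bsub>C\<^esub> b \<in> carrier C" using 5 by simp
    show ?case unfolding tensor_bimod_simps(3)
      by (rule additive_eq[OF X tensor_abelian_group])
        (use 5 c in \<open>simp_all add: S N.rsmult_r_distr N.rsmult_closed pure_add_right T.a_ac del: tensor_bimod_simps(6)\<close>)
  next
    case (6 X a b)
    hence X: "X \<in> carrier T" by simp
    have c: "a \<otimes>\<^bsub>C\<^esub> b \<in> carrier C" using 6 by simp
    show ?case
      by (rule additive_eq[OF X tensor_abelian_group])
        (use 6 c in \<open>simp_all add: S N.rsmult_assoc N.rsmult_closed del: tensor_bimod_simps(6)\<close>)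
  next
    case (7 X)
    hence X: "X \<in> carrier T" by simp
    show ?case
      by (rule additive_eq[OF X tensor_abelian_group])
        (use 7 in \<open>simp_all add: S N.rsmult_one del: tensor_bimod_simps(6)\<close>)
  next
    case (8 a X b)
    hence X: "X \<in> carrier T" by simp
    show ?case unfolding tensor_bimod_simps(4)
      by (rule additive_eq[OF X tensor_abelian_group])
        (use 8 in \<open>simp_all add: S P.smult_closed N.rsmult_closed del: tensor_bimod_simps(6)\<close>)
  next
    case (9 i j a X)
    have a: "a \<in> carrier C" using N.deg_part_right[OF 9(2)] .
    have X: "X \<in> gr_part T i" using 9 by simp
    show ?case unfolding tensor_bimod_simps(5)
    proof (rule gr_part_image[OF tensor_abelian_group tensor_gr_part_subgroup[OF gr_sub] gr_sub _ _ _ X])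
      show "rsmult (tensor_bimod A P N) (pure x y) a \<in> gr_part T (i + j)"
        if "x \<in> gr_part P k" "y \<in> gr_part N l" "k + l = i" for x y k l
        using rpure[OF a, of x y] gr_part_pure[OF that(1) N.gr_part_rsmult[OF that(2) 9(2)]]
          P.gr_part_closed[OF that(1)] N.gr_part_closed[OF that(2)] that(3)
        by (simp add: add.assoc[symmetric] del: tensor_bimod_simps(6))
    qed (use a in \<open>simp_all add: S del: tensor_bimod_simps(6)\<close>)
  next
    case (10 a i) then show ?case by (rule P.deg_part_left)
  next
    case (11 a i) then show ?case by (rule N.deg_part_right)
  qed
qed

subsection \<open>Maps out of a tensor product\<close>

text \<open>
  The extension of a balanced map \<open>\<beta>\<close> to the tensor product. Its values on the carrier are unique, so that the choice is
  immaterial.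
\<close>

definition tensor_lift ::
  "('r, 'x) gring_scheme \<Rightarrow> ('r, 'm, 'y) gbimod_scheme \<Rightarrow> ('r, 'n, 'z) gmod_scheme \<Rightarrow>
   ('s, 'l, 'w) gmod_scheme \<Rightarrow> ('m \<Rightarrow> 'n \<Rightarrow> 'l) \<Rightarrow> ('m \<times> 'n \<Rightarrow>\<^sub>0 int) set \<Rightarrow> 'l" where
  "tensor_lift A M N K \<beta> = (SOME h. h \<in> carrier (tensor_mod A M N) \<rightarrow> carrier K \<and>
     (\<forall>X\<in>carrier (tensor_mod A M N). \<forall>Y\<in>carrier (tensor_mod A M N).
        h (X \<oplus>\<^bsub>tensor_mod A M N\<^esub> Y) = h X \<oplus>\<^bsub>K\<^esub> h Y) \<and>
     (\<forall>x\<in>carrier M. \<forall>y\<in>carrier N. h (pure_tensor A M N x y) = \<beta> x y))"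

locale balanced_map = tensor_pair A M N + K: abelian_group K
  for A :: "('r, 'x) gring_scheme" and M :: "('r, 'm, 'y) gbimod_scheme" (structure)
    and N :: "('r, 'n, 'z) gmod_scheme" and K :: "('s, 'l, 'w) gmod_scheme" and \<beta> :: "'m \<Rightarrow> 'n \<Rightarrow> 'l" +
  assumes balanced_closed: "\<lbrakk>x \<in> carrier M; y \<in> carrier N\<rbrakk> \<Longrightarrow> \<beta> x y \<in> carrier K"
    and balanced_left: "\<lbrakk>x \<in> carrier M; x' \<in> carrier M; y \<in> carrier N\<rbrakk> \<Longrightarrow> \<beta> (x \<oplus>\<^bsub>M\<^esub> x') y = \<beta> x y \<oplus>\<^bsub>K\<^esub> \<beta> x' y"
    and balanced_right: "\<lbrakk>x \<in> carrier M; y \<in> carrier N; y' \<in> carrier N\<rbrakk> \<Longrightarrow> \<beta> x (y \<oplus>\<^bsub>N\<^esub> y') = \<beta> x y \<oplus>\<^bsub>K\<^esub> \<beta> x y'"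
    and balanced: "\<lbrakk>x \<in> carrier M; a \<in> carrier A; y \<in> carrier N\<rbrakk> \<Longrightarrow> \<beta> (rsmult M x a) y = \<beta> x (a \<odot>\<^bsub>N\<^esub> y)"
begin

abbreviation "lift \<equiv> tensor_lift A M N K \<beta>"

lemma
  shows lift_closed: "X \<in> carrier T \<Longrightarrow> lift X \<in> carrier K"
    and lift_add: "\<lbrakk>X \<in> carrier T; Y \<in> carrier T\<rbrakk> \<Longrightarrow> lift (X \<oplus>\<^bsub>T\<^esub> Y) = lift X \<oplus>\<^bsub>K\<^esub> lift Y"
    and lift_pure: "\<lbrakk>x \<in> carrier M; y \<in> carrier N\<rbrakk> \<Longrightarrow> lift (pure x y) = \<beta> x y"
proof -
  obtain h where h: "h \<in> carrier T \<rightarrow> carrier K"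
    "\<And>X Y. \<lbrakk>X \<in> carrier T; Y \<in> carrier T\<rbrakk> \<Longrightarrow> h (X \<oplus>\<^bsub>T\<^esub> Y) = h X \<oplus>\<^bsub>K\<^esub> h Y"
    "\<And>x y. \<lbrakk>x \<in> carrier M; y \<in> carrier N\<rbrakk> \<Longrightarrow> h (pure x y) = \<beta> x y"
    by (rule tensor_universal[OF K.abelian_group_axioms, of \<beta>])
      (simp_all add: balanced_closed balanced_left balanced_right balanced)
  let ?P = "\<lambda>h. h \<in> carrier T \<rightarrow> carrier K \<and>
     (\<forall>X\<in>carrier T. \<forall>Y\<in>carrier T. h (X \<oplus>\<^bsub>T\<^esub> Y) = h X \<oplus>\<^bsub>K\<^esub> h Y) \<and>
     (\<forall>x\<in>carrier M. \<forall>y\<in>carrier N. h (pure x y) = \<beta> x y)"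
  have "?P h" using h by simp
  hence P: "?P lift" unfolding tensor_lift_def by (rule someI[of ?P])
  show "X \<in> carrier T \<Longrightarrow> lift X \<in> carrier K" using P by auto
  show "\<lbrakk>X \<in> carrier T; Y \<in> carrier T\<rbrakk> \<Longrightarrow> lift (X \<oplus>\<^bsub>T\<^esub> Y) = lift X \<oplus>\<^bsub>K\<^esub> lift Y" using P by simp
  show "\<lbrakk>x \<in> carrier M; y \<in> carrier N\<rbrakk> \<Longrightarrow> lift (pure x y) = \<beta> x y" using P by simp
qed

lemma lift_minus: "X \<in> carrier T \<Longrightarrow> lift (\<ominus>\<^bsub>T\<^esub> X) = \<ominus>\<^bsub>K\<^esub> lift X"
proof -
  assume X: "X \<in> carrier T"
  have "lift \<zero>\<^bsub>T\<^esub> = \<zero>\<^bsub>K\<^esub>"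
    by (rule additive_zero[OF tensor_abelian_group K.abelian_group_axioms])
      (use lift_closed lift_add[OF T.zero_closed T.zero_closed] in simp_all)
  thus ?thesis
    using X lift_add[of "\<ominus>\<^bsub>T\<^esub> X" X] K.minus_equality[of "lift (\<ominus>\<^bsub>T\<^esub> X)" "lift X"]
    by (simp add: T.l_neg lift_closed)
qed

lemma lift_gr_part:
  assumes "\<And>i. gr_part M i \<subseteq> carrier M" "\<And>i. gr_part N i \<subseteq> carrier N"
    and "additive_subgroup (gr_part K (n - d)) K"
    and "\<And>x y i j. \<lbrakk>x \<in> gr_part M i; y \<in> gr_part N j\<rbrakk> \<Longrightarrow> \<beta> x y \<in> gr_part K (i + j - d)"
    and "X \<in> gr_part T n"
  shows "lift X \<in> gr_part K (n - d)"
proof (rule gr_part_image[OF K.abelian_group_axioms assms(3) assms(1,2) _ _ _ assms(5)])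
  show "lift (pure x y) \<in> gr_part K (n - d)"
    if "x \<in> gr_part M i" "y \<in> gr_part N j" "i + j = n" for x y i j
    using assms(4)[OF that(1,2)] that(3) lift_pure[OF subsetD[OF assms(1) that(1)] subsetD[OF assms(2) that(2)]]
    by simp
qed (simp_all add: lift_closed lift_add)

end

text \<open>
  Evaluation of scalars: a map \<open>c\<close> from \<open>M\<close> to scalars, linear for the right actions, yields the map
  \<open>x \<otimes> y \<mapsto> c x \<odot> y\<close>. Coordinates with respect to a right basis of \<open>M\<close> are of this form.
\<close>

abbreviation tensor_eval ::
  "('r, 'x) gring_scheme \<Rightarrow> ('r, 'm, 'y) gbimod_scheme \<Rightarrow> ('r, 'n, 'z) gmod_scheme \<Rightarrow> ('m \<Rightarrow> 'r) \<Rightarrow>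
   ('m \<times> 'n \<Rightarrow>\<^sub>0 int) set \<Rightarrow> 'n" where
  "tensor_eval A M N c \<equiv> tensor_lift A M N N (\<lambda>x y. c x \<odot>\<^bsub>N\<^esub> y)"

section \<open>Direct sum decompositions and right bases\<close>

subsection \<open>Graded decompositions\<close>

definition decomposes :: "('r, 'm, 'y) gmod_scheme \<Rightarrow> 'm \<Rightarrow> (int \<Rightarrow> 'm) \<Rightarrow> bool" where
  "decomposes M x c \<longleftrightarrow> (\<forall>i. c i \<in> gr_part M i) \<and> finite {i. c i \<noteq> \<zero>\<^bsub>M\<^esub>} \<and>
     x = (\<Oplus>\<^bsub>M\<^esub>i\<in>{i. c i \<noteq> \<zero>\<^bsub>M\<^esub>}. c i)"

definition direct_sum_graded :: "('r, 'm, 'y) gmod_scheme \<Rightarrow> bool" where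
  "direct_sum_graded M \<longleftrightarrow> (\<forall>x\<in>carrier M. \<exists>!c. decomposes M x c)"

lemma graded_left_module_iff:
  "graded_left_module R M \<longleftrightarrow> pregraded_module R M \<and> direct_sum_graded M"
  unfolding graded_left_module_def graded_left_module_axioms_def pregraded_module_def
    pregraded_module_axioms_def direct_sum_graded_def decomposes_def Ball_def
  by blast

locale graded_group = abelian_group M for M :: "('r, 'm, 'y) gmod_scheme" (structure) +
  assumes gr_part_carrier: "x \<in> gr_part M i \<Longrightarrow> x \<in> carrier M"
begin

lemma finsum_support:
  assumes "finite S" "\<And>i. i \<notin> S \<Longrightarrow> c i = \<zero>" "\<And>i. c i \<in> carrier M"
  shows "finsum M c S = finsum M c {i. c i \<noteq> \<zero>}"
proof -
  have sub: "{i. c i \<noteq> \<zero>} \<subseteq> S" using assms(2) by blast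
  show ?thesis
    by (rule add.finprod_mono_neutral_cong_right[OF assms(1) sub]) (use assms(3) in auto)
qed

lemma decomposesI:
  assumes "\<And>i. c i \<in> gr_part M i" "finite S" "\<And>i. i \<notin> S \<Longrightarrow> c i = \<zero>" "x = finsum M c S"
  shows "decomposes M x c"
proof -
  have "finite {i. c i \<noteq> \<zero>}"
    by (rule finite_subset[OF _ assms(2)]) (use assms(3) in blast)
  thus ?thesis
    unfolding decomposes_def using assms(1,4) finsum_support[OF assms(2,3) gr_part_carrier[OF assms(1)]] by simp
qed

lemma decomposesD:
  assumes "decomposes M x c"
  shows "c i \<in> gr_part M i" "c i \<in> carrier M" "finite {i. c i \<noteq> \<zero>}"
    and "\<lbrakk>finite S; \<And>i. i \<notin> S \<Longrightarrow> c i = \<zero>\<rbrakk> \<Longrightarrow> x = finsum M c S"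
proof -
  show c: "c i \<in> gr_part M i" "c i \<in> carrier M" "finite {i. c i \<noteq> \<zero>}" for i
    using assms gr_part_carrier by (auto simp: decomposes_def)
  show "x = finsum M c S" if "finite S" "\<And>i. i \<notin> S \<Longrightarrow> c i = \<zero>"
    using finsum_support[of S c] that c assms by (simp add: decomposes_def)
qed

end

lemma additive_finsum:
  assumes "abelian_group M" "abelian_group N"
    and f: "f \<in> carrier M \<rightarrow> carrier N" "\<And>x y. \<lbrakk>x \<in> carrier M; y \<in> carrier M\<rbrakk> \<Longrightarrow> f (x \<oplus>\<^bsub>M\<^esub> y) = f x \<oplus>\<^bsub>N\<^esub> f y"
    and c: "\<And>i. c i \<in> carrier M"
  shows "f (finsum M c S) = finsum N (\<lambda>i. f (c i)) S"
proof -
  interpret M: abelian_group M by fact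
  interpret N: abelian_group N by fact
  have f0: "f \<zero>\<^bsub>M\<^esub> = \<zero>\<^bsub>N\<^esub>"
    by (rule additive_zero[OF assms(1,2)])
      (use f(1) f(2)[OF M.zero_closed M.zero_closed] in \<open>simp_all add: Pi_iff\<close>)
  have fc: "\<And>i. f (c i) \<in> carrier N" using f(1) c by auto
  show ?thesis
  proof (induction S rule: infinite_finite_induct)
    case (insert i S)
    have "f (finsum M c (insert i S)) = f (c i \<oplus>\<^bsub>M\<^esub> finsum M c S)"
      using insert c by (simp add: M.finsum_insert)
    also have "\<dots> = f (c i) \<oplus>\<^bsub>N\<^esub> f (finsum M c S)"
      using c by (intro f(2) M.finsum_closed) auto
    finally show ?case using insert fc by (simp add: N.finsum_insert)
  qed (simp_all add: f0 M.finsum_infinite N.finsum_infinite)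
qed

text \<open>
  An additive map that lowers degrees by \<open>a\<close> sends the homogeneous components of an element to those of its image.
\<close>

lemma decomposes_coordinate:
  assumes "graded_group T" "graded_group M" "decomposes T X e"
    and p: "p \<in> carrier T \<rightarrow> carrier M" "\<And>X Y. \<lbrakk>X \<in> carrier T; Y \<in> carrier T\<rbrakk> \<Longrightarrow> p (X \<oplus>\<^bsub>T\<^esub> Y) = p X \<oplus>\<^bsub>M\<^esub> p Y"
    and gr: "\<And>X i. X \<in> gr_part T i \<Longrightarrow> p X \<in> gr_part M (i - a)"
  shows "decomposes M (p X) (\<lambda>j. p (e (j + a)))"
proof -
  interpret T: graded_group T by fact
  interpret M: graded_group M by fact
  note e = T.decomposesD[OF assms(3)]
  let ?S = "{i. e i \<noteq> \<zero>\<^bsub>T\<^esub>}"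
  have p0: "p \<zero>\<^bsub>T\<^esub> = \<zero>\<^bsub>M\<^esub>"
    by (rule additive_zero[OF T.abelian_group_axioms M.abelian_group_axioms])
      (use p(1) p(2)[OF T.zero_closed T.zero_closed] in \<open>simp_all add: Pi_iff\<close>)
  have pe: "p (e i) \<in> carrier M" for i using p(1) e(2) by auto
  show ?thesis
  proof (rule M.decomposesI[where S = "(\<lambda>i. i - a) ` ?S"])
    show "p (e (j + a)) \<in> gr_part M j" for j using gr[OF e(1)[of "j + a"]] by simp
    show "finite ((\<lambda>i. i - a) ` ?S)" using e(3) by simp
    show "p (e (j + a)) = \<zero>\<^bsub>M\<^esub>" if "j \<notin> (\<lambda>i. i - a) ` ?S" for j
    proof -
      have "e (j + a) = \<zero>\<^bsub>T\<^esub>"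
      proof (rule ccontr)
        assume "e (j + a) \<noteq> \<zero>\<^bsub>T\<^esub>"
        hence "j + a - a \<in> (\<lambda>i. i - a) ` ?S" by (intro imageI) simp
        thus False using that by simp
      qed
      thus ?thesis by (simp add: p0)
    qed
    have "X = finsum T e ?S" by (rule e(4)[OF e(3)]) simp
    hence "p X = p (finsum T e ?S)" by (rule arg_cong)
    also have "\<dots> = finsum M (\<lambda>i. p (e i)) ?S"
      by (rule additive_finsum[OF T.abelian_group_axioms M.abelian_group_axioms p e(2)])
    also have "\<dots> = finsum M (\<lambda>j. p (e (j + a))) ((\<lambda>i. i - a) ` ?S)"
    proof -
      have "inj_on (\<lambda>i. i - a) ?S" by (simp add: inj_on_def)
      thus ?thesis using pe by (subst M.finsum_reindex) simp_all
    qed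
    finally show "p X = finsum M (\<lambda>j. p (e (j + a))) ((\<lambda>i. i - a) ` ?S)" .
  qed
qed

text \<open>
  Decompositions are transported along a bijection \<open>(p, q)\<close> from \<open>T\<close> to the product of \<open>M\<close> and \<open>N\<close> that lowers degrees
  by \<open>a\<close> and \<open>b\<close>: components in \<open>M\<close> and \<open>N\<close> are lifted in pairs, and any decomposition in \<open>T\<close> projects to the unique ones
  in \<open>M\<close> and \<open>N\<close>. It serves both direct sums and tensor products.
\<close>

lemma direct_sum_graded_pair:
  assumes g: "graded_group T" "graded_group M" "graded_group N"
    and ds: "direct_sum_graded M" "direct_sum_graded N"
    and p: "p \<in> carrier T \<rightarrow> carrier M" "\<And>X Y. \<lbrakk>X \<in> carrier T; Y \<in> carrier T\<rbrakk> \<Longrightarrow> p (X \<oplus>\<^bsub>T\<^esub> Y) = p X \<oplus>\<^bsub>M\<^esub> p Y"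
    and q: "q \<in> carrier T \<rightarrow> carrier N" "\<And>X Y. \<lbrakk>X \<in> carrier T; Y \<in> carrier T\<rbrakk> \<Longrightarrow> q (X \<oplus>\<^bsub>T\<^esub> Y) = q X \<oplus>\<^bsub>N\<^esub> q Y"
    and surj: "\<And>m n. \<lbrakk>m \<in> carrier M; n \<in> carrier N\<rbrakk> \<Longrightarrow> \<exists>X\<in>carrier T. p X = m \<and> q X = n"
    and inj: "\<And>X Y. \<lbrakk>X \<in> carrier T; Y \<in> carrier T; p X = p Y; q X = q Y\<rbrakk> \<Longrightarrow> X = Y"
    and gr: "\<And>X i. X \<in> carrier T \<Longrightarrow> X \<in> gr_part T i \<longleftrightarrow> p X \<in> gr_part M (i - a) \<and> q X \<in> gr_part N (i - b)"
  shows "direct_sum_graded T"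
  unfolding direct_sum_graded_def
proof
  interpret T: graded_group T by fact
  interpret M: graded_group M by fact
  interpret N: graded_group N by fact
  fix X assume X: "X \<in> carrier T"
  have grp: "p X \<in> gr_part M (i - a)" "q X \<in> gr_part N (i - b)" if "X \<in> gr_part T i" for X i
    using gr[OF T.gr_part_carrier[OF that]] that by auto
  have pX: "p X \<in> carrier M" and qX: "q X \<in> carrier N" using p(1) q(1) X by auto
  obtain c where c: "decomposes M (p X) c" and cu: "\<And>c'. decomposes M (p X) c' \<Longrightarrow> c' = c"
    using ds(1) pX unfolding direct_sum_graded_def by metis
  obtain c' where c': "decomposes N (q X) c'" and cu': "\<And>c''. decomposes N (q X) c'' \<Longrightarrow> c'' = c'"
    using ds(2) qX unfolding direct_sum_graded_def by metis
  note cD = M.decomposesD[OF c] and cD' = N.decomposesD[OF c']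
  have "\<forall>i. \<exists>Y\<in>carrier T. p Y = c (i - a) \<and> q Y = c' (i - b)"
    using surj[OF cD(2) cD'(2)] by blast
  then obtain e where e: "\<And>i. e i \<in> carrier T" "\<And>i. p (e i) = c (i - a)" "\<And>i. q (e i) = c' (i - b)"
    by metis
  have egr: "e i \<in> gr_part T i" for i using gr[OF e(1)] e(2,3) cD(1) cD'(1) by simp
  have p0: "p \<zero>\<^bsub>T\<^esub> = \<zero>\<^bsub>M\<^esub>"
    by (rule additive_zero[OF T.abelian_group_axioms M.abelian_group_axioms])
      (use p(1) p(2)[OF T.zero_closed T.zero_closed] in \<open>simp_all add: Pi_iff\<close>)
  have q0: "q \<zero>\<^bsub>T\<^esub> = \<zero>\<^bsub>N\<^esub>"
    by (rule additive_zero[OF T.abelian_group_axioms N.abelian_group_axioms])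
      (use q(1) q(2)[OF T.zero_closed T.zero_closed] in \<open>simp_all add: Pi_iff\<close>)
  define S where "S = (\<lambda>j. j + a) ` {j. c j \<noteq> \<zero>\<^bsub>M\<^esub>} \<union> (\<lambda>j. j + b) ` {j. c' j \<noteq> \<zero>\<^bsub>N\<^esub>}"
  have fS: "finite S" unfolding S_def using cD(3) cD'(3) by blast
  have out: "c (i - a) = \<zero>\<^bsub>M\<^esub>" "c' (i - b) = \<zero>\<^bsub>N\<^esub>" if "i \<notin> S" for i
  proof -
    have "c (i - a) \<noteq> \<zero>\<^bsub>M\<^esub> \<Longrightarrow> i - a + a \<in> S" unfolding S_def by blast
    moreover have "c' (i - b) \<noteq> \<zero>\<^bsub>N\<^esub> \<Longrightarrow> i - b + b \<in> S" unfolding S_def by blast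
    ultimately show "c (i - a) = \<zero>\<^bsub>M\<^esub>" "c' (i - b) = \<zero>\<^bsub>N\<^esub>" using that by auto
  qed
  have e0: "e i = \<zero>\<^bsub>T\<^esub>" if "i \<notin> S" for i
    using inj[OF e(1) T.zero_closed] out[OF that] e(2,3) p0 q0 by simp
  let ?Y = "finsum T e S"
  have Y: "decomposes T ?Y e" by (rule T.decomposesI[OF egr fS e0 refl])
  have Yc: "?Y \<in> carrier T" using e(1) by (intro T.finsum_closed) auto
  have "p ?Y = p X"
  proof -
    have out': "c j = \<zero>\<^bsub>M\<^esub>" if "j \<notin> (\<lambda>i. i - a) ` S" for j
    proof -
      have "j + a \<notin> S" using that by force
      thus ?thesis using out(1)[of "j + a"] by simp
    qed
    have eq: "p (e (j + a)) = c j" for j using e(2)[of "j + a"] by simp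
    have "decomposes M (p ?Y) (\<lambda>j. p (e (j + a)))"
      by (rule decomposes_coordinate[OF g(1,2) Y p grp(1)])
    hence "p ?Y = finsum M c ((\<lambda>i. i - a) ` S)"
      unfolding eq by (rule M.decomposesD(4)) (use fS out' in auto)
    also have "\<dots> = p X"
      by (rule cD(4)[symmetric]) (use fS out' in auto)
    finally show ?thesis .
  qed
  moreover have "q ?Y = q X"
  proof -
    have out': "c' j = \<zero>\<^bsub>N\<^esub>" if "j \<notin> (\<lambda>i. i - b) ` S" for j
    proof -
      have "j + b \<notin> S" using that by force
      thus ?thesis using out(2)[of "j + b"] by simp
    qed
    have eq: "q (e (j + b)) = c' j" for j using e(3)[of "j + b"] by simp
    have "decomposes N (q ?Y) (\<lambda>j. q (e (j + b)))"
      by (rule decomposes_coordinate[OF g(1,3) Y q grp(2)])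
    hence "q ?Y = finsum N c' ((\<lambda>i. i - b) ` S)"
      unfolding eq by (rule N.decomposesD(4)) (use fS out' in auto)
    also have "\<dots> = q X"
      by (rule cD'(4)[symmetric]) (use fS out' in auto)
    finally show ?thesis .
  qed
  ultimately have YX: "?Y = X" using inj[OF Yc X] by simp
  show "\<exists>!c. decomposes T X c"
  proof (rule ex1I[of _ e])
    show "decomposes T X e" using Y YX by simp
    fix e' assume e': "decomposes T X e'"
    have 1: "(\<lambda>j. p (e' (j + a))) = c"
      by (rule cu) (rule decomposes_coordinate[OF g(1,2) e' p grp(1)])
    have 2: "(\<lambda>j. q (e' (j + b))) = c'"
      by (rule cu') (rule decomposes_coordinate[OF g(1,3) e' q grp(2)])
    show "e' = e"
    proof
      fix i
      have "p (e' i) = p (e i)" using fun_cong[OF 1, of "i - a"] e(2) by simp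
      moreover have "q (e' i) = q (e i)" using fun_cong[OF 2, of "i - b"] e(3) by simp
      ultimately show "e' i = e i" using inj T.decomposesD(2)[OF e'] e(1) by blast
    qed
  qed
qed

text \<open>The zero module, used to treat the case of one factor as a case of two factors.\<close>

definition zero_mod :: "('r, unit) gmod" where
  "zero_mod = \<lparr>carrier = {()}, mult = \<lambda>x y. (), one = (), ring.zero = (), add = \<lambda>x y. (),
     smult = \<lambda>a x. (), gr_part = \<lambda>i. {()}\<rparr>"

lemma zero_mod: "graded_group zero_mod" "direct_sum_graded zero_mod"
proof -
  have "abelian_group zero_mod" by (rule abelian_groupI) (auto simp: zero_mod_def)
  thus "graded_group zero_mod"
    by (intro graded_group.intro graded_group_axioms.intro) (simp_all add: zero_mod_def)
  then interpret Z: graded_group "zero_mod :: ('r, unit) gmod" .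
  have "decomposes zero_mod () c" for c
    by (rule Z.decomposesI[where S = "{}"]) (auto simp: zero_mod_def)
  thus "direct_sum_graded (zero_mod :: ('r, unit) gmod)"
    by (auto simp: direct_sum_graded_def intro!: ex1I)
qed

lemma pregraded_group: "pregraded_module R M \<Longrightarrow> graded_group M"
proof -
  assume "pregraded_module R M"
  then interpret pregraded_module R M .
  show ?thesis by unfold_locales (rule gr_part_closed)
qed

lemma direct_sum_graded_single:
  assumes g: "graded_group T" "graded_group M" and ds: "direct_sum_graded M"
    and p: "p \<in> carrier T \<rightarrow> carrier M" "\<And>X Y. \<lbrakk>X \<in> carrier T; Y \<in> carrier T\<rbrakk> \<Longrightarrow> p (X \<oplus>\<^bsub>T\<^esub> Y) = p X \<oplus>\<^bsub>M\<^esub> p Y"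
    and surj: "\<And>m. m \<in> carrier M \<Longrightarrow> \<exists>X\<in>carrier T. p X = m"
    and inj: "\<And>X Y. \<lbrakk>X \<in> carrier T; Y \<in> carrier T; p X = p Y\<rbrakk> \<Longrightarrow> X = Y"
    and gr: "\<And>X i. X \<in> carrier T \<Longrightarrow> X \<in> gr_part T i \<longleftrightarrow> p X \<in> gr_part M (i - a)"
  shows "direct_sum_graded T"
  by (rule direct_sum_graded_pair[OF g zero_mod(1) ds zero_mod(2) p, where q = "\<lambda>_. ()" and a = a and b = 0])
    (use surj inj gr in \<open>auto simp: zero_mod_def\<close>)

subsection \<open>Direct sums of graded modules\<close>

lemma gmod_sum_simps [simp]:
  "carrier (gmod_sum M N) = carrier M \<times> carrier N" "\<zero>\<^bsub>gmod_sum M N\<^esub> = (\<zero>\<^bsub>M\<^esub>, \<zero>\<^bsub>N\<^esub>)"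
  "(x, y) \<oplus>\<^bsub>gmod_sum M N\<^esub> (x', y') = (x \<oplus>\<^bsub>M\<^esub> x', y \<oplus>\<^bsub>N\<^esub> y')"
  "a \<odot>\<^bsub>gmod_sum M N\<^esub> (x, y) = (a \<odot>\<^bsub>M\<^esub> x, a \<odot>\<^bsub>N\<^esub> y)"
  "gr_part (gmod_sum M N) i = gr_part M i \<times> gr_part N i"
  by (simp_all add: gmod_sum_def)

lemma gmod_sum_abelian_group:
  assumes "abelian_group M" "abelian_group N"
  shows "abelian_group (gmod_sum M N)"
proof -
  interpret M: abelian_group M by fact
  interpret N: abelian_group N by fact
  show ?thesis
  proof (rule abelian_groupI)
    show "\<exists>y\<in>carrier (gmod_sum M N). y \<oplus>\<^bsub>gmod_sum M N\<^esub> x = \<zero>\<^bsub>gmod_sum M N\<^esub>"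
      if "x \<in> carrier (gmod_sum M N)" for x
      using that by (intro bexI[of _ "(\<ominus>\<^bsub>M\<^esub> fst x, \<ominus>\<^bsub>N\<^esub> snd x)"]) (auto simp: M.l_neg N.l_neg)
  qed (auto simp: M.a_ac N.a_ac)
qed

lemma gmod_sum_minus:
  assumes "abelian_group M" "abelian_group N" "x \<in> carrier M" "y \<in> carrier N"
  shows "\<ominus>\<^bsub>gmod_sum M N\<^esub> (x, y) = (\<ominus>\<^bsub>M\<^esub> x, \<ominus>\<^bsub>N\<^esub> y)"
proof -
  interpret M: abelian_group M by fact
  interpret N: abelian_group N by fact
  interpret S: abelian_group "gmod_sum M N" by (rule gmod_sum_abelian_group[OF assms(1,2)])
  show ?thesis by (rule S.minus_equality) (use assms in \<open>simp_all add: M.l_neg N.l_neg\<close>)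
qed

lemma gmod_sum_pregraded:
  assumes "pregraded_module R M" "pregraded_module R N"
  shows "pregraded_module R (gmod_sum M N)"
proof -
  interpret M: pregraded_module R M by fact
  interpret N: pregraded_module R N by fact
  have ab: "abelian_group (gmod_sum M N)"
    by (rule gmod_sum_abelian_group[OF M.M.abelian_group_axioms N.M.abelian_group_axioms])
  show ?thesis
  proof (rule pregraded_moduleI)
    show "additive_subgroup (gr_part (gmod_sum M N) i) (gmod_sum M N)" for i
      unfolding additive_subgroup_iff[OF ab]
      using M.gr_part_closed N.gr_part_closed
      by (auto simp: M.gr_part_zero N.gr_part_zero M.gr_part_add N.gr_part_add
          gmod_sum_minus[OF M.M.abelian_group_axioms N.M.abelian_group_axioms] M.gr_part_minus N.gr_part_minus)
  qed (auto simp: ab M.R.ring_axioms M.smult_closed N.smult_closed M.smult_l_distr N.smult_l_distr M.smult_r_distr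
      N.smult_r_distr M.smult_assoc N.smult_assoc M.smult_one N.smult_one M.gr_part_smult N.gr_part_smult)
qed

lemma gmod_sum_graded:
  assumes "graded_left_module R M" "graded_left_module R N"
  shows "graded_left_module R (gmod_sum M N)"
proof -
  have pg: "pregraded_module R M" "pregraded_module R N" and ds: "direct_sum_graded M" "direct_sum_graded N"
    using assms by (simp_all add: graded_left_module_iff)
  note s = gmod_sum_pregraded[OF pg]
  have "direct_sum_graded (gmod_sum M N)"
    by (rule direct_sum_graded_pair[OF pregraded_group[OF s] pregraded_group[OF pg(1)] pregraded_group[OF pg(2)] ds,
          where p = fst and q = snd and a = 0 and b = 0]) auto
  thus ?thesis using s by (simp add: graded_left_module_iff)
qed

subsection \<open>Tensoring with a bimodule that has a right basis of two elements\<close>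

text \<open>
  A bimodule that is free as a right module on two homogeneous elements. The coordinate functions \<open>c0\<close> and \<open>c1\<close> are part
  of the data, and freeness is expressed by their values on the basis together with the expansion of every element. Then
  \<open>P \<otimes> N\<close> is two copies of \<open>N\<close>, shifted in degree, whatever the module \<open>N\<close>.
\<close>

locale right_basis2 = graded_bimodule R A P
  for R :: "('r, 'x) gring_scheme" and A :: "('r, 'x') gring_scheme" and P :: "('r, 'p, 'y) gbimod_scheme" +
  fixes e0 e1 :: 'p and c0 c1 :: "'p \<Rightarrow> 'r" and d0 d1 :: int
  assumes basis_closed: "e0 \<in> carrier P" "e1 \<in> carrier P"
    and basis_deg: "e0 \<in> gr_part P d0" "e1 \<in> gr_part P d1"
    and coord_closed: "x \<in> carrier P \<Longrightarrow> c0 x \<in> carrier A" "x \<in> carrier P \<Longrightarrow> c1 x \<in> carrier A"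
    and coord_add: "\<lbrakk>x \<in> carrier P; y \<in> carrier P\<rbrakk> \<Longrightarrow> c0 (x \<oplus>\<^bsub>P\<^esub> y) = c0 x \<oplus>\<^bsub>A\<^esub> c0 y"
      "\<lbrakk>x \<in> carrier P; y \<in> carrier P\<rbrakk> \<Longrightarrow> c1 (x \<oplus>\<^bsub>P\<^esub> y) = c1 x \<oplus>\<^bsub>A\<^esub> c1 y"
    and coord_right: "\<lbrakk>x \<in> carrier P; a \<in> carrier A\<rbrakk> \<Longrightarrow> c0 (rsmult P x a) = c0 x \<otimes>\<^bsub>A\<^esub> a"
      "\<lbrakk>x \<in> carrier P; a \<in> carrier A\<rbrakk> \<Longrightarrow> c1 (rsmult P x a) = c1 x \<otimes>\<^bsub>A\<^esub> a"
    and coord_deg: "x \<in> gr_part P i \<Longrightarrow> c0 x \<in> deg_part A (i - d0)" "x \<in> gr_part P i \<Longrightarrow> c1 x \<in> deg_part A (i - d1)"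
    and coord_basis: "c0 e0 = \<one>\<^bsub>A\<^esub>" "c0 e1 = \<zero>\<^bsub>A\<^esub>" "c1 e0 = \<zero>\<^bsub>A\<^esub>" "c1 e1 = \<one>\<^bsub>A\<^esub>"
    and coord_expand: "x \<in> carrier P \<Longrightarrow> x = rsmult P e0 (c0 x) \<oplus>\<^bsub>P\<^esub> rsmult P e1 (c1 x)"

locale right_basis2_tensor = right_basis2 R A P e0 e1 c0 c1 d0 d1 + N: pregraded_module A N
  for R :: "('r, 'x) gring_scheme" and A :: "('r, 'x') gring_scheme" and P :: "('r, 'p, 'y) gbimod_scheme"
    and e0 e1 c0 c1 d0 d1 and N :: "('r, 'n, 'z) gmod_scheme"
begin

sublocale bimodule_tensor R A P N ..

sublocale E0: balanced_map A P N N "\<lambda>x y. c0 x \<odot>\<^bsub>N\<^esub> y"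
  by unfold_locales (simp_all add: N.smult_closed coord_closed coord_add coord_right N.smult_l_distr N.smult_r_distr N.smult_assoc)

sublocale E1: balanced_map A P N N "\<lambda>x y. c1 x \<odot>\<^bsub>N\<^esub> y"
  by unfold_locales (simp_all add: N.smult_closed coord_closed coord_add coord_right N.smult_l_distr N.smult_r_distr N.smult_assoc)

abbreviation "\<pi>0 \<equiv> tensor_eval A P N c0"
abbreviation "\<pi>1 \<equiv> tensor_eval A P N c1"
abbreviation "combine m0 m1 \<equiv> pure e0 m0 \<oplus>\<^bsub>T\<^esub> pure e1 m1"

lemma combine_closed: "\<lbrakk>m0 \<in> carrier N; m1 \<in> carrier N\<rbrakk> \<Longrightarrow> combine m0 m1 \<in> carrier T"
  using basis_closed by simp

lemma coord_combine:
  assumes "m0 \<in> carrier N" "m1 \<in> carrier N"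
  shows "\<pi>0 (combine m0 m1) = m0" "\<pi>1 (combine m0 m1) = m1"
  using assms basis_closed
  by (simp_all add: E0.lift_add E0.lift_pure E1.lift_add E1.lift_pure coord_basis N.smult_zero_left N.smult_one)

lemma combine_coord: "X \<in> carrier T \<Longrightarrow> combine (\<pi>0 X) (\<pi>1 X) = X"
proof -
  assume X: "X \<in> carrier T"
  have "(\<lambda>X. combine (\<pi>0 X) (\<pi>1 X)) X = (\<lambda>X. X) X"
  proof (rule additive_eq[OF X tensor_abelian_group])
    show "combine (\<pi>0 (pure x y)) (\<pi>1 (pure x y)) = pure x y" if "x \<in> carrier P" "y \<in> carrier N" for x y
    proof -
      have "combine (\<pi>0 (pure x y)) (\<pi>1 (pure x y)) = pure (rsmult P e0 (c0 x)) y \<oplus>\<^bsub>T\<^esub> pure (rsmult P e1 (c1 x)) y"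
        using that basis_closed coord_closed by (simp add: E0.lift_pure E1.lift_pure pure_balanced)
      also have "\<dots> = pure x y"
        using that basis_closed coord_closed coord_expand[OF that(1)]
        by (simp add: pure_add_left[symmetric] rsmult_closed)
      finally show ?thesis .
    qed
  qed (use basis_closed in \<open>simp_all add: E0.lift_closed E1.lift_closed E0.lift_add E1.lift_add pure_add_right T.a_ac\<close>)
  thus ?thesis .
qed

lemma gr_part_coord:
  assumes "X \<in> carrier T"
  shows "X \<in> gr_part T i \<longleftrightarrow> \<pi>0 X \<in> gr_part N (i - d0) \<and> \<pi>1 X \<in> gr_part N (i - d1)"
proof
  assume X: "X \<in> gr_part T i"
  have d: "c x \<odot>\<^bsub>N\<^esub> y \<in> gr_part N (k + l - d)"
    if "y \<in> gr_part N l" "c x \<in> deg_part A (k - d)" for c x y k l and d :: int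
    using N.gr_part_smult[OF that(2,1)] by (simp add: algebra_simps)
  show "\<pi>0 X \<in> gr_part N (i - d0) \<and> \<pi>1 X \<in> gr_part N (i - d1)"
  proof
    show "\<pi>0 X \<in> gr_part N (i - d0)"
      by (rule E0.lift_gr_part[OF gr_sub N.gr_part_subgroup _ X]) (rule d, assumption, rule coord_deg(1), assumption)
    show "\<pi>1 X \<in> gr_part N (i - d1)"
      by (rule E1.lift_gr_part[OF gr_sub N.gr_part_subgroup _ X]) (rule d, assumption, rule coord_deg(2), assumption)
  qed
next
  assume a: "\<pi>0 X \<in> gr_part N (i - d0) \<and> \<pi>1 X \<in> gr_part N (i - d1)"
  interpret T: pregraded_module R T by (rule tensor_pregraded)
  have "combine (\<pi>0 X) (\<pi>1 X) \<in> gr_part T i"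
    using a gr_part_pure[OF basis_deg(1), of "\<pi>0 X" "i - d0"] gr_part_pure[OF basis_deg(2), of "\<pi>1 X" "i - d1"]
    by (intro T.gr_part_add) simp_all
  thus "X \<in> gr_part T i" using combine_coord[OF assms] by simp
qed

lemma tensor_graded:
  assumes "direct_sum_graded N"
  shows "graded_left_module R T"
proof -
  have g: "graded_group T" "graded_group N"
    by (rule pregraded_group[OF tensor_pregraded], rule pregraded_group[OF N.pregraded_module_axioms])
  have "direct_sum_graded T"
  proof (rule direct_sum_graded_pair[OF g(1) g(2) g(2) assms assms, where p = \<pi>0 and q = \<pi>1])
    show "\<exists>X\<in>carrier T. \<pi>0 X = m \<and> \<pi>1 X = n" if "m \<in> carrier N" "n \<in> carrier N" for m n
      using combine_closed[OF that] coord_combine[OF that] by blast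
    show "X = Y" if "X \<in> carrier T" "Y \<in> carrier T" "\<pi>0 X = \<pi>0 Y" "\<pi>1 X = \<pi>1 Y" for X Y
      by (rule trans[OF combine_coord[OF that(1), symmetric, unfolded that(3,4)] combine_coord[OF that(2)]])
  qed (simp_all add: E0.lift_closed E1.lift_closed E0.lift_add E1.lift_add gr_part_coord)
  thus ?thesis using tensor_pregraded by (simp add: graded_left_module_iff)
qed

end

subsection \<open>Graded rings and their regular bimodules\<close>

locale pregraded_ring = ring R for R :: "('r, 'x) gring_scheme" (structure) +
  assumes deg_part_subgroup: "\<And>i. additive_subgroup (deg_part R i) R"
    and deg_part_mult: "\<And>i j a b. \<lbrakk>a \<in> deg_part R i; b \<in> deg_part R j\<rbrakk> \<Longrightarrow> a \<otimes> b \<in> deg_part R (i + j)"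
    and deg_part_one: "\<one> \<in> deg_part R 0"
begin

lemma deg_part_closed: "a \<in> deg_part R i \<Longrightarrow> a \<in> carrier R"
  using additive_subgroup.a_Hcarr[OF deg_part_subgroup] .

lemma deg_part_add: "\<lbrakk>a \<in> deg_part R i; b \<in> deg_part R i\<rbrakk> \<Longrightarrow> a \<oplus> b \<in> deg_part R i"
  using additive_subgroup.a_closed[OF deg_part_subgroup] .

lemma deg_part_zero: "\<zero> \<in> deg_part R i"
  using additive_subgroup.zero_closed[OF deg_part_subgroup] .

lemma deg_part_minus: "a \<in> deg_part R i \<Longrightarrow> \<ominus> a \<in> deg_part R i"
  using additive_subgroup.a_inv_closed[OF deg_part_subgroup] abelian_group_axioms by blast

end

lemma regular_bimod_simps [simp]:
  "carrier (regular_bimod R) = carrier R" "\<zero>\<^bsub>regular_bimod R\<^esub> = \<zero>\<^bsub>R\<^esub>" "add (regular_bimod R) = add R"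
  "smult (regular_bimod R) = mult R" "gr_part (regular_bimod R) = deg_part R" "rsmult (regular_bimod R) = mult R"
  by (simp_all add: regular_bimod_def)

text \<open>
  Here \<open>A\<close> and \<open>C\<close> are subrings of \<open>R\<close> that act by multiplication; the cases of interest are \<open>R\<close> and \<open>R\<^sup>s\<close> on each side.
\<close>

lemma regular_bimod_graded:
  assumes "pregraded_ring R" "ring A" "ring C"
    and A: "carrier A \<subseteq> carrier R" "add A = add R" "mult A = mult R" "\<one>\<^bsub>A\<^esub> = \<one>\<^bsub>R\<^esub>"
      "\<And>i. deg_part A i \<subseteq> deg_part R i" "\<And>i. deg_part A i \<subseteq> carrier A"
    and C: "carrier C \<subseteq> carrier R" "add C = add R" "mult C = mult R" "\<one>\<^bsub>C\<^esub> = \<one>\<^bsub>R\<^esub>"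
      "\<And>i. deg_part C i \<subseteq> deg_part R i" "\<And>i. deg_part C i \<subseteq> carrier C"
  shows "graded_bimodule A C (regular_bimod R)"
proof -
  interpret R: pregraded_ring R by fact
  have ab: "abelian_group (regular_bimod R)"
    by (rule abelian_group_cong[OF R.abelian_group_axioms]) simp_all
  have Ac: "a \<in> carrier A \<Longrightarrow> a \<in> carrier R" "a \<in> deg_part A i \<Longrightarrow> a \<in> deg_part R i" for a i using A by auto
  have Cc: "a \<in> carrier C \<Longrightarrow> a \<in> carrier R" "a \<in> deg_part C i \<Longrightarrow> a \<in> deg_part R i" for a i using C by auto
  have "pregraded_module A (regular_bimod R)"
  proof (rule pregraded_moduleI)
    show "additive_subgroup (gr_part (regular_bimod R) i) (regular_bimod R)" for i
      unfolding regular_bimod_simps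
      by (rule additive_subgroup_cong[OF R.abelian_group_axioms _ _ _ R.deg_part_subgroup]) simp_all
  qed (simp_all add: assms(2) ab Ac A(2-4) R.l_distr R.r_distr R.m_assoc R.deg_part_mult)
  thus ?thesis
  proof (intro graded_bimodule.intro graded_bimodule_axioms.intro, goal_cases)
    case 1 thus ?case .
  next
    case 2 show ?case by (rule assms(3))
  next
    case (9 i j a x)
    thus ?case using R.deg_part_mult Cc(2) by simp
  next
    case (10 a i)
    thus ?case using A(6) by blast
  next
    case (11 a i)
    thus ?case using C(6) by blast
  qed (simp_all add: Ac(1) Cc(1) C(2-4) R.l_distr R.r_distr R.m_assoc)
qed

subsection \<open>Tensoring with a shifted regular bimodule\<close>

locale regular_tensor = R: pregraded_ring R + N: pregraded_module R N
  for R :: "('r, 'x) gring_scheme" and N :: "('r, 'n, 'z) gmod_scheme" + fixes d :: int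
begin

abbreviation "P \<equiv> gr_shift d (regular_bimod R)"

lemma regular_bimodule: "graded_bimodule R R (regular_bimod R)"
  by (rule regular_bimod_graded[OF R.pregraded_ring_axioms R.ring_axioms R.ring_axioms])
    (use R.deg_part_closed in auto)

sublocale bimodule_tensor R R P N
  by (intro bimodule_tensor.intro graded_bimodule_gr_shift regular_bimodule N.pregraded_module_axioms)

sublocale E: balanced_map R P N N "\<lambda>r m. r \<odot>\<^bsub>N\<^esub> m"
  by unfold_locales (simp_all add: N.smult_closed N.smult_l_distr N.smult_r_distr N.smult_assoc)

abbreviation "\<epsilon> \<equiv> tensor_eval R P N (\<lambda>r. r)"

lemma eval_pure_one: "m \<in> carrier N \<Longrightarrow> \<epsilon> (pure \<one>\<^bsub>R\<^esub> m) = m"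
  by (simp add: E.lift_pure N.smult_one)

lemma pure_one_eval: "X \<in> carrier T \<Longrightarrow> pure \<one>\<^bsub>R\<^esub> (\<epsilon> X) = X"
proof -
  assume X: "X \<in> carrier T"
  have "(\<lambda>X. pure \<one>\<^bsub>R\<^esub> (\<epsilon> X)) X = (\<lambda>X. X) X"
  proof (rule additive_eq[OF X tensor_abelian_group])
    show "pure \<one>\<^bsub>R\<^esub> (\<epsilon> (pure x y)) = pure x y" if "x \<in> carrier P" "y \<in> carrier N" for x y
      unfolding E.lift_pure[OF that] using that pure_balanced[of "\<one>\<^bsub>R\<^esub>" x y] by simp
  qed (simp_all add: E.lift_closed E.lift_add pure_add_right)
  thus ?thesis .
qed

lemma eval_smult: "\<lbrakk>a \<in> carrier R; X \<in> carrier T\<rbrakk> \<Longrightarrow> \<epsilon> (a \<odot>\<^bsub>T\<^esub> X) = a \<odot>\<^bsub>N\<^esub> \<epsilon> X"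
  by (rule additive_eq[of X N "\<lambda>X. \<epsilon> (a \<odot>\<^bsub>T\<^esub> X)" "\<lambda>X. a \<odot>\<^bsub>N\<^esub> \<epsilon> X"])
    (simp_all add: N.M.abelian_group_axioms E.lift_closed E.lift_add E.lift_pure smult_tensor_closed smult_tensor_add
      smult_pure N.smult_closed N.smult_r_distr N.smult_assoc)

lemma gr_part_eval:
  assumes "X \<in> carrier T"
  shows "X \<in> gr_part T i \<longleftrightarrow> \<epsilon> X \<in> gr_part N (i - d)"
proof
  assume X: "X \<in> gr_part T i"
  show "\<epsilon> X \<in> gr_part N (i - d)"
  proof (rule E.lift_gr_part[OF gr_sub N.gr_part_subgroup _ X])
    show "r \<odot>\<^bsub>N\<^esub> m \<in> gr_part N (j + l - d)" if "r \<in> gr_part P j" "m \<in> gr_part N l" for r m j l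
      using N.gr_part_smult[of r "j - d" m l] that by (simp add: algebra_simps)
  qed
next
  assume "\<epsilon> X \<in> gr_part N (i - d)"
  hence "pure \<one>\<^bsub>R\<^esub> (\<epsilon> X) \<in> gr_part T (d + (i - d))"
    using R.deg_part_one by (intro gr_part_pure) simp_all
  thus "X \<in> gr_part T i" using pure_one_eval[OF assms] by simp
qed

lemma tensor_graded:
  assumes "direct_sum_graded N"
  shows "graded_left_module R T"
proof -
  have "direct_sum_graded T"
  proof (rule direct_sum_graded_single[OF pregraded_group[OF tensor_pregraded]
        pregraded_group[OF N.pregraded_module_axioms] assms, where p = \<epsilon>])
    show "\<exists>X\<in>carrier T. \<epsilon> X = m" if "m \<in> carrier N" for m
      using that by (intro bexI[of _ "pure \<one>\<^bsub>R\<^esub> m"]) (simp_all add: eval_pure_one)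
    show "X = Y" if "X \<in> carrier T" "Y \<in> carrier T" "\<epsilon> X = \<epsilon> Y" for X Y
      by (rule trans[OF pure_one_eval[OF that(1), symmetric, unfolded that(3)] pure_one_eval[OF that(2)]])
  qed (simp_all add: E.lift_closed E.lift_add gr_part_eval)
  thus ?thesis using tensor_pregraded by (simp add: graded_left_module_iff)
qed

end

section \<open>The homotopy category\<close>

lemma is_cpxD:
  assumes "is_cpx R X"
  shows "graded_left_module R (ob X n)" "pregraded_module R (ob X n)" "abelian_group (ob X n)"
    and "diff X n \<in> gmod_hom R (ob X n) (ob X (n + 1))"
    and "diff X (n - 1) \<in> gmod_hom R (ob X (n - 1)) (ob X n)"
    and "x \<in> carrier (ob X n) \<Longrightarrow> diff X (n + 1) (diff X n x) = \<zero>\<^bsub>ob X (n + 1 + 1)\<^esub>"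
proof -
  show 1: "graded_left_module R (ob X n)" "diff X n \<in> gmod_hom R (ob X n) (ob X (n + 1))" for n
    using assms by (simp_all add: is_cpx_def)
  show 2: "pregraded_module R (ob X n)" by (rule graded_is_pregraded[OF 1(1)])
  interpret pregraded_module R "ob X n" by (rule 2)
  show "abelian_group (ob X n)" by (rule M.abelian_group_axioms)
  show "diff X (n - 1) \<in> gmod_hom R (ob X (n - 1)) (ob X n)" using 1(2)[of "n - 1"] by simp
  show "x \<in> carrier (ob X n) \<Longrightarrow> diff X (n + 1) (diff X n x) = \<zero>\<^bsub>ob X (n + 1 + 1)\<^esub>"
    using assms by (simp add: is_cpx_def)
qed

lemma chain_mapsI:
  assumes "\<And>n. f n \<in> gmod_hom R (ob X n) (ob Y n)"
    and "\<And>n x. x \<in> carrier (ob X n) \<Longrightarrow> f (n + 1) (diff X n x) = diff Y n (f n x)"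
  shows "f \<in> chain_maps R X Y"
  using assms by (simp add: chain_maps_def)

lemma chain_mapsD:
  assumes "f \<in> chain_maps R X Y"
  shows "f n \<in> gmod_hom R (ob X n) (ob Y n)"
    and "x \<in> carrier (ob X n) \<Longrightarrow> f (n + 1) (diff X n x) = diff Y n (f n x)"
  using assms by (simp_all add: chain_maps_def)

lemma chain_maps_ident: "(\<lambda>n x. x) \<in> chain_maps R X X"
  by (rule chain_mapsI) (simp_all add: gmod_hom_ident)

lemma chain_maps_comp:
  assumes f: "f \<in> chain_maps R X Y" and g: "g \<in> chain_maps R Y Z"
  shows "(\<lambda>n. g n \<circ> f n) \<in> chain_maps R X Z"
proof (rule chain_mapsI)
  show "g n \<circ> f n \<in> gmod_hom R (ob X n) (ob Z n)" for n
    by (rule gmod_hom_comp[OF chain_mapsD(1)[OF f] chain_mapsD(1)[OF g]])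
  show "(g (n + 1) \<circ> f (n + 1)) (diff X n x) = diff Z n ((g n \<circ> f n) x)" if "x \<in> carrier (ob X n)" for n x
    using chain_mapsD(2)[OF f that] chain_mapsD(2)[OF g] gmod_homD(1)[OF chain_mapsD(1)[OF f] that] by simp
qed

lemma chain_maps_inverse:
  assumes X: "\<And>n x. x \<in> carrier (ob X n) \<Longrightarrow> diff X n x \<in> carrier (ob X (n + 1))"
    and f: "f \<in> chain_maps R X Y" and g: "\<And>n. g n \<in> gmod_hom R (ob Y n) (ob X n)"
    and fg: "\<And>n y. y \<in> carrier (ob Y n) \<Longrightarrow> f n (g n y) = y" and gf: "\<And>n x. x \<in> carrier (ob X n) \<Longrightarrow> g n (f n x) = x"
  shows "g \<in> chain_maps R Y X"
proof (rule chain_mapsI[OF g])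
  fix n y assume y: "y \<in> carrier (ob Y n)"
  have gy: "g n y \<in> carrier (ob X n)" by (rule gmod_homD(1)[OF g y])
  have "g (n + 1) (diff Y n y) = g (n + 1) (f (n + 1) (diff X n (g n y)))"
    using chain_mapsD(2)[OF f gy] by (simp add: fg[OF y])
  thus "g (n + 1) (diff Y n y) = diff X n (g n y)" by (simp add: gf X gy)
qed

lemma homotopic_mapsI:
  assumes "\<And>n. h n \<in> gmod_hom R (ob X n) (ob Y (n - 1))"
    and "\<And>n x. x \<in> carrier (ob X n) \<Longrightarrow>
      f n x = g n x \<oplus>\<^bsub>ob Y n\<^esub> (diff Y (n - 1) (h n x) \<oplus>\<^bsub>ob Y n\<^esub> h (n + 1) (diff X n x))"
  shows "homotopic_maps R X Y f g"
  unfolding homotopic_maps_def using assms by (intro exI[of _ h]) simp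

text \<open>
  The second property is the first one at \<open>n + 1\<close>, with the degree \<open>n + 1 - 1\<close> of the codomain evaluated.
\<close>

lemma homotopic_mapsE:
  assumes "homotopic_maps R X Y f g"
  obtains h where "\<And>n. h n \<in> gmod_hom R (ob X n) (ob Y (n - 1))"
    and "\<And>n. h (n + 1) \<in> gmod_hom R (ob X (n + 1)) (ob Y n)"
    and "\<And>n x. x \<in> carrier (ob X n) \<Longrightarrow>
      f n x = g n x \<oplus>\<^bsub>ob Y n\<^esub> (diff Y (n - 1) (h n x) \<oplus>\<^bsub>ob Y n\<^esub> h (n + 1) (diff X n x))"
proof -
  obtain h where h: "\<And>n. h n \<in> gmod_hom R (ob X n) (ob Y (n - 1))"
    "\<And>n x. x \<in> carrier (ob X n) \<Longrightarrow>
      f n x = g n x \<oplus>\<^bsub>ob Y n\<^esub> (diff Y (n - 1) (h n x) \<oplus>\<^bsub>ob Y n\<^esub> h (n + 1) (diff X n x))"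
    using assms unfolding homotopic_maps_def by blast
  show thesis
  proof (rule that[OF h(1) _ h(2)])
    show "h (n + 1) \<in> gmod_hom R (ob X (n + 1)) (ob Y n)" for n using h(1)[of "n + 1"] by simp
  qed
qed

lemma homotopic_maps_eqI:
  assumes "is_cpx R X" "is_cpx R Y" "f \<in> chain_maps R X Y"
    and eq: "\<And>n x. x \<in> carrier (ob X n) \<Longrightarrow> f n x = g n x"
  shows "homotopic_maps R X Y f g"
proof (rule homotopic_mapsI[where h = "\<lambda>n x. \<zero>\<^bsub>ob Y (n - 1)\<^esub>"])
  show "(\<lambda>x. \<zero>\<^bsub>ob Y (n - 1)\<^esub>) \<in> gmod_hom R (ob X n) (ob Y (n - 1))" for n
    by (rule gmod_hom_zero_map[OF is_cpxD(2)[OF assms(2)]])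
  fix n x assume x: "x \<in> carrier (ob X n)"
  interpret Y: abelian_group "ob Y n" by (rule is_cpxD(3)[OF assms(2)])
  have "g n x \<in> carrier (ob Y n)"
    using gmod_homD(1)[OF chain_mapsD(1)[OF assms(3)] x] eq[OF x] by simp
  moreover have "diff Y (n - 1) \<zero>\<^bsub>ob Y (n - 1)\<^esub> = \<zero>\<^bsub>ob Y n\<^esub>"
    by (rule gmod_hom_zero[OF is_cpxD(5)[OF assms(2)] is_cpxD(3)[OF assms(2)] is_cpxD(3)[OF assms(2)]])
  ultimately show "f n x = g n x \<oplus>\<^bsub>ob Y n\<^esub> (diff Y (n - 1) \<zero>\<^bsub>ob Y (n - 1)\<^esub> \<oplus>\<^bsub>ob Y n\<^esub> \<zero>\<^bsub>ob Y (n + 1 - 1)\<^esub>)"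
    using eq[OF x] by simp
qed

lemma homotopic_maps_sym:
  assumes "is_cpx R X" "is_cpx R Y" "f \<in> chain_maps R X Y" "g \<in> chain_maps R X Y"
    and "homotopic_maps R X Y f g"
  shows "homotopic_maps R X Y g f"
proof -
  obtain h where h: "\<And>n. h n \<in> gmod_hom R (ob X n) (ob Y (n - 1))"
    "\<And>n. h (n + 1) \<in> gmod_hom R (ob X (n + 1)) (ob Y n)"
    "\<And>n x. x \<in> carrier (ob X n) \<Longrightarrow>
      f n x = g n x \<oplus>\<^bsub>ob Y n\<^esub> (diff Y (n - 1) (h n x) \<oplus>\<^bsub>ob Y n\<^esub> h (n + 1) (diff X n x))"
    by (rule homotopic_mapsE[OF assms(5)]) (rule that)
  show ?thesis
  proof (rule homotopic_mapsI[where h = "\<lambda>n x. \<ominus>\<^bsub>ob Y (n - 1)\<^esub> h n x"])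
    show "(\<lambda>x. \<ominus>\<^bsub>ob Y (n - 1)\<^esub> h n x) \<in> gmod_hom R (ob X n) (ob Y (n - 1))" for n
      by (rule gmod_hom_minus_map[OF is_cpxD(2)[OF assms(2)] h(1)])
    fix n x assume x: "x \<in> carrier (ob X n)"
    interpret Y: abelian_group "ob Y n" by (rule is_cpxD(3)[OF assms(2)])
    have hx: "h n x \<in> carrier (ob Y (n - 1))" by (rule gmod_homD(1)[OF h(1) x])
    have c: "g n x \<in> carrier (ob Y n)" "diff Y (n - 1) (h n x) \<in> carrier (ob Y n)"
      "h (n + 1) (diff X n x) \<in> carrier (ob Y n)"
      using gmod_homD(1)[OF chain_mapsD(1)[OF assms(4)] x] gmod_homD(1)[OF is_cpxD(5)[OF assms(2)] hx]
        gmod_homD(1)[OF h(2) gmod_homD(1)[OF is_cpxD(4)[OF assms(1)] x]] by auto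
    have "diff Y (n - 1) (\<ominus>\<^bsub>ob Y (n - 1)\<^esub> h n x) = \<ominus>\<^bsub>ob Y n\<^esub> diff Y (n - 1) (h n x)"
      by (rule gmod_hom_minus[OF is_cpxD(5)[OF assms(2)] is_cpxD(3)[OF assms(2)] is_cpxD(3)[OF assms(2)] hx])
    thus "g n x = f n x \<oplus>\<^bsub>ob Y n\<^esub> (diff Y (n - 1) (\<ominus>\<^bsub>ob Y (n - 1)\<^esub> h n x)
        \<oplus>\<^bsub>ob Y n\<^esub> \<ominus>\<^bsub>ob Y (n + 1 - 1)\<^esub> h (n + 1) (diff X n x))"
      using c by (simp add: h(3)[OF x] Y.minus_add[symmetric] Y.a_assoc Y.r_neg)
  qed
qed

lemma homotopic_maps_trans:
  assumes "is_cpx R X" "is_cpx R Y" "k \<in> chain_maps R X Y"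
    and "homotopic_maps R X Y f g" "homotopic_maps R X Y g k"
  shows "homotopic_maps R X Y f k"
proof -
  obtain h where h: "\<And>n. h n \<in> gmod_hom R (ob X n) (ob Y (n - 1))"
    "\<And>n. h (n + 1) \<in> gmod_hom R (ob X (n + 1)) (ob Y n)"
    "\<And>n x. x \<in> carrier (ob X n) \<Longrightarrow>
      f n x = g n x \<oplus>\<^bsub>ob Y n\<^esub> (diff Y (n - 1) (h n x) \<oplus>\<^bsub>ob Y n\<^esub> h (n + 1) (diff X n x))"
    by (rule homotopic_mapsE[OF assms(4)]) (rule that)
  obtain h' where h': "\<And>n. h' n \<in> gmod_hom R (ob X n) (ob Y (n - 1))"
    "\<And>n. h' (n + 1) \<in> gmod_hom R (ob X (n + 1)) (ob Y n)"
    "\<And>n x. x \<in> carrier (ob X n) \<Longrightarrow>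
      g n x = k n x \<oplus>\<^bsub>ob Y n\<^esub> (diff Y (n - 1) (h' n x) \<oplus>\<^bsub>ob Y n\<^esub> h' (n + 1) (diff X n x))"
    by (rule homotopic_mapsE[OF assms(5)]) (rule that)
  show ?thesis
  proof (rule homotopic_mapsI[where h = "\<lambda>n x. h n x \<oplus>\<^bsub>ob Y (n - 1)\<^esub> h' n x"])
    show "(\<lambda>x. h n x \<oplus>\<^bsub>ob Y (n - 1)\<^esub> h' n x) \<in> gmod_hom R (ob X n) (ob Y (n - 1))" for n
      by (rule gmod_hom_add_map[OF is_cpxD(2)[OF assms(2)] h(1) h'(1)])
    fix n x assume x: "x \<in> carrier (ob X n)"
    interpret Y: abelian_group "ob Y n" by (rule is_cpxD(3)[OF assms(2)])
    note hx = gmod_homD(1)[OF h(1) x] gmod_homD(1)[OF h'(1) x]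
    note dx = gmod_homD(1)[OF is_cpxD(4)[OF assms(1)] x]
    note d = gmod_homD[OF is_cpxD(5)[OF assms(2)]]
    note c = gmod_homD(1)[OF chain_mapsD(1)[OF assms(3)] x] d(1)[OF hx(1)] d(1)[OF hx(2)]
      gmod_homD(1)[OF h(2) dx] gmod_homD(1)[OF h'(2) dx]
    show "f n x = k n x \<oplus>\<^bsub>ob Y n\<^esub> (diff Y (n - 1) (h n x \<oplus>\<^bsub>ob Y (n - 1)\<^esub> h' n x) \<oplus>\<^bsub>ob Y n\<^esub>
        (h (n + 1) (diff X n x) \<oplus>\<^bsub>ob Y (n + 1 - 1)\<^esub> h' (n + 1) (diff X n x)))"
      using c by (simp add: h(3)[OF x] h'(3)[OF x] d(2)[OF hx] Y.a_ac)
  qed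
qed

lemma homotopic_maps_comp:
  assumes X: "is_cpx R X" "is_cpx R Y" "is_cpx R Z"
    and f: "f \<in> chain_maps R X Y" "f' \<in> chain_maps R X Y" "homotopic_maps R X Y f f'"
    and g: "g \<in> chain_maps R Y Z" "g' \<in> chain_maps R Y Z" "homotopic_maps R Y Z g g'"
  shows "homotopic_maps R X Z (\<lambda>n. g n \<circ> f n) (\<lambda>n. g' n \<circ> f' n)"
proof -
  obtain h where h: "\<And>n. h n \<in> gmod_hom R (ob X n) (ob Y (n - 1))"
    "\<And>n. h (n + 1) \<in> gmod_hom R (ob X (n + 1)) (ob Y n)"
    "\<And>n x. x \<in> carrier (ob X n) \<Longrightarrow>
      f n x = f' n x \<oplus>\<^bsub>ob Y n\<^esub> (diff Y (n - 1) (h n x) \<oplus>\<^bsub>ob Y n\<^esub> h (n + 1) (diff X n x))"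
    by (rule homotopic_mapsE[OF f(3)]) (rule that)
  obtain h' where h': "\<And>n. h' n \<in> gmod_hom R (ob Y n) (ob Z (n - 1))"
    "\<And>n. h' (n + 1) \<in> gmod_hom R (ob Y (n + 1)) (ob Z n)"
    "\<And>n x. x \<in> carrier (ob Y n) \<Longrightarrow>
      g n x = g' n x \<oplus>\<^bsub>ob Z n\<^esub> (diff Z (n - 1) (h' n x) \<oplus>\<^bsub>ob Z n\<^esub> h' (n + 1) (diff Y n x))"
    by (rule homotopic_mapsE[OF g(3)]) (rule that)
  show ?thesis
  proof (rule homotopic_mapsI[where h = "\<lambda>n x. g (n - 1) (h n x) \<oplus>\<^bsub>ob Z (n - 1)\<^esub> h' n (f' n x)"])
    show "(\<lambda>x. g (n - 1) (h n x) \<oplus>\<^bsub>ob Z (n - 1)\<^esub> h' n (f' n x)) \<in> gmod_hom R (ob X n) (ob Z (n - 1))" for n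
      using gmod_hom_add_map[OF is_cpxD(2)[OF X(3)] gmod_hom_comp[OF h(1) chain_mapsD(1)[OF g(1)]]
        gmod_hom_comp[OF chain_mapsD(1)[OF f(2)] h'(1)]] by (simp add: comp_def)
    fix n x assume x: "x \<in> carrier (ob X n)"
    interpret Y: abelian_group "ob Y n" by (rule is_cpxD(3)[OF X(2)])
    interpret Z: abelian_group "ob Z n" by (rule is_cpxD(3)[OF X(3)])
    note hx = gmod_homD(1)[OF h(1) x]
    note dx = gmod_homD(1)[OF is_cpxD(4)[OF X(1)] x]
    note fx = gmod_homD(1)[OF chain_mapsD(1)[OF f(2)] x]
    note dhx = gmod_homD(1)[OF is_cpxD(5)[OF X(2)] hx]
    note hdx = gmod_homD(1)[OF h(2) dx]
    note G = gmod_homD[OF chain_mapsD(1)[OF g(1)]] and G' = gmod_homD[OF chain_mapsD(1)[OF g(2)]]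
    note hfx = gmod_homD(1)[OF h'(1) fx]
    note dfx = gmod_homD(1)[OF is_cpxD(4)[OF X(2)] fx]
    note dZ = gmod_homD[OF is_cpxD(5)[OF X(3)]]
    have gd: "g n (diff Y (n - 1) (h n x)) = diff Z (n - 1) (g (n - 1) (h n x))"
      using chain_mapsD(2)[OF g(1) hx] by simp
    have fd: "f' (n + 1) (diff X n x) = diff Y n (f' n x)" by (rule chain_mapsD(2)[OF f(2) x])
    have "g n (f n x) = g n (f' n x) \<oplus>\<^bsub>ob Z n\<^esub> (diff Z (n - 1) (g (n - 1) (h n x)) \<oplus>\<^bsub>ob Z n\<^esub> g n (h (n + 1) (diff X n x)))"
      by (simp add: h(3)[OF x] G(2) fx dhx hdx gd)
    also have "g n (f' n x) = g' n (f' n x) \<oplus>\<^bsub>ob Z n\<^esub> (diff Z (n - 1) (h' n (f' n x)) \<oplus>\<^bsub>ob Z n\<^esub> h' (n + 1) (diff Y n (f' n x)))"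
      by (rule h'(3)[OF fx])
    finally have e: "g n (f n x) = g' n (f' n x) \<oplus>\<^bsub>ob Z n\<^esub> (diff Z (n - 1) (h' n (f' n x)) \<oplus>\<^bsub>ob Z n\<^esub> h' (n + 1) (diff Y n (f' n x)))
      \<oplus>\<^bsub>ob Z n\<^esub> (diff Z (n - 1) (g (n - 1) (h n x)) \<oplus>\<^bsub>ob Z n\<^esub> g n (h (n + 1) (diff X n x)))" .
    note c = G'(1)[OF fx] dZ(1)[OF hfx] gmod_homD(1)[OF h'(2) dfx] dZ(1)[OF G(1)[OF hx]] G(1)[OF hdx]
    show "(g n \<circ> f n) x = (g' n \<circ> f' n) x \<oplus>\<^bsub>ob Z n\<^esub> (diff Z (n - 1) (g (n - 1) (h n x) \<oplus>\<^bsub>ob Z (n - 1)\<^esub> h' n (f' n x))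
      \<oplus>\<^bsub>ob Z n\<^esub> (g (n + 1 - 1) (h (n + 1) (diff X n x)) \<oplus>\<^bsub>ob Z (n + 1 - 1)\<^esub> h' (n + 1) (f' (n + 1) (diff X n x))))"
      using c by (simp add: e fd dZ(2)[OF G(1)[OF hx] hfx] Z.a_ac)
  qed
qed

lemma homotopy_equiv:
  assumes "is_cpx R X" "is_cpx R Y"
  shows "equiv (chain_maps R X Y) (homotopy_rel R X Y)"
proof (rule equivI)
  show "homotopy_rel R X Y \<subseteq> chain_maps R X Y \<times> chain_maps R X Y"
    by (auto simp: homotopy_rel_def)
  show "refl_on (chain_maps R X Y) (homotopy_rel R X Y)"
    using homotopic_maps_eqI[OF assms] by (auto simp: refl_on_def homotopy_rel_def)
  show "sym (homotopy_rel R X Y)"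
    using homotopic_maps_sym[OF assms] by (auto simp: sym_def homotopy_rel_def)
  show "trans (homotopy_rel R X Y)"
    using homotopic_maps_trans[OF assms] by (auto simp: trans_def homotopy_rel_def)
qed

abbreviation hclass :: "('r, 'x) gring_scheme \<Rightarrow> ('r, 'a) cpx \<Rightarrow> ('r, 'b) cpx \<Rightarrow> (int \<Rightarrow> 'a \<Rightarrow> 'b) \<Rightarrow> (int \<Rightarrow> 'a \<Rightarrow> 'b) set" where
  "hclass R X Y f \<equiv> homotopy_rel R X Y `` {f}"

lemma hclass_eqI:
  assumes "is_cpx R X" "is_cpx R Y" "f \<in> chain_maps R X Y" "g \<in> chain_maps R X Y" "homotopic_maps R X Y f g"
  shows "hclass R X Y f = hclass R X Y g"
  by (rule equiv_class_eq[OF homotopy_equiv[OF assms(1,2)]]) (use assms in \<open>simp add: homotopy_rel_def\<close>)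

lemma hclass_cong:
  assumes "is_cpx R X" "is_cpx R Y" "f \<in> chain_maps R X Y" "g \<in> chain_maps R X Y"
    and "\<And>n x. x \<in> carrier (ob X n) \<Longrightarrow> f n x = g n x"
  shows "hclass R X Y f = hclass R X Y g"
  by (rule hclass_eqI[OF assms(1-4) homotopic_maps_eqI[OF assms(1-3,5)]])

lemma hclass_self:
  assumes "is_cpx R X" "is_cpx R Y" "f \<in> chain_maps R X Y"
  shows "f \<in> hclass R X Y f"
  by (rule equiv_class_self[OF homotopy_equiv[OF assms(1,2)] assms(3)])

lemma hclass_Khom: "f \<in> chain_maps R X Y \<Longrightarrow> hclass R X Y f \<in> Khom R X Y"
  unfolding Khom_def by (rule quotientI)

lemma KhomE:
  assumes "\<phi> \<in> Khom R X Y"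
  obtains f where "f \<in> chain_maps R X Y" "\<phi> = hclass R X Y f"
  using assms unfolding Khom_def by (rule quotientE)

lemma hclassD: "f' \<in> hclass R X Y f \<Longrightarrow> f \<in> chain_maps R X Y \<and> f' \<in> chain_maps R X Y \<and> homotopic_maps R X Y f f'"
  by (simp add: homotopy_rel_def)

text \<open>
  The composition of classes is a union over all composites of representatives; these are homotopic to one another, so the
  union is a single class.
\<close>

lemma Kcomp_hclass:
  assumes X: "is_cpx R X" "is_cpx R Y" "is_cpx R Z"
    and f: "f \<in> chain_maps R X Y" and g: "g \<in> chain_maps R Y Z"
  shows "Kcomp R X Z (hclass R Y Z g) (hclass R X Y f) = hclass R X Z (\<lambda>n. g n \<circ> f n)"
proof -
  have eq: "hclass R X Z (\<lambda>n. g' n \<circ> f' n) = hclass R X Z (\<lambda>n. g n \<circ> f n)"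
    if "f' \<in> hclass R X Y f" "g' \<in> hclass R Y Z g" for f' g'
  proof (rule hclass_eqI[OF X(1,3), symmetric])
    note f' = hclassD[OF that(1)] and g' = hclassD[OF that(2)]
    show "(\<lambda>n. g n \<circ> f n) \<in> chain_maps R X Z" "(\<lambda>n. g' n \<circ> f' n) \<in> chain_maps R X Z"
      using f' g' by (blast intro: chain_maps_comp)+
    show "homotopic_maps R X Z (\<lambda>n. g n \<circ> f n) (\<lambda>n. g' n \<circ> f' n)"
      using f' g' by (intro homotopic_maps_comp[OF X]) auto
  qed
  have ne: "f \<in> hclass R X Y f" "g \<in> hclass R Y Z g"
    by (rule hclass_self[OF X(1,2) f], rule hclass_self[OF X(2,3) g])
  show ?thesis
    unfolding Kcomp_def
  proof (rule equalityI)
    show "(\<Union>g\<in>hclass R Y Z g. \<Union>f\<in>hclass R X Y f. hclass R X Z (\<lambda>n. g n \<circ> f n)) \<subseteq> hclass R X Z (\<lambda>n. g n \<circ> f n)"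
      using eq by (intro UN_least) simp
    show "hclass R X Z (\<lambda>n. g n \<circ> f n) \<subseteq> (\<Union>g\<in>hclass R Y Z g. \<Union>f\<in>hclass R X Y f. hclass R X Z (\<lambda>n. g n \<circ> f n))"
      by (rule subsetI, rule UN_I[OF ne(2)], rule UN_I[OF ne(1)])
  qed
qed

subsection \<open>Functors on complexes that preserve homotopies\<close>

text \<open>
  Functors between categories of complexes that preserve homotopies. The functor laws hold on carriers only, since maps
  are arbitrary outside; this suffices, because maps that agree on carriers are homotopic.
\<close>

locale strict_functor =
  fixes R :: "('r, 'x) gring_scheme" and Fob :: "('r, 'a) cpx \<Rightarrow> ('r, 'b) cpx"
    and Fmap :: "('r, 'a) cpx \<Rightarrow> (int \<Rightarrow> 'a \<Rightarrow> 'a) \<Rightarrow> int \<Rightarrow> 'b \<Rightarrow> 'b"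
  assumes ob_cpx: "is_cpx R X \<Longrightarrow> is_cpx R (Fob X)"
    and map_chain: "\<lbrakk>is_cpx R X; is_cpx R Y; f \<in> chain_maps R X Y\<rbrakk> \<Longrightarrow> Fmap Y f \<in> chain_maps R (Fob X) (Fob Y)"
    and map_homotopic: "\<lbrakk>is_cpx R X; is_cpx R Y; f \<in> chain_maps R X Y; g \<in> chain_maps R X Y; homotopic_maps R X Y f g\<rbrakk> \<Longrightarrow>
      homotopic_maps R (Fob X) (Fob Y) (Fmap Y f) (Fmap Y g)"
    and map_ident: "\<lbrakk>is_cpx R X; x \<in> carrier (ob (Fob X) n)\<rbrakk> \<Longrightarrow> Fmap X (\<lambda>n x. x) n x = x"
    and map_comp: "\<lbrakk>is_cpx R X; is_cpx R Y; is_cpx R Z; f \<in> chain_maps R X Y; g \<in> chain_maps R Y Z;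
      x \<in> carrier (ob (Fob X) n)\<rbrakk> \<Longrightarrow> Fmap Z (\<lambda>n. g n \<circ> f n) n x = Fmap Z g n (Fmap Y f n x)"
begin

definition induced :: "('r, 'a, 'b) kfunctor" where
  "induced = \<lparr>fob = Fob, fmor = (\<lambda>X Y \<phi>. \<Union>f\<in>\<phi>. hclass R (Fob X) (Fob Y) (Fmap Y f))\<rparr>"

lemma fob_induced: "fob induced X = Fob X"
  by (simp add: induced_def)

lemma fmor_induced:
  assumes X: "is_cpx R X" "is_cpx R Y" and f: "f \<in> chain_maps R X Y"
  shows "fmor induced X Y (hclass R X Y f) = hclass R (Fob X) (Fob Y) (Fmap Y f)"
proof -
  have eq: "hclass R (Fob X) (Fob Y) (Fmap Y f') = hclass R (Fob X) (Fob Y) (Fmap Y f)" if "f' \<in> hclass R X Y f" for f'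
    using hclassD[OF that]
    by (intro hclass_eqI[symmetric] ob_cpx X map_chain map_homotopic) auto
  show ?thesis
    unfolding induced_def kfunctor.simps
  proof (rule equalityI)
    show "(\<Union>f\<in>hclass R X Y f. hclass R (Fob X) (Fob Y) (Fmap Y f)) \<subseteq> hclass R (Fob X) (Fob Y) (Fmap Y f)"
      by (rule UN_least) (simp only: eq order_refl)
    show "hclass R (Fob X) (Fob Y) (Fmap Y f) \<subseteq> (\<Union>f\<in>hclass R X Y f. hclass R (Fob X) (Fob Y) (Fmap Y f))"
      by (rule subsetI, rule UN_I[OF hclass_self[OF X f]])
  qed
qed

lemma induced_kfunctor: "is_kfunctor R induced"
  unfolding is_kfunctor_def fob_induced
proof (intro conjI allI impI; (elim conjE)?)
  fix X Y :: "('r, 'a) cpx" and \<phi> assume X: "is_cpx R X" "is_cpx R Y" and "\<phi> \<in> Khom R X Y"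
  then obtain f where f: "f \<in> chain_maps R X Y" "\<phi> = hclass R X Y f" by (blast elim: KhomE)
  show "fmor induced X Y \<phi> \<in> Khom R (Fob X) (Fob Y)"
    unfolding f(2) fmor_induced[OF X f(1)] by (rule hclass_Khom[OF map_chain[OF X f(1)]])
next
  fix X :: "('r, 'a) cpx" assume X: "is_cpx R X"
  show "is_cpx R (Fob X)" by (rule ob_cpx[OF X])
  show "fmor induced X X (Kid R X) = Kid R (Fob X)"
    unfolding Kid_def fmor_induced[OF X X chain_maps_ident]
    by (rule hclass_cong[OF ob_cpx[OF X] ob_cpx[OF X] map_chain[OF X X chain_maps_ident] chain_maps_ident])
      (rule map_ident[OF X])
next
  fix X Y Z :: "('r, 'a) cpx" and \<phi> \<psi> assume X: "is_cpx R X" "is_cpx R Y" "is_cpx R Z" and "\<phi> \<in> Khom R X Y" "\<psi> \<in> Khom R Y Z"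
  then obtain f g where f: "f \<in> chain_maps R X Y" "\<phi> = hclass R X Y f"
    and g: "g \<in> chain_maps R Y Z" "\<psi> = hclass R Y Z g" by (blast elim: KhomE)
  note gf = chain_maps_comp[OF f(1) g(1)]
  show "fmor induced X Z (Kcomp R X Z \<psi> \<phi>) = Kcomp R (Fob X) (Fob Z) (fmor induced Y Z \<psi>) (fmor induced X Y \<phi>)"
    unfolding f(2) g(2) Kcomp_hclass[OF X f(1) g(1)] fmor_induced[OF X(1,2) f(1)] fmor_induced[OF X(2,3) g(1)]
      fmor_induced[OF X(1,3) gf]
      Kcomp_hclass[OF ob_cpx[OF X(1)] ob_cpx[OF X(2)] ob_cpx[OF X(3)] map_chain[OF X(1,2) f(1)] map_chain[OF X(2,3) g(1)]]
    by (rule hclass_cong[OF ob_cpx[OF X(1)] ob_cpx[OF X(3)] map_chain[OF X(1,3) gf]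
          chain_maps_comp[OF map_chain[OF X(1,2) f(1)] map_chain[OF X(2,3) g(1)]]])
      (simp add: map_comp[OF X f(1) g(1)])
qed

end

text \<open>
  Only one of the two families of maps has to be natural: a natural family of isomorphisms in the homotopy category is an
  isomorphism of functors, and the other family merely witnesses invertibility.
\<close>

lemma inverse_kfunctorI:
  fixes R :: "('r, 'x) gring_scheme"
  assumes F: "strict_functor R Fob Fmap" and G: "strict_functor R Gob Gmap"
    and \<alpha>: "\<And>X. is_cpx R X \<Longrightarrow> \<alpha> X \<in> chain_maps R X (Gob (Fob X))"
    and \<beta>: "\<And>X. is_cpx R X \<Longrightarrow> \<beta> X \<in> chain_maps R (Gob (Fob X)) X"
    and \<beta>\<alpha>: "\<And>X n x. \<lbrakk>is_cpx R X; x \<in> carrier (ob X n)\<rbrakk> \<Longrightarrow> \<beta> X n (\<alpha> X n x) = x"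
    and \<alpha>\<beta>: "\<And>X. is_cpx R X \<Longrightarrow>
      homotopic_maps R (Gob (Fob X)) (Gob (Fob X)) (\<lambda>n x. x) (\<lambda>n. \<alpha> X n \<circ> \<beta> X n)"
    and nat: "\<And>X Y f n z. \<lbrakk>is_cpx R X; is_cpx R Y; f \<in> chain_maps R X Y; z \<in> carrier (ob (Gob (Fob X)) n)\<rbrakk> \<Longrightarrow>
      \<beta> Y n (Gmap (Fob Y) (Fmap Y f) n z) = f n (\<beta> X n z)"
  shows "kfunctors_isomorphic R (kfunctor_comp (strict_functor.induced R Gob Gmap) (strict_functor.induced R Fob Fmap))
    kfunctor_id"
proof -
  interpret F: strict_functor R Fob Fmap by fact
  interpret G: strict_functor R Gob Gmap by fact
  note GF = G.ob_cpx[OF F.ob_cpx]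
  have ob: "fob (kfunctor_comp G.induced F.induced) X = Gob (Fob X)" for X
    by (simp add: kfunctor_comp_def F.fob_induced G.fob_induced)
  have id: "fob kfunctor_id X = X" "fmor kfunctor_id X Y \<phi> = \<phi>" for X :: "('r, 'a) cpx" and Y \<phi>
    by (simp_all add: kfunctor_id_def)
  show ?thesis
    unfolding kfunctors_isomorphic_def ob id
  proof (intro exI[of _ "\<lambda>X. hclass R (Gob (Fob X)) X (\<beta> X)"] conjI allI impI; (elim conjE)?)
    fix X :: "('r, 'a) cpx" assume X: "is_cpx R X"
    let ?Z = "Gob (Fob X)"
    show "Kiso R ?Z X (hclass R ?Z X (\<beta> X))"
      unfolding Kiso_def
    proof (intro conjI bexI[of _ "hclass R X ?Z (\<alpha> X)"])
      show "hclass R ?Z X (\<beta> X) \<in> Khom R ?Z X" by (rule hclass_Khom[OF \<beta>[OF X]])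
      show "hclass R X ?Z (\<alpha> X) \<in> Khom R X ?Z" by (rule hclass_Khom[OF \<alpha>[OF X]])
      show "Kcomp R ?Z ?Z (hclass R X ?Z (\<alpha> X)) (hclass R ?Z X (\<beta> X)) = Kid R ?Z"
        unfolding Kcomp_hclass[OF GF[OF X] X GF[OF X] \<beta>[OF X] \<alpha>[OF X]] Kid_def
        by (rule hclass_eqI[symmetric, OF GF[OF X] GF[OF X] chain_maps_ident chain_maps_comp[OF \<beta>[OF X] \<alpha>[OF X]] \<alpha>\<beta>[OF X]])
      show "Kcomp R X X (hclass R ?Z X (\<beta> X)) (hclass R X ?Z (\<alpha> X)) = Kid R X"
        unfolding Kcomp_hclass[OF X GF[OF X] X \<alpha>[OF X] \<beta>[OF X]] Kid_def
        by (rule hclass_cong[OF X X chain_maps_comp[OF \<alpha>[OF X] \<beta>[OF X]] chain_maps_ident]) (simp add: \<beta>\<alpha>[OF X])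
    qed
  next
    fix X Y :: "('r, 'a) cpx" and \<phi> assume X: "is_cpx R X" "is_cpx R Y" and "\<phi> \<in> Khom R X Y"
    then obtain f where f: "f \<in> chain_maps R X Y" "\<phi> = hclass R X Y f" by (blast elim: KhomE)
    note Ff = F.map_chain[OF X f(1)]
    note GFf = G.map_chain[OF F.ob_cpx[OF X(1)] F.ob_cpx[OF X(2)] Ff]
    have m: "fmor (kfunctor_comp G.induced F.induced) X Y (hclass R X Y f) =
        hclass R (Gob (Fob X)) (Gob (Fob Y)) (Gmap (Fob Y) (Fmap Y f))"
      unfolding kfunctor_comp_def
      by (simp add: F.fob_induced F.fmor_induced[OF X f(1)]
          G.fmor_induced[OF F.ob_cpx[OF X(1)] F.ob_cpx[OF X(2)] Ff])
    show "Kcomp R (Gob (Fob X)) Y (hclass R (Gob (Fob Y)) Y (\<beta> Y)) (fmor (kfunctor_comp G.induced F.induced) X Y \<phi>)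
      = Kcomp R (Gob (Fob X)) Y \<phi> (hclass R (Gob (Fob X)) X (\<beta> X))"
      unfolding f(2) m Kcomp_hclass[OF GF[OF X(1)] GF[OF X(2)] X(2) GFf \<beta>[OF X(2)]]
        Kcomp_hclass[OF GF[OF X(1)] X \<beta>[OF X(1)] f(1)]
      by (rule hclass_cong[OF GF[OF X(1)] X(2) chain_maps_comp[OF GFf \<beta>[OF X(2)]] chain_maps_comp[OF \<beta>[OF X(1)] f(1)]])
        (simp add: nat[OF X f(1)])
  qed
qed

text \<open>
  The homotopy equivalence is given on a model \<open>C X\<close> of the composite functor, and is transported along the isomorphism
  \<open>\<Phi>\<close>, along which \<open>C X\<close> also inherits the closure properties of a complex.
\<close>

lemma inverse_kfunctor_retractI:
  fixes R :: "('r, 'x) gring_scheme" and Fob :: "('r, 'a) cpx \<Rightarrow> ('r, 'b) cpx" and Gob :: "('r, 'b) cpx \<Rightarrow> ('r, 'c) cpx"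
    and C :: "('r, 'a) cpx \<Rightarrow> ('r, 'd) cpx"
  assumes F: "strict_functor R Fob Fmap" and G: "strict_functor R Gob Gmap"
    and \<Phi>: "\<And>X. is_cpx R X \<Longrightarrow> \<Phi> X \<in> chain_maps R (Gob (Fob X)) (C X)"
    and \<Psi>: "\<And>X n. is_cpx R X \<Longrightarrow> \<Psi> X n \<in> gmod_hom R (ob (C X) n) (ob (Gob (Fob X)) n)"
    and \<Phi>\<Psi>: "\<And>X n z. \<lbrakk>is_cpx R X; z \<in> carrier (ob (C X) n)\<rbrakk> \<Longrightarrow> \<Phi> X n (\<Psi> X n z) = z"
    and \<Psi>\<Phi>: "\<And>X n z. \<lbrakk>is_cpx R X; z \<in> carrier (ob (Gob (Fob X)) n)\<rbrakk> \<Longrightarrow> \<Psi> X n (\<Phi> X n z) = z"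
    and \<Phi>_nat: "\<And>X Y f n z. \<lbrakk>is_cpx R X; is_cpx R Y; f \<in> chain_maps R X Y; z \<in> carrier (ob (Gob (Fob X)) n)\<rbrakk> \<Longrightarrow>
      \<Phi> Y n (Gmap (Fob Y) (Fmap Y f) n z) = Cmap f n (\<Phi> X n z)"
    and \<alpha>: "\<And>X. is_cpx R X \<Longrightarrow> \<alpha> X \<in> chain_maps R X (C X)"
    and \<beta>: "\<And>X. is_cpx R X \<Longrightarrow> \<beta> X \<in> chain_maps R (C X) X"
    and \<beta>\<alpha>: "\<And>X n x. \<lbrakk>is_cpx R X; x \<in> carrier (ob X n)\<rbrakk> \<Longrightarrow> \<beta> X n (\<alpha> X n x) = x"
    and \<beta>_nat: "\<And>X Y f n z. \<lbrakk>is_cpx R X; is_cpx R Y; f \<in> chain_maps R X Y; z \<in> carrier (ob (C X) n)\<rbrakk> \<Longrightarrow>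
      \<beta> Y n (Cmap f n z) = f n (\<beta> X n z)"
    and h: "\<And>X n. is_cpx R X \<Longrightarrow> h X n \<in> gmod_hom R (ob (C X) n) (ob (C X) (n - 1))"
    and retract: "\<And>X n z. \<lbrakk>is_cpx R X; z \<in> carrier (ob (C X) n)\<rbrakk> \<Longrightarrow>
      z = \<alpha> X n (\<beta> X n z) \<oplus>\<^bsub>ob (C X) n\<^esub> (diff (C X) (n - 1) (h X n z) \<oplus>\<^bsub>ob (C X) n\<^esub> h X (n + 1) (diff (C X) n z))"
  shows "kfunctors_isomorphic R (kfunctor_comp (strict_functor.induced R Gob Gmap) (strict_functor.induced R Fob Fmap))
    kfunctor_id"
proof (rule inverse_kfunctorI[OF F G, where \<alpha> = "\<lambda>X n. \<Psi> X n \<circ> \<alpha> X n" and \<beta> = "\<lambda>X n. \<beta> X n \<circ> \<Phi> X n"])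
  fix X :: "('r, 'a) cpx" assume X: "is_cpx R X"
  note GF = strict_functor.ob_cpx[OF G strict_functor.ob_cpx[OF F]]
  have \<Psi>c: "\<Psi> X \<in> chain_maps R (C X) (Gob (Fob X))"
    by (rule chain_maps_inverse[OF gmod_homD(1)[OF is_cpxD(4)[OF GF[OF X]]] \<Phi>[OF X] \<Psi>[OF X] \<Phi>\<Psi>[OF X] \<Psi>\<Phi>[OF X]])
  note \<Phi>h = gmod_homD[OF chain_mapsD(1)[OF \<Phi>[OF X]]] and \<Psi>h = gmod_homD[OF chain_mapsD(1)[OF \<Psi>c]]
    and \<alpha>h = gmod_homD[OF chain_mapsD(1)[OF \<alpha>[OF X]]] and \<beta>h = gmod_homD[OF chain_mapsD(1)[OF \<beta>[OF X]]]
  show "(\<lambda>n. \<Psi> X n \<circ> \<alpha> X n) \<in> chain_maps R X (Gob (Fob X))" by (rule chain_maps_comp[OF \<alpha>[OF X] \<Psi>c])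
  show "(\<lambda>n. \<beta> X n \<circ> \<Phi> X n) \<in> chain_maps R (Gob (Fob X)) X" by (rule chain_maps_comp[OF \<Phi>[OF X] \<beta>[OF X]])
  show "(\<beta> X n \<circ> \<Phi> X n) ((\<Psi> X n \<circ> \<alpha> X n) x) = x" if "x \<in> carrier (ob X n)" for n x
    using that by (simp add: \<Phi>\<Psi>[OF X \<alpha>h(1)] \<beta>\<alpha>[OF X])
  show "homotopic_maps R (Gob (Fob X)) (Gob (Fob X)) (\<lambda>n x. x) (\<lambda>n. (\<Psi> X n \<circ> \<alpha> X n) \<circ> (\<beta> X n \<circ> \<Phi> X n))"
  proof (rule homotopic_mapsI[where h = "\<lambda>n. \<Psi> X (n - 1) \<circ> h X n \<circ> \<Phi> X n"])
    show "\<Psi> X (n - 1) \<circ> h X n \<circ> \<Phi> X n \<in> gmod_hom R (ob (Gob (Fob X)) n) (ob (Gob (Fob X)) (n - 1))" for n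
      by (intro gmod_hom_comp[OF chain_mapsD(1)[OF \<Phi>[OF X]]] gmod_hom_comp[OF h[OF X]] chain_mapsD(1)[OF \<Psi>c])
    fix n z assume z: "z \<in> carrier (ob (Gob (Fob X)) n)"
    have addC: "z' \<oplus>\<^bsub>ob (C X) n\<^esub> w \<in> carrier (ob (C X) n)" if "z' \<in> carrier (ob (C X) n)" "w \<in> carrier (ob (C X) n)" for z' w
      using \<Phi>h(1)[OF abelian_groupE(1)[OF is_cpxD(3)[OF GF[OF X]] \<Psi>h(1)[OF that(1)] \<Psi>h(1)[OF that(2)]]]
      by (simp add: \<Phi>h(2) \<Psi>h(1) \<Phi>\<Psi>[OF X] that)
    have dC: "diff (C X) i z' \<in> carrier (ob (C X) (i + 1))" if "z' \<in> carrier (ob (C X) i)" for i z'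
      using chain_mapsD(2)[OF \<Phi>[OF X] \<Psi>h(1)[OF that]] \<Phi>h(1)[OF gmod_homD(1)[OF is_cpxD(4)[OF GF[OF X]] \<Psi>h(1)[OF that]]]
      by (simp add: \<Phi>\<Psi>[OF X that])
    note w = \<Phi>h(1)[OF z]
    note hw = gmod_homD(1)[OF h[OF X] w]
    have dhw: "diff (C X) (n - 1) (h X n (\<Phi> X n z)) \<in> carrier (ob (C X) n)" using dC[OF hw] by simp
    have hdw: "h X (n + 1) (diff (C X) n (\<Phi> X n z)) \<in> carrier (ob (C X) n)"
      using gmod_homD(1)[OF h[OF X] dC[OF w]] by simp
    have "z = \<Psi> X n (\<Phi> X n z)" by (simp add: \<Psi>\<Phi>[OF X z])
    also have "\<dots> = \<Psi> X n (\<alpha> X n (\<beta> X n (\<Phi> X n z)) \<oplus>\<^bsub>ob (C X) n\<^esub> (diff (C X) (n - 1) (h X n (\<Phi> X n z))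
        \<oplus>\<^bsub>ob (C X) n\<^esub> h X (n + 1) (diff (C X) n (\<Phi> X n z))))"
      by (rule arg_cong[OF retract[OF X w]])
    also have "\<dots> = \<Psi> X n (\<alpha> X n (\<beta> X n (\<Phi> X n z))) \<oplus>\<^bsub>ob (Gob (Fob X)) n\<^esub> (\<Psi> X n (diff (C X) (n - 1) (h X n (\<Phi> X n z)))
        \<oplus>\<^bsub>ob (Gob (Fob X)) n\<^esub> \<Psi> X n (h X (n + 1) (diff (C X) n (\<Phi> X n z))))"
      by (simp add: \<Psi>h(2) \<alpha>h(1) \<beta>h(1) w dhw hdw addC)
    also have "\<Psi> X n (diff (C X) (n - 1) (h X n (\<Phi> X n z))) = diff (Gob (Fob X)) (n - 1) (\<Psi> X (n - 1) (h X n (\<Phi> X n z)))"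
      using chain_mapsD(2)[OF \<Psi>c hw] by simp
    also have "diff (C X) n (\<Phi> X n z) = \<Phi> X (n + 1) (diff (Gob (Fob X)) n z)"
      by (simp add: chain_mapsD(2)[OF \<Phi>[OF X] z])
    finally show "z = (\<Psi> X n \<circ> \<alpha> X n \<circ> (\<beta> X n \<circ> \<Phi> X n)) z \<oplus>\<^bsub>ob (Gob (Fob X)) n\<^esub>
        (diff (Gob (Fob X)) (n - 1) ((\<Psi> X (n - 1) \<circ> h X n \<circ> \<Phi> X n) z) \<oplus>\<^bsub>ob (Gob (Fob X)) n\<^esub>
         (\<Psi> X (n + 1 - 1) \<circ> h X (n + 1) \<circ> \<Phi> X (n + 1)) (diff (Gob (Fob X)) n z))"
      by simp
  qed
next
  fix X Y :: "('r, 'a) cpx" and f n z assume X: "is_cpx R X" and Y: "is_cpx R Y" and f: "f \<in> chain_maps R X Y" and z: "z \<in> carrier (ob (Gob (Fob X)) n)"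
  show "(\<beta> Y n \<circ> \<Phi> Y n) (Gmap (Fob Y) (Fmap Y f) n z) = f n ((\<beta> X n \<circ> \<Phi> X n) z)"
    using \<beta>_nat[OF X Y f gmod_homD(1)[OF chain_mapsD(1)[OF \<Phi>[OF X]] z]] by (simp add: \<Phi>_nat[OF X Y f z])
qed

section \<open>The free algebra and its quotient by the anticommutation relation\<close>

locale odd_poly = cring k for k :: "('k, 'z) ring_scheme" (structure)
begin

abbreviation "FA \<equiv> free_alg k"

definition conv :: "(gen list \<Rightarrow> 'k) \<Rightarrow> (gen list \<Rightarrow> 'k) \<Rightarrow> gen list \<Rightarrow> 'k" where
  "conv f g w = (\<Oplus>i\<in>{..length w}. f (take i w) \<otimes> g (drop i w))"

text \<open>
  All coefficient functions, of finite support or not. The identities for the convolution hold for these, and this class is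
  evidently closed under the passage to tails, by which the identities are proved.
\<close>

definition coeffs :: "(gen list \<Rightarrow> 'k) set" where
  "coeffs = {f. \<forall>w. f w \<in> carrier k}"

definition mono :: "'k \<Rightarrow> gen list \<Rightarrow> gen list \<Rightarrow> 'k" where
  "mono c v = (\<lambda>w. if w = v then c else \<zero>)"

lemma coeffsD: "f \<in> coeffs \<Longrightarrow> f w \<in> carrier k"
  by (simp add: coeffs_def)

lemma coeffs_tail: "f \<in> coeffs \<Longrightarrow> (\<lambda>w. f (a # w)) \<in> coeffs"
  by (simp add: coeffs_def)

lemma free_alg_simps:
  "f \<in> carrier FA \<longleftrightarrow> f \<in> coeffs \<and> finite {w. f w \<noteq> \<zero>}"
  "f \<otimes>\<^bsub>FA\<^esub> g = conv f g" "f \<oplus>\<^bsub>FA\<^esub> g = (\<lambda>w. f w \<oplus> g w)" "\<zero>\<^bsub>FA\<^esub> = (\<lambda>w. \<zero>)" "\<one>\<^bsub>FA\<^esub> = mono \<one> []"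
  by (simp_all add: free_alg_def coeffs_def conv_def mono_def fun_eq_iff)

lemma conv_Nil: "\<lbrakk>f \<in> coeffs; g \<in> coeffs\<rbrakk> \<Longrightarrow> conv f g [] = f [] \<otimes> g []"
  by (simp add: conv_def coeffsD)

text \<open>
  Either the first factor of a splitting of \<open>a # w\<close> is empty or it begins with \<open>a\<close>. Associativity follows from this recursion
  by induction on the word.
\<close>

lemma conv_Cons:
  assumes "f \<in> coeffs" "g \<in> coeffs"
  shows "conv f g (a # w) = f [] \<otimes> g (a # w) \<oplus> conv (\<lambda>v. f (a # v)) g w"
proof -
  have "conv f g (a # w) = (\<Oplus>i\<in>{..length w}. f (a # take i w) \<otimes> g (drop i w)) \<oplus> f [] \<otimes> g (a # w)"
    unfolding conv_def using assms by (simp add: coeffsD finsum_Suc2 del: finsum_Suc)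
  thus ?thesis using assms by (simp add: conv_def coeffsD a_comm)
qed

lemma conv_closed: "\<lbrakk>f \<in> coeffs; g \<in> coeffs\<rbrakk> \<Longrightarrow> conv f g \<in> coeffs"
  by (simp add: coeffs_def conv_def)

lemma add_coeffs: "\<lbrakk>f \<in> coeffs; g \<in> coeffs\<rbrakk> \<Longrightarrow> (\<lambda>w. f w \<oplus> g w) \<in> coeffs"
  by (simp add: coeffs_def)

lemma scale_coeffs: "\<lbrakk>c \<in> carrier k; f \<in> coeffs\<rbrakk> \<Longrightarrow> (\<lambda>w. c \<otimes> f w) \<in> coeffs"
  by (simp add: coeffs_def)

lemma mono_coeffs: "c \<in> carrier k \<Longrightarrow> mono c v \<in> coeffs"
  by (simp add: coeffs_def mono_def)

lemma conv_add_left: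
  "\<lbrakk>f \<in> coeffs; f' \<in> coeffs; g \<in> coeffs\<rbrakk> \<Longrightarrow> conv (\<lambda>w. f w \<oplus> f' w) g w = conv f g w \<oplus> conv f' g w"
  by (simp add: conv_def coeffsD l_distr finsum_addf)

lemma conv_add_right:
  "\<lbrakk>f \<in> coeffs; g \<in> coeffs; g' \<in> coeffs\<rbrakk> \<Longrightarrow> conv f (\<lambda>w. g w \<oplus> g' w) w = conv f g w \<oplus> conv f g' w"
  by (simp add: conv_def coeffsD r_distr finsum_addf)

lemma conv_scale_left:
  "\<lbrakk>c \<in> carrier k; f \<in> coeffs; g \<in> coeffs\<rbrakk> \<Longrightarrow> conv (\<lambda>w. c \<otimes> f w) g w = c \<otimes> conv f g w"
  by (simp add: conv_def coeffsD m_assoc finsum_rdistr)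

lemma conv_zero_left: "g \<in> coeffs \<Longrightarrow> conv (\<lambda>w. \<zero>) g w = \<zero>"
  by (simp add: conv_def coeffsD)

lemma conv_assoc:
  assumes "g \<in> coeffs" "h \<in> coeffs"
  shows "f \<in> coeffs \<Longrightarrow> conv (conv f g) h w = conv f (conv g h) w"
proof (induction w arbitrary: f)
  case Nil
  then show ?case using assms by (simp add: conv_Nil conv_closed coeffsD m_assoc)
next
  case (Cons a w)
  let ?fa = "\<lambda>v. f (a # v)" and ?ga = "\<lambda>v. g (a # v)"
  have fa: "?fa \<in> coeffs" "?ga \<in> coeffs" using Cons.prems assms coeffs_tail by auto
  have tail: "(\<lambda>v. conv f g (a # v)) = (\<lambda>v. f [] \<otimes> ?ga v \<oplus> conv ?fa g v)"
    using Cons.prems assms by (simp add: conv_Cons)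
  have "conv (\<lambda>v. conv f g (a # v)) h w = f [] \<otimes> conv ?ga h w \<oplus> conv (conv ?fa g) h w"
    unfolding tail using Cons.prems assms fa coeffsD[OF Cons.prems]
    by (subst conv_add_left) (simp_all add: scale_coeffs conv_closed conv_scale_left)
  also have "\<dots> = f [] \<otimes> conv ?ga h w \<oplus> conv ?fa (conv g h) w"
    using Cons.IH[OF fa(1)] by simp
  finally have "conv (conv f g) h (a # w) =
      (f [] \<otimes> g []) \<otimes> h (a # w) \<oplus> (f [] \<otimes> conv ?ga h w \<oplus> conv ?fa (conv g h) w)"
    using Cons.prems assms by (simp add: conv_Cons conv_closed conv_Nil)
  moreover have "conv f (conv g h) (a # w) =
      f [] \<otimes> (g [] \<otimes> h (a # w) \<oplus> conv ?ga h w) \<oplus> conv ?fa (conv g h) w"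
    using Cons.prems assms by (simp add: conv_Cons conv_closed)
  ultimately show ?case
    using coeffsD[OF Cons.prems] coeffsD[OF assms(1)] coeffsD[OF assms(2)] coeffsD[OF conv_closed[OF fa(2) assms(2)]]
      coeffsD[OF conv_closed[OF fa(1) conv_closed[OF assms]]]
    by (simp add: m_assoc r_distr a_assoc)
qed

lemma conv_mono_left:
  assumes "c \<in> carrier k" "g \<in> coeffs"
  shows "conv (mono c []) g w = c \<otimes> g w"
proof (cases w)
  case Nil
  then show ?thesis using assms by (simp add: conv_Nil mono_coeffs) (simp add: mono_def)
next
  case (Cons a v)
  have "(\<lambda>v. mono c [] (a # v)) = (\<lambda>v. \<zero>)" by (simp add: mono_def)
  then show ?thesis using assms Cons coeffsD[OF assms(2)]
    by (simp add: conv_Cons mono_coeffs conv_zero_left) (simp add: mono_def)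
qed

lemma conv_mono_right:
  assumes "c \<in> carrier k"
  shows "f \<in> coeffs \<Longrightarrow> conv f (mono c []) w = f w \<otimes> c"
proof (induction w arbitrary: f)
  case Nil
  then show ?case using assms by (simp add: conv_Nil mono_coeffs) (simp add: mono_def)
next
  case (Cons a w)
  then show ?case using assms coeffsD[OF Cons.prems] Cons.IH[OF coeffs_tail[OF Cons.prems]]
    by (simp add: conv_Cons mono_coeffs) (simp add: mono_def)
qed

lemma conv_mono_mono:
  assumes "c \<in> carrier k" "d \<in> carrier k"
  shows "conv (mono c u) (mono d v) w = mono (c \<otimes> d) (u @ v) w"
proof (induction u arbitrary: w)
  case Nil
  then show ?case using assms by (simp add: conv_mono_left mono_coeffs) (simp add: mono_def)
next
  case (Cons a u)
  show ?case
  proof (cases w)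
    case Nil
    then show ?thesis using assms by (simp add: conv_Nil mono_coeffs) (simp add: mono_def)
  next
    case w: (Cons b w')
    have t: "(\<lambda>v. mono c (a # u) (b # v)) = (if a = b then mono c u else (\<lambda>v. \<zero>))"
      by (auto simp: mono_def)
    have z: "mono c (a # u) [] = \<zero>" by (simp add: mono_def)
    have d: "mono d v w \<in> carrier k" "mono (c \<otimes> d) (u @ v) w' \<in> carrier k"
      using assms by (auto simp: mono_def)
    have "conv (mono c (a # u)) (mono d v) w = conv (\<lambda>v. mono c (a # u) (b # v)) (mono d v) w'"
      using assms d by (simp add: w conv_Cons mono_coeffs z conv_closed coeffsD coeffs_tail)
    also have "\<dots> = (if a = b then mono (c \<otimes> d) (u @ v) w' else \<zero>)"
      unfolding t using Cons.IH[of w'] assms by (simp add: conv_zero_left mono_coeffs)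
    also have "\<dots> = mono (c \<otimes> d) ((a # u) @ v) w" by (auto simp: w mono_def)
    finally show ?thesis .
  qed
qed

lemma conv_nonzero:
  assumes "f \<in> coeffs" "g \<in> coeffs" "conv f g w \<noteq> \<zero>"
  obtains u v where "w = u @ v" "f u \<noteq> \<zero>" "g v \<noteq> \<zero>"
proof -
  have "\<exists>i\<le>length w. f (take i w) \<noteq> \<zero> \<and> g (drop i w) \<noteq> \<zero>"
  proof (rule ccontr)
    assume "\<not> ?thesis"
    hence z: "f (take i w) \<otimes> g (drop i w) = \<zero>" if "i \<le> length w" for i
      using that coeffsD[OF assms(1)] coeffsD[OF assms(2)] by fastforce
    have "conv f g w = (\<Oplus>i\<in>{..length w}. \<zero>)"
      unfolding conv_def by (rule finsum_cong') (auto simp: z)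
    thus False using assms(3) by simp
  qed
  then obtain i where "f (take i w) \<noteq> \<zero>" "g (drop i w) \<noteq> \<zero>" by blast
  thus thesis using that[of "take i w" "drop i w"] by simp
qed

lemma free_alg_mult_closed:
  assumes "f \<in> carrier FA" "g \<in> carrier FA"
  shows "conv f g \<in> carrier FA"
proof -
  have c: "f \<in> coeffs" "g \<in> coeffs" and fin: "finite {w. f w \<noteq> \<zero>}" "finite {w. g w \<noteq> \<zero>}"
    using assms by (auto simp: free_alg_simps)
  have "{w. conv f g w \<noteq> \<zero>} \<subseteq> (\<lambda>(u, v). u @ v) ` ({w. f w \<noteq> \<zero>} \<times> {w. g w \<noteq> \<zero>})"
    by (auto elim!: conv_nonzero[OF c])
  hence "finite {w. conv f g w \<noteq> \<zero>}"
    by (rule finite_subset) (use fin in blast)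
  thus ?thesis
    using conv_closed[OF c] by (simp add: free_alg_simps)
qed

lemma mono_closed: "c \<in> carrier k \<Longrightarrow> mono c v \<in> carrier FA"
  by (auto simp: free_alg_simps mono_coeffs) (simp add: mono_def)

lemma free_alg_add_closed:
  assumes "f \<in> carrier FA" "g \<in> carrier FA"
  shows "(\<lambda>w. f w \<oplus> g w) \<in> carrier FA"
proof -
  have "{w. f w \<oplus> g w \<noteq> \<zero>} \<subseteq> {w. f w \<noteq> \<zero>} \<union> {w. g w \<noteq> \<zero>}" by auto
  thus ?thesis using assms finite_subset by (auto simp: free_alg_simps add_coeffs)
qed

lemma free_alg_ring: "ring FA"
proof (rule ringI)
  have c: "f \<in> coeffs" if "f \<in> carrier FA" for f using that by (simp add: free_alg_simps(1))
  show "abelian_group FA"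
  proof (rule abelian_groupI)
    show "\<exists>g\<in>carrier FA. g \<oplus>\<^bsub>FA\<^esub> f = \<zero>\<^bsub>FA\<^esub>" if f: "f \<in> carrier FA" for f
    proof (rule bexI[of _ "\<lambda>w. \<ominus> f w"])
      have "{w. \<ominus> f w \<noteq> \<zero>} \<subseteq> {w. f w \<noteq> \<zero>}" by auto
      thus "(\<lambda>w. \<ominus> f w) \<in> carrier FA"
        using f finite_subset by (auto simp: free_alg_simps coeffs_def)
      show "(\<lambda>w. \<ominus> f w) \<oplus>\<^bsub>FA\<^esub> f = \<zero>\<^bsub>FA\<^esub>"
        using coeffsD[OF c[OF f]] by (simp add: free_alg_simps l_neg)
    qed
    show "\<zero>\<^bsub>FA\<^esub> \<in> carrier FA" by (simp add: free_alg_simps coeffs_def)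
  qed (simp_all add: free_alg_simps(2-) free_alg_add_closed, simp_all add: c coeffsD a_ac)
  show "monoid FA"
    by (rule monoidI)
      (simp_all add: free_alg_simps(2-) free_alg_mult_closed mono_closed,
       simp_all add: fun_eq_iff c conv_assoc conv_mono_left conv_mono_right coeffsD)
qed (simp_all add: free_alg_simps fun_eq_iff conv_add_left conv_add_right)

sublocale FA: ring FA by (rule free_alg_ring)

lemma free_alg_induct [consumes 1, case_names zero mono add]:
  assumes "f \<in> carrier FA" and zero: "Q (\<lambda>w. \<zero>)"
    and mono: "\<And>c w. c \<in> carrier k \<Longrightarrow> Q (mono c w)"
    and add: "\<And>f g. \<lbrakk>f \<in> carrier FA; g \<in> carrier FA; Q f; Q g\<rbrakk> \<Longrightarrow> Q (\<lambda>w. f w \<oplus> g w)"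
  shows "Q f"
proof -
  have c: "f \<in> coeffs" and fin: "finite {w. f w \<noteq> \<zero>}" using assms(1) by (auto simp: free_alg_simps)
  have "Q f" if "finite S" "{w. f w \<noteq> \<zero>} \<subseteq> S" "f \<in> coeffs" for S f
    using that
  proof (induction S arbitrary: f rule: finite_induct)
    case empty
    hence "f = (\<lambda>w. \<zero>)" by auto
    then show ?case using zero by simp
  next
    case (insert v S)
    let ?g = "\<lambda>w. if w = v then \<zero> else f w"
    have g: "?g \<in> coeffs" "{w. ?g w \<noteq> \<zero>} \<subseteq> S" using insert by (auto simp: coeffs_def)
    have gc: "?g \<in> carrier FA" using g finite_subset[OF g(2) insert(1)] by (simp add: free_alg_simps)
    have fv: "f v \<in> carrier k" using insert coeffsD by blast
    have "Q (\<lambda>w. mono (f v) v w \<oplus> ?g w)"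
      by (rule add[OF mono_closed[OF fv] gc mono[OF fv] insert.IH[OF g(2,1)]])
    moreover have "(\<lambda>w. mono (f v) v w \<oplus> ?g w) = f"
      using coeffsD[OF insert.prems(2)] by (auto simp: mono_def fun_eq_iff)
    ultimately show ?case by simp
  qed
  thus ?thesis using fin c by blast
qed

end

section \<open>The ring of odd polynomials, its involution and the odd Demazure operator\<close>

lemma ring_cong:
  assumes "ring R" "carrier R' = carrier R" "\<zero>\<^bsub>R'\<^esub> = \<zero>\<^bsub>R\<^esub>" "add R' = add R" "mult R' = mult R" "\<one>\<^bsub>R'\<^esub> = \<one>\<^bsub>R\<^esub>"
  shows "ring R'"
proof -
  interpret R: ring R by fact
  show ?thesis
  proof (rule ringI)
    show "abelian_group R'" by (rule abelian_group_cong[OF R.abelian_group_axioms assms(2-4)])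
    show "monoid R'" by (rule monoidI) (simp_all add: assms(2-) R.m_assoc)
  qed (simp_all add: assms(2-) R.l_distr R.r_distr)
qed

lemma additive_subgroup_finsum:
  assumes "abelian_group M" "additive_subgroup H M" "\<And>i. i \<in> S \<Longrightarrow> c i \<in> H"
  shows "finsum M c S \<in> H"
proof -
  interpret M: abelian_group M by fact
  interpret H: additive_subgroup H M by fact
  show ?thesis
    using assms(3)
  proof (induction S rule: infinite_finite_induct)
    case (insert i S)
    hence "c \<in> S \<rightarrow> carrier M" "c i \<in> carrier M" using H.a_Hcarr by auto
    then show ?case using insert by (simp add: M.finsum_insert)
  qed (simp_all add: M.finsum_infinite)
qed

context odd_poly
begin

abbreviation "I \<equiv> odd_ideal k"
abbreviation "R \<equiv> odd_R k"
abbreviation "cl f \<equiv> odd_ideal k +>\<^bsub>free_alg k\<^esub> f"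
abbreviation "x1 \<equiv> odd_x k X1"
abbreviation "x2 \<equiv> odd_x k X2"
abbreviation "const \<equiv> odd_const k"

lemma free_gen_mono: "free_gen k g = mono \<one> [g]"
  by (simp add: free_gen_def mono_def)

lemma odd_x_mono: "odd_x k g = cl (mono \<one> [g])"
  by (simp add: odd_x_def free_gen_mono)

lemma const_mono: "const a = cl (mono a [])"
  by (simp add: odd_const_def mono_def)

definition relation :: "gen list \<Rightarrow> 'k" where
  "relation = mono \<one> [X1] \<otimes>\<^bsub>FA\<^esub> mono \<one> [X2] \<oplus>\<^bsub>FA\<^esub> mono \<one> [X2] \<otimes>\<^bsub>FA\<^esub> mono \<one> [X1]"

lemma relation_closed: "relation \<in> carrier FA"
  unfolding relation_def by (intro FA.a_closed FA.m_closed mono_closed one_closed)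

lemma odd_ideal_eq: "I = Idl\<^bsub>FA\<^esub> {relation}"
  by (simp add: odd_ideal_def relation_def free_gen_mono)

lemma odd_ideal: "ideal I FA"
  unfolding odd_ideal_eq by (rule FA.genideal_ideal) (simp add: relation_closed)

sublocale I: ideal I FA by (rule odd_ideal)

lemma odd_R_simps:
  "carrier R = carrier (FA Quot I)" "mult R = mult (FA Quot I)" "\<one>\<^bsub>R\<^esub> = \<one>\<^bsub>FA Quot I\<^esub>"
  "add R = add (FA Quot I)" "\<zero>\<^bsub>R\<^esub> = \<zero>\<^bsub>FA Quot I\<^esub>"
  "deg_part R i = {cl f | f. f \<in> carrier FA \<and> (\<forall>w. f w \<noteq> \<zero> \<longrightarrow> 2 * int (length w) = i)}"
  by (simp_all add: odd_R_def ring.defs gring.defs)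

lemma odd_R_ring: "ring R"
  by (rule ring_cong[OF I.quotient_is_ring]) (simp_all add: odd_R_simps)

sublocale R: ring R by (rule odd_R_ring)

lemma
  assumes "f \<in> carrier FA"
  shows cl_closed: "cl f \<in> carrier R"
    and cl_add: "g \<in> carrier FA \<Longrightarrow> cl (\<lambda>w. f w \<oplus> g w) = cl f \<oplus>\<^bsub>R\<^esub> cl g"
    and cl_mult: "g \<in> carrier FA \<Longrightarrow> cl (conv f g) = cl f \<otimes>\<^bsub>R\<^esub> cl g"
  using ring_hom_closed[OF I.rcos_ring_hom assms] ring_hom_add[OF I.rcos_ring_hom assms, of g]
    ring_hom_mult[OF I.rcos_ring_hom assms, of g] free_alg_simps(3)[of f g]
  by (simp_all add: odd_R_simps free_alg_simps(2))

lemma cl_one: "cl (mono \<one> []) = \<one>\<^bsub>R\<^esub>"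
  using ring_hom_one[OF I.rcos_ring_hom] by (simp add: odd_R_simps free_alg_simps)

lemma cl_surj: "X \<in> carrier R \<Longrightarrow> \<exists>f\<in>carrier FA. X = cl f"
  by (auto simp: odd_R_simps FactRing_def A_RCOSETS_def')

lemma cl_eq: "\<lbrakk>f \<in> carrier FA; g \<in> carrier FA\<rbrakk> \<Longrightarrow> cl f = cl g \<longleftrightarrow> f \<ominus>\<^bsub>FA\<^esub> g \<in> I"
  using FA.quotient_eq_iff_same_a_r_cos[OF odd_ideal] by simp

lemma cl_zero: "cl (\<lambda>w. \<zero>) = \<zero>\<^bsub>R\<^esub>"
  using cl_add[of "\<lambda>w. \<zero>" "\<lambda>w. \<zero>"] cl_closed[of "\<lambda>w. \<zero>"] FA.zero_closed
  by (simp add: free_alg_simps(4) R.add.l_cancel_one')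

definition word :: "gen list \<Rightarrow> 'k odd_poly" where
  "word w = cl (mono \<one> w)"

lemma conv_mono: "\<lbrakk>c \<in> carrier k; d \<in> carrier k\<rbrakk> \<Longrightarrow> conv (mono c u) (mono d v) = mono (c \<otimes> d) (u @ v)"
  by (simp add: fun_eq_iff conv_mono_mono)

lemma word_closed [simp]: "word w \<in> carrier R"
  by (simp add: word_def cl_closed mono_closed)

lemma const_closed [simp]: "c \<in> carrier k \<Longrightarrow> const c \<in> carrier R"
  by (simp add: const_mono cl_closed mono_closed)

lemma odd_x_closed [simp]: "odd_x k g \<in> carrier R"
  by (simp add: odd_x_mono cl_closed mono_closed)

lemma word_Nil: "word [] = \<one>\<^bsub>R\<^esub>"
  by (simp add: word_def cl_one)

lemma word_append: "word (u @ v) = word u \<otimes>\<^bsub>R\<^esub> word v"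
  by (simp add: word_def conv_mono[symmetric] cl_mult[symmetric] mono_closed) (simp add: conv_mono)

lemma word_Cons: "word (g # w) = odd_x k g \<otimes>\<^bsub>R\<^esub> word w"
  using word_append[of "[g]" w] by (simp add: odd_x_mono word_def)

lemma cl_mono: "c \<in> carrier k \<Longrightarrow> cl (mono c w) = const c \<otimes>\<^bsub>R\<^esub> word w"
  by (simp add: const_mono word_def cl_mult[symmetric] mono_closed conv_mono)

lemma const_one: "const \<one> = \<one>\<^bsub>R\<^esub>"
  by (simp add: const_mono cl_one)

lemma const_add: "\<lbrakk>c \<in> carrier k; d \<in> carrier k\<rbrakk> \<Longrightarrow> const (c \<oplus> d) = const c \<oplus>\<^bsub>R\<^esub> const d"
proof -
  assume "c \<in> carrier k" "d \<in> carrier k"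
  moreover have "mono (c \<oplus> d) [] = (\<lambda>w. mono c [] w \<oplus> mono d [] w)" by (auto simp: mono_def fun_eq_iff)
  ultimately show ?thesis by (simp add: const_mono cl_add mono_closed)
qed

lemma const_zero: "const \<zero> = \<zero>\<^bsub>R\<^esub>"
proof -
  have "mono \<zero> [] = (\<lambda>w. \<zero>)" by (auto simp: mono_def)
  thus ?thesis by (simp add: const_mono cl_zero)
qed

lemma const_mult: "\<lbrakk>c \<in> carrier k; d \<in> carrier k\<rbrakk> \<Longrightarrow> const (c \<otimes> d) = const c \<otimes>\<^bsub>R\<^esub> const d"
  by (simp add: const_mono cl_mult[symmetric] mono_closed conv_mono)

lemma const_central:
  assumes "c \<in> carrier k" "X \<in> carrier R"
  shows "X \<otimes>\<^bsub>R\<^esub> const c = const c \<otimes>\<^bsub>R\<^esub> X"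
proof -
  obtain f where f: "f \<in> carrier FA" "X = cl f" using cl_surj[OF assms(2)] by blast
  hence fc: "f \<in> coeffs" by (simp add: free_alg_simps)
  have "conv f (mono c []) = conv (mono c []) f"
    using assms(1) fc coeffsD[OF fc] by (simp add: fun_eq_iff conv_mono_left conv_mono_right m_comm)
  thus ?thesis using f assms(1) by (simp add: const_mono cl_mult[symmetric] mono_closed)
qed

text \<open>
  Monomials are products of a scalar and generators, so that each statement about \<open>R\<close> that is stable under sums and products
  needs to be checked on scalars and generators only.
\<close>

lemma odd_R_induct [consumes 1, case_names const gen add mult]:
  assumes "X \<in> carrier R"
    and const: "\<And>c. c \<in> carrier k \<Longrightarrow> Q (const c)" and gen: "\<And>g. Q (odd_x k g)"
    and add: "\<And>X Y. \<lbrakk>X \<in> carrier R; Y \<in> carrier R; Q X; Q Y\<rbrakk> \<Longrightarrow> Q (X \<oplus>\<^bsub>R\<^esub> Y)"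
    and mult: "\<And>X Y. \<lbrakk>X \<in> carrier R; Y \<in> carrier R; Q X; Q Y\<rbrakk> \<Longrightarrow> Q (X \<otimes>\<^bsub>R\<^esub> Y)"
  shows "Q X"
proof -
  obtain f where f: "f \<in> carrier FA" "X = cl f" using cl_surj[OF assms(1)] by blast
  have w: "Q (word w)" for w
    by (induction w) (use const[OF one_closed] in \<open>simp_all add: word_Nil const_one word_Cons gen mult\<close>)
  from f(1) have "Q (cl f)"
  proof (induction rule: free_alg_induct)
    case zero
    then show ?case using const[OF zero_closed] by (simp add: cl_zero const_zero)
  next
    case (mono c v)
    then show ?case using const w by (simp add: cl_mono mult)
  next
    case (add f g)
    then show ?case using assms(4) by (simp add: cl_add cl_closed)
  qed
  thus ?thesis using f by simp
qed

subsection \<open>Linear maps defined on words\<close>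

definition lin_ext :: "(gen list \<Rightarrow> 'k odd_poly) \<Rightarrow> (gen list \<Rightarrow> 'k) \<Rightarrow> 'k odd_poly" where
  "lin_ext b f = finsum R (\<lambda>w. const (f w) \<otimes>\<^bsub>R\<^esub> b w) {w. f w \<noteq> \<zero>}"

context
  fixes b :: "gen list \<Rightarrow> 'k odd_poly"
  assumes b: "\<And>w. b w \<in> carrier R"
begin

lemma lin_ext_closed: "f \<in> carrier FA \<Longrightarrow> lin_ext b f \<in> carrier R"
  unfolding lin_ext_def using b by (intro R.finsum_closed) (auto simp: free_alg_simps coeffsD)

lemma lin_ext_support:
  assumes "f \<in> carrier FA" "finite S" "{w. f w \<noteq> \<zero>} \<subseteq> S"
  shows "lin_ext b f = finsum R (\<lambda>w. const (f w) \<otimes>\<^bsub>R\<^esub> b w) S"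
  unfolding lin_ext_def
  by (rule R.add.finprod_mono_neutral_cong_left[OF assms(2,3)])
    (use assms(1) b in \<open>auto simp: const_zero free_alg_simps coeffsD\<close>)

lemma lin_ext_add:
  assumes f: "f \<in> carrier FA" and g: "g \<in> carrier FA"
  shows "lin_ext b (\<lambda>w. f w \<oplus> g w) = lin_ext b f \<oplus>\<^bsub>R\<^esub> lin_ext b g"
proof -
  let ?S = "{w. f w \<noteq> \<zero>} \<union> {w. g w \<noteq> \<zero>}"
  have S: "finite ?S" using f g by (simp add: free_alg_simps)
  have c: "f w \<in> carrier k" "g w \<in> carrier k" for w using f g by (auto simp: free_alg_simps coeffsD)
  have "lin_ext b (\<lambda>w. f w \<oplus> g w) = finsum R (\<lambda>w. const (f w \<oplus> g w) \<otimes>\<^bsub>R\<^esub> b w) ?S"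
    by (rule lin_ext_support[OF free_alg_add_closed[OF f g] S]) auto
  also have "\<dots> = finsum R (\<lambda>w. const (f w) \<otimes>\<^bsub>R\<^esub> b w \<oplus>\<^bsub>R\<^esub> const (g w) \<otimes>\<^bsub>R\<^esub> b w) ?S"
    using b c by (simp add: const_add R.l_distr)
  also have "\<dots> = finsum R (\<lambda>w. const (f w) \<otimes>\<^bsub>R\<^esub> b w) ?S \<oplus>\<^bsub>R\<^esub> finsum R (\<lambda>w. const (g w) \<otimes>\<^bsub>R\<^esub> b w) ?S"
    using b c by (intro R.finsum_addf) auto
  also have "\<dots> = lin_ext b f \<oplus>\<^bsub>R\<^esub> lin_ext b g"
    using lin_ext_support[OF f S] lin_ext_support[OF g S] by simp
  finally show ?thesis .
qed

lemma lin_ext_mono: "c \<in> carrier k \<Longrightarrow> lin_ext b (mono c v) = const c \<otimes>\<^bsub>R\<^esub> b v"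
proof -
  assume c: "c \<in> carrier k"
  have "lin_ext b (mono c v) = finsum R (\<lambda>w. const (mono c v w) \<otimes>\<^bsub>R\<^esub> b w) {v}"
    by (rule lin_ext_support[OF mono_closed[OF c]]) (auto simp: mono_def)
  also have "\<dots> = const c \<otimes>\<^bsub>R\<^esub> b v"
    using c b by (subst R.finsum_insert) (simp_all add: mono_def)
  finally show ?thesis .
qed

lemma lin_ext_zero: "lin_ext b (\<lambda>w. \<zero>) = \<zero>\<^bsub>R\<^esub>"
  by (simp add: lin_ext_def)

lemma lin_ext_minus:
  assumes f: "f \<in> carrier FA" and g: "g \<in> carrier FA" and z: "lin_ext b (f \<ominus>\<^bsub>FA\<^esub> g) = \<zero>\<^bsub>R\<^esub>"
  shows "lin_ext b f = lin_ext b g"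
proof -
  have "f = (f \<ominus>\<^bsub>FA\<^esub> g) \<oplus>\<^bsub>FA\<^esub> g" using f g FA.eq_minus_iff[of f g "f \<ominus>\<^bsub>FA\<^esub> g"] by simp
  hence "lin_ext b f = lin_ext b (\<lambda>w. (f \<ominus>\<^bsub>FA\<^esub> g) w \<oplus> g w)" by (simp add: free_alg_simps(3))
  also have "\<dots> = lin_ext b (f \<ominus>\<^bsub>FA\<^esub> g) \<oplus>\<^bsub>R\<^esub> lin_ext b g" by (rule lin_ext_add) (use f g in auto)
  finally show ?thesis using z lin_ext_closed[OF g] by simp
qed

lemma lin_ext_deg:
  assumes "\<And>i. additive_subgroup (deg_part R i) R" "f \<in> carrier FA"
    and "\<And>w. f w \<noteq> \<zero> \<Longrightarrow> const (f w) \<otimes>\<^bsub>R\<^esub> b w \<in> deg_part R i"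
  shows "lin_ext b f \<in> deg_part R i"
  unfolding lin_ext_def
  by (rule additive_subgroup_finsum[OF R.abelian_group_axioms assms(1)]) (use assms(3) in simp)

end

fun swap :: "gen \<Rightarrow> gen" where
  "swap X1 = X2" | "swap X2 = X1"

text \<open>
  The involution and the Demazure operator on words, with values in \<open>R\<close>. By the Leibniz rule they are the entries of a
  ring homomorphism from the free algebra to triangular matrices over \<open>R\<close>, with rows \<open>(s f, \<partial> f)\<close> and \<open>(0, f)\<close>.
\<close>

fun s_word :: "gen list \<Rightarrow> 'k odd_poly" where
  "s_word [] = \<one>\<^bsub>R\<^esub>" | "s_word (g # w) = (\<ominus>\<^bsub>R\<^esub> odd_x k (swap g)) \<otimes>\<^bsub>R\<^esub> s_word w"

fun d_word :: "gen list \<Rightarrow> 'k odd_poly" where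
  "d_word [] = \<zero>\<^bsub>R\<^esub>" | "d_word (g # w) = word w \<oplus>\<^bsub>R\<^esub> (\<ominus>\<^bsub>R\<^esub> odd_x k (swap g)) \<otimes>\<^bsub>R\<^esub> d_word w"

lemma s_word_closed [simp]: "s_word w \<in> carrier R"
  by (induction w) simp_all

lemma d_word_closed [simp]: "d_word w \<in> carrier R"
  by (induction w) simp_all

lemma s_word_append: "s_word (u @ v) = s_word u \<otimes>\<^bsub>R\<^esub> s_word v"
  by (induction u) (simp_all add: R.m_assoc)

lemma d_word_append: "d_word (u @ v) = d_word u \<otimes>\<^bsub>R\<^esub> word v \<oplus>\<^bsub>R\<^esub> s_word u \<otimes>\<^bsub>R\<^esub> d_word v"
  by (induction u) (simp_all add: R.m_assoc word_append R.l_distr R.r_distr R.a_assoc)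

abbreviation "S0 \<equiv> lin_ext s_word"
abbreviation "D0 \<equiv> lin_ext d_word"

lemmas lin_ext_simps = lin_ext_closed[of s_word, simplified] lin_ext_closed[of d_word, simplified]
  lin_ext_add[of s_word, simplified] lin_ext_add[of d_word, simplified]
  lin_ext_mono[of s_word, simplified] lin_ext_mono[of d_word, simplified]
  lin_ext_zero[of s_word, simplified] lin_ext_zero[of d_word, simplified]

lemma conv_zero_right: "f \<in> coeffs \<Longrightarrow> conv f (\<lambda>w. \<zero>) = (\<lambda>w. \<zero>)"
  by (simp add: fun_eq_iff conv_def coeffsD)

lemma conv_bilinear_induct:
  assumes f: "f \<in> carrier FA" and g: "g \<in> carrier FA"
    and z: "\<And>g. g \<in> carrier FA \<Longrightarrow> Q (\<lambda>w. \<zero>) g" "\<And>f. f \<in> carrier FA \<Longrightarrow> Q f (\<lambda>w. \<zero>)"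
    and m: "\<And>c u d v. \<lbrakk>c \<in> carrier k; d \<in> carrier k\<rbrakk> \<Longrightarrow> Q (mono c u) (mono d v)"
    and a: "\<And>f f' g. \<lbrakk>f \<in> carrier FA; f' \<in> carrier FA; g \<in> carrier FA; Q f g; Q f' g\<rbrakk> \<Longrightarrow> Q (\<lambda>w. f w \<oplus> f' w) g"
      "\<And>f g g'. \<lbrakk>f \<in> carrier FA; g \<in> carrier FA; g' \<in> carrier FA; Q f g; Q f g'\<rbrakk> \<Longrightarrow> Q f (\<lambda>w. g w \<oplus> g' w)"
  shows "Q f g"
  using f
proof (induction rule: free_alg_induct)
  case zero
  then show ?case using z g by simp
next
  case (mono c u)
  show ?case using g
  proof (induction rule: free_alg_induct)
    case zero
    show ?case by (rule z(2)[OF mono_closed[OF mono]])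
  next
    case (mono d v)
    show ?case by (rule m[OF \<open>c \<in> carrier k\<close> mono])
  next
    case (add g g')
    show ?case by (rule a(2)[OF mono_closed[OF mono] add])
  qed
next
  case (add f f')
  show ?case by (rule a(1)[OF add(1,2) g add(3,4)])
qed

lemma conv_add_right_fun: "\<lbrakk>f \<in> coeffs; g \<in> coeffs; g' \<in> coeffs\<rbrakk> \<Longrightarrow> conv f (\<lambda>w. g w \<oplus> g' w) = (\<lambda>w. conv f g w \<oplus> conv f g' w)"
  by (simp add: fun_eq_iff conv_add_right)

lemma conv_add_left_fun: "\<lbrakk>f \<in> coeffs; f' \<in> coeffs; g \<in> coeffs\<rbrakk> \<Longrightarrow> conv (\<lambda>w. f w \<oplus> f' w) g = (\<lambda>w. conv f g w \<oplus> conv f' g w)"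
  by (simp add: fun_eq_iff conv_add_left)

lemma conv_zero_left_fun: "g \<in> coeffs \<Longrightarrow> conv (\<lambda>w. \<zero>) g = (\<lambda>w. \<zero>)"
  by (simp add: fun_eq_iff conv_zero_left)

lemma coeffs_closed: "f \<in> carrier FA \<Longrightarrow> f \<in> coeffs"
  by (simp add: free_alg_simps)

lemma zero_fun_closed: "(\<lambda>w. \<zero>) \<in> carrier FA"
  using FA.zero_closed by (simp add: free_alg_simps(4))

lemma const_shuffle:
  assumes "c \<in> carrier k" "d \<in> carrier k" "X \<in> carrier R" "Y \<in> carrier R"
  shows "(const c \<otimes>\<^bsub>R\<^esub> X) \<otimes>\<^bsub>R\<^esub> (const d \<otimes>\<^bsub>R\<^esub> Y) = const (c \<otimes> d) \<otimes>\<^bsub>R\<^esub> (X \<otimes>\<^bsub>R\<^esub> Y)"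
proof -
  have "(const c \<otimes>\<^bsub>R\<^esub> X) \<otimes>\<^bsub>R\<^esub> (const d \<otimes>\<^bsub>R\<^esub> Y) = const c \<otimes>\<^bsub>R\<^esub> ((X \<otimes>\<^bsub>R\<^esub> const d) \<otimes>\<^bsub>R\<^esub> Y)"
    using assms by (simp add: R.m_assoc)
  also have "X \<otimes>\<^bsub>R\<^esub> const d = const d \<otimes>\<^bsub>R\<^esub> X" by (rule const_central[OF assms(2,3)])
  finally show ?thesis using assms by (simp add: const_mult R.m_assoc)
qed

lemma S0_mult: "\<lbrakk>f \<in> carrier FA; g \<in> carrier FA\<rbrakk> \<Longrightarrow> S0 (conv f g) = S0 f \<otimes>\<^bsub>R\<^esub> S0 g"
  by (rule conv_bilinear_induct[where Q = "\<lambda>f g. S0 (conv f g) = S0 f \<otimes>\<^bsub>R\<^esub> S0 g"])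
    (simp_all add: lin_ext_simps coeffs_closed conv_zero_left_fun conv_zero_right conv_add_left_fun conv_add_right_fun
      free_alg_mult_closed R.l_distr R.r_distr conv_mono const_shuffle s_word_append)

lemma D0_mult: "\<lbrakk>f \<in> carrier FA; g \<in> carrier FA\<rbrakk> \<Longrightarrow> D0 (conv f g) = D0 f \<otimes>\<^bsub>R\<^esub> cl g \<oplus>\<^bsub>R\<^esub> S0 f \<otimes>\<^bsub>R\<^esub> D0 g"
  by (rule conv_bilinear_induct[where Q = "\<lambda>f g. D0 (conv f g) = D0 f \<otimes>\<^bsub>R\<^esub> cl g \<oplus>\<^bsub>R\<^esub> S0 f \<otimes>\<^bsub>R\<^esub> D0 g"])
    (simp_all add: lin_ext_simps coeffs_closed conv_zero_left_fun conv_zero_right conv_add_left_fun conv_add_right_fun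
      free_alg_mult_closed R.l_distr R.r_distr conv_mono const_shuffle d_word_append cl_closed cl_add cl_zero cl_mono
      R.a_ac)

lemma anticommute: "x1 \<otimes>\<^bsub>R\<^esub> x2 \<oplus>\<^bsub>R\<^esub> x2 \<otimes>\<^bsub>R\<^esub> x1 = \<zero>\<^bsub>R\<^esub>"
proof -
  have "cl relation = cl (\<lambda>w. \<zero>)"
    using FA.genideal_self'[OF relation_closed] relation_closed zero_fun_closed
    by (subst cl_eq) (simp_all add: odd_ideal_eq free_alg_simps(4)[symmetric] FA.minus_eq)
  moreover have "cl relation = x1 \<otimes>\<^bsub>R\<^esub> x2 \<oplus>\<^bsub>R\<^esub> x2 \<otimes>\<^bsub>R\<^esub> x1"
    unfolding relation_def free_alg_simps(2,3)
    by (simp add: cl_add cl_mult free_alg_mult_closed mono_closed odd_x_mono)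
  ultimately show ?thesis by (simp add: cl_zero)
qed

text \<open>
  The elements \<open>f\<close> for which \<open>s f\<close>, \<open>\<partial> f\<close> and the class of \<open>f\<close> all vanish form the kernel of that homomorphism to triangular
  matrices, hence an ideal. The relation belongs to it, because \<open>\<partial>(x\<^sub>1 x\<^sub>2 + x\<^sub>2 x\<^sub>1) = x\<^sub>2 - x\<^sub>2 + x\<^sub>1 - x\<^sub>1\<close>
  and \<open>s\<close> exchanges its two terms.
\<close>

lemma ideal_annihilated:
  assumes "f \<in> I"
  shows "S0 f = \<zero>\<^bsub>R\<^esub>" "D0 f = \<zero>\<^bsub>R\<^esub>"
proof -
  define N where "N = {f \<in> carrier FA. cl f = \<zero>\<^bsub>R\<^esub> \<and> S0 f = \<zero>\<^bsub>R\<^esub> \<and> D0 f = \<zero>\<^bsub>R\<^esub>}"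
  \<comment> \<open>Written as a product with a scalar, a negative is covered by the multiplicativity of \<open>S0\<close> and \<open>D0\<close>.\<close>
  have minus: "\<ominus>\<^bsub>FA\<^esub> f = conv (mono (\<ominus> \<one>) []) f" if "f \<in> carrier FA" for f
  proof (rule FA.minus_equality)
    show "conv (mono (\<ominus> \<one>) []) f \<oplus>\<^bsub>FA\<^esub> f = \<zero>\<^bsub>FA\<^esub>"
      using coeffs_closed[OF that] by (simp add: free_alg_simps(3,4) conv_mono_left coeffsD l_minus l_neg)
  qed (use that in \<open>simp_all add: free_alg_mult_closed mono_closed\<close>)
  have sub: "subgroup N (add_monoid FA)"
  proof (rule FA.add.subgroupI)
    show "N \<subseteq> carrier FA" by (auto simp: N_def)
    show "N \<noteq> {}" using zero_fun_closed by (auto simp: N_def lin_ext_simps cl_zero intro!: exI[of _ "\<lambda>w. \<zero>"])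
    show "\<ominus>\<^bsub>FA\<^esub> f \<in> N" if "f \<in> N" for f
      using that by (simp add: N_def minus free_alg_mult_closed mono_closed S0_mult D0_mult cl_mult lin_ext_simps cl_closed)
    show "f \<oplus>\<^bsub>FA\<^esub> g \<in> N" if "f \<in> N" "g \<in> N" for f g
      using that by (simp add: N_def free_alg_simps(3) lin_ext_simps free_alg_add_closed cl_add)
  qed
  have "ideal N FA"
  proof (rule idealI[OF free_alg_ring sub])
    show "x \<otimes>\<^bsub>FA\<^esub> a \<in> N" if "a \<in> N" "x \<in> carrier FA" for a x
      using that by (simp add: N_def free_alg_simps(2) S0_mult D0_mult cl_mult free_alg_mult_closed lin_ext_simps cl_closed)
    show "a \<otimes>\<^bsub>FA\<^esub> x \<in> N" if "a \<in> N" "x \<in> carrier FA" for a x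
      using that by (simp add: N_def free_alg_simps(2) S0_mult D0_mult cl_mult free_alg_mult_closed lin_ext_simps cl_closed)
  qed
  moreover have "relation \<in> N"
  proof -
    have "relation = (\<lambda>w. mono \<one> [X1, X2] w \<oplus> mono \<one> [X2, X1] w)"
      by (simp add: relation_def free_alg_simps(2,3) conv_mono)
    moreover have "x2 \<otimes>\<^bsub>R\<^esub> x1 \<oplus>\<^bsub>R\<^esub> x1 \<otimes>\<^bsub>R\<^esub> x2 = \<zero>\<^bsub>R\<^esub>" using anticommute by (simp add: R.a_comm)
    ultimately show ?thesis
      using anticommute
      by (simp add: N_def lin_ext_simps mono_closed free_alg_add_closed cl_add cl_mono word_Cons word_Nil const_one
          R.l_minus R.r_minus R.r_neg)
  qed
  ultimately have "I \<subseteq> N" unfolding odd_ideal_eq by (intro FA.genideal_minimal) auto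
  thus "S0 f = \<zero>\<^bsub>R\<^esub>" "D0 f = \<zero>\<^bsub>R\<^esub>" using assms by (auto simp: N_def)
qed

end

context odd_poly
begin

subsection \<open>Descent to the quotient\<close>

lemma lin_ext_cl:
  assumes "f \<in> carrier FA" "g \<in> carrier FA" "cl f = cl g"
  shows "S0 f = S0 g" "D0 f = D0 g"
proof -
  have "f \<ominus>\<^bsub>FA\<^esub> g \<in> I" using assms cl_eq[OF assms(1,2)] by simp
  note z = ideal_annihilated[OF this]
  show "S0 f = S0 g" by (rule lin_ext_minus[OF s_word_closed assms(1,2) z(1)])
  show "D0 f = D0 g" by (rule lin_ext_minus[OF d_word_closed assms(1,2) z(2)])
qed

definition s_op :: "'k odd_poly \<Rightarrow> 'k odd_poly" where
  "s_op X = S0 (SOME f. f \<in> carrier FA \<and> X = cl f)"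

definition d_op :: "'k odd_poly \<Rightarrow> 'k odd_poly" where
  "d_op X = D0 (SOME f. f \<in> carrier FA \<and> X = cl f)"

lemma
  assumes f: "f \<in> carrier FA"
  shows s_op_cl: "s_op (cl f) = S0 f" and d_op_cl: "d_op (cl f) = D0 f"
proof -
  let ?g = "SOME g. g \<in> carrier FA \<and> cl f = cl g"
  have g: "?g \<in> carrier FA \<and> cl f = cl ?g"
    by (rule someI[of _ f]) (use f in simp)
  show "s_op (cl f) = S0 f" "d_op (cl f) = D0 f"
    unfolding s_op_def d_op_def
    by (rule lin_ext_cl[OF f conjunct1[OF g] conjunct2[OF g], symmetric])+
qed

lemma
  assumes "X \<in> carrier R" "Y \<in> carrier R"
  shows s_op_closed: "s_op X \<in> carrier R"
    and d_op_closed: "d_op X \<in> carrier R"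
    and s_op_add: "s_op (X \<oplus>\<^bsub>R\<^esub> Y) = s_op X \<oplus>\<^bsub>R\<^esub> s_op Y"
    and d_op_add: "d_op (X \<oplus>\<^bsub>R\<^esub> Y) = d_op X \<oplus>\<^bsub>R\<^esub> d_op Y"
    and s_op_mult: "s_op (X \<otimes>\<^bsub>R\<^esub> Y) = s_op X \<otimes>\<^bsub>R\<^esub> s_op Y"
    and d_op_mult: "d_op (X \<otimes>\<^bsub>R\<^esub> Y) = d_op X \<otimes>\<^bsub>R\<^esub> Y \<oplus>\<^bsub>R\<^esub> s_op X \<otimes>\<^bsub>R\<^esub> d_op Y"
proof -
  obtain f g where f: "f \<in> carrier FA" "X = cl f" and g: "g \<in> carrier FA" "Y = cl g"
    using cl_surj assms by meson
  show "s_op X \<in> carrier R" "d_op X \<in> carrier R" 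
    "s_op (X \<oplus>\<^bsub>R\<^esub> Y) = s_op X \<oplus>\<^bsub>R\<^esub> s_op Y" "d_op (X \<oplus>\<^bsub>R\<^esub> Y) = d_op X \<oplus>\<^bsub>R\<^esub> d_op Y"
    "s_op (X \<otimes>\<^bsub>R\<^esub> Y) = s_op X \<otimes>\<^bsub>R\<^esub> s_op Y" "d_op (X \<otimes>\<^bsub>R\<^esub> Y) = d_op X \<otimes>\<^bsub>R\<^esub> Y \<oplus>\<^bsub>R\<^esub> s_op X \<otimes>\<^bsub>R\<^esub> d_op Y"
    unfolding f(2) g(2) cl_add[OF f(1) g(1), symmetric] cl_mult[OF f(1) g(1), symmetric]
      s_op_cl[OF f(1)] s_op_cl[OF g(1)] d_op_cl[OF f(1)] d_op_cl[OF g(1)]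
      s_op_cl[OF free_alg_add_closed[OF f(1) g(1)]] d_op_cl[OF free_alg_add_closed[OF f(1) g(1)]]
      s_op_cl[OF free_alg_mult_closed[OF f(1) g(1)]] d_op_cl[OF free_alg_mult_closed[OF f(1) g(1)]]
    using f(1) g(1) by (simp_all add: lin_ext_simps S0_mult D0_mult)
qed

lemma s_op_const: "c \<in> carrier k \<Longrightarrow> s_op (const c) = const c"
  by (simp add: const_mono s_op_cl mono_closed lin_ext_simps) (simp add: const_mono[symmetric])

lemma d_op_const: "c \<in> carrier k \<Longrightarrow> d_op (const c) = \<zero>\<^bsub>R\<^esub>"
  by (simp add: const_mono d_op_cl mono_closed lin_ext_simps) (simp add: const_mono[symmetric])

lemma s_op_gen: "s_op (odd_x k g) = \<ominus>\<^bsub>R\<^esub> odd_x k (swap g)"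
  using s_op_cl[OF mono_closed[OF one_closed], of "[g]"]
  by (simp add: odd_x_mono[symmetric] lin_ext_simps const_one)

lemma d_op_gen: "d_op (odd_x k g) = \<one>\<^bsub>R\<^esub>"
  using d_op_cl[OF mono_closed[OF one_closed], of "[g]"]
  by (simp add: odd_x_mono[symmetric] lin_ext_simps const_one word_Nil)

lemma s_op_minus: "X \<in> carrier R \<Longrightarrow> s_op (\<ominus>\<^bsub>R\<^esub> X) = \<ominus>\<^bsub>R\<^esub> s_op X"
  using s_op_add[of "\<ominus>\<^bsub>R\<^esub> X" X] s_op_const[OF zero_closed] s_op_closed[of X X] s_op_closed[of "\<ominus>\<^bsub>R\<^esub> X" X]
    R.minus_equality[of "s_op (\<ominus>\<^bsub>R\<^esub> X)" "s_op X"] by (simp add: R.l_neg const_zero)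

lemma d_op_minus: "X \<in> carrier R \<Longrightarrow> d_op (\<ominus>\<^bsub>R\<^esub> X) = \<ominus>\<^bsub>R\<^esub> d_op X"
  using d_op_add[of "\<ominus>\<^bsub>R\<^esub> X" X] d_op_const[OF zero_closed] d_op_closed[of X X] d_op_closed[of "\<ominus>\<^bsub>R\<^esub> X" X]
    R.minus_equality[of "d_op (\<ominus>\<^bsub>R\<^esub> X)" "d_op X"] by (simp add: R.l_neg const_zero)

lemmas op_closed [simp] = s_op_closed[OF _ R.zero_closed] d_op_closed[OF _ R.zero_closed]

lemma swap_swap [simp]: "swap (swap g) = g"
  by (cases g) simp_all

lemma s_op_s_op: "X \<in> carrier R \<Longrightarrow> s_op (s_op X) = X"
  by (induction rule: odd_R_induct) (simp_all add: s_op_const s_op_gen s_op_minus s_op_add s_op_mult)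

text \<open>
  The two operators anticommute on generators, where \<open>\<partial>\<close> is \<open>1\<close> and \<open>s\<close> changes the sign, and the twisted Leibniz rule
  propagates this to products. Together with \<open>s s = 1\<close> it implies \<open>\<partial> \<partial> = 0\<close>.
\<close>

lemma d_op_s_op: "X \<in> carrier R \<Longrightarrow> d_op (s_op X) = \<ominus>\<^bsub>R\<^esub> s_op (d_op X)"
proof (induction rule: odd_R_induct)
  case (const c)
  then show ?case using s_op_const[OF zero_closed] by (simp add: s_op_const d_op_const const_zero)
next
  case (gen g)
  then show ?case using s_op_const[OF one_closed] by (simp add: s_op_gen d_op_gen d_op_minus const_one)
next
  case (mult X Y)
  then show ?case
    by (simp add: s_op_mult d_op_mult s_op_add s_op_s_op R.minus_add[symmetric] R.l_minus R.r_minus R.a_comm)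
qed (simp add: s_op_add d_op_add R.minus_add[symmetric])

lemma d_op_d_op: "X \<in> carrier R \<Longrightarrow> d_op (d_op X) = \<zero>\<^bsub>R\<^esub>"
proof (induction rule: odd_R_induct)
  case (const c)
  then show ?case using d_op_const[OF zero_closed] by (simp add: d_op_const const_zero)
next
  case (gen g)
  then show ?case using d_op_const[OF one_closed] by (simp add: d_op_gen const_one)
next
  case (mult X Y)
  then show ?case
    by (simp add: d_op_mult d_op_add d_op_s_op s_op_s_op R.l_minus R.r_neg)
qed (simp add: d_op_add)

subsection \<open>Identification with the defining descriptions\<close>

lemma s_op_ring_iso: "restrict s_op (carrier R) \<in> ring_iso R R"
proof (rule ring_iso_memI)
  show "bij_betw (restrict s_op (carrier R)) (carrier R) (carrier R)"
    by (rule bij_betwI[of _ _ _ s_op]) (simp_all add: s_op_s_op)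
qed (use s_op_const[OF one_closed] in \<open>simp_all add: s_op_mult s_op_add const_one\<close>)

text \<open>
  The definite descriptions of \<open>s\<close> and \<open>\<partial>\<close> select the operators just constructed, since their values on scalars and generators
  determine them.
\<close>

lemma odd_s_eq: "odd_s k = restrict s_op (carrier R)"
  unfolding odd_s_def
proof (rule the_equality, goal_cases)
  case 1
  show ?case using s_op_ring_iso by (simp add: s_op_const s_op_gen)
next
  case (2 s)
  hence s: "s \<in> extensional (carrier R)" "s \<in> ring_hom R R" "\<And>a. a \<in> carrier k \<Longrightarrow> s (const a) = const a"
    "s x1 = \<ominus>\<^bsub>R\<^esub> x2" "s x2 = \<ominus>\<^bsub>R\<^esub> x1"
    by (auto simp: ring_iso_def)
  have "s X = s_op X" if "X \<in> carrier R" for X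
    using that
  proof (induction rule: odd_R_induct)
    case (gen g)
    then show ?case by (cases g) (simp_all add: s_op_gen s)
  qed (simp_all add: s(3) s_op_const s_op_add s_op_mult ring_hom_add[OF s(2)] ring_hom_mult[OF s(2)])
  thus ?case by (intro extensionalityI[OF s(1) restrict_extensional]) simp
qed

lemma odd_demazure_eq: "odd_demazure k = restrict d_op (carrier R)"
  unfolding odd_demazure_def
proof (rule the_equality, goal_cases)
  case 1
  show ?case
    using d_op_const[OF one_closed]
    by (simp add: d_op_add d_op_mult d_op_const d_op_gen odd_s_eq s_op_const const_one)
next
  case (2 D)
  hence D: "D \<in> carrier R \<rightarrow>\<^sub>E carrier R"
    "\<And>X Y. \<lbrakk>X \<in> carrier R; Y \<in> carrier R\<rbrakk> \<Longrightarrow> D (X \<oplus>\<^bsub>R\<^esub> Y) = D X \<oplus>\<^bsub>R\<^esub> D Y"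
    "\<And>a X. \<lbrakk>a \<in> carrier k; X \<in> carrier R\<rbrakk> \<Longrightarrow> D (const a \<otimes>\<^bsub>R\<^esub> X) = const a \<otimes>\<^bsub>R\<^esub> D X"
    "D \<one>\<^bsub>R\<^esub> = \<zero>\<^bsub>R\<^esub>" "D x1 = \<one>\<^bsub>R\<^esub>" "D x2 = \<one>\<^bsub>R\<^esub>"
    "\<And>X Y. \<lbrakk>X \<in> carrier R; Y \<in> carrier R\<rbrakk> \<Longrightarrow> D (X \<otimes>\<^bsub>R\<^esub> Y) = D X \<otimes>\<^bsub>R\<^esub> Y \<oplus>\<^bsub>R\<^esub> s_op X \<otimes>\<^bsub>R\<^esub> D Y"
    by (simp_all only: odd_s_eq restrict_apply if_True)
  have "D X = d_op X" if "X \<in> carrier R" for X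
    using that
  proof (induction rule: odd_R_induct)
    case (const c)
    then show ?case using D(3)[of c "\<one>\<^bsub>R\<^esub>"] by (simp add: D(4) d_op_const)
  next
    case (gen g)
    then show ?case by (cases g) (simp_all add: d_op_gen D)
  next
    case (mult X Y)
    then show ?case by (simp add: D(7) d_op_mult)
  qed (simp add: D(2) d_op_add)
  thus ?case
    using D(1) by (intro extensionalityI[OF _ restrict_extensional]) (auto simp: PiE_def)
qed

abbreviation "s \<equiv> odd_s k"
abbreviation "dem \<equiv> odd_demazure k"

lemma s_simps:
  "X \<in> carrier R \<Longrightarrow> s X \<in> carrier R"
  "\<lbrakk>X \<in> carrier R; Y \<in> carrier R\<rbrakk> \<Longrightarrow> s (X \<oplus>\<^bsub>R\<^esub> Y) = s X \<oplus>\<^bsub>R\<^esub> s Y"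
  "\<lbrakk>X \<in> carrier R; Y \<in> carrier R\<rbrakk> \<Longrightarrow> s (X \<otimes>\<^bsub>R\<^esub> Y) = s X \<otimes>\<^bsub>R\<^esub> s Y"
  "X \<in> carrier R \<Longrightarrow> s (\<ominus>\<^bsub>R\<^esub> X) = \<ominus>\<^bsub>R\<^esub> s X"
  "s \<one>\<^bsub>R\<^esub> = \<one>\<^bsub>R\<^esub>" "s \<zero>\<^bsub>R\<^esub> = \<zero>\<^bsub>R\<^esub>" "s x1 = \<ominus>\<^bsub>R\<^esub> x2" "s x2 = \<ominus>\<^bsub>R\<^esub> x1"
  "X \<in> carrier R \<Longrightarrow> s (s X) = X"
  using s_op_const[OF one_closed] s_op_const[OF zero_closed]
  by (simp_all add: odd_s_eq s_op_add s_op_mult s_op_minus s_op_gen s_op_s_op const_one const_zero)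

lemma dem_simps:
  "X \<in> carrier R \<Longrightarrow> dem X \<in> carrier R"
  "\<lbrakk>X \<in> carrier R; Y \<in> carrier R\<rbrakk> \<Longrightarrow> dem (X \<oplus>\<^bsub>R\<^esub> Y) = dem X \<oplus>\<^bsub>R\<^esub> dem Y"
  "\<lbrakk>X \<in> carrier R; Y \<in> carrier R\<rbrakk> \<Longrightarrow> dem (X \<otimes>\<^bsub>R\<^esub> Y) = dem X \<otimes>\<^bsub>R\<^esub> Y \<oplus>\<^bsub>R\<^esub> s X \<otimes>\<^bsub>R\<^esub> dem Y"
  "X \<in> carrier R \<Longrightarrow> dem (\<ominus>\<^bsub>R\<^esub> X) = \<ominus>\<^bsub>R\<^esub> dem X"
  "dem \<one>\<^bsub>R\<^esub> = \<zero>\<^bsub>R\<^esub>" "dem \<zero>\<^bsub>R\<^esub> = \<zero>\<^bsub>R\<^esub>" "dem x1 = \<one>\<^bsub>R\<^esub>" "dem x2 = \<one>\<^bsub>R\<^esub>"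
  "X \<in> carrier R \<Longrightarrow> dem (dem X) = \<zero>\<^bsub>R\<^esub>"
  "X \<in> carrier R \<Longrightarrow> dem (s X) = \<ominus>\<^bsub>R\<^esub> s (dem X)"
  "X \<in> carrier R \<Longrightarrow> s (dem X) = \<ominus>\<^bsub>R\<^esub> dem (s X)"
  using d_op_const[OF one_closed] d_op_const[OF zero_closed]
  by (simp_all add: odd_demazure_eq odd_s_eq d_op_add d_op_mult d_op_minus d_op_gen d_op_d_op d_op_s_op const_one const_zero)

subsection \<open>Degrees\<close>

lemma deg_partI:
  "\<lbrakk>f \<in> carrier FA; \<And>w. f w \<noteq> \<zero> \<Longrightarrow> 2 * int (length w) = i\<rbrakk> \<Longrightarrow> cl f \<in> deg_part R i"
  by (auto simp: odd_R_simps(6))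

lemma deg_partE:
  assumes "X \<in> deg_part R i"
  obtains f where "f \<in> carrier FA" "X = cl f" "\<And>w. f w \<noteq> \<zero> \<Longrightarrow> 2 * int (length w) = i"
  using assms by (auto simp: odd_R_simps(6))

lemma const_deg: "c \<in> carrier k \<Longrightarrow> const c \<in> deg_part R 0"
  unfolding const_mono by (rule deg_partI[OF mono_closed]) (auto simp: mono_def split: if_splits)

lemma word_deg: "word w \<in> deg_part R (2 * int (length w))"
  unfolding word_def by (rule deg_partI[OF mono_closed]) (auto simp: mono_def split: if_splits)

lemma odd_x_deg: "odd_x k g \<in> deg_part R 2"
  using word_deg[of "[g]"] by (simp add: word_Cons word_Nil)

lemma deg_mult:
  assumes "X \<in> deg_part R i" "Y \<in> deg_part R j"
  shows "X \<otimes>\<^bsub>R\<^esub> Y \<in> deg_part R (i + j)"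
proof -
  obtain f where f: "f \<in> carrier FA" "X = cl f" "\<And>w. f w \<noteq> \<zero> \<Longrightarrow> 2 * int (length w) = i"
    using assms(1) by (rule deg_partE) (rule that)
  obtain g where g: "g \<in> carrier FA" "Y = cl g" "\<And>w. g w \<noteq> \<zero> \<Longrightarrow> 2 * int (length w) = j"
    using assms(2) by (rule deg_partE) (rule that)
  show ?thesis
    unfolding f(2) g(2) cl_mult[OF f(1) g(1), symmetric]
  proof (rule deg_partI[OF free_alg_mult_closed[OF f(1) g(1)]])
    fix w assume "conv f g w \<noteq> \<zero>"
    then obtain u v where "w = u @ v" "f u \<noteq> \<zero>" "g v \<noteq> \<zero>"
      by (rule conv_nonzero[OF coeffs_closed[OF f(1)] coeffs_closed[OF g(1)]])
    thus "2 * int (length w) = i + j" using f(3)[of u] g(3)[of v] by simp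
  qed
qed

lemma deg_subgroup: "additive_subgroup (deg_part R i) R"
  unfolding additive_subgroup_iff[OF R.abelian_group_axioms]
proof (intro conjI ballI subsetI)
  show "X \<in> carrier R" if "X \<in> deg_part R i" for X
    using that by (rule deg_partE) (simp add: cl_closed)
  show "\<zero>\<^bsub>R\<^esub> \<in> deg_part R i"
    unfolding cl_zero[symmetric] by (rule deg_partI[OF zero_fun_closed]) simp
  show "X \<oplus>\<^bsub>R\<^esub> Y \<in> deg_part R i" if a: "X \<in> deg_part R i" "Y \<in> deg_part R i" for X Y
  proof -
    obtain f where f: "f \<in> carrier FA" "X = cl f" "\<And>w. f w \<noteq> \<zero> \<Longrightarrow> 2 * int (length w) = i"
      using a(1) by (rule deg_partE) (rule that)
    obtain g where g: "g \<in> carrier FA" "Y = cl g" "\<And>w. g w \<noteq> \<zero> \<Longrightarrow> 2 * int (length w) = i"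
      using a(2) by (rule deg_partE) (rule that)
    show ?thesis
      unfolding f(2) g(2) cl_add[OF f(1) g(1), symmetric]
    proof (rule deg_partI[OF free_alg_add_closed[OF f(1) g(1)]])
      fix w assume "f w \<oplus> g w \<noteq> \<zero>"
      hence "f w \<noteq> \<zero> \<or> g w \<noteq> \<zero>" by auto
      thus "2 * int (length w) = i" using f(3) g(3) by blast
    qed
  qed
  show "\<ominus>\<^bsub>R\<^esub> X \<in> deg_part R i" if "X \<in> deg_part R i" for X
  proof -
    have "X \<in> carrier R" using that by (rule deg_partE) (simp add: cl_closed)
    hence "const (\<ominus> \<one>) \<otimes>\<^bsub>R\<^esub> X \<oplus>\<^bsub>R\<^esub> const \<one> \<otimes>\<^bsub>R\<^esub> X = const (\<ominus> \<one> \<oplus> \<one>) \<otimes>\<^bsub>R\<^esub> X"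
      by (subst const_add) (simp_all add: R.l_distr)
    hence "const (\<ominus> \<one>) \<otimes>\<^bsub>R\<^esub> X \<oplus>\<^bsub>R\<^esub> X = \<zero>\<^bsub>R\<^esub>"
      using \<open>X \<in> carrier R\<close> by (simp add: const_one l_neg const_zero)
    hence "\<ominus>\<^bsub>R\<^esub> X = const (\<ominus> \<one>) \<otimes>\<^bsub>R\<^esub> X"
      using \<open>X \<in> carrier R\<close> by (intro R.minus_equality) simp_all
    thus ?thesis using deg_mult[OF const_deg that, of "\<ominus> \<one>"] by simp
  qed
qed

sublocale pregraded_ring R
  using deg_subgroup deg_mult word_deg[of "[]"]
  by (intro pregraded_ring.intro pregraded_ring_axioms.intro) (simp_all add: R.ring_axioms word_Nil)

lemma s_word_deg: "s_word w \<in> deg_part R (2 * int (length w))"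
proof (induction w)
  case Nil
  then show ?case by (simp add: deg_part_one)
next
  case (Cons g w)
  then show ?case using deg_part_mult[OF deg_part_minus[OF odd_x_deg[of "swap g"]] Cons] by (simp add: algebra_simps)
qed

lemma d_word_deg: "d_word w \<in> deg_part R (2 * int (length w) - 2)"
proof (induction w)
  case Nil
  then show ?case by (simp add: deg_part_zero)
next
  case (Cons g w)
  show ?case
    using deg_part_add[OF word_deg[of w]] deg_part_mult[OF deg_part_minus[OF odd_x_deg[of "swap g"]] Cons] by simp
qed

lemma s_deg: "X \<in> deg_part R i \<Longrightarrow> s X \<in> deg_part R i"
proof (erule deg_partE)
  fix f assume f: "f \<in> carrier FA" "X = cl f" "\<And>w. f w \<noteq> \<zero> \<Longrightarrow> 2 * int (length w) = i"
  have "S0 f \<in> deg_part R i"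
  proof (rule lin_ext_deg[OF s_word_closed deg_part_subgroup f(1)])
    show "const (f w) \<otimes>\<^bsub>R\<^esub> s_word w \<in> deg_part R i" if "f w \<noteq> \<zero>" for w
      using deg_part_mult[OF const_deg s_word_deg[of w], of "f w"] coeffsD[OF coeffs_closed[OF f(1)]] f(3)[OF that] by simp
  qed
  thus ?thesis using f by (simp add: odd_s_eq s_op_cl cl_closed)
qed

lemma dem_deg: "X \<in> deg_part R i \<Longrightarrow> dem X \<in> deg_part R (i - 2)"
proof (erule deg_partE)
  fix f assume f: "f \<in> carrier FA" "X = cl f" "\<And>w. f w \<noteq> \<zero> \<Longrightarrow> 2 * int (length w) = i"
  have "D0 f \<in> deg_part R (i - 2)"
  proof (rule lin_ext_deg[OF d_word_closed deg_part_subgroup f(1)])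
    show "const (f w) \<otimes>\<^bsub>R\<^esub> d_word w \<in> deg_part R (i - 2)" if "f w \<noteq> \<zero>" for w
      using deg_part_mult[OF const_deg d_word_deg[of w], of "f w"] coeffsD[OF coeffs_closed[OF f(1)]] f(3)[OF that] by simp
  qed
  thus ?thesis using f by (simp add: odd_demazure_eq d_op_cl cl_closed)
qed

end

section \<open>Bases of the bimodules\<close>

context odd_poly
begin

abbreviation "Rs \<equiv> odd_Rs k"
abbreviation "Reg \<equiv> regular_bimod R"
abbreviation "Tw \<equiv> odd_Rs_twisted k"

lemma Rs_simps [simp]:
  "add Rs = add R" "mult Rs = mult R" "\<one>\<^bsub>Rs\<^esub> = \<one>\<^bsub>R\<^esub>" "\<zero>\<^bsub>Rs\<^esub> = \<zero>\<^bsub>R\<^esub>"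
  "deg_part Rs i = {f \<in> deg_part R i. dem f = \<zero>\<^bsub>R\<^esub>}"
  by (simp_all add: odd_Rs_def)

lemma Rs_carrier: "f \<in> carrier Rs \<longleftrightarrow> f \<in> carrier R \<and> dem f = \<zero>\<^bsub>R\<^esub>"
  by (simp add: odd_Rs_def)

lemma Rs_closed:
  "f \<in> carrier Rs \<Longrightarrow> f \<in> carrier R" "f \<in> carrier Rs \<Longrightarrow> s f \<in> carrier Rs"
  "\<lbrakk>f \<in> carrier Rs; g \<in> carrier Rs\<rbrakk> \<Longrightarrow> f \<oplus>\<^bsub>R\<^esub> g \<in> carrier Rs"
  "\<lbrakk>f \<in> carrier Rs; g \<in> carrier Rs\<rbrakk> \<Longrightarrow> f \<otimes>\<^bsub>R\<^esub> g \<in> carrier Rs"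
  "f \<in> carrier Rs \<Longrightarrow> \<ominus>\<^bsub>R\<^esub> f \<in> carrier Rs"
  "\<one>\<^bsub>R\<^esub> \<in> carrier Rs" "\<zero>\<^bsub>R\<^esub> \<in> carrier Rs" "g \<in> carrier R \<Longrightarrow> dem g \<in> carrier Rs"
  by (auto simp: Rs_carrier s_simps(1-6) dem_simps(1-10))

lemma Rs_ring: "ring Rs"
proof (rule ringI)
  show "abelian_group Rs"
  proof (rule abelian_groupI)
    show "\<exists>g\<in>carrier Rs. g \<oplus>\<^bsub>Rs\<^esub> f = \<zero>\<^bsub>Rs\<^esub>" if "f \<in> carrier Rs" for f
      using that by (intro bexI[of _ "\<ominus>\<^bsub>R\<^esub> f"]) (simp_all add: Rs_closed R.l_neg)
  qed (simp_all add: Rs_closed R.a_ac)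
  show "monoid Rs" by (rule monoidI) (simp_all add: Rs_closed R.m_assoc)
qed (simp_all add: Rs_closed R.l_distr R.r_distr)

lemma Reg_bimodule:
  "graded_bimodule R R Reg" "graded_bimodule R Rs Reg" "graded_bimodule Rs R Reg" "graded_bimodule Rs Rs Reg"
  by (rule regular_bimod_graded[OF pregraded_ring_axioms];
      use R.ring_axioms Rs_ring deg_part_closed in \<open>auto simp: Rs_carrier\<close>)+

lemma Tw_simps [simp]:
  "carrier Tw = carrier Rs" "\<zero>\<^bsub>Tw\<^esub> = \<zero>\<^bsub>R\<^esub>" "add Tw = add R" "f \<odot>\<^bsub>Tw\<^esub> g = s f \<otimes>\<^bsub>R\<^esub> g"
  "gr_part Tw i = deg_part Rs i" "rsmult Tw = mult R"
  by (simp_all add: odd_Rs_twisted_def regular_bimod_def)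

lemma Tw_bimodule: "graded_bimodule Rs Rs Tw"
proof -
  have ab: "abelian_group Tw"
    by (rule abelian_group_cong[OF ringE(1)[OF Rs_ring]]) simp_all
  have "pregraded_module Rs Tw"
  proof (rule pregraded_moduleI)
    show "additive_subgroup (gr_part Tw i) Tw" for i
    proof -
      have m: "\<ominus>\<^bsub>Tw\<^esub> f = \<ominus>\<^bsub>R\<^esub> f" if "f \<in> carrier Rs" for f
        by (rule abelian_group.minus_equality[OF ab]) (use that in \<open>simp_all add: Rs_closed R.l_neg\<close>)
      show ?thesis
        unfolding additive_subgroup_iff[OF ab]
        using deg_part_closed
        by (auto simp: Rs_carrier m deg_part_zero deg_part_add deg_part_minus dem_simps(2,4,6))
    qed
    show "a \<odot>\<^bsub>Tw\<^esub> f \<in> gr_part Tw (i + j)" if "a \<in> deg_part Rs i" "f \<in> gr_part Tw j" for i j a f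
      using that deg_part_mult[OF s_deg[of a i], of f j] deg_part_closed
      by (auto simp: dem_simps(3,10) s_simps(1,6))
  qed (simp_all add: Rs_ring ab Rs_closed s_simps(1-6) R.l_distr R.r_distr R.m_assoc)
  thus ?thesis
  proof (intro graded_bimodule.intro graded_bimodule_axioms.intro, goal_cases)
    case 2 show ?case by (rule Rs_ring)
  next
    case (9 i j a x)
    then show ?case using deg_part_closed by (auto simp: deg_part_mult dem_simps(3) s_simps(1))
  next
    case (10 a i)
    then show ?case using deg_part_closed by (auto simp: Rs_carrier)
  next
    case (11 a i)
    then show ?case using deg_part_closed by (auto simp: Rs_carrier)
  qed (simp_all add: Rs_closed s_simps R.l_distr R.r_distr R.m_assoc)
qed

text \<open>
  Under the left action of \<open>a\<close> the coordinates transform by the triangular matrix with rows \<open>(f, 0)\<close> and \<open>(\<partial> f, s f)\<close>, where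
  \<open>f = \<sigma> a\<close>. The twist \<open>\<sigma>\<close> is the identity for \<open>B\<close> and the involution for the twisted bimodule. The degrees \<open>-1\<close> and \<open>1\<close> of
  the basis are those of the constants and of \<open>x\<^sub>1\<close>, lowered by the shift.
\<close>

definition triangular_basis ::
  "('k odd_poly \<Rightarrow> 'k odd_poly) \<Rightarrow> ('k odd_poly, 'p) gbimod \<Rightarrow> 'p \<Rightarrow> 'p \<Rightarrow> ('p \<Rightarrow> 'k odd_poly) \<Rightarrow> ('p \<Rightarrow> 'k odd_poly) \<Rightarrow> bool" where
  "triangular_basis \<sigma> P e0 e1 c0 c1 \<longleftrightarrow> right_basis2 R R P e0 e1 c0 c1 (-1) 1 \<and>
     (\<forall>a\<in>carrier R. \<forall>x\<in>carrier P. c0 (a \<odot>\<^bsub>P\<^esub> x) = \<sigma> a \<otimes>\<^bsub>R\<^esub> c0 x \<and>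
        c1 (a \<odot>\<^bsub>P\<^esub> x) = dem (\<sigma> a) \<otimes>\<^bsub>R\<^esub> c0 x \<oplus>\<^bsub>R\<^esub> s (\<sigma> a) \<otimes>\<^bsub>R\<^esub> c1 x)"

subsection \<open>The untwisted bimodule\<close>

abbreviation "B0 \<equiv> tensor_bimod Rs Reg Reg"
abbreviation "pureB \<equiv> odd_B_pure k"
abbreviation "b0 \<equiv> tensor_lift Rs Reg Reg Reg (\<lambda>f g. f \<otimes>\<^bsub>R\<^esub> g)"
abbreviation "b1 \<equiv> tensor_lift Rs Reg Reg Reg (\<lambda>f g. dem f \<otimes>\<^bsub>R\<^esub> g)"

lemma Reg_abelian: "abelian_group Reg"
  by (rule abelian_group_cong[OF R.abelian_group_axioms]) simp_all

interpretation BT: bimodule_tensor R Rs Reg Reg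
  by (intro bimodule_tensor.intro Reg_bimodule(2) graded_bimodule.axioms(1)[OF Reg_bimodule(3)])

interpretation b0: balanced_map Rs Reg Reg Reg "\<lambda>f g. f \<otimes>\<^bsub>R\<^esub> g"
  by (intro balanced_map.intro BT.tensor_pair_axioms Reg_abelian balanced_map_axioms.intro)
    (simp_all add: Rs_carrier R.l_distr R.r_distr R.m_assoc)

interpretation b1: balanced_map Rs Reg Reg Reg "\<lambda>f g. dem f \<otimes>\<^bsub>R\<^esub> g"
  by (intro balanced_map.intro BT.tensor_pair_axioms Reg_abelian balanced_map_axioms.intro)
    (simp_all add: Rs_carrier R.l_distr R.r_distr R.m_assoc dem_simps s_simps(1))

lemma odd_B_simps [simp]:
  "carrier (odd_B k) = carrier BT.T" "\<zero>\<^bsub>odd_B k\<^esub> = \<zero>\<^bsub>BT.T\<^esub>" "add (odd_B k) = add BT.T"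
  "smult (odd_B k) = smult BT.T" "gr_part (odd_B k) i = gr_part BT.T (i + 1)" "rsmult (odd_B k) = rsmult B0"
  by (simp_all add: odd_B_def)

lemma pureB_eq: "pureB f g = BT.pure f g"
  by (simp add: odd_B_pure_def)

lemma B0_bimodule: "graded_bimodule R R B0"
  by (rule tensor_graded_bimodule(1)[OF Reg_bimodule(2,3)])

lemma odd_B_bimodule: "graded_bimodule R R (odd_B k)"
  unfolding odd_B_def by (rule graded_bimodule_gr_shift[OF B0_bimodule])

interpretation B0: graded_bimodule R R B0 by (rule B0_bimodule)

lemma rsmult_pureB:
  "\<lbrakk>f \<in> carrier R; g \<in> carrier R; a \<in> carrier R\<rbrakk> \<Longrightarrow> rsmult B0 (BT.pure f g) a = BT.pure f (g \<otimes>\<^bsub>R\<^esub> a)"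
  using tensor_rsmult_pure[OF Reg_bimodule(2,3), of f g a] by simp

lemma rsmult_B:
  "\<lbrakk>X \<in> carrier BT.T; a \<in> carrier R\<rbrakk> \<Longrightarrow> rsmult B0 X a \<in> carrier BT.T"
  "\<lbrakk>X \<in> carrier BT.T; Y \<in> carrier BT.T; a \<in> carrier R\<rbrakk> \<Longrightarrow>
     rsmult B0 (X \<oplus>\<^bsub>BT.T\<^esub> Y) a = rsmult B0 X a \<oplus>\<^bsub>BT.T\<^esub> rsmult B0 Y a"
  "\<lbrakk>X \<in> carrier BT.T; a \<in> carrier R; b \<in> carrier R\<rbrakk> \<Longrightarrow>
     rsmult B0 X (a \<oplus>\<^bsub>R\<^esub> b) = rsmult B0 X a \<oplus>\<^bsub>BT.T\<^esub> rsmult B0 X b"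
  using B0.rsmult_closed[of X a] B0.rsmult_l_distr[of X Y a] B0.rsmult_r_distr[of X a b] by (simp_all del: tensor_bimod_simps(6))

abbreviation "B_one \<equiv> BT.pure \<one>\<^bsub>R\<^esub> \<one>\<^bsub>R\<^esub>"
abbreviation "B_comm \<equiv> BT.pure x1 \<one>\<^bsub>R\<^esub> \<oplus>\<^bsub>BT.T\<^esub> \<ominus>\<^bsub>BT.T\<^esub> BT.pure \<one>\<^bsub>R\<^esub> x1"

lemma rsmult_B_comm:
  assumes "a \<in> carrier R"
  shows "rsmult B0 B_comm a = BT.pure x1 a \<oplus>\<^bsub>BT.T\<^esub> \<ominus>\<^bsub>BT.T\<^esub> BT.pure \<one>\<^bsub>R\<^esub> (x1 \<otimes>\<^bsub>R\<^esub> a)"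
proof -
  have "B_comm = BT.pure x1 \<one>\<^bsub>R\<^esub> \<oplus>\<^bsub>BT.T\<^esub> BT.pure \<one>\<^bsub>R\<^esub> (\<ominus>\<^bsub>R\<^esub> x1)"
    using BT.pure_minus_right[of "\<one>\<^bsub>R\<^esub>" x1] a_inv_cong[of Reg R x1] by simp
  thus ?thesis
    using assms BT.pure_minus_right[of "\<one>\<^bsub>R\<^esub>" "x1 \<otimes>\<^bsub>R\<^esub> a"] a_inv_cong[of Reg R "x1 \<otimes>\<^bsub>R\<^esub> a"]
    by (simp add: rsmult_B rsmult_pureB R.l_minus del: tensor_bimod_simps(6))
qed

text \<open>
  The elements \<open>\<partial> f\<close> and \<open>f - x\<^sub>1 \<partial> f\<close> are invariant, hence
  \<open>f \<otimes> g = 1 \<otimes> (f - x\<^sub>1 \<partial> f) g + x\<^sub>1 \<otimes> \<partial>(f) g\<close>, which is the asserted expansion.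
\<close>

lemma B_expand:
  assumes "X \<in> carrier BT.T"
  shows "X = rsmult B0 B_one (b0 X) \<oplus>\<^bsub>BT.T\<^esub> rsmult B0 B_comm (b1 X)"
proof -
  have "(\<lambda>X. X) X = (\<lambda>X. rsmult B0 B_one (b0 X) \<oplus>\<^bsub>BT.T\<^esub> rsmult B0 B_comm (b1 X)) X"
  proof (rule BT.additive_eq[OF assms BT.tensor_abelian_group])
    fix f g assume "f \<in> carrier Reg" "g \<in> carrier Reg"
    hence f: "f \<in> carrier R" and g: "g \<in> carrier R" by simp_all
    have d: "dem f \<in> carrier Rs" "dem f \<in> carrier R" using f Rs_closed(8) dem_simps(1) by auto
    have p: "f \<oplus>\<^bsub>R\<^esub> \<ominus>\<^bsub>R\<^esub> (x1 \<otimes>\<^bsub>R\<^esub> dem f) \<in> carrier Rs"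
      using f d by (simp add: Rs_carrier dem_simps s_simps(1) R.r_neg)
    have "rsmult B0 B_one (b0 (BT.pure f g)) \<oplus>\<^bsub>BT.T\<^esub> rsmult B0 B_comm (b1 (BT.pure f g)) =
      BT.pure \<one>\<^bsub>R\<^esub> (f \<otimes>\<^bsub>R\<^esub> g) \<oplus>\<^bsub>BT.T\<^esub> (BT.pure x1 (dem f \<otimes>\<^bsub>R\<^esub> g) \<oplus>\<^bsub>BT.T\<^esub> \<ominus>\<^bsub>BT.T\<^esub> BT.pure \<one>\<^bsub>R\<^esub> (x1 \<otimes>\<^bsub>R\<^esub> (dem f \<otimes>\<^bsub>R\<^esub> g)))"
      using f g d by (simp add: b0.lift_pure b1.lift_pure rsmult_pureB rsmult_B_comm del: tensor_bimod_simps(6))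
    also have "\<dots> = BT.pure \<one>\<^bsub>R\<^esub> (f \<otimes>\<^bsub>R\<^esub> g) \<oplus>\<^bsub>BT.T\<^esub> BT.pure \<one>\<^bsub>R\<^esub> (\<ominus>\<^bsub>R\<^esub> (x1 \<otimes>\<^bsub>R\<^esub> (dem f \<otimes>\<^bsub>R\<^esub> g))) \<oplus>\<^bsub>BT.T\<^esub> BT.pure x1 (dem f \<otimes>\<^bsub>R\<^esub> g)"
      using f g d BT.pure_minus_right[of "\<one>\<^bsub>R\<^esub>" "x1 \<otimes>\<^bsub>R\<^esub> (dem f \<otimes>\<^bsub>R\<^esub> g)"] a_inv_cong[of Reg R "x1 \<otimes>\<^bsub>R\<^esub> (dem f \<otimes>\<^bsub>R\<^esub> g)"]
      by (simp add: BT.T.a_ac)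
    also have "\<dots> = BT.pure \<one>\<^bsub>R\<^esub> ((f \<oplus>\<^bsub>R\<^esub> \<ominus>\<^bsub>R\<^esub> (x1 \<otimes>\<^bsub>R\<^esub> dem f)) \<otimes>\<^bsub>R\<^esub> g) \<oplus>\<^bsub>BT.T\<^esub> BT.pure x1 (dem f \<otimes>\<^bsub>R\<^esub> g)"
      using f g d BT.pure_add_right[of "\<one>\<^bsub>R\<^esub>" "f \<otimes>\<^bsub>R\<^esub> g" "\<ominus>\<^bsub>R\<^esub> (x1 \<otimes>\<^bsub>R\<^esub> (dem f \<otimes>\<^bsub>R\<^esub> g))"]
      by (simp add: R.l_distr R.l_minus R.m_assoc)
    also have "\<dots> = BT.pure (f \<oplus>\<^bsub>R\<^esub> \<ominus>\<^bsub>R\<^esub> (x1 \<otimes>\<^bsub>R\<^esub> dem f)) g \<oplus>\<^bsub>BT.T\<^esub> BT.pure (x1 \<otimes>\<^bsub>R\<^esub> dem f) g"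
      using f g d BT.pure_balanced[of "\<one>\<^bsub>R\<^esub>", OF _ p, of g] BT.pure_balanced[of x1 "dem f" g] by simp
    also have "\<dots> = BT.pure (f \<oplus>\<^bsub>R\<^esub> \<ominus>\<^bsub>R\<^esub> (x1 \<otimes>\<^bsub>R\<^esub> dem f) \<oplus>\<^bsub>R\<^esub> x1 \<otimes>\<^bsub>R\<^esub> dem f) g"
      using f g d BT.pure_add_left[of "f \<oplus>\<^bsub>R\<^esub> \<ominus>\<^bsub>R\<^esub> (x1 \<otimes>\<^bsub>R\<^esub> dem f)" "x1 \<otimes>\<^bsub>R\<^esub> dem f" g] by simp
    also have "f \<oplus>\<^bsub>R\<^esub> \<ominus>\<^bsub>R\<^esub> (x1 \<otimes>\<^bsub>R\<^esub> dem f) \<oplus>\<^bsub>R\<^esub> x1 \<otimes>\<^bsub>R\<^esub> dem f = f"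
      using f d by (simp add: R.a_assoc R.l_neg)
    finally show "BT.pure f g = rsmult B0 B_one (b0 (BT.pure f g)) \<oplus>\<^bsub>BT.T\<^esub> rsmult B0 B_comm (b1 (BT.pure f g))" ..
  qed (use b0.lift_closed b1.lift_closed in \<open>simp_all add: rsmult_B b0.lift_add b1.lift_add BT.T.a_ac del: tensor_bimod_simps(6)\<close>)
  thus ?thesis .
qed

lemma B_left:
  assumes "a \<in> carrier R" "X \<in> carrier BT.T"
  shows "b0 (a \<odot>\<^bsub>BT.T\<^esub> X) = a \<otimes>\<^bsub>R\<^esub> b0 X"
    and "b1 (a \<odot>\<^bsub>BT.T\<^esub> X) = dem a \<otimes>\<^bsub>R\<^esub> b0 X \<oplus>\<^bsub>R\<^esub> s a \<otimes>\<^bsub>R\<^esub> b1 X"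
proof -
  note b = b0.lift_closed b1.lift_closed
  show "b0 (a \<odot>\<^bsub>BT.T\<^esub> X) = a \<otimes>\<^bsub>R\<^esub> b0 X"
    by (rule BT.additive_eq[OF assms(2) R.abelian_group_axioms])
      (use assms(1) b in \<open>simp_all add: BT.smult_tensor_closed BT.smult_tensor_add BT.smult_pure b0.lift_add b0.lift_pure
        R.r_distr R.m_assoc\<close>)
  show "b1 (a \<odot>\<^bsub>BT.T\<^esub> X) = dem a \<otimes>\<^bsub>R\<^esub> b0 X \<oplus>\<^bsub>R\<^esub> s a \<otimes>\<^bsub>R\<^esub> b1 X"
    by (rule BT.additive_eq[OF assms(2) R.abelian_group_axioms])
      (use assms(1) b in \<open>simp_all add: BT.smult_tensor_closed BT.smult_tensor_add BT.smult_pure b0.lift_add b0.lift_pure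
        b1.lift_add b1.lift_pure R.l_distr R.r_distr R.m_assoc R.a_ac dem_simps(1,3) s_simps(1)\<close>)
qed

lemma B_right:
  assumes "a \<in> carrier R" "X \<in> carrier BT.T"
  shows "b0 (rsmult B0 X a) = b0 X \<otimes>\<^bsub>R\<^esub> a" and "b1 (rsmult B0 X a) = b1 X \<otimes>\<^bsub>R\<^esub> a"
proof -
  note b = b0.lift_closed b1.lift_closed
  show "b0 (rsmult B0 X a) = b0 X \<otimes>\<^bsub>R\<^esub> a"
    by (rule BT.additive_eq[OF assms(2) R.abelian_group_axioms])
      (use assms(1) b in \<open>simp_all add: rsmult_B rsmult_pureB b0.lift_add b0.lift_pure R.l_distr R.m_assoc del: tensor_bimod_simps(6)\<close>)
  show "b1 (rsmult B0 X a) = b1 X \<otimes>\<^bsub>R\<^esub> a"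
    by (rule BT.additive_eq[OF assms(2) R.abelian_group_axioms])
      (use assms(1) b in \<open>simp_all add: rsmult_B rsmult_pureB b1.lift_add b1.lift_pure R.l_distr R.m_assoc dem_simps(1) del: tensor_bimod_simps(6)\<close>)
qed

lemma B_deg:
  assumes "X \<in> gr_part BT.T n"
  shows "b0 X \<in> deg_part R n" "b1 X \<in> deg_part R (n - 2)"
proof -
  have sub: "additive_subgroup (gr_part Reg i) Reg" for i
    using graded_bimodule.axioms(1)[OF Reg_bimodule(1)] by (rule pregraded_module.gr_part_subgroup)
  show "b0 X \<in> deg_part R n"
    using b0.lift_gr_part[where d = 0, OF BT.gr_sub sub _ assms] by (simp add: deg_part_mult)
  have "dem f \<otimes>\<^bsub>R\<^esub> g \<in> gr_part Reg (i + j - 2)" if "f \<in> gr_part Reg i" "g \<in> gr_part Reg j" for f g i j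
    using deg_part_mult[OF dem_deg[of f i], of g j] that by (simp add: algebra_simps)
  thus "b1 X \<in> deg_part R (n - 2)"
    using b1.lift_gr_part[where d = 2, OF BT.gr_sub sub _ assms] by simp
qed

lemma B_triangular_basis: "triangular_basis (\<lambda>a. a) (odd_B k) B_one B_comm b0 b1"
  unfolding triangular_basis_def
proof (intro conjI ballI)
  show "right_basis2 R R (odd_B k) B_one B_comm b0 b1 (-1) 1"
  proof (intro right_basis2.intro right_basis2_axioms.intro odd_B_bimodule, goal_cases)
    case 3
    show ?case using BT.gr_part_pure[of "\<one>\<^bsub>R\<^esub>" 0 "\<one>\<^bsub>R\<^esub>" 0] by (simp add: deg_part_one)
  next
    case 4
    interpret T: pregraded_module R BT.T by (rule BT.tensor_pregraded)
    have "BT.pure x1 \<one>\<^bsub>R\<^esub> \<in> gr_part BT.T 2" "BT.pure \<one>\<^bsub>R\<^esub> x1 \<in> gr_part BT.T 2"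
      using BT.gr_part_pure[of x1 2 "\<one>\<^bsub>R\<^esub>" 0] BT.gr_part_pure[of "\<one>\<^bsub>R\<^esub>" 0 x1 2]
      by (simp_all add: deg_part_one odd_x_deg)
    then show ?case by (simp add: T.gr_part_add T.gr_part_minus)
  next
    case (12 X i)
    then show ?case using B_deg(2)[of X "i + 1"] by simp
  qed (use b0.lift_closed b1.lift_closed B_deg in \<open>simp_all add: b0.lift_add b1.lift_add b0.lift_pure b1.lift_pure
      b0.lift_minus b1.lift_minus B_right dem_simps a_inv_cong[of Reg R] R.r_neg B_expand[symmetric] del: tensor_bimod_simps(6)\<close>)
qed (simp_all add: B_left)

end

context odd_poly
begin

interpretation BT: bimodule_tensor R Rs Reg Reg
  by (intro bimodule_tensor.intro Reg_bimodule(2) graded_bimodule.axioms(1)[OF Reg_bimodule(3)])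

interpretation b0: balanced_map Rs Reg Reg Reg "\<lambda>f g. f \<otimes>\<^bsub>R\<^esub> g"
  by (intro balanced_map.intro BT.tensor_pair_axioms Reg_abelian balanced_map_axioms.intro)
    (simp_all add: Rs_carrier R.l_distr R.r_distr R.m_assoc)

lemma a_inv_Reg [simp]: "\<ominus>\<^bsub>Reg\<^esub> f = \<ominus>\<^bsub>R\<^esub> f"
  by (rule a_inv_cong) simp_all

subsection \<open>The twisted bimodule\<close>

text \<open>
  The product \<open>U\<close> of the first two factors is identified with \<open>R\<close> by \<open>\<tau>(f \<otimes> c) = s(f) c\<close>. This map is linear over \<open>R\<^sup>s\<close>
  on the right and semilinear with respect to \<open>s\<close> on the left. The coordinates of \<open>B\<close>, composed with \<open>\<tau>\<close>, become the
  coordinates of the twisted bimodule.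
\<close>

abbreviation "U \<equiv> tensor_bimod Rs Reg Tw"
abbreviation "\<tau> \<equiv> tensor_lift Rs Reg Tw Reg (\<lambda>f c. s f \<otimes>\<^bsub>R\<^esub> c)"
abbreviation "t0 \<equiv> tensor_lift Rs U Reg Reg (\<lambda>q g. \<tau> q \<otimes>\<^bsub>R\<^esub> g)"
abbreviation "t1 \<equiv> tensor_lift Rs U Reg Reg (\<lambda>q g. dem (\<tau> q) \<otimes>\<^bsub>R\<^esub> g)"
abbreviation "Btw0 \<equiv> tensor_bimod Rs U Reg"

interpretation UT: bimodule_tensor R Rs Reg Tw
  by (intro bimodule_tensor.intro Reg_bimodule(2) graded_bimodule.axioms(1)[OF Tw_bimodule])

interpretation \<tau>: balanced_map Rs Reg Tw Reg "\<lambda>f c. s f \<otimes>\<^bsub>R\<^esub> c"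
  by (intro balanced_map.intro UT.tensor_pair_axioms Reg_abelian balanced_map_axioms.intro)
    (simp_all add: Rs_carrier R.l_distr R.r_distr R.m_assoc s_simps(1-3))

lemma U_bimodule: "graded_bimodule R Rs U"
  by (rule tensor_graded_bimodule(1)[OF Reg_bimodule(2) Tw_bimodule])

interpretation U: graded_bimodule R Rs U by (rule U_bimodule)

lemma rsmult_U_pure:
  "\<lbrakk>f \<in> carrier R; c \<in> carrier Rs; a \<in> carrier Rs\<rbrakk> \<Longrightarrow> rsmult U (UT.pure f c) a = UT.pure f (c \<otimes>\<^bsub>R\<^esub> a)"
  using tensor_rsmult_pure[OF Reg_bimodule(2) Tw_bimodule, of f c a] by (simp del: tensor_bimod_simps(6))

lemma rsmult_U:
  "\<lbrakk>X \<in> carrier UT.T; a \<in> carrier Rs\<rbrakk> \<Longrightarrow> rsmult U X a \<in> carrier UT.T"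
  "\<lbrakk>X \<in> carrier UT.T; Y \<in> carrier UT.T; a \<in> carrier Rs\<rbrakk> \<Longrightarrow>
     rsmult U (X \<oplus>\<^bsub>UT.T\<^esub> Y) a = rsmult U X a \<oplus>\<^bsub>UT.T\<^esub> rsmult U Y a"
  using U.rsmult_closed[of X a] U.rsmult_l_distr[of X Y a] by (simp_all del: tensor_bimod_simps(6))

lemma \<tau>_closed: "X \<in> carrier UT.T \<Longrightarrow> \<tau> X \<in> carrier R"
  using \<tau>.lift_closed by simp

lemma \<tau>_add: "\<lbrakk>X \<in> carrier UT.T; Y \<in> carrier UT.T\<rbrakk> \<Longrightarrow> \<tau> (X \<oplus>\<^bsub>UT.T\<^esub> Y) = \<tau> X \<oplus>\<^bsub>R\<^esub> \<tau> Y"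
  using \<tau>.lift_add by simp

lemma \<tau>_pure: "\<lbrakk>f \<in> carrier R; c \<in> carrier Rs\<rbrakk> \<Longrightarrow> \<tau> (UT.pure f c) = s f \<otimes>\<^bsub>R\<^esub> c"
  using \<tau>.lift_pure by simp

lemma \<tau>_right:
  assumes "X \<in> carrier UT.T" "a \<in> carrier Rs"
  shows "\<tau> (rsmult U X a) = \<tau> X \<otimes>\<^bsub>R\<^esub> a"
  by (rule UT.additive_eq[OF assms(1) R.abelian_group_axioms])
    (use assms(2) Rs_closed in \<open>simp_all add: rsmult_U rsmult_U_pure \<tau>_closed \<tau>_add \<tau>_pure R.l_distr R.m_assoc s_simps(1)
      del: tensor_bimod_simps(6)\<close>)

lemma \<tau>_left:
  assumes "X \<in> carrier UT.T" "a \<in> carrier R"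
  shows "\<tau> (a \<odot>\<^bsub>UT.T\<^esub> X) = s a \<otimes>\<^bsub>R\<^esub> \<tau> X"
  by (rule UT.additive_eq[OF assms(1) R.abelian_group_axioms])
    (use assms(2) Rs_closed(1) in \<open>simp_all add: UT.smult_tensor_closed UT.smult_tensor_add UT.smult_pure \<tau>_closed \<tau>_add \<tau>_pure
      R.r_distr R.m_assoc s_simps(1,3)\<close>)

lemma Reg_gr_subgroup: "additive_subgroup (gr_part Reg i) Reg"
  using graded_bimodule.axioms(1)[OF Reg_bimodule(1)] by (rule pregraded_module.gr_part_subgroup)

lemma \<tau>_deg: "X \<in> gr_part UT.T i \<Longrightarrow> \<tau> X \<in> deg_part R i"
  using \<tau>.lift_gr_part[where d = 0, OF UT.gr_sub Reg_gr_subgroup, of X i] by (simp add: deg_part_mult s_deg)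

interpretation VT: bimodule_tensor R Rs U Reg
  by (intro bimodule_tensor.intro U_bimodule graded_bimodule.axioms(1)[OF Reg_bimodule(3)])

interpretation t0: balanced_map Rs U Reg Reg "\<lambda>q g. \<tau> q \<otimes>\<^bsub>R\<^esub> g"
  by (intro balanced_map.intro VT.tensor_pair_axioms Reg_abelian balanced_map_axioms.intro)
    (simp_all add: Rs_closed(1) R.l_distr R.r_distr R.m_assoc \<tau>_closed \<tau>_add \<tau>_right del: tensor_bimod_simps(6))

interpretation t1: balanced_map Rs U Reg Reg "\<lambda>q g. dem (\<tau> q) \<otimes>\<^bsub>R\<^esub> g"
  by (intro balanced_map.intro VT.tensor_pair_axioms Reg_abelian balanced_map_axioms.intro)
    (simp_all add: Rs_carrier R.l_distr R.r_distr R.m_assoc \<tau>_closed \<tau>_add \<tau>_right dem_simps s_simps(1) del: tensor_bimod_simps(6))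

lemma Btw0_bimodule: "graded_bimodule R R Btw0"
  by (rule tensor_graded_bimodule(1)[OF U_bimodule Reg_bimodule(3)])

lemma odd_B_tw_bimodule: "graded_bimodule R R (odd_B_tw k)"
  unfolding odd_B_tw_def by (rule graded_bimodule_gr_shift[OF Btw0_bimodule])

interpretation Btw0: graded_bimodule R R Btw0 by (rule Btw0_bimodule)

lemma odd_B_tw_simps [simp]:
  "carrier (odd_B_tw k) = carrier VT.T" "\<zero>\<^bsub>odd_B_tw k\<^esub> = \<zero>\<^bsub>VT.T\<^esub>" "add (odd_B_tw k) = add VT.T"
  "smult (odd_B_tw k) = smult VT.T" "gr_part (odd_B_tw k) i = gr_part VT.T (i + 1)" "rsmult (odd_B_tw k) = rsmult Btw0"
  by (simp_all add: odd_B_tw_def)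

lemma rsmult_V_pure:
  "\<lbrakk>q \<in> carrier UT.T; g \<in> carrier R; a \<in> carrier R\<rbrakk> \<Longrightarrow> rsmult Btw0 (VT.pure q g) a = VT.pure q (g \<otimes>\<^bsub>R\<^esub> a)"
  using tensor_rsmult_pure[OF U_bimodule Reg_bimodule(3), of q g a] by (simp del: tensor_bimod_simps(6))

lemma rsmult_V:
  "\<lbrakk>X \<in> carrier VT.T; a \<in> carrier R\<rbrakk> \<Longrightarrow> rsmult Btw0 X a \<in> carrier VT.T"
  "\<lbrakk>X \<in> carrier VT.T; Y \<in> carrier VT.T; a \<in> carrier R\<rbrakk> \<Longrightarrow>
     rsmult Btw0 (X \<oplus>\<^bsub>VT.T\<^esub> Y) a = rsmult Btw0 X a \<oplus>\<^bsub>VT.T\<^esub> rsmult Btw0 Y a"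
  "\<lbrakk>X \<in> carrier VT.T; a \<in> carrier R; b \<in> carrier R\<rbrakk> \<Longrightarrow>
     rsmult Btw0 X (a \<oplus>\<^bsub>R\<^esub> b) = rsmult Btw0 X a \<oplus>\<^bsub>VT.T\<^esub> rsmult Btw0 X b"
  using Btw0.rsmult_closed[of X a] Btw0.rsmult_l_distr[of X Y a] Btw0.rsmult_r_distr[of X a b] by (simp_all del: tensor_bimod_simps(6))

abbreviation "Btw_one \<equiv> VT.pure (UT.pure \<one>\<^bsub>R\<^esub> \<one>\<^bsub>R\<^esub>) \<one>\<^bsub>R\<^esub>"
abbreviation "Btw_Delta \<equiv> \<ominus>\<^bsub>VT.T\<^esub> VT.pure (UT.pure x2 \<one>\<^bsub>R\<^esub>) \<one>\<^bsub>R\<^esub> \<oplus>\<^bsub>VT.T\<^esub>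
  \<ominus>\<^bsub>VT.T\<^esub> VT.pure (UT.pure \<one>\<^bsub>R\<^esub> \<one>\<^bsub>R\<^esub>) x1"

lemma U_pure_closed: "\<lbrakk>f \<in> carrier R; c \<in> carrier Rs\<rbrakk> \<Longrightarrow> UT.pure f c \<in> carrier UT.T"
  by (rule UT.pure_closed) simp_all

lemma V_pure_closed: "\<lbrakk>q \<in> carrier UT.T; g \<in> carrier R\<rbrakk> \<Longrightarrow> VT.pure q g \<in> carrier VT.T"
  by (rule VT.pure_closed) simp_all

lemma rsmult_Btw_one: "a \<in> carrier R \<Longrightarrow> rsmult Btw0 Btw_one a = VT.pure (UT.pure \<one>\<^bsub>R\<^esub> \<one>\<^bsub>R\<^esub>) a"
  using rsmult_V_pure[of "UT.pure \<one>\<^bsub>R\<^esub> \<one>\<^bsub>R\<^esub>" "\<one>\<^bsub>R\<^esub>" a] U_pure_closed Rs_closed(6) by (simp del: tensor_bimod_simps(6))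

lemma V_pure_minus: "\<lbrakk>q \<in> carrier UT.T; g \<in> carrier R\<rbrakk> \<Longrightarrow> \<ominus>\<^bsub>VT.T\<^esub> VT.pure q g = VT.pure q (\<ominus>\<^bsub>R\<^esub> g)"
  using VT.pure_minus_right[of q g] by simp

lemma rsmult_Btw_Delta:
  assumes "a \<in> carrier R"
  shows "rsmult Btw0 Btw_Delta a = VT.pure (UT.pure x2 \<one>\<^bsub>R\<^esub>) (\<ominus>\<^bsub>R\<^esub> a) \<oplus>\<^bsub>VT.T\<^esub>
    VT.pure (UT.pure \<one>\<^bsub>R\<^esub> \<one>\<^bsub>R\<^esub>) (\<ominus>\<^bsub>R\<^esub> (x1 \<otimes>\<^bsub>R\<^esub> a))"
proof -
  have c: "UT.pure x2 \<one>\<^bsub>R\<^esub> \<in> carrier UT.T" "UT.pure \<one>\<^bsub>R\<^esub> \<one>\<^bsub>R\<^esub> \<in> carrier UT.T"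
    using U_pure_closed Rs_closed(6) by simp_all
  show ?thesis
    using assms c by (simp add: V_pure_minus V_pure_closed rsmult_V rsmult_V_pure R.l_minus del: tensor_bimod_simps(6))
qed

text \<open>
  As for \<open>B\<close>, but with \<open>s f\<close> written as \<open>a + x\<^sub>1 b\<close>, where \<open>b = \<partial>(s f)\<close> and \<open>a = s f - x\<^sub>1 b\<close> are invariant. Moving an invariant
  element across the middle factor applies \<open>s\<close> to it, and \<open>s(a) - x\<^sub>2 s(b) = f\<close>, as \<open>s\<close> is an involution. The second basis
  element is therefore \<open>\<Delta>(1)\<close>, with \<open>- x\<^sub>2\<close> on the left and \<open>- x\<^sub>1\<close> on the right.
\<close>

lemma Btw_expand_pure:
  assumes f: "f \<in> carrier R" and c: "c \<in> carrier Rs" and g: "g \<in> carrier R"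
  shows "rsmult Btw0 Btw_one (\<tau> (UT.pure f c) \<otimes>\<^bsub>R\<^esub> g) \<oplus>\<^bsub>VT.T\<^esub> rsmult Btw0 Btw_Delta (dem (\<tau> (UT.pure f c)) \<otimes>\<^bsub>R\<^esub> g)
    = VT.pure (UT.pure f c) g"
proof -
  let ?b = "dem (s f)"
  let ?a = "s f \<oplus>\<^bsub>R\<^esub> \<ominus>\<^bsub>R\<^esub> (x1 \<otimes>\<^bsub>R\<^esub> ?b)"
  let ?e = "UT.pure \<one>\<^bsub>R\<^esub> \<one>\<^bsub>R\<^esub>" and ?x = "UT.pure x2 \<one>\<^bsub>R\<^esub>"
  have cR: "c \<in> carrier R" and dc: "dem c = \<zero>\<^bsub>R\<^esub>" using c by (simp_all add: Rs_carrier)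
  have sf: "s f \<in> carrier R" using f by (simp add: s_simps(1))
  have b: "?b \<in> carrier Rs" "?b \<in> carrier R" "s ?b \<in> carrier Rs" "s ?b \<in> carrier R"
    using sf Rs_closed(8) Rs_closed(2) Rs_closed(1) by blast+
  have a: "?a \<in> carrier Rs"
    using sf b by (simp add: Rs_carrier dem_simps(1-9) s_simps(1) R.r_neg)
  have aR: "?a \<in> carrier R" using a by (rule Rs_closed(1))
  have e: "?e \<in> carrier UT.T" "?x \<in> carrier UT.T" using U_pure_closed Rs_closed(6) by simp_all
  have t: "\<tau> (UT.pure f c) = s f \<otimes>\<^bsub>R\<^esub> c" by (rule \<tau>_pure[OF f c])
  have dt: "dem (s f \<otimes>\<^bsub>R\<^esub> c) = ?b \<otimes>\<^bsub>R\<^esub> c" using sf cR b dc by (simp add: dem_simps(3) s_simps(1))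
  have ac: "?a \<otimes>\<^bsub>R\<^esub> c \<in> carrier Rs" "?b \<otimes>\<^bsub>R\<^esub> c \<in> carrier Rs" using Rs_closed(4)[OF a c] Rs_closed(4)[OF b(1) c] by simp_all
  have sa: "s ?a \<in> carrier Rs" "s ?a \<in> carrier R" using Rs_closed(1,2) a by blast+
  have 1: "VT.pure ?e (?a \<otimes>\<^bsub>R\<^esub> c \<otimes>\<^bsub>R\<^esub> g) = VT.pure (UT.pure (s ?a) c) g"
  proof -
    have "VT.pure ?e (?a \<otimes>\<^bsub>R\<^esub> c \<otimes>\<^bsub>R\<^esub> g) = VT.pure (rsmult U ?e (?a \<otimes>\<^bsub>R\<^esub> c)) g"
      using VT.pure_balanced[of ?e "?a \<otimes>\<^bsub>R\<^esub> c" g] e ac g by (simp del: tensor_bimod_simps(6))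
    also have "rsmult U ?e (?a \<otimes>\<^bsub>R\<^esub> c) = UT.pure \<one>\<^bsub>R\<^esub> (?a \<otimes>\<^bsub>R\<^esub> c)"
      using rsmult_U_pure[of "\<one>\<^bsub>R\<^esub>" "\<one>\<^bsub>R\<^esub>" "?a \<otimes>\<^bsub>R\<^esub> c"] Rs_closed(1)[OF ac(1)] Rs_closed(6) ac(1) by simp
    also have "\<dots> = UT.pure \<one>\<^bsub>R\<^esub> (s ?a \<odot>\<^bsub>Tw\<^esub> c)" using s_simps(9)[OF aR] by simp
    also have "\<dots> = UT.pure (s ?a) c"
      using UT.pure_balanced[of "\<one>\<^bsub>R\<^esub>" "s ?a" c] sa c by simp
    finally show ?thesis .
  qed
  have 2: "VT.pure ?x (\<ominus>\<^bsub>R\<^esub> (?b \<otimes>\<^bsub>R\<^esub> c \<otimes>\<^bsub>R\<^esub> g)) = VT.pure (UT.pure (\<ominus>\<^bsub>R\<^esub> (x2 \<otimes>\<^bsub>R\<^esub> s ?b)) c) g"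
  proof -
    have nb: "\<ominus>\<^bsub>R\<^esub> ?b \<otimes>\<^bsub>R\<^esub> c \<in> carrier Rs" using Rs_closed(4)[OF Rs_closed(5)[OF b(1)] c] .
    have "VT.pure ?x (\<ominus>\<^bsub>R\<^esub> (?b \<otimes>\<^bsub>R\<^esub> c \<otimes>\<^bsub>R\<^esub> g)) = VT.pure (rsmult U ?x (\<ominus>\<^bsub>R\<^esub> ?b \<otimes>\<^bsub>R\<^esub> c)) g"
      using VT.pure_balanced[of ?x "\<ominus>\<^bsub>R\<^esub> ?b \<otimes>\<^bsub>R\<^esub> c" g] e nb g b cR by (simp add: R.l_minus del: tensor_bimod_simps(6))
    also have "rsmult U ?x (\<ominus>\<^bsub>R\<^esub> ?b \<otimes>\<^bsub>R\<^esub> c) = UT.pure x2 (\<ominus>\<^bsub>R\<^esub> ?b \<otimes>\<^bsub>R\<^esub> c)"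
      using rsmult_U_pure[of x2 "\<one>\<^bsub>R\<^esub>" "\<ominus>\<^bsub>R\<^esub> ?b \<otimes>\<^bsub>R\<^esub> c"] Rs_closed(1)[OF nb] Rs_closed(6) nb by simp
    also have "\<dots> = UT.pure x2 ((\<ominus>\<^bsub>R\<^esub> s ?b) \<odot>\<^bsub>Tw\<^esub> c)" using s_simps(9)[OF b(2)] s_simps(4)[OF b(4)] by simp
    also have "\<dots> = UT.pure (x2 \<otimes>\<^bsub>R\<^esub> \<ominus>\<^bsub>R\<^esub> s ?b) c"
      using UT.pure_balanced[of x2 "\<ominus>\<^bsub>R\<^esub> s ?b" c] Rs_closed(5)[OF b(3)] c by simp
    also have "x2 \<otimes>\<^bsub>R\<^esub> \<ominus>\<^bsub>R\<^esub> s ?b = \<ominus>\<^bsub>R\<^esub> (x2 \<otimes>\<^bsub>R\<^esub> s ?b)" using b by (simp add: R.r_minus)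
    finally show ?thesis .
  qed
  have sum: "s ?a \<oplus>\<^bsub>R\<^esub> \<ominus>\<^bsub>R\<^esub> (x2 \<otimes>\<^bsub>R\<^esub> s ?b) = f"
    using f sf b by (simp add: s_simps R.l_minus R.a_assoc R.r_neg)
  have "rsmult Btw0 Btw_one (s f \<otimes>\<^bsub>R\<^esub> c \<otimes>\<^bsub>R\<^esub> g) \<oplus>\<^bsub>VT.T\<^esub> rsmult Btw0 Btw_Delta (?b \<otimes>\<^bsub>R\<^esub> c \<otimes>\<^bsub>R\<^esub> g)
    = VT.pure ?e (s f \<otimes>\<^bsub>R\<^esub> c \<otimes>\<^bsub>R\<^esub> g) \<oplus>\<^bsub>VT.T\<^esub> (VT.pure ?x (\<ominus>\<^bsub>R\<^esub> (?b \<otimes>\<^bsub>R\<^esub> c \<otimes>\<^bsub>R\<^esub> g)) \<oplus>\<^bsub>VT.T\<^esub>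
       VT.pure ?e (\<ominus>\<^bsub>R\<^esub> (x1 \<otimes>\<^bsub>R\<^esub> (?b \<otimes>\<^bsub>R\<^esub> c \<otimes>\<^bsub>R\<^esub> g))))"
    using sf cR g b by (simp add: rsmult_Btw_one rsmult_Btw_Delta del: tensor_bimod_simps(6))
  also have "\<dots> = (VT.pure ?e (s f \<otimes>\<^bsub>R\<^esub> c \<otimes>\<^bsub>R\<^esub> g) \<oplus>\<^bsub>VT.T\<^esub> VT.pure ?e (\<ominus>\<^bsub>R\<^esub> (x1 \<otimes>\<^bsub>R\<^esub> (?b \<otimes>\<^bsub>R\<^esub> c \<otimes>\<^bsub>R\<^esub> g))))
      \<oplus>\<^bsub>VT.T\<^esub> VT.pure ?x (\<ominus>\<^bsub>R\<^esub> (?b \<otimes>\<^bsub>R\<^esub> c \<otimes>\<^bsub>R\<^esub> g))"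
    using sf cR g b e by (simp add: V_pure_closed VT.T.a_ac)
  also have "VT.pure ?e (s f \<otimes>\<^bsub>R\<^esub> c \<otimes>\<^bsub>R\<^esub> g) \<oplus>\<^bsub>VT.T\<^esub> VT.pure ?e (\<ominus>\<^bsub>R\<^esub> (x1 \<otimes>\<^bsub>R\<^esub> (?b \<otimes>\<^bsub>R\<^esub> c \<otimes>\<^bsub>R\<^esub> g)))
      = VT.pure ?e (?a \<otimes>\<^bsub>R\<^esub> c \<otimes>\<^bsub>R\<^esub> g)"
    using VT.pure_add_right[of ?e "s f \<otimes>\<^bsub>R\<^esub> c \<otimes>\<^bsub>R\<^esub> g" "\<ominus>\<^bsub>R\<^esub> (x1 \<otimes>\<^bsub>R\<^esub> (?b \<otimes>\<^bsub>R\<^esub> c \<otimes>\<^bsub>R\<^esub> g))"] sf cR g b e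
    by (simp add: R.l_distr R.l_minus R.m_assoc)
  also have "VT.pure ?e (?a \<otimes>\<^bsub>R\<^esub> c \<otimes>\<^bsub>R\<^esub> g) \<oplus>\<^bsub>VT.T\<^esub> VT.pure ?x (\<ominus>\<^bsub>R\<^esub> (?b \<otimes>\<^bsub>R\<^esub> c \<otimes>\<^bsub>R\<^esub> g))
      = VT.pure (UT.pure (s ?a) c) g \<oplus>\<^bsub>VT.T\<^esub> VT.pure (UT.pure (\<ominus>\<^bsub>R\<^esub> (x2 \<otimes>\<^bsub>R\<^esub> s ?b)) c) g"
    unfolding 1 2 ..
  also have "\<dots> = VT.pure (UT.pure (s ?a) c \<oplus>\<^bsub>UT.T\<^esub> UT.pure (\<ominus>\<^bsub>R\<^esub> (x2 \<otimes>\<^bsub>R\<^esub> s ?b)) c) g"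
    using VT.pure_add_left[of "UT.pure (s ?a) c" "UT.pure (\<ominus>\<^bsub>R\<^esub> (x2 \<otimes>\<^bsub>R\<^esub> s ?b)) c" g] g U_pure_closed[OF sa(2) c]
      U_pure_closed[OF _ c, of "\<ominus>\<^bsub>R\<^esub> (x2 \<otimes>\<^bsub>R\<^esub> s ?b)"] b by simp
  also have "UT.pure (s ?a) c \<oplus>\<^bsub>UT.T\<^esub> UT.pure (\<ominus>\<^bsub>R\<^esub> (x2 \<otimes>\<^bsub>R\<^esub> s ?b)) c = UT.pure (s ?a \<oplus>\<^bsub>R\<^esub> \<ominus>\<^bsub>R\<^esub> (x2 \<otimes>\<^bsub>R\<^esub> s ?b)) c"
    using UT.pure_add_left[of "s ?a" "\<ominus>\<^bsub>R\<^esub> (x2 \<otimes>\<^bsub>R\<^esub> s ?b)" c] sa b c by simp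
  finally show ?thesis unfolding sum t dt .
qed

lemma t_closed: "X \<in> carrier VT.T \<Longrightarrow> t0 X \<in> carrier R" "X \<in> carrier VT.T \<Longrightarrow> t1 X \<in> carrier R"
  using t0.lift_closed t1.lift_closed by simp_all

lemma t_add:
  "\<lbrakk>X \<in> carrier VT.T; Y \<in> carrier VT.T\<rbrakk> \<Longrightarrow> t0 (X \<oplus>\<^bsub>VT.T\<^esub> Y) = t0 X \<oplus>\<^bsub>R\<^esub> t0 Y"
  "\<lbrakk>X \<in> carrier VT.T; Y \<in> carrier VT.T\<rbrakk> \<Longrightarrow> t1 (X \<oplus>\<^bsub>VT.T\<^esub> Y) = t1 X \<oplus>\<^bsub>R\<^esub> t1 Y"
  using t0.lift_add t1.lift_add by simp_all

lemma t_pure: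
  "\<lbrakk>q \<in> carrier UT.T; g \<in> carrier R\<rbrakk> \<Longrightarrow> t0 (VT.pure q g) = \<tau> q \<otimes>\<^bsub>R\<^esub> g"
  "\<lbrakk>q \<in> carrier UT.T; g \<in> carrier R\<rbrakk> \<Longrightarrow> t1 (VT.pure q g) = dem (\<tau> q) \<otimes>\<^bsub>R\<^esub> g"
  using t0.lift_pure t1.lift_pure by simp_all

lemma Btw_elements: "Btw_one \<in> carrier VT.T" "Btw_Delta \<in> carrier VT.T"
  using U_pure_closed Rs_closed(6) V_pure_closed by simp_all

lemma Btw_expand:
  assumes "X \<in> carrier VT.T"
  shows "X = rsmult Btw0 Btw_one (t0 X) \<oplus>\<^bsub>VT.T\<^esub> rsmult Btw0 Btw_Delta (t1 X)"
proof -
  note e = Btw_elements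
  have "(\<lambda>X. rsmult Btw0 Btw_one (t0 X) \<oplus>\<^bsub>VT.T\<^esub> rsmult Btw0 Btw_Delta (t1 X)) X = (\<lambda>X. X) X"
  proof (rule VT.additive_eq[OF assms VT.tensor_abelian_group])
    fix q g assume "q \<in> carrier U" "g \<in> carrier Reg"
    hence q: "q \<in> carrier UT.T" and g: "g \<in> carrier R" by simp_all
    have "(\<lambda>q. rsmult Btw0 Btw_one (\<tau> q \<otimes>\<^bsub>R\<^esub> g) \<oplus>\<^bsub>VT.T\<^esub> rsmult Btw0 Btw_Delta (dem (\<tau> q) \<otimes>\<^bsub>R\<^esub> g)) q = (\<lambda>q. VT.pure q g) q"
    proof (rule UT.additive_eq[OF q VT.tensor_abelian_group])
      show "VT.pure (X \<oplus>\<^bsub>UT.T\<^esub> Y) g = VT.pure X g \<oplus>\<^bsub>VT.T\<^esub> VT.pure Y g" if "X \<in> carrier UT.T" "Y \<in> carrier UT.T" for X Y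
        using VT.pure_add_left[of X Y g] that g by simp
    qed (use g e in \<open>simp_all add: rsmult_V \<tau>_closed \<tau>_add dem_simps(1,2) R.l_distr VT.T.a_ac V_pure_closed Btw_expand_pure
        del: tensor_bimod_simps(6)\<close>)
    thus "rsmult Btw0 Btw_one (t0 (VT.pure q g)) \<oplus>\<^bsub>VT.T\<^esub> rsmult Btw0 Btw_Delta (t1 (VT.pure q g)) = VT.pure q g"
      unfolding t_pure[OF q g] .
  qed (use e in \<open>simp_all add: rsmult_V t_closed t_add VT.T.a_ac del: tensor_bimod_simps(6)\<close>)
  thus ?thesis by simp
qed

lemma Btw_left:
  assumes "a \<in> carrier R" "X \<in> carrier VT.T"
  shows "t0 (a \<odot>\<^bsub>VT.T\<^esub> X) = s a \<otimes>\<^bsub>R\<^esub> t0 X"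
    and "t1 (a \<odot>\<^bsub>VT.T\<^esub> X) = dem (s a) \<otimes>\<^bsub>R\<^esub> t0 X \<oplus>\<^bsub>R\<^esub> a \<otimes>\<^bsub>R\<^esub> t1 X"
proof -
  have sa: "s a \<in> carrier R" "dem (s a) \<in> carrier R" using assms(1) s_simps(1) dem_simps(1) by simp_all
  have q: "a \<odot>\<^bsub>UT.T\<^esub> q \<in> carrier UT.T" if "q \<in> carrier UT.T" for q
    by (rule UT.smult_tensor_closed[OF assms(1) that])
  show "t0 (a \<odot>\<^bsub>VT.T\<^esub> X) = s a \<otimes>\<^bsub>R\<^esub> t0 X"
    by (rule VT.additive_eq[OF assms(2) R.abelian_group_axioms])
      (use assms(1) sa q in \<open>simp_all add: VT.smult_tensor_closed VT.smult_tensor_add VT.smult_pure t_closed t_add t_pure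
        \<tau>_left \<tau>_closed R.r_distr R.m_assoc\<close>)
  show "t1 (a \<odot>\<^bsub>VT.T\<^esub> X) = dem (s a) \<otimes>\<^bsub>R\<^esub> t0 X \<oplus>\<^bsub>R\<^esub> a \<otimes>\<^bsub>R\<^esub> t1 X"
    by (rule VT.additive_eq[OF assms(2) R.abelian_group_axioms])
      (use assms(1) sa q in \<open>simp_all add: VT.smult_tensor_closed VT.smult_tensor_add VT.smult_pure t_closed t_add t_pure
        \<tau>_left \<tau>_closed R.l_distr R.r_distr R.m_assoc R.a_ac dem_simps(1,3) s_simps(9)\<close>)
qed

lemma Btw_right:
  assumes "a \<in> carrier R" "X \<in> carrier VT.T"
  shows "t0 (rsmult Btw0 X a) = t0 X \<otimes>\<^bsub>R\<^esub> a" and "t1 (rsmult Btw0 X a) = t1 X \<otimes>\<^bsub>R\<^esub> a"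
proof -
  show "t0 (rsmult Btw0 X a) = t0 X \<otimes>\<^bsub>R\<^esub> a"
    by (rule VT.additive_eq[OF assms(2) R.abelian_group_axioms])
      (use assms(1) in \<open>simp_all add: rsmult_V rsmult_V_pure t_closed t_add t_pure \<tau>_closed R.l_distr R.m_assoc
        del: tensor_bimod_simps(6)\<close>)
  show "t1 (rsmult Btw0 X a) = t1 X \<otimes>\<^bsub>R\<^esub> a"
    by (rule VT.additive_eq[OF assms(2) R.abelian_group_axioms])
      (use assms(1) in \<open>simp_all add: rsmult_V rsmult_V_pure t_closed t_add t_pure \<tau>_closed dem_simps(1) R.l_distr R.m_assoc
        del: tensor_bimod_simps(6)\<close>)
qed

lemma Btw_deg:
  assumes "X \<in> gr_part VT.T n"
  shows "t0 X \<in> deg_part R n" "t1 X \<in> deg_part R (n - 2)"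
proof -
  show "t0 X \<in> deg_part R n"
    using t0.lift_gr_part[where d = 0, OF VT.gr_sub Reg_gr_subgroup _ assms] by (simp add: deg_part_mult \<tau>_deg)
  have "dem (\<tau> q) \<otimes>\<^bsub>R\<^esub> g \<in> gr_part Reg (i + j - 2)" if "q \<in> gr_part U i" "g \<in> gr_part Reg j" for q g i j
    using deg_part_mult[OF dem_deg[OF \<tau>_deg[of q i]], of g j] that by (simp add: algebra_simps)
  thus "t1 X \<in> deg_part R (n - 2)"
    using t1.lift_gr_part[where d = 2, OF VT.gr_sub Reg_gr_subgroup _ assms] by simp
qed

lemma Btw_triangular_basis: "triangular_basis s (odd_B_tw k) Btw_one Btw_Delta t0 t1"
  unfolding triangular_basis_def
proof (intro conjI ballI)
  have u: "UT.pure x2 \<one>\<^bsub>R\<^esub> \<in> gr_part U 2" "UT.pure \<one>\<^bsub>R\<^esub> \<one>\<^bsub>R\<^esub> \<in> gr_part U 0"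
    using UT.gr_part_pure[of x2 2 "\<one>\<^bsub>R\<^esub>" 0] UT.gr_part_pure[of "\<one>\<^bsub>R\<^esub>" 0 "\<one>\<^bsub>R\<^esub>" 0]
    by (simp_all add: deg_part_one odd_x_deg dem_simps(5))
  have c: "UT.pure x2 \<one>\<^bsub>R\<^esub> \<in> carrier UT.T" "UT.pure \<one>\<^bsub>R\<^esub> \<one>\<^bsub>R\<^esub> \<in> carrier UT.T"
    using U_pure_closed Rs_closed(6) by simp_all
  show "right_basis2 R R (odd_B_tw k) Btw_one Btw_Delta t0 t1 (-1) 1"
  proof (intro right_basis2.intro right_basis2_axioms.intro odd_B_tw_bimodule, goal_cases)
    case 1 show ?case using Btw_elements by simp
  next
    case 2 show ?case using Btw_elements by simp
  next
    case 3
    show ?case using VT.gr_part_pure[OF u(2), of "\<one>\<^bsub>R\<^esub>" 0] by (simp add: deg_part_one)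
  next
    case 4
    interpret T: pregraded_module R VT.T by (rule VT.tensor_pregraded)
    have "VT.pure (UT.pure x2 \<one>\<^bsub>R\<^esub>) \<one>\<^bsub>R\<^esub> \<in> gr_part VT.T 2" "VT.pure (UT.pure \<one>\<^bsub>R\<^esub> \<one>\<^bsub>R\<^esub>) x1 \<in> gr_part VT.T 2"
      using VT.gr_part_pure[OF u(1), of "\<one>\<^bsub>R\<^esub>" 0] VT.gr_part_pure[OF u(2), of x1 2]
      by (simp_all add: deg_part_one odd_x_deg)
    then show ?case by (simp add: T.gr_part_add T.gr_part_minus)
  next
    case (12 X i)
    then show ?case using Btw_deg(2)[of X "i + 1"] by simp
  next
    case (17 X)
    then show ?case using Btw_expand[of X] by (simp del: tensor_bimod_simps(6))
  qed (use Btw_deg(1) c Rs_closed(6) in \<open>simp_all add: t_closed t_add t_pure V_pure_closed V_pure_minus \<tau>_pure Btw_right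
      dem_simps s_simps R.l_neg R.r_neg R.l_minus R.r_minus R.minus_minus del: tensor_bimod_simps(6)\<close>)
qed (simp_all add: Btw_left s_simps(9))

subsection \<open>The two bimodule maps in coordinates\<close>

text \<open>
  A bimodule map is determined by its values on pure tensors, and the first coordinate has the required ones.
\<close>

lemma odd_m_eq:
  assumes "X \<in> carrier (odd_B k)"
  shows "odd_m k X = b0 X"
proof -
  have b: "right_basis2 R R (odd_B k) B_one B_comm b0 b1 (-1) 1"
    using B_triangular_basis by (simp add: triangular_basis_def)
  note bD = right_basis2.coord_closed(1)[OF b] right_basis2.coord_add(1)[OF b] right_basis2.coord_right(1)[OF b]
    right_basis2.coord_deg(1)[OF b]
  have "odd_m k = restrict b0 (carrier (odd_B k))"
    unfolding odd_m_def
  proof (rule the_equality, goal_cases)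
    case 1
    interpret B: graded_bimodule R R "odd_B k" by (rule odd_B_bimodule)
    have hom: "restrict b0 (carrier (odd_B k)) \<in> gbimod_hom R (odd_B k) (gr_shift (-1) Reg)"
      unfolding gbimod_hom_eq bimod_hom_def
    proof (intro CollectI conjI ballI gmod_homI)
      show "restrict b0 (carrier (odd_B k)) X \<in> gr_part (gr_shift (-1) Reg) i" if "X \<in> gr_part (odd_B k) i" for i X
        using bD(4)[OF that] B.gr_part_closed[OF that] by simp
    qed (use bD B.M.a_closed B.smult_closed B.rsmult_closed B_left(1) in simp_all)
    show ?case using hom b0.lift_pure by (simp add: pureB_eq)
  next
    case (2 m)
    hence m: "m \<in> extensional (carrier (odd_B k))" "m \<in> gmod_hom R (odd_B k) (gr_shift (-1) Reg)"
      "\<And>f g. \<lbrakk>f \<in> carrier R; g \<in> carrier R\<rbrakk> \<Longrightarrow> m (BT.pure f g) = f \<otimes>\<^bsub>R\<^esub> g"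
      by (auto simp: pureB_eq gbimod_hom_def)
    have "m X = b0 X" if "X \<in> carrier BT.T" for X
      by (rule BT.additive_eq[OF that Reg_abelian])
        (use gmod_homD(1,2)[OF m(2)] m(3) in \<open>simp_all add: b0.lift_closed[simplified] b0.lift_add[simplified] b0.lift_pure[simplified]\<close>)
    thus ?case by (intro extensionalityI[OF m(1) restrict_extensional]) simp
  qed
  thus ?thesis using assms by simp
qed

lemma odd_m_hom: "odd_m k \<in> bimod_hom R R (odd_B k) (gr_shift (-1) Reg)"
proof -
  have b: "right_basis2 R R (odd_B k) B_one B_comm b0 b1 (-1) 1"
    using B_triangular_basis by (simp add: triangular_basis_def)
  note bD = right_basis2.coord_closed(1)[OF b] right_basis2.coord_add(1)[OF b] right_basis2.coord_right(1)[OF b]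
    right_basis2.coord_deg(1)[OF b]
  interpret B: graded_bimodule R R "odd_B k" by (rule odd_B_bimodule)
  show ?thesis
    unfolding bimod_hom_def
  proof (intro CollectI conjI ballI gmod_homI)
    show "odd_m k X \<in> gr_part (gr_shift (-1) Reg) i" if "X \<in> gr_part (odd_B k) i" for i X
      using bD(4)[OF that] odd_m_eq[OF B.gr_part_closed[OF that]] by simp
  qed (use bD B.M.a_closed B.smult_closed B.rsmult_closed B_left(1) in \<open>simp_all add: odd_m_eq\<close>)
qed

text \<open>
  Right multiples of the second basis element form a subbimodule: the coordinates of \<open>a \<Delta>(1) r\<close> are \<open>0\<close> and \<open>s(s(a)) r = a r\<close>,
  by triangularity, so that \<open>a \<Delta>(1) = \<Delta>(1) a\<close>.
\<close>

lemma Delta_hom: "(\<lambda>r. rsmult (odd_B_tw k) Btw_Delta r) \<in> bimod_hom R R (gr_shift 1 Reg) (odd_B_tw k)"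
proof -
  have t: "right_basis2 R R (odd_B_tw k) Btw_one Btw_Delta t0 t1 (-1) 1"
    using Btw_triangular_basis by (simp add: triangular_basis_def)
  interpret B: right_basis2 R R "odd_B_tw k" Btw_one Btw_Delta t0 t1 "-1" 1 by (rule t)
  have left: "rsmult (odd_B_tw k) Btw_Delta (a \<otimes>\<^bsub>R\<^esub> r) = a \<odot>\<^bsub>odd_B_tw k\<^esub> rsmult (odd_B_tw k) Btw_Delta r"
    if a: "a \<in> carrier R" and r: "r \<in> carrier R" for a r
  proof -
    have c: "rsmult (odd_B_tw k) Btw_Delta r \<in> carrier (odd_B_tw k)"
      by (rule B.rsmult_closed[OF B.basis_closed(2) r])
    let ?X = "a \<odot>\<^bsub>odd_B_tw k\<^esub> rsmult (odd_B_tw k) Btw_Delta r"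
    have X: "?X \<in> carrier (odd_B_tw k)" by (rule B.smult_closed[OF a c])
    have "t0 (rsmult (odd_B_tw k) Btw_Delta r) = \<zero>\<^bsub>R\<^esub>" "t1 (rsmult (odd_B_tw k) Btw_Delta r) = r"
      using B.coord_right[OF B.basis_closed(2) r] r by (simp_all add: B.coord_basis)
    hence "t0 ?X = \<zero>\<^bsub>R\<^esub>" "t1 ?X = a \<otimes>\<^bsub>R\<^esub> r"
      using Btw_left[OF a, of "rsmult (odd_B_tw k) Btw_Delta r"] c a r
      by (simp_all add: s_simps(1) dem_simps(1) del: tensor_bimod_simps(6))
    hence "?X = rsmult (odd_B_tw k) Btw_one \<zero>\<^bsub>R\<^esub> \<oplus>\<^bsub>odd_B_tw k\<^esub> rsmult (odd_B_tw k) Btw_Delta (a \<otimes>\<^bsub>R\<^esub> r)"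
      using B.coord_expand[OF X] by metis
    moreover have "rsmult (odd_B_tw k) Btw_one \<zero>\<^bsub>R\<^esub> = \<zero>\<^bsub>odd_B_tw k\<^esub>"
      using B.rsmult_r_distr[OF B.basis_closed(1) R.zero_closed R.zero_closed]
        B.rsmult_closed[OF B.basis_closed(1) R.zero_closed] by (simp add: B.M.add.l_cancel_one' del: odd_B_tw_simps)
    ultimately show ?thesis
      using B.rsmult_closed[OF B.basis_closed(2), of "a \<otimes>\<^bsub>R\<^esub> r"] a r by (simp del: odd_B_tw_simps)
  qed
  show ?thesis
    unfolding bimod_hom_def
  proof (intro CollectI conjI ballI gmod_homI)
    show "rsmult (odd_B_tw k) Btw_Delta r \<in> gr_part (odd_B_tw k) i" if "r \<in> gr_part (gr_shift 1 Reg) i" for r i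
      using B.gr_part_rsmult[OF B.basis_deg(2), of r "i - 1"] that by (simp del: odd_B_tw_simps)
    show "rsmult (odd_B_tw k) Btw_Delta (rsmult (gr_shift 1 Reg) r a) = rsmult (odd_B_tw k) (rsmult (odd_B_tw k) Btw_Delta r) a"
      if "r \<in> carrier (gr_shift 1 Reg)" "a \<in> carrier R" for r a
      using B.rsmult_assoc[OF B.basis_closed(2), of r a] that by (simp del: odd_B_tw_simps)
  qed (use B.rsmult_closed[OF B.basis_closed(2)] B.rsmult_r_distr[OF B.basis_closed(2)] left in \<open>simp_all del: odd_B_tw_simps\<close>)
qed

lemma odd_Delta_eq:
  assumes "r \<in> carrier R"
  shows "odd_Delta k r = rsmult (odd_B_tw k) Btw_Delta r"
proof -
  interpret B: graded_bimodule R R "odd_B_tw k" by (rule odd_B_tw_bimodule)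
  have B1: "(\<ominus>\<^bsub>odd_B_tw k\<^esub> odd_B_tw_pure k x2 \<one>\<^bsub>R\<^esub> \<one>\<^bsub>R\<^esub>) \<ominus>\<^bsub>odd_B_tw k\<^esub> odd_B_tw_pure k \<one>\<^bsub>R\<^esub> \<one>\<^bsub>R\<^esub> x1 = Btw_Delta"
    by (simp add: B.M.minus_eq odd_B_tw_pure_def a_inv_cong[of "odd_B_tw k" VT.T])
  have D: "Btw_Delta \<in> carrier (odd_B_tw k)" using Btw_elements by simp
  have "odd_Delta k = restrict (\<lambda>r. rsmult (odd_B_tw k) Btw_Delta r) (carrier R)"
    unfolding odd_Delta_def B1
  proof (rule the_equality, goal_cases)
    case 1
    have "restrict (\<lambda>r. rsmult (odd_B_tw k) Btw_Delta r) (carrier R) \<in> gbimod_hom R (gr_shift 1 Reg) (odd_B_tw k)"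
      using Delta_hom deg_part_closed unfolding gbimod_hom_eq bimod_hom_def gmod_hom_def
      by (auto simp: image_subset_iff simp del: odd_B_tw_simps)
    then show ?case using B.rsmult_one[OF D] by (simp del: odd_B_tw_simps)
  next
    case (2 \<Delta>)
    hence \<Delta>: "\<Delta> \<in> extensional (carrier R)" "\<Delta> \<one>\<^bsub>R\<^esub> = Btw_Delta"
      "\<And>r a. \<lbrakk>r \<in> carrier R; a \<in> carrier R\<rbrakk> \<Longrightarrow> \<Delta> (r \<otimes>\<^bsub>R\<^esub> a) = rsmult (odd_B_tw k) (\<Delta> r) a"
      by (simp_all add: gbimod_hom_def del: odd_B_tw_simps)
    have "\<Delta> r = rsmult (odd_B_tw k) Btw_Delta r" if "r \<in> carrier R" for r
      using \<Delta>(3)[of "\<one>\<^bsub>R\<^esub>" r] \<Delta>(2) that by (simp del: odd_B_tw_simps)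
    thus ?case by (intro extensionalityI[OF \<Delta>(1) restrict_extensional]) simp
  qed
  thus ?thesis using assms by simp
qed

lemma odd_Delta_hom: "odd_Delta k \<in> bimod_hom R R (gr_shift 1 Reg) (odd_B_tw k)"
  using Delta_hom deg_part_closed odd_Delta_eq unfolding bimod_hom_def gmod_hom_def
  by (auto simp: image_subset_iff simp del: odd_B_tw_simps)

end

section \<open>Tensoring with a two-term complex is a functor\<close>

lemma signed_even: "even p \<Longrightarrow> signed M p x = x" "even p \<Longrightarrow> signed M (p + 1) x = \<ominus>\<^bsub>M\<^esub> x"
  and signed_odd: "odd p \<Longrightarrow> signed M p x = \<ominus>\<^bsub>M\<^esub> x" "odd p \<Longrightarrow> signed M (p + 1) x = x"
  by (simp_all add: signed_def)

lemma signed_hom: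
  assumes "pregraded_module R N" "f \<in> gmod_hom R M N"
  shows "(\<lambda>x. signed N i (f x)) \<in> gmod_hom R M N"
  using assms(2) gmod_hom_minus_map[OF assms] by (cases "even i") (simp_all add: signed_def)

text \<open>
  Tensor products with the two bimodules are assumed to preserve the direct sum decomposition of graded modules. This is
  where the bases of the bimodules enter. The carrier type of the modules is fixed by the type parameter.
\<close>

locale two_term_functor =
  fixes R :: "('r, 'x) gring_scheme" and T :: "('r, 'p, 'q) two_term"
  assumes fst_bimodule: "graded_bimodule R R (fst_bimod T)"
    and snd_bimodule: "graded_bimodule R R (snd_bimod T)"
    and two_map_hom: "two_map T \<in> bimod_hom R R (fst_bimod T) (snd_bimod T)"
    and fst_graded: "\<And>N :: ('r, 'm) gmod. graded_left_module R N \<Longrightarrow> graded_left_module R (tensor_mod R (fst_bimod T) N)"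
    and snd_graded: "\<And>N :: ('r, 'm) gmod. graded_left_module R N \<Longrightarrow> graded_left_module R (tensor_mod R (snd_bimod T) N)"
begin

abbreviation "p \<equiv> fst_deg T"
abbreviation "P \<equiv> fst_bimod T"
abbreviation "Q \<equiv> snd_bimod T"
abbreviation "mapP N g \<equiv> tensor_map R P N (\<lambda>t. t) g"
abbreviation "mapQ N g \<equiv> tensor_map R Q N (\<lambda>t. t) g"
abbreviation "mapF N \<equiv> tensor_map R Q N (two_map T) (\<lambda>x. x)"
abbreviation "TP N \<equiv> tensor_mod R P N"
abbreviation "TQ N \<equiv> tensor_mod R Q N"

text \<open>
  Objects, differential and maps, indexed by the degree \<open>j\<close> of \<open>X\<close> in the first summand. The total degree is \<open>j + p\<close>, and
  the offset \<open>p\<close> survives in the signs alone.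
\<close>

definition Ob :: "('r, 'm) cpx \<Rightarrow> int \<Rightarrow> ('r, ('p \<times> 'm \<Rightarrow>\<^sub>0 int) set \<times> ('q \<times> 'm \<Rightarrow>\<^sub>0 int) set) gmod" where
  "Ob X j = gmod_sum (TP (ob X j)) (TQ (ob X (j - 1)))"

definition Df :: "('r, 'm) cpx \<Rightarrow> int \<Rightarrow> ('p \<times> 'm \<Rightarrow>\<^sub>0 int) set \<times> ('q \<times> 'm \<Rightarrow>\<^sub>0 int) set \<Rightarrow>
    ('p \<times> 'm \<Rightarrow>\<^sub>0 int) set \<times> ('q \<times> 'm \<Rightarrow>\<^sub>0 int) set" where
  "Df X j = (\<lambda>(u, v). (signed (TP (ob X (j + 1))) p (mapP (ob X (j + 1)) (diff X j) u),
     mapF (ob X j) u \<oplus>\<^bsub>TQ (ob X j)\<^esub> signed (TQ (ob X j)) (p + 1) (mapQ (ob X j) (diff X (j - 1)) v)))"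

definition Mp :: "('r, 'm) cpx \<Rightarrow> (int \<Rightarrow> 'm \<Rightarrow> 'm) \<Rightarrow> int \<Rightarrow> ('p \<times> 'm \<Rightarrow>\<^sub>0 int) set \<times> ('q \<times> 'm \<Rightarrow>\<^sub>0 int) set \<Rightarrow>
    ('p \<times> 'm \<Rightarrow>\<^sub>0 int) set \<times> ('q \<times> 'm \<Rightarrow>\<^sub>0 int) set" where
  "Mp Y f j = (\<lambda>(u, v). (mapP (ob Y j) (f j) u, mapQ (ob Y (j - 1)) (f (j - 1)) v))"

lemma index_shift: "n + 1 - i = (n - i) + (1::int)" "n - 1 - i = (n - i) - (1::int)"
  by simp_all

lemma tensor_cpx_eq:
  "ob (tensor_cpx R T X) n = Ob X (n - p)"
  "diff (tensor_cpx R T X) n = Df X (n - p)"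
  "tensor_chain_map R T Y f n = Mp Y f (n - p)"
  by (simp_all add: tensor_cpx_def tensor_chain_map_def Ob_def Df_def Mp_def Let_def index_shift(1) del: diff_add_eq)

context
  fixes X :: "('r, 'm) cpx"
  assumes X: "is_cpx R X"
begin

lemma tensors: "bimodule_tensor R R P (ob X i)" "bimodule_tensor R R Q (ob X i)"
  by (intro bimodule_tensor.intro fst_bimodule snd_bimodule is_cpxD(2)[OF X])+

lemma TP_module: "pregraded_module R (TP (ob X i))" "pregraded_module R (TQ (ob X i))"
  "abelian_group (TP (ob X i))" "abelian_group (TQ (ob X i))"
proof -
  interpret P: bimodule_tensor R R P "ob X i" by (rule tensors)
  interpret Q: bimodule_tensor R R Q "ob X i" by (rule tensors)
  show "pregraded_module R (TP (ob X i))" "pregraded_module R (TQ (ob X i))"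
    "abelian_group (TP (ob X i))" "abelian_group (TQ (ob X i))"
    by (rule P.tensor_pregraded Q.tensor_pregraded P.tensor_abelian_group Q.tensor_abelian_group)+
qed

lemma mapF_hom: "mapF (ob X i) \<in> gmod_hom R (TP (ob X i)) (TQ (ob X i))"
  by (rule tensor_map_hom[OF tensors two_map_hom gmod_hom_ident])

lemma Ob_graded: "graded_left_module R (Ob X j)"
  unfolding Ob_def
  by (intro gmod_sum_graded fst_graded snd_graded is_cpxD(1)[OF X])

end

context
  fixes X Y :: "('r, 'm) cpx" and i j :: int
  assumes X: "is_cpx R X" and Y: "is_cpx R Y"
begin

lemma mapP_hom: "g \<in> gmod_hom R (ob X i) (ob Y j) \<Longrightarrow> mapP (ob Y j) g \<in> gmod_hom R (TP (ob X i)) (TP (ob Y j))"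
  by (rule tensor_map_hom[OF tensors(1)[OF X] tensors(1)[OF Y] bimod_hom_ident])

lemma mapQ_hom: "g \<in> gmod_hom R (ob X i) (ob Y j) \<Longrightarrow> mapQ (ob Y j) g \<in> gmod_hom R (TQ (ob X i)) (TQ (ob Y j))"
  by (rule tensor_map_hom[OF tensors(2)[OF X] tensors(2)[OF Y] bimod_hom_ident])

lemma mapF_natural:
  assumes g: "g \<in> gmod_hom R (ob X i) (ob Y j)" and u: "u \<in> carrier (TP (ob X i))"
  shows "mapF (ob Y j) (mapP (ob Y j) g u) = mapQ (ob Y j) g (mapF (ob X i) u)"
  using tensor_map_comp[OF tensors(1)[OF X] tensors(1)[OF Y] tensors(2)[OF Y] bimod_hom_ident two_map_hom g gmod_hom_ident u]
    tensor_map_comp[OF tensors(1)[OF X] tensors(2)[OF X] tensors(2)[OF Y] two_map_hom bimod_hom_ident gmod_hom_ident g u]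
  by simp

lemma mapP_add:
  assumes "g \<in> gmod_hom R (ob X i) (ob Y j)" "g' \<in> gmod_hom R (ob X i) (ob Y j)" "u \<in> carrier (TP (ob X i))"
  shows "mapP (ob Y j) (\<lambda>x. g x \<oplus>\<^bsub>ob Y j\<^esub> g' x) u = mapP (ob Y j) g u \<oplus>\<^bsub>TP (ob Y j)\<^esub> mapP (ob Y j) g' u"
  by (rule tensor_map_right_add[OF tensors(1)[OF X] tensors(1)[OF Y] bimod_hom_ident assms])

lemma mapQ_add:
  assumes "g \<in> gmod_hom R (ob X i) (ob Y j)" "g' \<in> gmod_hom R (ob X i) (ob Y j)" "u \<in> carrier (TQ (ob X i))"
  shows "mapQ (ob Y j) (\<lambda>x. g x \<oplus>\<^bsub>ob Y j\<^esub> g' x) u = mapQ (ob Y j) g u \<oplus>\<^bsub>TQ (ob Y j)\<^esub> mapQ (ob Y j) g' u"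
  by (rule tensor_map_right_add[OF tensors(2)[OF X] tensors(2)[OF Y] bimod_hom_ident assms])

lemma mapP_cong:
  assumes "g \<in> gmod_hom R (ob X i) (ob Y j)" "g' \<in> gmod_hom R (ob X i) (ob Y j)"
    and "\<And>x. x \<in> carrier (ob X i) \<Longrightarrow> g x = g' x" "u \<in> carrier (TP (ob X i))"
  shows "mapP (ob Y j) g u = mapP (ob Y j) g' u"
  by (rule tensor_map_cong[OF tensors(1)[OF X] tensors(1)[OF Y] bimod_hom_ident bimod_hom_ident assms(1,2) refl assms(3,4)])

lemma mapQ_cong:
  assumes "g \<in> gmod_hom R (ob X i) (ob Y j)" "g' \<in> gmod_hom R (ob X i) (ob Y j)"
    and "\<And>x. x \<in> carrier (ob X i) \<Longrightarrow> g x = g' x" "u \<in> carrier (TQ (ob X i))"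
  shows "mapQ (ob Y j) g u = mapQ (ob Y j) g' u"
  by (rule tensor_map_cong[OF tensors(2)[OF X] tensors(2)[OF Y] bimod_hom_ident bimod_hom_ident assms(1,2) refl assms(3,4)])

lemma map_zero:
  "u \<in> carrier (TP (ob X i)) \<Longrightarrow> mapP (ob Y j) (\<lambda>x. \<zero>\<^bsub>ob Y j\<^esub>) u = \<zero>\<^bsub>TP (ob Y j)\<^esub>"
  "v \<in> carrier (TQ (ob X i)) \<Longrightarrow> mapQ (ob Y j) (\<lambda>x. \<zero>\<^bsub>ob Y j\<^esub>) v = \<zero>\<^bsub>TQ (ob Y j)\<^esub>"
  by (rule tensor_map_right_zero[OF tensors(1)[OF X] tensors(1)[OF Y] bimod_hom_ident],
      assumption, rule tensor_map_right_zero[OF tensors(2)[OF X] tensors(2)[OF Y] bimod_hom_ident], assumption)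

lemma map_comp:
  fixes Z :: "('r, 'm) cpx"
  assumes "is_cpx R Z" and g: "g \<in> gmod_hom R (ob X i) (ob Y j)" "g' \<in> gmod_hom R (ob Y j) (ob Z l)"
  shows "u \<in> carrier (TP (ob X i)) \<Longrightarrow> mapP (ob Z l) g' (mapP (ob Y j) g u) = mapP (ob Z l) (\<lambda>x. g' (g x)) u"
    and "v \<in> carrier (TQ (ob X i)) \<Longrightarrow> mapQ (ob Z l) g' (mapQ (ob Y j) g v) = mapQ (ob Z l) (\<lambda>x. g' (g x)) v"
  by (rule tensor_map_comp[OF tensors(1)[OF X] tensors(1)[OF Y] tensors(1)[OF assms(1)] bimod_hom_ident bimod_hom_ident g],
      assumption,
      rule tensor_map_comp[OF tensors(2)[OF X] tensors(2)[OF Y] tensors(2)[OF assms(1)] bimod_hom_ident bimod_hom_ident g],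
      assumption)

end

lemma Df_hom:
  assumes X: "is_cpx R X"
  shows "Df X j \<in> gmod_hom R (Ob X j) (Ob X (j + 1))"
proof -
  note d = is_cpxD(4)[OF X, of j] and d' = is_cpxD(5)[OF X, of j]
  note h1 = gmod_homD[OF signed_hom[OF TP_module(1)[OF X] mapP_hom[OF X X d], where i = p]]
  note h2 = gmod_homD[OF signed_hom[OF TP_module(2)[OF X] mapQ_hom[OF X X d'], where i = "p + 1"]]
  note h3 = gmod_homD[OF mapF_hom[OF X, of j]]
  interpret N: pregraded_module R "TQ (ob X j)" by (rule TP_module(2)[OF X])
  show ?thesis
    unfolding Ob_def Df_def
    by (rule gmod_homI) (auto simp: h1 h2 h3 N.smult_r_distr N.gr_part_add N.M.a_ac)
qed

text \<open>
  The squares of the differentials of the two summands vanish by functoriality; the mixed terms cancel, because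
  the signs of consecutive cohomological degrees are opposite.
\<close>

lemma Df_Df:
  assumes X: "is_cpx R X" and "z \<in> carrier (Ob X j)"
  shows "Df X (j + 1) (Df X j z) = \<zero>\<^bsub>Ob X (j + 1 + 1)\<^esub>"
proof -
  obtain u v where z: "z = (u, v)" "u \<in> carrier (TP (ob X j))" "v \<in> carrier (TQ (ob X (j - 1)))"
    using assms(2) by (cases z) (simp add: Ob_def)
  \<comment> \<open>Names for the neighbouring degrees keep the simplifier from reordering the index arithmetic.\<close>
  obtain m l where m: "j + 1 = m" "m - 1 = j" "m + 1 = l" "l - 1 = m" by (metis add_diff_cancel_right')
  note d = is_cpxD(4)[OF X, of j, unfolded m] and d2 = is_cpxD(4)[OF X, of m, unfolded m] and d' = is_cpxD(5)[OF X, of j]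
  note hP = mapP_hom[OF X X d] mapP_hom[OF X X d2] and hQ = mapQ_hom[OF X X d'] mapQ_hom[OF X X d] and hF = mapF_hom[OF X]
  interpret N: abelian_group "TQ (ob X m)" by (rule TP_module(4)[OF X])
  interpret N2: abelian_group "TP (ob X l)" by (rule TP_module(3)[OF X])
  note mP = gmod_hom_minus[OF hP(2) TP_module(3)[OF X] TP_module(3)[OF X]]
  note mQ = gmod_hom_minus[OF hQ(2) TP_module(4)[OF X] TP_module(4)[OF X]]
  note mF = gmod_hom_minus[OF hF TP_module(3)[OF X] TP_module(4)[OF X]]
  have dd: "diff X m (diff X j x) = \<zero>\<^bsub>ob X l\<^esub>" if "x \<in> carrier (ob X j)" for x
    using is_cpxD(6)[OF X that] unfolding m .
  have dd': "diff X j (diff X (j - 1) x) = \<zero>\<^bsub>ob X m\<^esub>" if "x \<in> carrier (ob X (j - 1))" for x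
    using is_cpxD(6)[OF X that] by (simp add: m)
  have PP: "mapP (ob X l) (diff X m) (mapP (ob X m) (diff X j) u) = \<zero>\<^bsub>TP (ob X l)\<^esub>"
    unfolding map_comp(1)[OF X X X d d2 z(2)]
    using mapP_cong[OF X X gmod_hom_comp[OF d d2, unfolded comp_def] gmod_hom_zero_map[OF is_cpxD(2)[OF X]] dd z(2)]
      map_zero(1)[OF X X z(2)] by simp
  have QQ: "mapQ (ob X m) (diff X j) (mapQ (ob X j) (diff X (j - 1)) v) = \<zero>\<^bsub>TQ (ob X m)\<^esub>"
    unfolding map_comp(2)[OF X X X d' d z(3)]
    using mapQ_cong[OF X X gmod_hom_comp[OF d' d, unfolded comp_def] gmod_hom_zero_map[OF is_cpxD(2)[OF X]] dd' z(3)]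
      map_zero(2)[OF X X z(3)] by simp
  have FP: "mapF (ob X m) (mapP (ob X m) (diff X j) u) = mapQ (ob X m) (diff X j) (mapF (ob X j) u)"
    by (rule mapF_natural[OF X X d z(2)])
  note c = gmod_homD(1)[OF hP(1) z(2)] gmod_homD(1)[OF hQ(1) z(3)] gmod_homD(1)[OF hF z(2)]
  interpret K: abelian_group "TQ (ob X j)" by (rule TP_module(4)[OF X])
  note c' = gmod_homD(1)[OF hQ(2) c(3)] gmod_homD(2)[OF hQ(2)]
  show ?thesis
    by (cases "even p")
      (simp_all add: z(1) Df_def Ob_def m signed_even signed_odd mP[OF c(1)] mF[OF c(1)] mQ[OF c(2)] PP QQ FP c c'
        N.r_neg N.l_neg N.a_inv_zero N2.a_inv_zero)
qed

lemma Mp_hom: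
  assumes X: "is_cpx R X" and Y: "is_cpx R Y" and f: "f \<in> chain_maps R X Y"
  shows "Mp Y f j \<in> gmod_hom R (Ob X j) (Ob Y j)"
proof -
  note f = chain_mapsD(1)[OF f]
  note h = gmod_homD[OF mapP_hom[OF X Y f, of j]] gmod_homD[OF mapQ_hom[OF X Y f, of "j - 1"]]
  show ?thesis
    unfolding Ob_def Mp_def by (rule gmod_homI) (auto simp: h)
qed

lemma Mp_chain:
  assumes X: "is_cpx R X" and Y: "is_cpx R Y" and f: "f \<in> chain_maps R X Y" and "z \<in> carrier (Ob X j)"
  shows "Mp Y f (j + 1) (Df X j z) = Df Y j (Mp Y f j z)"
proof -
  obtain u v where z: "z = (u, v)" "u \<in> carrier (TP (ob X j))" "v \<in> carrier (TQ (ob X (j - 1)))"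
    using assms(4) by (cases z) (simp add: Ob_def)
  note dX = is_cpxD(4)[OF X] and dX' = is_cpxD(5)[OF X]
  note dY = is_cpxD(4)[OF Y] and dY' = is_cpxD(5)[OF Y]
  note fh = chain_mapsD(1)[OF f]
  have 1: "mapP (ob Y (j + 1)) (f (j + 1)) (mapP (ob X (j + 1)) (diff X j) u) = mapP (ob Y (j + 1)) (diff Y j) (mapP (ob Y j) (f j) u)"
    unfolding map_comp(1)[OF X X Y dX fh z(2)] map_comp(1)[OF X Y Y fh dY z(2)]
    by (rule mapP_cong[OF X Y gmod_hom_comp[OF dX fh, unfolded comp_def] gmod_hom_comp[OF fh dY, unfolded comp_def] chain_mapsD(2)[OF f] z(2)])
  have fd: "f j (diff X (j - 1) x) = diff Y (j - 1) (f (j - 1) x)" if "x \<in> carrier (ob X (j - 1))" for x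
    using chain_mapsD(2)[OF f that] by simp
  have 2: "mapQ (ob Y j) (f j) (mapQ (ob X j) (diff X (j - 1)) v) = mapQ (ob Y j) (diff Y (j - 1)) (mapQ (ob Y (j - 1)) (f (j - 1)) v)"
    unfolding map_comp(2)[OF X X Y dX' fh z(3)] map_comp(2)[OF X Y Y fh dY' z(3)]
    by (rule mapQ_cong[OF X Y gmod_hom_comp[OF dX' fh, unfolded comp_def] gmod_hom_comp[OF fh dY', unfolded comp_def] fd z(3)])
  have 3: "mapF (ob Y j) (mapP (ob Y j) (f j) u) = mapQ (ob Y j) (f j) (mapF (ob X j) u)"
    by (rule mapF_natural[OF X Y fh z(2)])
  note hP = mapP_hom[OF X Y fh] and hQ = mapQ_hom[OF X Y fh]
  note mP = gmod_hom_minus[OF hP TP_module(3)[OF X] TP_module(3)[OF Y]]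
  note mQ = gmod_hom_minus[OF hQ TP_module(4)[OF X] TP_module(4)[OF Y]]
  note c = gmod_homD(1)[OF mapP_hom[OF X X dX] z(2)] gmod_homD(1)[OF mapQ_hom[OF X X dX'] z(3)] gmod_homD(1)[OF mapF_hom[OF X] z(2)]
  interpret N: abelian_group "TQ (ob X j)" by (rule TP_module(4)[OF X])
  show ?thesis
    by (cases "even p")
      (simp_all add: z(1) Df_def Mp_def signed_even signed_odd mP[OF c(1)] mQ[OF c(2)] c gmod_homD(2)[OF hQ] 1 2 3)
qed

lemma Mp_homotopic:
  assumes X: "is_cpx R X" and Y: "is_cpx R Y" and f: "f \<in> chain_maps R X Y" and g: "g \<in> chain_maps R X Y"
    and "homotopic_maps R X Y f g"
  obtains H where "\<And>j. H j \<in> gmod_hom R (Ob X j) (Ob Y (j - 1))"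
    and "\<And>j z. z \<in> carrier (Ob X j) \<Longrightarrow>
      Mp Y f j z = Mp Y g j z \<oplus>\<^bsub>Ob Y j\<^esub> (Df Y (j - 1) (H j z) \<oplus>\<^bsub>Ob Y j\<^esub> H (j + 1) (Df X j z))"
proof -
  obtain h where h: "\<And>n. h n \<in> gmod_hom R (ob X n) (ob Y (n - 1))"
    "\<And>n. h (n + 1) \<in> gmod_hom R (ob X (n + 1)) (ob Y n)"
    "\<And>n x. x \<in> carrier (ob X n) \<Longrightarrow>
      f n x = g n x \<oplus>\<^bsub>ob Y n\<^esub> (diff Y (n - 1) (h n x) \<oplus>\<^bsub>ob Y n\<^esub> h (n + 1) (diff X n x))"
    by (rule homotopic_mapsE[OF assms(5)]) (rule that)
  \<comment> \<open>A homotopy passes an element \<open>t\<close> of cohomological degree \<open>i\<close> with the sign \<open>(-1)\<^sup>i\<close>, as the differential does.\<close>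
  define H where "H j = (\<lambda>(u, v). (signed (TP (ob Y (j - 1))) p (mapP (ob Y (j - 1)) (h j) u),
    signed (TQ (ob Y (j - 2))) (p + 1) (mapQ (ob Y (j - 2)) (h (j - 1)) v)))" for j
  note fh = chain_mapsD(1)[OF f] and gh = chain_mapsD(1)[OF g]
  note dX = is_cpxD(4)[OF X] and dX' = is_cpxD(5)[OF X]
  note dY = is_cpxD(4)[OF Y] and dY' = is_cpxD(5)[OF Y]
  show thesis
  proof (rule that[of H])
    fix j
    have hm: "h (j - 1) \<in> gmod_hom R (ob X (j - 1)) (ob Y (j - 2))" using h(1)[of "j - 1"] by simp
    have dm: "diff Y (j - 2) \<in> gmod_hom R (ob Y (j - 2)) (ob Y (j - 1))" using dY'[of "j - 1"] by simp
    note h1 = gmod_homD[OF signed_hom[OF TP_module(1)[OF Y] mapP_hom[OF X Y h(1)[of j]], where i = p]]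
    note h2 = gmod_homD[OF signed_hom[OF TP_module(2)[OF Y] mapQ_hom[OF X Y hm], where i = "p + 1"]]
    show "H j \<in> gmod_hom R (Ob X j) (Ob Y (j - 1))"
      unfolding Ob_def H_def by (rule gmod_homI) (auto simp: h1 h2)
    fix z assume "z \<in> carrier (Ob X j)"
    then obtain u v where z: "z = (u, v)" "u \<in> carrier (TP (ob X j))" "v \<in> carrier (TQ (ob X (j - 1)))"
      by (cases z) (simp add: Ob_def)
    interpret N: abelian_group "TP (ob Y j)" by (rule TP_module(3)[OF Y])
    interpret N': abelian_group "TQ (ob Y (j - 1))" by (rule TP_module(4)[OF Y])
    interpret K: abelian_group "TQ (ob X j)" by (rule TP_module(4)[OF X])
    have h': "h j \<in> gmod_hom R (ob X j) (ob Y (j - 1))" by (rule h(1))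
    note dh = gmod_hom_comp[OF h(1) dY', unfolded comp_def, of j] gmod_hom_comp[OF dX h(2), unfolded comp_def, of j]
    note dh2 = gmod_hom_comp[OF hm dm, unfolded comp_def] gmod_hom_comp[OF dX' h', unfolded comp_def]
    have hx: "f (j - 1) x = g (j - 1) x \<oplus>\<^bsub>ob Y (j - 1)\<^esub> (diff Y (j - 2) (h (j - 1) x) \<oplus>\<^bsub>ob Y (j - 1)\<^esub> h j (diff X (j - 1) x))"
      if "x \<in> carrier (ob X (j - 1))" for x
      using h(3)[OF that] by simp
    have eP: "mapP (ob Y j) (f j) u = mapP (ob Y j) (g j) u \<oplus>\<^bsub>TP (ob Y j)\<^esub>
        (mapP (ob Y j) (diff Y (j - 1)) (mapP (ob Y (j - 1)) (h j) u) \<oplus>\<^bsub>TP (ob Y j)\<^esub>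
         mapP (ob Y j) (h (j + 1)) (mapP (ob X (j + 1)) (diff X j) u))"
    proof -
      have "mapP (ob Y j) (f j) u = mapP (ob Y j) (\<lambda>x. g j x \<oplus>\<^bsub>ob Y j\<^esub> (diff Y (j - 1) (h j x) \<oplus>\<^bsub>ob Y j\<^esub> h (j + 1) (diff X j x))) u"
        by (rule mapP_cong[OF X Y fh gmod_hom_add_map[OF is_cpxD(2)[OF Y] gh gmod_hom_add_map[OF is_cpxD(2)[OF Y] dh]] h(3) z(2)])
      thus ?thesis
        unfolding mapP_add[OF X Y gh gmod_hom_add_map[OF is_cpxD(2)[OF Y] dh] z(2)] mapP_add[OF X Y dh z(2)]
          map_comp(1)[OF X Y Y h(1) dY' z(2)] map_comp(1)[OF X X Y dX h(2) z(2)] .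
    qed
    have eQ: "mapQ (ob Y (j - 1)) (f (j - 1)) v = mapQ (ob Y (j - 1)) (g (j - 1)) v \<oplus>\<^bsub>TQ (ob Y (j - 1))\<^esub>
        (mapQ (ob Y (j - 1)) (diff Y (j - 2)) (mapQ (ob Y (j - 2)) (h (j - 1)) v) \<oplus>\<^bsub>TQ (ob Y (j - 1))\<^esub>
         mapQ (ob Y (j - 1)) (h j) (mapQ (ob X j) (diff X (j - 1)) v))"
    proof -
      have "mapQ (ob Y (j - 1)) (f (j - 1)) v = mapQ (ob Y (j - 1)) (\<lambda>x. g (j - 1) x \<oplus>\<^bsub>ob Y (j - 1)\<^esub>
          (diff Y (j - 2) (h (j - 1) x) \<oplus>\<^bsub>ob Y (j - 1)\<^esub> h j (diff X (j - 1) x))) v"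
        by (rule mapQ_cong[OF X Y fh gmod_hom_add_map[OF is_cpxD(2)[OF Y] gh gmod_hom_add_map[OF is_cpxD(2)[OF Y] dh2]] hx z(3)])
      thus ?thesis
        unfolding mapQ_add[OF X Y gh gmod_hom_add_map[OF is_cpxD(2)[OF Y] dh2] z(3)] mapQ_add[OF X Y dh2 z(3)]
          map_comp(2)[OF X Y Y hm dm z(3)] map_comp(2)[OF X X Y dX' h' z(3)] .
    qed
    have eF: "mapF (ob Y (j - 1)) (mapP (ob Y (j - 1)) (h j) u) = mapQ (ob Y (j - 1)) (h j) (mapF (ob X j) u)"
      by (rule mapF_natural[OF X Y h' z(2)])
    note hP = mapP_hom[OF X Y h'] mapP_hom[OF X Y h(2)[of j]] mapP_hom[OF Y Y dY'[of j]] mapP_hom[OF X X dX[of j]]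
    note hQ = mapQ_hom[OF X Y h'] mapQ_hom[OF X Y hm] mapQ_hom[OF Y Y dm] mapQ_hom[OF X X dX'[of j]]
    note hF = mapF_hom[OF X, of j] mapF_hom[OF Y, of "j - 1"]
    note mP = gmod_hom_minus[OF hP(3) TP_module(3)[OF Y] TP_module(3)[OF Y]] gmod_hom_minus[OF hP(2) TP_module(3)[OF X] TP_module(3)[OF Y]]
    note mQ = gmod_hom_minus[OF hQ(3) TP_module(4)[OF Y] TP_module(4)[OF Y]] gmod_hom_minus[OF hQ(1) TP_module(4)[OF X] TP_module(4)[OF Y]]
    note mF = gmod_hom_minus[OF hF(2) TP_module(3)[OF Y] TP_module(4)[OF Y]]
    note c = gmod_homD(1)[OF hP(1) z(2)] gmod_homD(1)[OF hP(4) z(2)] gmod_homD(1)[OF hQ(2) z(3)] gmod_homD(1)[OF hQ(4) z(3)]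
      gmod_homD(1)[OF hF(1) z(2)]
    note c' = gmod_homD(1)[OF hP(3) c(1)] gmod_homD(1)[OF hP(2) c(2)] gmod_homD(1)[OF hQ(3) c(3)] gmod_homD(1)[OF hQ(1) c(4)]
      gmod_homD(1)[OF hQ(1) c(5)] gmod_homD(1)[OF mapP_hom[OF X Y gh[of j]] z(2)] gmod_homD(1)[OF mapQ_hom[OF X Y gh[of "j - 1"]] z(3)]
    show "Mp Y f j z = Mp Y g j z \<oplus>\<^bsub>Ob Y j\<^esub> (Df Y (j - 1) (H j z) \<oplus>\<^bsub>Ob Y j\<^esub> H (j + 1) (Df X j z))"
      by (cases "even p")
        (simp_all add: z(1) Mp_def Df_def H_def Ob_def signed_even signed_odd eP eQ eF mP(1)[OF c(1)] mP(2)[OF c(2)] mQ(1)[OF c(3)]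
          mQ(2)[OF c(4)] mF[OF c(1)] c c' gmod_homD(2)[OF hQ(1)] N.a_ac N'.a_ac N'.r_neg N'.l_neg N'.r_neg1 N'.r_neg2 N'.cancel_between N'.minus_add N'.minus_minus N.minus_minus)
  qed
qed

lemma strict: "strict_functor R (tensor_cpx R T :: ('r, 'm) cpx \<Rightarrow> _) (tensor_chain_map R T)"
proof (rule strict_functor.intro)
  fix X :: "('r, 'm) cpx" assume X: "is_cpx R X"
  show "is_cpx R (tensor_cpx R T X)"
    unfolding is_cpx_def tensor_cpx_eq index_shift
    using Ob_graded[OF X] Df_hom[OF X] Df_Df[OF X] by blast
  fix z n assume z: "z \<in> carrier (ob (tensor_cpx R T X) n)"
  then obtain u v where uv: "z = (u, v)" "u \<in> carrier (TP (ob X (n - p)))" "v \<in> carrier (TQ (ob X (n - p - 1)))"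
    by (cases z) (simp add: tensor_cpx_eq Ob_def)
  show "tensor_chain_map R T X (\<lambda>n x. x) n z = z"
    unfolding tensor_cpx_eq Mp_def uv(1)
    using tensor_map_ident[OF tensors(1)[OF X] bimod_hom_ident gmod_hom_ident refl refl uv(2)]
      tensor_map_ident[OF tensors(2)[OF X] bimod_hom_ident gmod_hom_ident refl refl uv(3)] by simp
next
  fix X Y :: "('r, 'm) cpx" and f assume X: "is_cpx R X" and Y: "is_cpx R Y" and f: "f \<in> chain_maps R X Y"
  show "tensor_chain_map R T Y f \<in> chain_maps R (tensor_cpx R T X) (tensor_cpx R T Y)"
    by (rule chain_mapsI; unfold tensor_cpx_eq index_shift) (rule Mp_hom[OF X Y f], rule Mp_chain[OF X Y f])
  fix g assume g: "g \<in> chain_maps R X Y" "homotopic_maps R X Y f g"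
  obtain H where H: "\<And>j. H j \<in> gmod_hom R (Ob X j) (Ob Y (j - 1))"
    "\<And>j z. z \<in> carrier (Ob X j) \<Longrightarrow>
      Mp Y f j z = Mp Y g j z \<oplus>\<^bsub>Ob Y j\<^esub> (Df Y (j - 1) (H j z) \<oplus>\<^bsub>Ob Y j\<^esub> H (j + 1) (Df X j z))"
    by (rule Mp_homotopic[OF X Y f g]) (rule that)
  show "homotopic_maps R (tensor_cpx R T X) (tensor_cpx R T Y) (tensor_chain_map R T Y f) (tensor_chain_map R T Y g)"
    by (rule homotopic_mapsI[where h = "\<lambda>n. H (n - p)"]; unfold tensor_cpx_eq index_shift) (rule H)+
next
  fix X Y Z :: "('r, 'm) cpx" and f g z n assume X: "is_cpx R X" and Y: "is_cpx R Y" and Z: "is_cpx R Z"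
    and f: "f \<in> chain_maps R X Y" and g: "g \<in> chain_maps R Y Z" and z: "z \<in> carrier (ob (tensor_cpx R T X) n)"
  then obtain u v where uv: "z = (u, v)" "u \<in> carrier (TP (ob X (n - p)))" "v \<in> carrier (TQ (ob X (n - p - 1)))"
    by (cases z) (simp add: tensor_cpx_eq Ob_def)
  show "tensor_chain_map R T Z (\<lambda>n. g n \<circ> f n) n z = tensor_chain_map R T Z g n (tensor_chain_map R T Y f n z)"
    unfolding tensor_cpx_eq Mp_def uv(1)
    by (simp add: map_comp[OF X Y Z chain_mapsD(1)[OF f] chain_mapsD(1)[OF g]] uv comp_def)
qed

lemma tensor_functor_induced:
  "(tensor_functor R T :: ('r, 'm, _) kfunctor) = strict_functor.induced R (tensor_cpx R T) (tensor_chain_map R T)"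
  by (simp add: tensor_functor_def strict_functor.induced_def[OF strict])

end

section \<open>Concrete models of the two functors\<close>

lemma gmod_hom_inverse:
  assumes T: "pregraded_module R T" and f: "f \<in> gmod_hom R T K"
    and g: "\<And>y. y \<in> carrier K \<Longrightarrow> g y \<in> carrier T"
    and fg: "\<And>y. y \<in> carrier K \<Longrightarrow> f (g y) = y" and gf: "\<And>x. x \<in> carrier T \<Longrightarrow> g (f x) = x"
    and gr: "\<And>x i. \<lbrakk>x \<in> carrier T; f x \<in> gr_part K i\<rbrakk> \<Longrightarrow> x \<in> gr_part T i"
    and sub: "\<And>i y. y \<in> gr_part K i \<Longrightarrow> y \<in> carrier K"
  shows "g \<in> gmod_hom R K T"
proof -
  interpret T: pregraded_module R T by fact
  note f = gmod_homD[OF f]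
  show ?thesis
  proof (rule gmod_homI)
    show "g (x \<oplus>\<^bsub>K\<^esub> y) = g x \<oplus>\<^bsub>T\<^esub> g y" if "x \<in> carrier K" "y \<in> carrier K" for x y
      using gf[of "g x \<oplus>\<^bsub>T\<^esub> g y"] f(2)[of "g x" "g y"] that by (simp add: g fg)
    show "g (a \<odot>\<^bsub>K\<^esub> x) = a \<odot>\<^bsub>T\<^esub> g x" if "a \<in> carrier R" "x \<in> carrier K" for a x
      using gf[of "a \<odot>\<^bsub>T\<^esub> g x"] f(3)[of a "g x"] that by (simp add: g fg T.smult_closed)
    show "g y \<in> gr_part T i" if "y \<in> gr_part K i" for i y
      using gr[of "g y" i] sub[OF that] that by (simp add: g fg)
  qed (rule g)
qed

context odd_poly
begin

text \<open>
  The model of \<open>B \<otimes> M\<close>, with \<open>\<sigma>\<close> the identity, and of its twisted analogue, with \<open>\<sigma>\<close> the involution. The graded parts are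
  offset by the degrees \<open>-1\<close> and \<open>1\<close> of the two basis elements.
\<close>

definition tri_mod :: "('k odd_poly \<Rightarrow> 'k odd_poly) \<Rightarrow> ('k odd_poly, 'm, 'y) gmod_scheme \<Rightarrow> ('k odd_poly, 'm \<times> 'm) gmod" where
  "tri_mod \<sigma> M = \<lparr>carrier = carrier M \<times> carrier M, mult = undefined, one = undefined,
     ring.zero = (\<zero>\<^bsub>M\<^esub>, \<zero>\<^bsub>M\<^esub>),
     add = (\<lambda>(x, y) (x', y'). (x \<oplus>\<^bsub>M\<^esub> x', y \<oplus>\<^bsub>M\<^esub> y')),
     smult = (\<lambda>a (w, m). (\<sigma> a \<odot>\<^bsub>M\<^esub> w, dem (\<sigma> a) \<odot>\<^bsub>M\<^esub> w \<oplus>\<^bsub>M\<^esub> s (\<sigma> a) \<odot>\<^bsub>M\<^esub> m)),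
     gr_part = (\<lambda>i. gr_part M (i + 1) \<times> gr_part M (i - 1))\<rparr>"

lemma tri_mod_simps [simp]:
  "carrier (tri_mod \<sigma> M) = carrier M \<times> carrier M" "\<zero>\<^bsub>tri_mod \<sigma> M\<^esub> = (\<zero>\<^bsub>M\<^esub>, \<zero>\<^bsub>M\<^esub>)"
  "(x, y) \<oplus>\<^bsub>tri_mod \<sigma> M\<^esub> (x', y') = (x \<oplus>\<^bsub>M\<^esub> x', y \<oplus>\<^bsub>M\<^esub> y')"
  "a \<odot>\<^bsub>tri_mod \<sigma> M\<^esub> (w, m) = (\<sigma> a \<odot>\<^bsub>M\<^esub> w, dem (\<sigma> a) \<odot>\<^bsub>M\<^esub> w \<oplus>\<^bsub>M\<^esub> s (\<sigma> a) \<odot>\<^bsub>M\<^esub> m)"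
  "gr_part (tri_mod \<sigma> M) i = gr_part M (i + 1) \<times> gr_part M (i - 1)"
  by (simp_all add: tri_mod_def)

lemma tri_mod_abelian_group: "abelian_group M \<Longrightarrow> abelian_group (tri_mod \<sigma> M)"
  by (rule abelian_group_cong[OF gmod_sum_abelian_group[of M M]]) (simp_all add: tri_mod_def gmod_sum_def)

lemma tri_mod_minus:
  assumes "abelian_group M" "x \<in> carrier M" "y \<in> carrier M"
  shows "\<ominus>\<^bsub>tri_mod \<sigma> M\<^esub> (x, y) = (\<ominus>\<^bsub>M\<^esub> x, \<ominus>\<^bsub>M\<^esub> y)"
proof -
  have "\<ominus>\<^bsub>tri_mod \<sigma> M\<^esub> (x, y) = \<ominus>\<^bsub>gmod_sum M M\<^esub> (x, y)"
    by (rule a_inv_cong) (simp_all add: tri_mod_def gmod_sum_def)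
  thus ?thesis by (simp add: gmod_sum_minus[OF assms(1,1,2,3)])
qed

lemma tri_mod_map:
  assumes f: "f \<in> gmod_hom R M N" and \<sigma>: "\<And>a. a \<in> carrier R \<Longrightarrow> \<sigma> a \<in> carrier R"
    and M: "\<And>a x. \<lbrakk>a \<in> carrier R; x \<in> carrier M\<rbrakk> \<Longrightarrow> a \<odot>\<^bsub>M\<^esub> x \<in> carrier M"
  shows "(\<lambda>(w, m). (f w, f m)) \<in> gmod_hom R (tri_mod \<sigma> M) (tri_mod \<sigma> N)"
  by (rule gmod_homI) (auto simp: gmod_homD[OF f] M \<sigma> s_simps(1) dem_simps(1))

subsection \<open>Coordinates on the tensor products\<close>

definition tri_coords ::
  "('k odd_poly, 'p) gbimod \<Rightarrow> ('p \<Rightarrow> 'k odd_poly) \<Rightarrow> ('p \<Rightarrow> 'k odd_poly) \<Rightarrow> ('k odd_poly, 'm) gmod \<Rightarrow>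
   ('p \<times> 'm \<Rightarrow>\<^sub>0 int) set \<Rightarrow> 'm \<times> 'm" where
  "tri_coords P c0 c1 N X = (tensor_eval R P N c0 X, tensor_eval R P N c1 X)"

definition tri_combine ::
  "('k odd_poly, 'p) gbimod \<Rightarrow> 'p \<Rightarrow> 'p \<Rightarrow> ('k odd_poly, 'm) gmod \<Rightarrow> 'm \<times> 'm \<Rightarrow> ('p \<times> 'm \<Rightarrow>\<^sub>0 int) set" where
  "tri_combine P e0 e1 N = (\<lambda>(w, m). pure_tensor R P N e0 w \<oplus>\<^bsub>tensor_mod R P N\<^esub> pure_tensor R P N e1 m)"

context
  fixes \<sigma> and P :: "('k odd_poly, 'p) gbimod" and e0 e1 c0 c1
  assumes P: "triangular_basis \<sigma> P e0 e1 c0 c1" and \<sigma>: "\<And>a. a \<in> carrier R \<Longrightarrow> \<sigma> a \<in> carrier R"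
begin

lemma basis2: "right_basis2 R R P e0 e1 c0 c1 (-1) 1"
  using P by (simp add: triangular_basis_def)

lemma basis2_tensor: "pregraded_module R N \<Longrightarrow> right_basis2_tensor R R P e0 e1 c0 c1 (-1) 1 N"
  by (intro right_basis2_tensor.intro basis2)

lemma basis2_bimodule_tensor: "pregraded_module R N \<Longrightarrow> bimodule_tensor R R P N"
  by (intro bimodule_tensor.intro right_basis2.axioms(1)[OF basis2])

lemma tri_coords_hom:
  assumes N: "pregraded_module R N"
  shows "tri_coords P c0 c1 N \<in> gmod_hom R (tensor_mod R P N) (tri_mod \<sigma> N)"
proof -
  interpret right_basis2_tensor R R P e0 e1 c0 c1 "-1" 1 N by (rule basis2_tensor[OF N])
  have P0: "c0 (a \<odot>\<^bsub>P\<^esub> x) = \<sigma> a \<otimes>\<^bsub>R\<^esub> c0 x" and P1: "c1 (a \<odot>\<^bsub>P\<^esub> x) = dem (\<sigma> a) \<otimes>\<^bsub>R\<^esub> c0 x \<oplus>\<^bsub>R\<^esub> s (\<sigma> a) \<otimes>\<^bsub>R\<^esub> c1 x"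
    if "a \<in> carrier R" "x \<in> carrier P" for a x
    using P that by (simp_all add: triangular_basis_def)
  note cl = s_simps(1) dem_simps(1)
  have 0: "\<pi>0 (a \<odot>\<^bsub>T\<^esub> X) = \<sigma> a \<odot>\<^bsub>N\<^esub> \<pi>0 X" if a: "a \<in> carrier R" and X: "X \<in> carrier T" for a X
    by (rule additive_eq[OF X N.M.abelian_group_axioms])
      (use a \<sigma>[OF a] in \<open>simp_all add: smult_tensor_closed smult_tensor_add smult_pure E0.lift_closed E0.lift_add E0.lift_pure
        N.smult_closed N.smult_r_distr N.smult_assoc[symmetric] P0 coord_closed smult_closed\<close>)
  have 1: "\<pi>1 (a \<odot>\<^bsub>T\<^esub> X) = dem (\<sigma> a) \<odot>\<^bsub>N\<^esub> \<pi>0 X \<oplus>\<^bsub>N\<^esub> s (\<sigma> a) \<odot>\<^bsub>N\<^esub> \<pi>1 X" if a: "a \<in> carrier R" and X: "X \<in> carrier T" for a X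
    by (rule additive_eq[OF X N.M.abelian_group_axioms])
      (use a \<sigma>[OF a] cl in \<open>simp_all add: smult_tensor_closed smult_tensor_add smult_pure E0.lift_closed E0.lift_add E0.lift_pure
        E1.lift_closed E1.lift_add E1.lift_pure N.smult_closed N.smult_r_distr N.smult_l_distr N.smult_assoc[symmetric]
        P1 coord_closed smult_closed N.M.a_ac\<close>)
  show ?thesis
    unfolding tri_coords_def
  proof (rule gmod_homI)
    show "(\<pi>0 X, \<pi>1 X) \<in> gr_part (tri_mod \<sigma> N) i" if "X \<in> gr_part T i" for i X
      using gr_part_coord[OF pregraded_module.gr_part_closed[OF tensor_pregraded that], of i] that by simp
  qed (simp_all add: E0.lift_closed E1.lift_closed E0.lift_add E1.lift_add 0 1)
qed

lemma tri_coords_combine: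
  assumes N: "pregraded_module R N"
  shows "z \<in> carrier N \<times> carrier N \<Longrightarrow> tri_coords P c0 c1 N (tri_combine P e0 e1 N z) = z"
    and "X \<in> carrier (tensor_mod R P N) \<Longrightarrow> tri_combine P e0 e1 N (tri_coords P c0 c1 N X) = X"
proof -
  interpret right_basis2_tensor R R P e0 e1 c0 c1 "-1" 1 N by (rule basis2_tensor[OF N])
  show "z \<in> carrier N \<times> carrier N \<Longrightarrow> tri_coords P c0 c1 N (tri_combine P e0 e1 N z) = z"
    using coord_combine by (cases z) (simp add: tri_coords_def tri_combine_def)
  show "X \<in> carrier (tensor_mod R P N) \<Longrightarrow> tri_combine P e0 e1 N (tri_coords P c0 c1 N X) = X"
    using combine_coord by (simp add: tri_coords_def tri_combine_def)
qed

lemma tri_combine_hom: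
  assumes N: "pregraded_module R N"
  shows "tri_combine P e0 e1 N \<in> gmod_hom R (tri_mod \<sigma> N) (tensor_mod R P N)"
proof -
  interpret right_basis2_tensor R R P e0 e1 c0 c1 "-1" 1 N by (rule basis2_tensor[OF N])
  show ?thesis
  proof (rule gmod_hom_inverse[OF tensor_pregraded tri_coords_hom[OF N]])
    show "tri_combine P e0 e1 N z \<in> carrier T" if "z \<in> carrier (tri_mod \<sigma> N)" for z
      using combine_closed that by (cases z) (simp add: tri_combine_def)
    show "X \<in> gr_part T i" if "X \<in> carrier T" "tri_coords P c0 c1 N X \<in> gr_part (tri_mod \<sigma> N) i" for X i
      using gr_part_coord[OF that(1)] that(2) by (simp add: tri_coords_def)
    show "z \<in> carrier (tri_mod \<sigma> N)" if "z \<in> gr_part (tri_mod \<sigma> N) i" for i z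
      using that N.gr_part_closed by auto
  qed (use tri_coords_combine[OF N] in auto)
qed

lemma tri_coords_natural:
  assumes N: "pregraded_module R N" "pregraded_module R N'" and g: "g \<in> gmod_hom R N N'"
    and X: "X \<in> carrier (tensor_mod R P N)"
  shows "tri_coords P c0 c1 N' (tensor_map R P N' (\<lambda>t. t) g X) = (g (fst (tri_coords P c0 c1 N X)), g (snd (tri_coords P c0 c1 N X)))"
proof -
  interpret S: right_basis2_tensor R R P e0 e1 c0 c1 "-1" 1 N by (rule basis2_tensor[OF N(1)])
  interpret S': right_basis2_tensor R R P e0 e1 c0 c1 "-1" 1 N' by (rule basis2_tensor[OF N(2)])
  note t = basis2_bimodule_tensor[OF N(1)] basis2_bimodule_tensor[OF N(2)]
  note h = gmod_homD[OF tensor_map_hom[OF t bimod_hom_ident g]]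
  note hp = tensor_map_hom_pure[OF t bimod_hom_ident g]
  note gD = gmod_homD[OF g]
  have 0: "S'.\<pi>0 (tensor_map R P N' (\<lambda>t. t) g X) = g (S.\<pi>0 X)"
    by (rule S.additive_eq[OF X S'.N.M.abelian_group_axioms])
      (simp_all add: h gD hp S.E0.lift_closed S.E0.lift_add S.E0.lift_pure S'.E0.lift_closed S'.E0.lift_add S'.E0.lift_pure
        S.coord_closed S.N.smult_closed)
  have 1: "S'.\<pi>1 (tensor_map R P N' (\<lambda>t. t) g X) = g (S.\<pi>1 X)"
    by (rule S.additive_eq[OF X S'.N.M.abelian_group_axioms])
      (simp_all add: h gD hp S.E1.lift_closed S.E1.lift_add S.E1.lift_pure S'.E1.lift_closed S'.E1.lift_add S'.E1.lift_pure
        S.coord_closed S.N.smult_closed)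
  show ?thesis unfolding tri_coords_def using 0 1 by simp
qed

lemma tri_tensor_graded:
  assumes "graded_left_module R (N :: ('k odd_poly, 'm) gmod)"
  shows "graded_left_module R (tensor_mod R P N)"
proof -
  have N: "pregraded_module R N" "direct_sum_graded N" using assms by (simp_all add: graded_left_module_iff)
  interpret right_basis2_tensor R R P e0 e1 c0 c1 "-1" 1 N by (rule basis2_tensor[OF N(1)])
  show ?thesis by (rule tensor_graded[OF N(2)])
qed

end

abbreviation "RegS d \<equiv> gr_shift d Reg"

definition reg_coord :: "int \<Rightarrow> ('k odd_poly, 'm) gmod \<Rightarrow> ('k odd_poly \<times> 'm \<Rightarrow>\<^sub>0 int) set \<Rightarrow> 'm" where
  "reg_coord d N = tensor_eval R (RegS d) N (\<lambda>r. r)"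

lemma regular_tensor: "pregraded_module R N \<Longrightarrow> regular_tensor R N"
  by (intro regular_tensor.intro pregraded_ring_axioms)

lemma reg_coord_hom:
  assumes N: "pregraded_module R N"
  shows "reg_coord d N \<in> gmod_hom R (tensor_mod R (RegS d) N) (gr_shift d N)"
proof -
  interpret regular_tensor R N d by (rule regular_tensor[OF N])
  show ?thesis
    unfolding reg_coord_def
  proof (rule gmod_homI)
    show "\<epsilon> X \<in> gr_part (gr_shift d N) i" if "X \<in> gr_part T i" for i X
      using gr_part_eval[OF pregraded_module.gr_part_closed[OF tensor_pregraded that], of i] that by simp
  qed (simp_all add: E.lift_closed E.lift_add eval_smult)
qed

lemma reg_coord_pure_one:
  assumes N: "pregraded_module R N"
  shows "m \<in> carrier N \<Longrightarrow> reg_coord d N (pure_tensor R (RegS d) N \<one>\<^bsub>R\<^esub> m) = m"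
    and "X \<in> carrier (tensor_mod R (RegS d) N) \<Longrightarrow> pure_tensor R (RegS d) N \<one>\<^bsub>R\<^esub> (reg_coord d N X) = X"
proof -
  interpret regular_tensor R N d by (rule regular_tensor[OF N])
  show "m \<in> carrier N \<Longrightarrow> reg_coord d N (pure_tensor R (RegS d) N \<one>\<^bsub>R\<^esub> m) = m"
    "X \<in> carrier (tensor_mod R (RegS d) N) \<Longrightarrow> pure_tensor R (RegS d) N \<one>\<^bsub>R\<^esub> (reg_coord d N X) = X"
    unfolding reg_coord_def by (rule eval_pure_one pure_one_eval; assumption)+
qed

lemma pure_one_hom:
  fixes N :: "('k odd_poly, 'm) gmod"
  assumes N: "pregraded_module R N"
  shows "pure_tensor R (RegS d) N \<one>\<^bsub>R\<^esub> \<in> gmod_hom R (gr_shift d N) (tensor_mod R (RegS d) N)"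
proof -
  interpret regular_tensor R N d by (rule regular_tensor[OF N])
  show ?thesis
  proof (rule gmod_hom_inverse[OF tensor_pregraded reg_coord_hom[OF N]])
    show "X \<in> gr_part T i" if "X \<in> carrier T" "reg_coord d N X \<in> gr_part (gr_shift d N) i" for X i
      using gr_part_eval[OF that(1)] that(2) by (simp add: reg_coord_def)
    show "z \<in> carrier (gr_shift d N)" if "z \<in> gr_part (gr_shift d N) i" for i z
      using that N.gr_part_closed by auto
  qed (use reg_coord_pure_one[OF N] in auto)
qed

lemma reg_coord_natural:
  assumes N: "pregraded_module R N" "pregraded_module R N'" and g: "g \<in> gmod_hom R N N'"
    and X: "X \<in> carrier (tensor_mod R (RegS d) N)"
  shows "reg_coord d N' (tensor_map R (RegS d) N' (\<lambda>t. t) g X) = g (reg_coord d N X)"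
proof -
  interpret S: regular_tensor R N d by (rule regular_tensor[OF N(1)])
  interpret S': regular_tensor R N' d by (rule regular_tensor[OF N(2)])
  note t = S.bimodule_tensor_axioms S'.bimodule_tensor_axioms
  note h = gmod_homD[OF tensor_map_hom[OF t bimod_hom_ident g]]
  note hp = tensor_map_hom_pure[OF t bimod_hom_ident g]
  note gD = gmod_homD[OF g]
  show ?thesis
    unfolding reg_coord_def
    by (rule S.additive_eq[OF X S'.N.M.abelian_group_axioms])
      (simp_all add: h gD hp S.E.lift_closed S.E.lift_add S.E.lift_pure S'.E.lift_closed S'.E.lift_add S'.E.lift_pure
        S.N.smult_closed)
qed

lemma reg_tensor_graded:
  assumes "graded_left_module R (N :: ('k odd_poly, 'm) gmod)"
  shows "graded_left_module R (tensor_mod R (RegS d) N)"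
proof -
  have N: "pregraded_module R N" "direct_sum_graded N" using assms by (simp_all add: graded_left_module_iff)
  interpret regular_tensor R N d by (rule regular_tensor[OF N(1)])
  show ?thesis by (rule tensor_graded[OF N(2)])
qed

abbreviation "B_coords N \<equiv> tri_coords (odd_B k) b0 b1 N"
abbreviation "Btw_coords N \<equiv> tri_coords (odd_B_tw k) t0 t1 N"

text \<open>
  Multiplication is the first coordinate on \<open>B\<close> itself, and \<open>\<Delta>(1)\<close> is the second basis element; both facts persist after
  tensoring with a module.
\<close>

lemma odd_m_coords:
  assumes N: "pregraded_module R N" and X: "X \<in> carrier (tensor_mod R (odd_B k) N)"
  shows "reg_coord (-1) N (tensor_map R (RegS (-1)) N (odd_m k) (\<lambda>x. x) X) = fst (B_coords N X)"
proof -
  interpret S: right_basis2_tensor R R "odd_B k" B_one B_comm b0 b1 "-1" 1 N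
    by (rule basis2_tensor[OF B_triangular_basis _ N]) simp
  interpret S': regular_tensor R N "-1" by (rule regular_tensor[OF N])
  note t = S.bimodule_tensor_axioms S'.bimodule_tensor_axioms
  note h = gmod_homD[OF tensor_map_hom[OF t odd_m_hom gmod_hom_ident]]
  note hp = tensor_map_hom_pure[OF t odd_m_hom gmod_hom_ident]
  have "S'.\<epsilon> (tensor_map R (RegS (-1)) N (odd_m k) (\<lambda>x. x) X) = S.\<pi>0 X"
    by (rule S.additive_eq[OF X S.N.M.abelian_group_axioms])
      (use odd_m_eq S.coord_closed(1) in \<open>simp_all add: h hp S.E0.lift_closed S.E0.lift_add S.E0.lift_pure S'.E.lift_closed
        S'.E.lift_add S'.E.lift_pure del: odd_B_simps\<close>)
  thus ?thesis by (simp add: reg_coord_def tri_coords_def)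
qed

lemma odd_Delta_coords:
  assumes N: "pregraded_module R N" and X: "X \<in> carrier (tensor_mod R (RegS 1) N)"
  shows "Btw_coords N (tensor_map R (odd_B_tw k) N (odd_Delta k) (\<lambda>x. x) X) = (\<zero>\<^bsub>N\<^esub>, reg_coord 1 N X)"
proof -
  interpret S: right_basis2_tensor R R "odd_B_tw k" Btw_one Btw_Delta t0 t1 "-1" 1 N
    by (rule basis2_tensor[OF Btw_triangular_basis _ N]) (rule s_simps(1))
  interpret S': regular_tensor R N 1 by (rule regular_tensor[OF N])
  note t = S'.bimodule_tensor_axioms S.bimodule_tensor_axioms
  note h = gmod_homD[OF tensor_map_hom[OF t odd_Delta_hom gmod_hom_ident]]
  note hp = tensor_map_hom_pure[OF t odd_Delta_hom gmod_hom_ident]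
  have c: "t0 (odd_Delta k r) = \<zero>\<^bsub>R\<^esub>" "t1 (odd_Delta k r) = r" "odd_Delta k r \<in> carrier (odd_B_tw k)" if "r \<in> carrier R" for r
    using S.coord_right[OF S.basis_closed(2) that] S.rsmult_closed[OF S.basis_closed(2) that] that
    by (simp_all add: odd_Delta_eq S.coord_basis del: odd_B_tw_simps)
  have "S.\<pi>0 (tensor_map R (odd_B_tw k) N (odd_Delta k) (\<lambda>x. x) X) = \<zero>\<^bsub>N\<^esub>"
    by (rule S'.additive_eq[OF X S.N.M.abelian_group_axioms, where g = "\<lambda>X. \<zero>\<^bsub>N\<^esub>"])
      (simp_all add: h hp c S.E0.lift_closed S.E0.lift_add S.E0.lift_pure S.N.smult_zero_left del: odd_B_tw_simps)
  moreover have "S.\<pi>1 (tensor_map R (odd_B_tw k) N (odd_Delta k) (\<lambda>x. x) X) = S'.\<epsilon> X"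
    by (rule S'.additive_eq[OF X S.N.M.abelian_group_axioms])
      (simp_all add: h hp c S.E1.lift_closed S.E1.lift_add S.E1.lift_pure S'.E.lift_closed S'.E.lift_add S'.E.lift_pure
        del: odd_B_tw_simps)
  ultimately show ?thesis by (simp add: reg_coord_def tri_coords_def)
qed

subsection \<open>The functors\<close>

lemma rouquier_simps [simp]:
  "fst_deg (rouquier k) = 0" "fst_bimod (rouquier k) = odd_B k" "snd_bimod (rouquier k) = RegS (-1)" "two_map (rouquier k) = odd_m k"
  "fst_deg (rouquier' k) = -1" "fst_bimod (rouquier' k) = RegS 1" "snd_bimod (rouquier' k) = odd_B_tw k" "two_map (rouquier' k) = odd_Delta k"
  by (simp_all add: rouquier_def rouquier'_def)

lemma rouquier_functor: "two_term_functor TYPE('m) R (rouquier k)"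
  by (rule two_term_functor.intro)
    (use odd_B_bimodule graded_bimodule_gr_shift[OF Reg_bimodule(1)] odd_m_hom reg_tensor_graded
      tri_tensor_graded[OF B_triangular_basis] in simp_all)

lemma rouquier'_functor: "two_term_functor TYPE('m) R (rouquier' k)"
  by (rule two_term_functor.intro)
    (use odd_B_tw_bimodule graded_bimodule_gr_shift[OF Reg_bimodule(1)] odd_Delta_hom reg_tensor_graded
      tri_tensor_graded[OF Btw_triangular_basis] s_simps(1) in simp_all)

end

lemma gmod_sum_map:
  assumes "f \<in> gmod_hom R M M'" "g \<in> gmod_hom R N N'"
  shows "(\<lambda>(x, y). (f x, g y)) \<in> gmod_hom R (gmod_sum M N) (gmod_sum M' N')"
  by (rule gmod_homI) (auto simp: gmod_homD[OF assms(1)] gmod_homD[OF assms(2)])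

lemma gr_shift_map: "f \<in> gmod_hom R M N \<Longrightarrow> f \<in> gmod_hom R (gr_shift d M) (gr_shift d N)"
  by (rule gmod_homI) (simp_all add: gmod_homD)

context odd_poly
begin

text \<open>
  The two functors in coordinates. The term \<open>w - d v\<close> consists of the image of \<open>(w, m)\<close> under multiplication and the
  differential of \<open>X\<close> with the sign of cohomological degree \<open>1\<close>. In the other complex the element \<open>u\<close> has cohomological degree
  \<open>-1\<close>, and \<open>\<Delta>\<close> adds it to the second coordinate.
\<close>

definition cone :: "('k odd_poly, 'm) cpx \<Rightarrow> ('k odd_poly, ('m \<times> 'm) \<times> 'm) cpx" where
  "cone X = \<lparr>ob = \<lambda>n. gmod_sum (tri_mod (\<lambda>a. a) (ob X n)) (gr_shift (-1) (ob X (n - 1))),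
     diff = \<lambda>n ((w, m), v). ((diff X n w, diff X n m), w \<oplus>\<^bsub>ob X n\<^esub> \<ominus>\<^bsub>ob X n\<^esub> diff X (n - 1) v)\<rparr>"

definition cocone :: "('k odd_poly, 'm) cpx \<Rightarrow> ('k odd_poly, 'm \<times> ('m \<times> 'm)) cpx" where
  "cocone X = \<lparr>ob = \<lambda>n. gmod_sum (gr_shift 1 (ob X (n + 1))) (tri_mod s (ob X n)),
     diff = \<lambda>n (u, (w, m)). (\<ominus>\<^bsub>ob X (n + 1 + 1)\<^esub> diff X (n + 1) u, (diff X n w, diff X n m \<oplus>\<^bsub>ob X (n + 1)\<^esub> u))\<rparr>"

definition cone_map :: "(int \<Rightarrow> 'm \<Rightarrow> 'n) \<Rightarrow> int \<Rightarrow> ('m \<times> 'm) \<times> 'm \<Rightarrow> ('n \<times> 'n) \<times> 'n" where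
  "cone_map f n = (\<lambda>(z, v). (case z of (w, m) \<Rightarrow> (f n w, f n m), f (n - 1) v))"

definition cocone_map :: "(int \<Rightarrow> 'm \<Rightarrow> 'n) \<Rightarrow> int \<Rightarrow> 'm \<times> ('m \<times> 'm) \<Rightarrow> 'n \<times> ('n \<times> 'n)" where
  "cocone_map f n = (\<lambda>(u, z). (f (n + 1) u, case z of (w, m) \<Rightarrow> (f n w, f n m)))"

definition to_cone :: "('k odd_poly, 'm) cpx \<Rightarrow> int \<Rightarrow> ('k odd_B_elt \<times> 'm \<Rightarrow>\<^sub>0 int) set \<times> ('k odd_poly \<times> 'm \<Rightarrow>\<^sub>0 int) set \<Rightarrow> ('m \<times> 'm) \<times> 'm" where
  "to_cone X n = (\<lambda>(u, v). (B_coords (ob X n) u, reg_coord (-1) (ob X (n - 1)) v))"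

definition from_cone :: "('k odd_poly, 'm) cpx \<Rightarrow> int \<Rightarrow> ('m \<times> 'm) \<times> 'm \<Rightarrow> ('k odd_B_elt \<times> 'm \<Rightarrow>\<^sub>0 int) set \<times> ('k odd_poly \<times> 'm \<Rightarrow>\<^sub>0 int) set" where
  "from_cone X n = (\<lambda>(z, v). (tri_combine (odd_B k) B_one B_comm (ob X n) z, pure_tensor R (RegS (-1)) (ob X (n - 1)) \<one>\<^bsub>R\<^esub> v))"

definition to_cocone :: "('k odd_poly, 'm) cpx \<Rightarrow> int \<Rightarrow> ('k odd_poly \<times> 'm \<Rightarrow>\<^sub>0 int) set \<times> ('k odd_B_tw_elt \<times> 'm \<Rightarrow>\<^sub>0 int) set \<Rightarrow> 'm \<times> ('m \<times> 'm)" where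
  "to_cocone X n = (\<lambda>(u, v). (reg_coord 1 (ob X (n + 1)) u, Btw_coords (ob X n) v))"

definition from_cocone :: "('k odd_poly, 'm) cpx \<Rightarrow> int \<Rightarrow> 'm \<times> ('m \<times> 'm) \<Rightarrow> ('k odd_poly \<times> 'm \<Rightarrow>\<^sub>0 int) set \<times> ('k odd_B_tw_elt \<times> 'm \<Rightarrow>\<^sub>0 int) set" where
  "from_cocone X n = (\<lambda>(u, z). (pure_tensor R (RegS 1) (ob X (n + 1)) \<one>\<^bsub>R\<^esub> u, tri_combine (odd_B_tw k) Btw_one Btw_Delta (ob X n) z))"

abbreviation "F X \<equiv> tensor_cpx R (rouquier k) X"
abbreviation "F' X \<equiv> tensor_cpx R (rouquier' k) X"

lemma F_ob: "ob (F X) n = gmod_sum (tensor_mod R (odd_B k) (ob X n)) (tensor_mod R (RegS (-1)) (ob X (n - 1)))"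
  by (simp add: tensor_cpx_def Let_def)

lemma F'_ob: "ob (F' X) n = gmod_sum (tensor_mod R (RegS 1) (ob X (n + 1))) (tensor_mod R (odd_B_tw k) (ob X n))"
  by (simp add: tensor_cpx_def Let_def)

lemma F_diff: "diff (F X) n (u, v) = (tensor_map R (odd_B k) (ob X (n + 1)) (\<lambda>t. t) (diff X n) u,
    tensor_map R (RegS (-1)) (ob X n) (odd_m k) (\<lambda>x. x) u \<oplus>\<^bsub>tensor_mod R (RegS (-1)) (ob X n)\<^esub>
    \<ominus>\<^bsub>tensor_mod R (RegS (-1)) (ob X n)\<^esub> tensor_map R (RegS (-1)) (ob X n) (\<lambda>t. t) (diff X (n - 1)) v)"
  by (simp add: tensor_cpx_def Let_def signed_def)

lemma F'_diff: "diff (F' X) n (u, v) = (\<ominus>\<^bsub>tensor_mod R (RegS 1) (ob X (n + 1 + 1))\<^esub> tensor_map R (RegS 1) (ob X (n + 1 + 1)) (\<lambda>t. t) (diff X (n + 1)) u,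
    tensor_map R (odd_B_tw k) (ob X (n + 1)) (odd_Delta k) (\<lambda>x. x) u \<oplus>\<^bsub>tensor_mod R (odd_B_tw k) (ob X (n + 1))\<^esub>
    tensor_map R (odd_B_tw k) (ob X (n + 1)) (\<lambda>t. t) (diff X n) v)"
  by (simp add: tensor_cpx_def Let_def signed_def)

lemma F_map: "tensor_chain_map R (rouquier k) Y f n (u, v) = (tensor_map R (odd_B k) (ob Y n) (\<lambda>t. t) (f n) u,
    tensor_map R (RegS (-1)) (ob Y (n - 1)) (\<lambda>t. t) (f (n - 1)) v)"
  by (simp add: tensor_chain_map_def Let_def)

lemma F'_map: "tensor_chain_map R (rouquier' k) Y f n (u, v) = (tensor_map R (RegS 1) (ob Y (n + 1)) (\<lambda>t. t) (f (n + 1)) u,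
    tensor_map R (odd_B_tw k) (ob Y n) (\<lambda>t. t) (f n) v)"
  by (simp add: tensor_chain_map_def Let_def)

lemmas B_coords_hom = tri_coords_hom[OF B_triangular_basis] and Btw_coords_hom = tri_coords_hom[OF Btw_triangular_basis s_simps(1)]
lemmas B_natural = tri_coords_natural[OF B_triangular_basis] and Btw_natural = tri_coords_natural[OF Btw_triangular_basis s_simps(1)]

lemma B_tensor: "pregraded_module R N \<Longrightarrow> bimodule_tensor R R (odd_B k) N"
  "pregraded_module R N \<Longrightarrow> bimodule_tensor R R (odd_B_tw k) N"
  "pregraded_module R N \<Longrightarrow> bimodule_tensor R R (RegS d) N"
  by (intro bimodule_tensor.intro odd_B_bimodule odd_B_tw_bimodule graded_bimodule_gr_shift Reg_bimodule(1); assumption)+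

lemma tensor_abelian: "bimodule_tensor R R P N \<Longrightarrow> abelian_group (tensor_mod R P N)"
  by (rule tensor_pair.tensor_abelian_group[OF graded_bimodule_tensor_pair[OF bimodule_tensor.axioms]])

lemma F_cpx: "is_cpx R X \<Longrightarrow> is_cpx R (F X)" "is_cpx R X \<Longrightarrow> is_cpx R (F' X)"
  using strict_functor.ob_cpx[OF two_term_functor.strict[OF rouquier_functor]]
    strict_functor.ob_cpx[OF two_term_functor.strict[OF rouquier'_functor]] by blast+

context
  fixes X :: "('k odd_poly, 'm) cpx"
  assumes X: "is_cpx R X"
begin

lemma to_cone_chain: "to_cone X \<in> chain_maps R (F X) (cone X)"
proof (rule chain_mapsI)
  note N = is_cpxD(2)[OF X]
  show "to_cone X n \<in> gmod_hom R (ob (F X) n) (ob (cone X) n)" for n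
    unfolding to_cone_def F_ob cone_def cpx.simps
    by (rule gmod_sum_map[OF B_coords_hom reg_coord_hom]) (simp_all add: N)
  fix n z assume "z \<in> carrier (ob (F X) n)"
  then obtain u v where z: "z = (u, v)" "u \<in> carrier (tensor_mod R (odd_B k) (ob X n))"
    "v \<in> carrier (tensor_mod R (RegS (-1)) (ob X (n - 1)))"
    by (cases z) (simp add: F_ob)
  note d = is_cpxD(4)[OF X, of n] and d' = is_cpxD(5)[OF X, of n]
  note r = gmod_homD[OF reg_coord_hom[OF N, of "-1" n]]
  have ab: "abelian_group (tensor_mod R (RegS (-1)) (ob X n))" "abelian_group (gr_shift (-1) (ob X n))"
    by (rule tensor_abelian[OF B_tensor(3)[OF N]], rule abelian_group_cong[OF is_cpxD(3)[OF X, of n]]) simp_all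
  have m: "tensor_map R (RegS (-1)) (ob X n) (odd_m k) (\<lambda>x. x) u \<in> carrier (tensor_mod R (RegS (-1)) (ob X n))"
    by (rule gmod_homD(1)[OF tensor_map_hom[OF B_tensor(1)[OF N] B_tensor(3)[OF N] odd_m_hom gmod_hom_ident] z(2)])
  have dv: "tensor_map R (RegS (-1)) (ob X n) (\<lambda>t. t) (diff X (n - 1)) v \<in> carrier (tensor_mod R (RegS (-1)) (ob X n))"
    by (rule gmod_homD(1)[OF tensor_map_hom[OF B_tensor(3)[OF N] B_tensor(3)[OF N] bimod_hom_ident d'] z(3)])
  have mdv: "\<ominus>\<^bsub>tensor_mod R (RegS (-1)) (ob X n)\<^esub> tensor_map R (RegS (-1)) (ob X n) (\<lambda>t. t) (diff X (n - 1)) v \<in> carrier (tensor_mod R (RegS (-1)) (ob X n))"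
    by (rule abelian_group.a_inv_closed[OF ab(1) dv])
  show "to_cone X (n + 1) (diff (F X) n z) = diff (cone X) n (to_cone X n z)"
    using z
    by (simp add: to_cone_def F_diff cone_def B_natural[OF _ N N d z(2)] split_beta r(2)[OF m mdv] odd_m_coords[OF N z(2)]
        gmod_hom_minus[OF reg_coord_hom[OF N] ab dv] reg_coord_natural[OF N N d' z(3)])
qed

lemma from_cone_chain: "from_cone X \<in> chain_maps R (cone X) (F X)"
  and to_from_cone: "z \<in> carrier (ob (cone X) n) \<Longrightarrow> to_cone X n (from_cone X n z) = z"
  and from_to_cone: "x \<in> carrier (ob (F X) n) \<Longrightarrow> from_cone X n (to_cone X n x) = x"
proof -
  note N = is_cpxD(2)[OF X]
  show 1: "to_cone X n (from_cone X n z) = z" if "z \<in> carrier (ob (cone X) n)" for n z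
    using that tri_coords_combine(1)[OF B_triangular_basis _ N] reg_coord_pure_one(1)[OF N]
    by (auto simp: to_cone_def from_cone_def cone_def)
  show 2: "from_cone X n (to_cone X n x) = x" if "x \<in> carrier (ob (F X) n)" for n x
    using that tri_coords_combine(2)[OF B_triangular_basis _ N] reg_coord_pure_one(2)[OF N]
    by (auto simp: to_cone_def from_cone_def F_ob)
  have h: "from_cone X n \<in> gmod_hom R (ob (cone X) n) (ob (F X) n)" for n
    unfolding from_cone_def F_ob cone_def cpx.simps
    by (rule gmod_sum_map[OF tri_combine_hom[OF B_triangular_basis] pure_one_hom]) (simp_all add: N)
  show "from_cone X \<in> chain_maps R (cone X) (F X)"
    by (rule chain_maps_inverse[OF gmod_homD(1)[OF is_cpxD(4)[OF F_cpx(1)[OF X]]] to_cone_chain h 1 2])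
qed

lemma to_cocone_chain: "to_cocone X \<in> chain_maps R (F' X) (cocone X)"
proof (rule chain_mapsI)
  note N = is_cpxD(2)[OF X]
  show "to_cocone X n \<in> gmod_hom R (ob (F' X) n) (ob (cocone X) n)" for n
    unfolding to_cocone_def F'_ob cocone_def cpx.simps
    by (rule gmod_sum_map[OF reg_coord_hom Btw_coords_hom]) (simp_all add: N)
  fix n z assume "z \<in> carrier (ob (F' X) n)"
  then obtain u v where z: "z = (u, v)" "u \<in> carrier (tensor_mod R (RegS 1) (ob X (n + 1)))"
    "v \<in> carrier (tensor_mod R (odd_B_tw k) (ob X n))"
    by (cases z) (simp add: F'_ob)
  obtain m l where ml: "n + 1 = m" "m + 1 = l" by blast
  note z = z[unfolded ml]
  note d = is_cpxD(4)[OF X, of n, unfolded ml] and d' = is_cpxD(4)[OF X, of m, unfolded ml]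
  have ab: "abelian_group (tensor_mod R (RegS 1) (ob X l))" "abelian_group (gr_shift 1 (ob X l))"
    by (rule tensor_abelian[OF B_tensor(3)[OF N]], rule abelian_group_cong[OF is_cpxD(3)[OF X, of l]]) simp_all
  interpret M: abelian_group "ob X m" by (rule is_cpxD(3)[OF X])
  have D: "tensor_map R (odd_B_tw k) (ob X m) (odd_Delta k) (\<lambda>x. x) u \<in> carrier (tensor_mod R (odd_B_tw k) (ob X m))"
    by (rule gmod_homD(1)[OF tensor_map_hom[OF B_tensor(3)[OF N] B_tensor(2)[OF N] odd_Delta_hom gmod_hom_ident] z(2)])
  have dv: "tensor_map R (odd_B_tw k) (ob X m) (\<lambda>t. t) (diff X n) v \<in> carrier (tensor_mod R (odd_B_tw k) (ob X m))"
    by (rule gmod_homD(1)[OF tensor_map_hom[OF B_tensor(2)[OF N] B_tensor(2)[OF N] bimod_hom_ident d] z(3)])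
  have du: "tensor_map R (RegS 1) (ob X l) (\<lambda>t. t) (diff X m) u \<in> carrier (tensor_mod R (RegS 1) (ob X l))"
    by (rule gmod_homD(1)[OF tensor_map_hom[OF B_tensor(3)[OF N] B_tensor(3)[OF N] bimod_hom_ident d'] z(2)])
  obtain w0 m0 where wm: "Btw_coords (ob X n) v = (w0, m0)" "w0 \<in> carrier (ob X n)" "m0 \<in> carrier (ob X n)"
    using gmod_homD(1)[OF Btw_coords_hom[OF _ N] z(3)] by (cases "Btw_coords (ob X n) v") auto
  have ru: "reg_coord 1 (ob X m) u \<in> carrier (ob X m)" using gmod_homD(1)[OF reg_coord_hom[OF N] z(2)] by simp
  have c: "diff X n w0 \<in> carrier (ob X m)" "diff X n m0 \<in> carrier (ob X m)" using gmod_homD(1)[OF d] wm by auto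
  show "to_cocone X (n + 1) (diff (F' X) n z) = diff (cocone X) n (to_cocone X n z)"
    using wm ru c unfolding z(1) F'_diff cocone_def cpx.simps to_cocone_def prod.case ml
    by (simp add: z(1) to_cocone_def F'_diff cocone_def ml gmod_homD(2)[OF Btw_coords_hom[OF _ N] D dv] Btw_natural[OF _ N N d z(3)]
        odd_Delta_coords[OF N z(2)] gmod_hom_minus[OF reg_coord_hom[OF N] ab du] reg_coord_natural[OF N N d' z(2)] M.a_comm)
qed

lemma from_cocone_chain: "from_cocone X \<in> chain_maps R (cocone X) (F' X)"
  and to_from_cocone: "z \<in> carrier (ob (cocone X) n) \<Longrightarrow> to_cocone X n (from_cocone X n z) = z"
  and from_to_cocone: "x \<in> carrier (ob (F' X) n) \<Longrightarrow> from_cocone X n (to_cocone X n x) = x"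
proof -
  note N = is_cpxD(2)[OF X]
  show 1: "to_cocone X n (from_cocone X n z) = z" if "z \<in> carrier (ob (cocone X) n)" for n z
    using that tri_coords_combine(1)[OF Btw_triangular_basis s_simps(1) N] reg_coord_pure_one(1)[OF N]
    by (auto simp: to_cocone_def from_cocone_def cocone_def)
  show 2: "from_cocone X n (to_cocone X n x) = x" if "x \<in> carrier (ob (F' X) n)" for n x
    using that tri_coords_combine(2)[OF Btw_triangular_basis s_simps(1) N] reg_coord_pure_one(2)[OF N]
    by (auto simp: to_cocone_def from_cocone_def F'_ob)
  have h: "from_cocone X n \<in> gmod_hom R (ob (cocone X) n) (ob (F' X) n)" for n
    unfolding from_cocone_def F'_ob cocone_def cpx.simps
    by (rule gmod_sum_map[OF pure_one_hom tri_combine_hom[OF Btw_triangular_basis]]) (simp_all add: N s_simps(1))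
  show "from_cocone X \<in> chain_maps R (cocone X) (F' X)"
    by (rule chain_maps_inverse[OF gmod_homD(1)[OF is_cpxD(4)[OF F_cpx(2)[OF X]]] to_cocone_chain h 1 2])
qed

end

lemma to_cone_natural:
  assumes X: "is_cpx R X" and Y: "is_cpx R Y" and f: "f \<in> chain_maps R X Y" and "z \<in> carrier (ob (F X) n)"
  shows "to_cone Y n (tensor_chain_map R (rouquier k) Y f n z) = cone_map f n (to_cone X n z)"
proof -
  obtain u v where z: "z = (u, v)" "u \<in> carrier (tensor_mod R (odd_B k) (ob X n))"
    "v \<in> carrier (tensor_mod R (RegS (-1)) (ob X (n - 1)))"
    using assms(4) by (cases z) (simp add: F_ob)
  note N = is_cpxD(2)[OF X] is_cpxD(2)[OF Y] and fh = chain_mapsD(1)[OF f]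
  show ?thesis
    unfolding z(1) F_map to_cone_def cone_map_def
    by (simp add: split_beta B_natural[OF _ N fh z(2)] reg_coord_natural[OF N fh z(3)])
qed

lemma to_cocone_natural:
  assumes X: "is_cpx R X" and Y: "is_cpx R Y" and f: "f \<in> chain_maps R X Y" and "z \<in> carrier (ob (F' X) n)"
  shows "to_cocone Y n (tensor_chain_map R (rouquier' k) Y f n z) = cocone_map f n (to_cocone X n z)"
proof -
  obtain u v where z: "z = (u, v)" "u \<in> carrier (tensor_mod R (RegS 1) (ob X (n + 1)))"
    "v \<in> carrier (tensor_mod R (odd_B_tw k) (ob X n))"
    using assms(4) by (cases z) (simp add: F'_ob)
  note N = is_cpxD(2)[OF X] is_cpxD(2)[OF Y] and fh = chain_mapsD(1)[OF f]
  show ?thesis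
    unfolding z(1) F'_map to_cocone_def cocone_map_def
    by (simp add: split_beta Btw_natural[OF _ N fh z(3)] reg_coord_natural[OF N fh z(2)])
qed

lemma cone_abelian: "is_cpx R X \<Longrightarrow> abelian_group (ob (cone X) n)"
  unfolding cone_def cpx.simps
  by (intro gmod_sum_abelian_group tri_mod_abelian_group abelian_group_cong[of "ob X (n - 1)" "gr_shift (-1) (ob X (n - 1))"] is_cpxD(3)[of R X])
    simp_all

lemma cocone_abelian: "is_cpx R X \<Longrightarrow> abelian_group (ob (cocone X) n)"
  unfolding cocone_def cpx.simps
  by (intro gmod_sum_abelian_group tri_mod_abelian_group abelian_group_cong[of "ob X (n + 1)" "gr_shift 1 (ob X (n + 1))"] is_cpxD(3)[of R X])
    simp_all

lemma cone_map_hom: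
  assumes f: "\<And>n. f n \<in> gmod_hom R (ob X n) (ob Y n)"
    and smult: "\<And>n r x. \<lbrakk>r \<in> carrier R; x \<in> carrier (ob X n)\<rbrakk> \<Longrightarrow> r \<odot>\<^bsub>ob X n\<^esub> x \<in> carrier (ob X n)"
  shows "cone_map f n \<in> gmod_hom R (ob (cone X) n) (ob (cone Y) n)"
  unfolding cone_map_def cone_def cpx.simps
  by (rule gmod_sum_map[OF tri_mod_map[OF f] gr_shift_map[OF f]]) (simp_all add: smult)

lemma cone_map_chain:
  assumes X: "is_cpx R X" and Y: "\<And>n. abelian_group (ob Y n)" and f: "f \<in> chain_maps R X Y"
  shows "cone_map f \<in> chain_maps R (cone X) (cone Y)"
proof (rule chain_mapsI)
  note N = pregraded_module.axioms(1)[OF is_cpxD(2)[OF X]]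
  show "cone_map f n \<in> gmod_hom R (ob (cone X) n) (ob (cone Y) n)" for n
    by (rule cone_map_hom[OF chain_mapsD(1)[OF f] left_module.smult_closed[OF N]])
  note fD = gmod_homD[OF chain_mapsD(1)[OF f]] and fd = chain_mapsD(2)[OF f]
  note mn = gmod_hom_minus[OF chain_mapsD(1)[OF f] is_cpxD(3)[OF X] Y]
  fix n z assume "z \<in> carrier (ob (cone X) n)"
  then obtain w m v where z: "z = ((w, m), v)" "w \<in> carrier (ob X n)" "m \<in> carrier (ob X n)" "v \<in> carrier (ob X (n - 1))"
    by (auto simp: cone_def)
  have dv: "diff X (n - 1) v \<in> carrier (ob X n)" by (rule gmod_homD(1)[OF is_cpxD(5)[OF X] z(4)])
  have fdv: "f n (diff X (n - 1) v) = diff Y (n - 1) (f (n - 1) v)" using fd[OF z(4)] by simp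
  show "cone_map f (n + 1) (diff (cone X) n z) = diff (cone Y) n (cone_map f n z)"
    using z dv abelian_group.a_inv_closed[OF is_cpxD(3)[OF X] dv]
    by (simp add: cone_map_def cone_def fd fD(2) mn fdv)
qed

lemma cocone_map_hom:
  assumes f: "\<And>n. f n \<in> gmod_hom R (ob X n) (ob Y n)"
    and smult: "\<And>n r x. \<lbrakk>r \<in> carrier R; x \<in> carrier (ob X n)\<rbrakk> \<Longrightarrow> r \<odot>\<^bsub>ob X n\<^esub> x \<in> carrier (ob X n)"
  shows "cocone_map f n \<in> gmod_hom R (ob (cocone X) n) (ob (cocone Y) n)"
  unfolding cocone_map_def cocone_def cpx.simps
  by (rule gmod_sum_map[OF gr_shift_map[OF f] tri_mod_map[OF f s_simps(1)]]) (simp_all add: smult)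

lemma cocone_map_chain:
  assumes X: "is_cpx R X" and Y: "\<And>n. abelian_group (ob Y n)" and f: "f \<in> chain_maps R X Y"
  shows "cocone_map f \<in> chain_maps R (cocone X) (cocone Y)"
proof (rule chain_mapsI)
  note N = pregraded_module.axioms(1)[OF is_cpxD(2)[OF X]]
  show "cocone_map f n \<in> gmod_hom R (ob (cocone X) n) (ob (cocone Y) n)" for n
    by (rule cocone_map_hom[OF chain_mapsD(1)[OF f] left_module.smult_closed[OF N]])
  note fD = gmod_homD[OF chain_mapsD(1)[OF f]] and fd = chain_mapsD(2)[OF f]
  note mn = gmod_hom_minus[OF chain_mapsD(1)[OF f] is_cpxD(3)[OF X] Y]
  fix n z assume "z \<in> carrier (ob (cocone X) n)"
  then obtain w m u where z: "z = (u, (w, m))" "w \<in> carrier (ob X n)" "m \<in> carrier (ob X n)" "u \<in> carrier (ob X (n + 1))"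
    by (auto simp: cocone_def)
  obtain j l where jl: "n + 1 = j" "j + 1 = l" by blast
  note z = z[unfolded jl]
  have c: "diff X n m \<in> carrier (ob X j)" "diff X j u \<in> carrier (ob X l)"
    using gmod_homD(1)[OF is_cpxD(4)[OF X] z(3)] gmod_homD(1)[OF is_cpxD(4)[OF X] z(4)] by (simp_all add: jl)
  have fd': "f j (diff X n w) = diff Y n (f n w)" "f j (diff X n m) = diff Y n (f n m)" "f l (diff X j u) = diff Y j (f j u)"
    using fd[OF z(2)] fd[OF z(3)] fd[OF z(4)] by (simp_all add: jl)
  show "cocone_map f (n + 1) (diff (cocone X) n z) = diff (cocone Y) n (cocone_map f n z)"
    using z(2-4) c unfolding z(1) cocone_def cocone_map_def cpx.simps prod.case jl
    by (simp add: fD(2) mn fd')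
qed

end

section \<open>The deformation retractions\<close>

context odd_poly
begin

context
  fixes X :: "('k odd_poly, 'm) cpx"
  assumes X: "is_cpx R X"
begin

interpretation ob: pregraded_module R "ob X i" for i
  by (rule is_cpxD(2)[OF X])

lemmas ob_simps = ob.M.a_closed ob.M.zero_closed ob.M.a_inv_closed ob.M.l_zero ob.M.r_zero ob.M.r_neg ob.M.l_neg
  ob.M.minus_minus ob.M.a_inv_zero ob.M.minus_add ob.M.r_neg2

lemmas ob_ac = ob.M.a_assoc ob.M.a_comm ob.M.a_lcomm

lemmas ob_cancel = ob.M.cancel_between ob.M.cancel_between2 ob.M.cancel_end ob.M.cancel_end2

lemmas ob_smult = ob.smult_closed ob.smult_r_distr ob.smult_zero_right ob.smult_zero_left ob.smult_minus_right
  ob.smult_minus_left ob.gr_part_add ob.gr_part_zero ob.gr_part_minus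

lemma diff_simps:
  assumes "i + 1 = j"
  shows "x \<in> carrier (ob X i) \<Longrightarrow> diff X i x \<in> carrier (ob X j)"
    and "\<lbrakk>x \<in> carrier (ob X i); y \<in> carrier (ob X i)\<rbrakk> \<Longrightarrow> diff X i (x \<oplus>\<^bsub>ob X i\<^esub> y) = diff X i x \<oplus>\<^bsub>ob X j\<^esub> diff X i y"
    and "x \<in> carrier (ob X i) \<Longrightarrow> diff X i (\<ominus>\<^bsub>ob X i\<^esub> x) = \<ominus>\<^bsub>ob X j\<^esub> diff X i x"
    and "diff X i \<zero>\<^bsub>ob X i\<^esub> = \<zero>\<^bsub>ob X j\<^esub>"
  using gmod_homD(1,2)[OF is_cpxD(4)[OF X, of i]] gmod_hom_minus[OF is_cpxD(4)[OF X] is_cpxD(3)[OF X] is_cpxD(3)[OF X], of x i]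
    gmod_hom_zero[OF is_cpxD(4)[OF X] is_cpxD(3)[OF X] is_cpxD(3)[OF X], of i]
  unfolding assms by blast+

lemma cone_minus:
  "\<lbrakk>a0 \<in> carrier (ob X i); a1 \<in> carrier (ob X i); a2 \<in> carrier (ob X j)\<rbrakk> \<Longrightarrow>
    \<ominus>\<^bsub>gmod_sum (tri_mod \<sigma> (ob X i)) (gr_shift d (ob X j))\<^esub> ((a0, a1), a2) = ((\<ominus>\<^bsub>ob X i\<^esub> a0, \<ominus>\<^bsub>ob X i\<^esub> a1), \<ominus>\<^bsub>ob X j\<^esub> a2)"
  "\<lbrakk>a0 \<in> carrier (ob X i); a1 \<in> carrier (ob X i); a2 \<in> carrier (ob X j)\<rbrakk> \<Longrightarrow>
    \<ominus>\<^bsub>gmod_sum (gr_shift d (ob X j)) (tri_mod \<sigma> (ob X i))\<^esub> (a2, (a0, a1)) = (\<ominus>\<^bsub>ob X j\<^esub> a2, (\<ominus>\<^bsub>ob X i\<^esub> a0, \<ominus>\<^bsub>ob X i\<^esub> a1))"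
proof -
  have ab: "abelian_group (tri_mod \<sigma> (ob X i))" "abelian_group (gr_shift d (ob X j))"
    by (rule tri_mod_abelian_group[OF is_cpxD(3)[OF X]], rule abelian_group_cong[OF is_cpxD(3)[OF X, of j]]) simp_all
  show "\<lbrakk>a0 \<in> carrier (ob X i); a1 \<in> carrier (ob X i); a2 \<in> carrier (ob X j)\<rbrakk> \<Longrightarrow>
    \<ominus>\<^bsub>gmod_sum (tri_mod \<sigma> (ob X i)) (gr_shift d (ob X j))\<^esub> ((a0, a1), a2) = ((\<ominus>\<^bsub>ob X i\<^esub> a0, \<ominus>\<^bsub>ob X i\<^esub> a1), \<ominus>\<^bsub>ob X j\<^esub> a2)"
    "\<lbrakk>a0 \<in> carrier (ob X i); a1 \<in> carrier (ob X i); a2 \<in> carrier (ob X j)\<rbrakk> \<Longrightarrow>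
    \<ominus>\<^bsub>gmod_sum (gr_shift d (ob X j)) (tri_mod \<sigma> (ob X i))\<^esub> (a2, (a0, a1)) = (\<ominus>\<^bsub>ob X j\<^esub> a2, (\<ominus>\<^bsub>ob X i\<^esub> a0, \<ominus>\<^bsub>ob X i\<^esub> a1))"
    by (simp_all add: gmod_sum_minus ab tri_mod_minus is_cpxD(3)[OF X])
qed

end

subsection \<open>The cocone of a cone\<close>

abbreviation "CC X \<equiv> cocone (cone X)"

text \<open>
  An element of the cocone of the cone is a triple \<open>(a, (u, c))\<close> of elements of \<open>cone X\<close>, and each of these is a triple
  \<open>((a0, a1), a2)\<close> in turn. Scalars \<open>r\<close> act on \<open>u\<close> through \<open>s r\<close>, and \<open>c\<close> receives the correction \<open>\<partial>(s r) u\<close>. The entries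
  \<open>u1\<close> and \<open>c0\<close> both receive \<open>\<partial>(s r) u0\<close>, so that their difference is linear, as needed for the counit.
\<close>

definition unit_l :: "('k odd_poly, 'm) cpx \<Rightarrow> int \<Rightarrow> 'm \<Rightarrow> (('m \<times> 'm) \<times> 'm) \<times> ((('m \<times> 'm) \<times> 'm) \<times> (('m \<times> 'm) \<times> 'm))" where
  "unit_l X n x = (((\<zero>\<^bsub>ob X (n + 1)\<^esub>, \<zero>\<^bsub>ob X (n + 1)\<^esub>), x),
     ((\<zero>\<^bsub>ob X n\<^esub>, \<ominus>\<^bsub>ob X n\<^esub> x), \<zero>\<^bsub>ob X (n - 1)\<^esub>), ((\<ominus>\<^bsub>ob X n\<^esub> x, \<zero>\<^bsub>ob X n\<^esub>), \<zero>\<^bsub>ob X (n - 1)\<^esub>))"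

definition counit_l :: "('k odd_poly, 'm) cpx \<Rightarrow> int \<Rightarrow> (('m \<times> 'm) \<times> 'm) \<times> ((('m \<times> 'm) \<times> 'm) \<times> (('m \<times> 'm) \<times> 'm)) \<Rightarrow> 'm" where
  "counit_l X n = (\<lambda>(((a0, a1), a2), ((u0, u1), u2), ((c0, c1), c2)). a2 \<oplus>\<^bsub>ob X n\<^esub> (\<ominus>\<^bsub>ob X n\<^esub> u1 \<oplus>\<^bsub>ob X n\<^esub> c0))"

text \<open>
  The differential contains the identity from \<open>a0\<close> and \<open>a1\<close> to \<open>c0\<close> and \<open>c1\<close> and from \<open>u0\<close> and \<open>c0\<close> to \<open>u2\<close> and \<open>c2\<close>. The homotopy
  inverts these components; the term \<open>- u1\<close> in the place of \<open>a0\<close> and the entry \<open>c2\<close> in the place of \<open>u1\<close> make it linear.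
\<close>

definition homotopy_l :: "('k odd_poly, 'm) cpx \<Rightarrow> int \<Rightarrow> (('m \<times> 'm) \<times> 'm) \<times> ((('m \<times> 'm) \<times> 'm) \<times> (('m \<times> 'm) \<times> 'm)) \<Rightarrow>
    (('m \<times> 'm) \<times> 'm) \<times> ((('m \<times> 'm) \<times> 'm) \<times> (('m \<times> 'm) \<times> 'm))" where
  "homotopy_l X n = (\<lambda>(((a0, a1), a2), ((u0, u1), u2), ((c0, c1), c2)).
     (((c0 \<oplus>\<^bsub>ob X n\<^esub> \<ominus>\<^bsub>ob X n\<^esub> u1, c1), \<zero>\<^bsub>ob X (n - 1)\<^esub>),
      ((u2, c2), \<zero>\<^bsub>ob X (n - 1 - 1)\<^esub>), ((c2, \<zero>\<^bsub>ob X (n - 1)\<^esub>), \<zero>\<^bsub>ob X (n - 1 - 1)\<^esub>)))"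

context
  fixes X :: "('k odd_poly, 'm) cpx" and q p n m l :: int
  assumes X: "is_cpx R X"
    and idx: "n + 1 = m" "m + 1 = l" "m - 1 = n" "l - 1 = m" "n - 1 = p" "p + 1 = n" "p - 1 = q" "q + 1 = p"
begin

text \<open>
  The neighbouring degrees \<open>q\<close>, \<open>p\<close>, \<open>n\<close>, \<open>m\<close>, \<open>l\<close> have names of their own, since the simplifier would rearrange \<open>n + 1\<close> and its
  relatives inside the subscripts.
\<close>

lemmas simps_l = ob_simps[OF X] ob_smult[OF X] diff_simps[OF X] cone_minus[OF X] idx s_simps(1,4,9) dem_simps(1,4,9,11)

lemma CC_carrier:
  "z \<in> carrier (ob (CC X) n) \<longleftrightarrow> (\<exists>a0\<in>carrier (ob X m). \<exists>a1\<in>carrier (ob X m). \<exists>a2\<in>carrier (ob X n).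
     \<exists>u0\<in>carrier (ob X n). \<exists>u1\<in>carrier (ob X n). \<exists>u2\<in>carrier (ob X p).
     \<exists>c0\<in>carrier (ob X n). \<exists>c1\<in>carrier (ob X n). \<exists>c2\<in>carrier (ob X p).
     z = (((a0, a1), a2), ((u0, u1), u2), ((c0, c1), c2)))"
  by (auto simp: cone_def cocone_def idx)

lemma CC_ob: "ob (CC X) n = gmod_sum (gr_shift 1 (gmod_sum (tri_mod (\<lambda>a. a) (ob X m)) (gr_shift (-1) (ob X n))))
    (tri_mod s (gmod_sum (tri_mod (\<lambda>a. a) (ob X n)) (gr_shift (-1) (ob X p))))"
  by (simp add: cone_def cocone_def idx)

lemma CC_diff:
  assumes "a0 \<in> carrier (ob X m)" "a1 \<in> carrier (ob X m)" "a2 \<in> carrier (ob X n)"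
    "u0 \<in> carrier (ob X n)" "u1 \<in> carrier (ob X n)" "u2 \<in> carrier (ob X p)"
    "c0 \<in> carrier (ob X n)" "c1 \<in> carrier (ob X n)" "c2 \<in> carrier (ob X p)"
  shows "diff (CC X) n (((a0, a1), a2), ((u0, u1), u2), ((c0, c1), c2)) =
    (((\<ominus>\<^bsub>ob X l\<^esub> diff X m a0, \<ominus>\<^bsub>ob X l\<^esub> diff X m a1), \<ominus>\<^bsub>ob X m\<^esub> a0 \<oplus>\<^bsub>ob X m\<^esub> diff X n a2),
     ((diff X n u0, diff X n u1), u0 \<oplus>\<^bsub>ob X n\<^esub> \<ominus>\<^bsub>ob X n\<^esub> diff X p u2),
     ((diff X n c0 \<oplus>\<^bsub>ob X m\<^esub> a0, diff X n c1 \<oplus>\<^bsub>ob X m\<^esub> a1), c0 \<oplus>\<^bsub>ob X n\<^esub> \<ominus>\<^bsub>ob X n\<^esub> diff X p c2 \<oplus>\<^bsub>ob X n\<^esub> a2))"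
  using assms unfolding cone_def cocone_def cpx.simps prod.case idx
  by (simp add: simps_l)

lemma unit_l_hom: "unit_l X n \<in> gmod_hom R (ob X n) (ob (CC X) n)"
  unfolding CC_ob unit_l_def idx
  by (rule gmod_homI) (simp_all add: simps_l)

lemma unit_l_chain: "x \<in> carrier (ob X n) \<Longrightarrow> unit_l X (n + 1) (diff X n x) = diff (CC X) n (unit_l X n x)"
  unfolding unit_l_def idx by (simp add: CC_diff simps_l)

lemma counit_l_hom: "counit_l X n \<in> gmod_hom R (ob (CC X) n) (ob X n)"
  unfolding CC_ob counit_l_def
  by (rule gmod_homI) (auto simp: simps_l ob_ac[OF X] ob_cancel[OF X])

lemma counit_l_chain: "z \<in> carrier (ob (CC X) n) \<Longrightarrow> counit_l X (n + 1) (diff (CC X) n z) = diff X n (counit_l X n z)"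
  unfolding CC_carrier counit_l_def idx by (auto simp: CC_diff simps_l ob_ac[OF X] ob_cancel[OF X])

lemma counit_unit_l: "x \<in> carrier (ob X n) \<Longrightarrow> counit_l X n (unit_l X n x) = x"
  by (simp add: counit_l_def unit_l_def simps_l)

lemma CC_ob_prev: "ob (CC X) p = gmod_sum (gr_shift 1 (gmod_sum (tri_mod (\<lambda>a. a) (ob X n)) (gr_shift (-1) (ob X p))))
    (tri_mod s (gmod_sum (tri_mod (\<lambda>a. a) (ob X p)) (gr_shift (-1) (ob X q))))"
  by (simp add: cone_def cocone_def idx)

lemma CC_diff_prev:
  assumes "a0 \<in> carrier (ob X n)" "a1 \<in> carrier (ob X n)" "a2 \<in> carrier (ob X p)"
    "u0 \<in> carrier (ob X p)" "u1 \<in> carrier (ob X p)" "u2 \<in> carrier (ob X q)"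
    "c0 \<in> carrier (ob X p)" "c1 \<in> carrier (ob X p)" "c2 \<in> carrier (ob X q)"
  shows "diff (CC X) p (((a0, a1), a2), ((u0, u1), u2), ((c0, c1), c2)) =
    (((\<ominus>\<^bsub>ob X m\<^esub> diff X n a0, \<ominus>\<^bsub>ob X m\<^esub> diff X n a1), \<ominus>\<^bsub>ob X n\<^esub> a0 \<oplus>\<^bsub>ob X n\<^esub> diff X p a2),
     ((diff X p u0, diff X p u1), u0 \<oplus>\<^bsub>ob X p\<^esub> \<ominus>\<^bsub>ob X p\<^esub> diff X q u2),
     ((diff X p c0 \<oplus>\<^bsub>ob X n\<^esub> a0, diff X p c1 \<oplus>\<^bsub>ob X n\<^esub> a1), c0 \<oplus>\<^bsub>ob X p\<^esub> \<ominus>\<^bsub>ob X p\<^esub> diff X q c2 \<oplus>\<^bsub>ob X p\<^esub> a2))"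
  using assms unfolding cone_def cocone_def cpx.simps prod.case idx
  by (simp add: simps_l)

lemma homotopy_l_hom: "homotopy_l X n \<in> gmod_hom R (ob (CC X) n) (ob (CC X) p)"
  unfolding CC_ob CC_ob_prev homotopy_l_def idx
  by (rule gmod_homI) (auto simp: simps_l ob_ac[OF X] ob_cancel[OF X])

lemma homotopy_l:
  "z \<in> carrier (ob (CC X) n) \<Longrightarrow> z = unit_l X n (counit_l X n z) \<oplus>\<^bsub>ob (CC X) n\<^esub>
     (diff (CC X) p (homotopy_l X n z) \<oplus>\<^bsub>ob (CC X) n\<^esub> homotopy_l X m (diff (CC X) n z))"
  unfolding CC_carrier
  by (elim bexE, hypsubst)
    (simp add: CC_ob CC_diff unit_l_def counit_l_def homotopy_l_def idx simps_l CC_diff_prev ob_ac[OF X] ob_cancel[OF X])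

end

subsection \<open>The cone of a cocone\<close>

abbreviation "KC X \<equiv> cone (cocone X)"

text \<open>
  An element of the cone of the cocone is a pair of elements \<open>(a0, (u0, u1))\<close> and \<open>(a1, (c0, c1))\<close> of \<open>cocone X\<close>,
  followed by a third one, \<open>(a2, (v0, v1))\<close>. A scalar \<open>r\<close> adds \<open>\<partial>(s r) u0\<close> to \<open>u1\<close> and \<open>s(\<partial> r) u0\<close> to \<open>c0\<close>; these
  are opposite, so that the sum of \<open>u1\<close> and \<open>c0\<close> is linear.
\<close>

definition unit_r :: "('k odd_poly, 'm) cpx \<Rightarrow> int \<Rightarrow> 'm \<Rightarrow> (('m \<times> ('m \<times> 'm)) \<times> ('m \<times> ('m \<times> 'm))) \<times> ('m \<times> ('m \<times> 'm))" where
  "unit_r X n x = (((\<zero>\<^bsub>ob X (n + 1)\<^esub>, (\<zero>\<^bsub>ob X n\<^esub>, x)), (\<zero>\<^bsub>ob X (n + 1)\<^esub>, (\<ominus>\<^bsub>ob X n\<^esub> x, \<zero>\<^bsub>ob X n\<^esub>))),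
     (x, (\<zero>\<^bsub>ob X (n - 1)\<^esub>, \<zero>\<^bsub>ob X (n - 1)\<^esub>)))"

definition counit_r :: "('k odd_poly, 'm) cpx \<Rightarrow> int \<Rightarrow> (('m \<times> ('m \<times> 'm)) \<times> ('m \<times> ('m \<times> 'm))) \<times> ('m \<times> ('m \<times> 'm)) \<Rightarrow> 'm" where
  "counit_r X n = (\<lambda>(((a0, (u0, u1)), (a1, (c0, c1))), (a2, (v0, v1))). a2 \<oplus>\<^bsub>ob X n\<^esub> (\<ominus>\<^bsub>ob X n\<^esub> u1 \<oplus>\<^bsub>ob X n\<^esub> \<ominus>\<^bsub>ob X n\<^esub> c0))"

text \<open>
  Here the differential contains the identity from \<open>a0\<close> and \<open>a1\<close> to \<open>u1\<close> and \<open>c1\<close> and from \<open>u0\<close> and \<open>u1\<close> to \<open>v0\<close> and \<open>v1\<close>, to be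
  inverted up to the corrections that make the inverse linear.
\<close>

definition homotopy_r :: "('k odd_poly, 'm) cpx \<Rightarrow> int \<Rightarrow> (('m \<times> ('m \<times> 'm)) \<times> ('m \<times> ('m \<times> 'm))) \<times> ('m \<times> ('m \<times> 'm)) \<Rightarrow>
    (('m \<times> ('m \<times> 'm)) \<times> ('m \<times> ('m \<times> 'm))) \<times> ('m \<times> ('m \<times> 'm))" where
  "homotopy_r X n = (\<lambda>(((a0, (u0, u1)), (a1, (c0, c1))), (a2, (v0, v1))).
     (((u1 \<oplus>\<^bsub>ob X n\<^esub> c0, (v0, v1)), (c1, (\<ominus>\<^bsub>ob X (n - 1)\<^esub> v1, \<zero>\<^bsub>ob X (n - 1)\<^esub>))),
      (\<zero>\<^bsub>ob X (n - 1)\<^esub>, (\<zero>\<^bsub>ob X (n - 1 - 1)\<^esub>, \<zero>\<^bsub>ob X (n - 1 - 1)\<^esub>))))"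

context
  fixes X :: "('k odd_poly, 'm) cpx" and q p n m l :: int
  assumes X: "is_cpx R X"
    and idx: "n + 1 = m" "m + 1 = l" "m - 1 = n" "l - 1 = m" "n - 1 = p" "p + 1 = n" "p - 1 = q" "q + 1 = p"
begin

lemmas simps_r = ob_simps[OF X] ob_smult[OF X] diff_simps[OF X] cone_minus[OF X] idx s_simps(1,4,9) dem_simps(1,4,9,11)

lemma KC_carrier:
  "z \<in> carrier (ob (KC X) n) \<longleftrightarrow> (\<exists>a0\<in>carrier (ob X m). \<exists>u0\<in>carrier (ob X n). \<exists>u1\<in>carrier (ob X n).
     \<exists>a1\<in>carrier (ob X m). \<exists>c0\<in>carrier (ob X n). \<exists>c1\<in>carrier (ob X n).
     \<exists>a2\<in>carrier (ob X n). \<exists>v0\<in>carrier (ob X p). \<exists>v1\<in>carrier (ob X p).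
     z = (((a0, (u0, u1)), (a1, (c0, c1))), (a2, (v0, v1))))"
  by (auto simp: cone_def cocone_def idx)

lemma KC_ob: "ob (KC X) n = gmod_sum (tri_mod (\<lambda>a. a) (gmod_sum (gr_shift 1 (ob X m)) (tri_mod s (ob X n))))
    (gr_shift (-1) (gmod_sum (gr_shift 1 (ob X n)) (tri_mod s (ob X p))))"
  by (simp add: cone_def cocone_def idx)

lemma KC_ob_prev: "ob (KC X) p = gmod_sum (tri_mod (\<lambda>a. a) (gmod_sum (gr_shift 1 (ob X n)) (tri_mod s (ob X p))))
    (gr_shift (-1) (gmod_sum (gr_shift 1 (ob X p)) (tri_mod s (ob X q))))"
  by (simp add: cone_def cocone_def idx)

lemma KC_diff:
  assumes "a0 \<in> carrier (ob X m)" "u0 \<in> carrier (ob X n)" "u1 \<in> carrier (ob X n)"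
    "a1 \<in> carrier (ob X m)" "c0 \<in> carrier (ob X n)" "c1 \<in> carrier (ob X n)"
    "a2 \<in> carrier (ob X n)" "v0 \<in> carrier (ob X p)" "v1 \<in> carrier (ob X p)"
  shows "diff (KC X) n (((a0, (u0, u1)), (a1, (c0, c1))), (a2, (v0, v1))) =
    (((\<ominus>\<^bsub>ob X l\<^esub> diff X m a0, (diff X n u0, diff X n u1 \<oplus>\<^bsub>ob X m\<^esub> a0)),
      (\<ominus>\<^bsub>ob X l\<^esub> diff X m a1, (diff X n c0, diff X n c1 \<oplus>\<^bsub>ob X m\<^esub> a1))),
     (a0 \<oplus>\<^bsub>ob X m\<^esub> diff X n a2, (u0 \<oplus>\<^bsub>ob X n\<^esub> \<ominus>\<^bsub>ob X n\<^esub> diff X p v0,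
       u1 \<oplus>\<^bsub>ob X n\<^esub> \<ominus>\<^bsub>ob X n\<^esub> (diff X p v1 \<oplus>\<^bsub>ob X n\<^esub> a2))))"
  using assms unfolding cone_def cocone_def cpx.simps prod.case idx
  by (simp add: simps_r)

lemma KC_diff_prev:
  assumes "a0 \<in> carrier (ob X n)" "u0 \<in> carrier (ob X p)" "u1 \<in> carrier (ob X p)"
    "a1 \<in> carrier (ob X n)" "c0 \<in> carrier (ob X p)" "c1 \<in> carrier (ob X p)"
    "a2 \<in> carrier (ob X p)" "v0 \<in> carrier (ob X q)" "v1 \<in> carrier (ob X q)"
  shows "diff (KC X) p (((a0, (u0, u1)), (a1, (c0, c1))), (a2, (v0, v1))) =
    (((\<ominus>\<^bsub>ob X m\<^esub> diff X n a0, (diff X p u0, diff X p u1 \<oplus>\<^bsub>ob X n\<^esub> a0)),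
      (\<ominus>\<^bsub>ob X m\<^esub> diff X n a1, (diff X p c0, diff X p c1 \<oplus>\<^bsub>ob X n\<^esub> a1))),
     (a0 \<oplus>\<^bsub>ob X n\<^esub> diff X p a2, (u0 \<oplus>\<^bsub>ob X p\<^esub> \<ominus>\<^bsub>ob X p\<^esub> diff X q v0,
       u1 \<oplus>\<^bsub>ob X p\<^esub> \<ominus>\<^bsub>ob X p\<^esub> (diff X q v1 \<oplus>\<^bsub>ob X p\<^esub> a2))))"
  using assms unfolding cone_def cocone_def cpx.simps prod.case idx
  by (simp add: simps_r)

lemma unit_r_hom: "unit_r X n \<in> gmod_hom R (ob X n) (ob (KC X) n)"
  unfolding KC_ob unit_r_def idx
  by (rule gmod_homI) (simp_all add: simps_r)

lemma unit_r_chain: "x \<in> carrier (ob X n) \<Longrightarrow> unit_r X (n + 1) (diff X n x) = diff (KC X) n (unit_r X n x)"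
  unfolding unit_r_def idx by (simp add: KC_diff simps_r)

lemma counit_r_hom: "counit_r X n \<in> gmod_hom R (ob (KC X) n) (ob X n)"
  unfolding KC_ob counit_r_def
  by (rule gmod_homI) (auto simp: simps_r ob_ac[OF X] ob_cancel[OF X])

lemma counit_r_chain: "z \<in> carrier (ob (KC X) n) \<Longrightarrow> counit_r X (n + 1) (diff (KC X) n z) = diff X n (counit_r X n z)"
  unfolding KC_carrier counit_r_def idx by (auto simp: KC_diff simps_r ob_ac[OF X] ob_cancel[OF X])

lemma counit_unit_r: "x \<in> carrier (ob X n) \<Longrightarrow> counit_r X n (unit_r X n x) = x"
  by (simp add: counit_r_def unit_r_def simps_r)

lemma homotopy_r_hom: "homotopy_r X n \<in> gmod_hom R (ob (KC X) n) (ob (KC X) p)"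
  unfolding KC_ob KC_ob_prev homotopy_r_def idx
  by (rule gmod_homI) (auto simp: simps_r ob_ac[OF X] ob_cancel[OF X])

lemma homotopy_r:
  "z \<in> carrier (ob (KC X) n) \<Longrightarrow> z = unit_r X n (counit_r X n z) \<oplus>\<^bsub>ob (KC X) n\<^esub>
     (diff (KC X) p (homotopy_r X n z) \<oplus>\<^bsub>ob (KC X) n\<^esub> homotopy_r X m (diff (KC X) n z))"
  unfolding KC_carrier
  by (elim bexE, hypsubst)
    (simp add: KC_ob KC_diff unit_r_def counit_r_def homotopy_r_def idx simps_r KC_diff_prev ob_ac[OF X] ob_cancel[OF X])

end

end

section \<open>The equivalence\<close>

context odd_poly
begin

lemma counit_natural:
  assumes X: "is_cpx R X" and Y: "is_cpx R Y" and f: "f \<in> chain_maps R X Y"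
  shows "z \<in> carrier (ob (CC X) n) \<Longrightarrow> counit_l Y n (cocone_map (cone_map f) n z) = f n (counit_l X n z)"
    and "z' \<in> carrier (ob (KC X) n) \<Longrightarrow> counit_r Y n (cone_map (cocone_map f) n z') = f n (counit_r X n z')"
proof -
  note fD = gmod_homD(1,2)[OF chain_mapsD(1)[OF f]]
    and mn = gmod_hom_minus[OF chain_mapsD(1)[OF f] is_cpxD(3)[OF X] is_cpxD(3)[OF Y]]
  show "z \<in> carrier (ob (CC X) n) \<Longrightarrow> counit_l Y n (cocone_map (cone_map f) n z) = f n (counit_l X n z)"
    by (auto simp: cone_def cocone_def counit_l_def cone_map_def cocone_map_def fD(2) mn ob_simps[OF X])
  show "z' \<in> carrier (ob (KC X) n) \<Longrightarrow> counit_r Y n (cone_map (cocone_map f) n z') = f n (counit_r X n z')"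
    by (auto simp: cone_def cocone_def counit_r_def cone_map_def cocone_map_def fD(2) mn ob_simps[OF X])
qed

lemma index_eqs: "(n :: int) + 1 = n + 1" "n + 1 + 1 = n + 1 + 1" "n + 1 - 1 = n" "n + 1 + 1 - 1 = n + 1" "n - 1 = n - 1" "n - 1 + 1 = n" "n - 1 - 1 = n - 1 - 1" "n - 1 - 1 + 1 = n - 1"
  by simp_all

text \<open>
  The isomorphisms between the composite functors and their models: coordinates for the outer functor first, then those
  for the inner one in each entry.
\<close>

abbreviation "to_CC X n \<equiv> cocone_map (to_cone X) n \<circ> to_cocone (F X) n"
abbreviation "from_CC X n \<equiv> from_cocone (F X) n \<circ> cocone_map (from_cone X) n"
abbreviation "to_KC X n \<equiv> cone_map (to_cocone X) n \<circ> to_cone (F' X) n"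
abbreviation "from_KC X n \<equiv> from_cone (F' X) n \<circ> cone_map (from_cocone X) n"

lemma cone_map_inverse:
  assumes "\<And>n x. x \<in> carrier (ob A n) \<Longrightarrow> g n (f n x) = x"
  shows "z \<in> carrier (ob (cone A) n) \<Longrightarrow> cone_map g n (cone_map f n z) = z"
    and "z' \<in> carrier (ob (cocone A) n) \<Longrightarrow> cocone_map g n (cocone_map f n z') = z'"
  using assms by (auto simp: cone_map_def cocone_map_def cone_def cocone_def)

lemma cone_map_natural:
  assumes "\<And>n x. x \<in> carrier (ob A n) \<Longrightarrow> g n (f n x) = f' n (g' n x)"
  shows "z \<in> carrier (ob (cone A) n) \<Longrightarrow> cone_map g n (cone_map f n z) = cone_map f' n (cone_map g' n z)"
    and "z' \<in> carrier (ob (cocone A) n) \<Longrightarrow> cocone_map g n (cocone_map f n z') = cocone_map f' n (cocone_map g' n z')"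
  using assms by (auto simp: cone_map_def cocone_map_def cone_def cocone_def)

lemma cone_smult_closed:
  assumes X: "is_cpx R X"
  shows "\<lbrakk>r \<in> carrier R; z \<in> carrier (ob (cone X) n)\<rbrakk> \<Longrightarrow> r \<odot>\<^bsub>ob (cone X) n\<^esub> z \<in> carrier (ob (cone X) n)"
    and "\<lbrakk>r \<in> carrier R; z' \<in> carrier (ob (cocone X) n)\<rbrakk> \<Longrightarrow> r \<odot>\<^bsub>ob (cocone X) n\<^esub> z' \<in> carrier (ob (cocone X) n)"
  by (auto simp: cone_def cocone_def ob_simps[OF X] ob_smult[OF X] dem_simps(1) s_simps(1))

lemma rouquier'_rouquier:
  "kfunctors_isomorphic R (kfunctor_comp (tensor_functor R (rouquier' k)) (tensor_functor R (rouquier k)))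
    (kfunctor_id :: ('k odd_poly, 'm, 'm) kfunctor)"
  unfolding two_term_functor.tensor_functor_induced[OF rouquier_functor] two_term_functor.tensor_functor_induced[OF rouquier'_functor]
proof (rule inverse_kfunctor_retractI[OF two_term_functor.strict[OF rouquier_functor] two_term_functor.strict[OF rouquier'_functor],
      where C = CC and \<Phi> = to_CC and \<Psi> = from_CC and \<alpha> = unit_l and \<beta> = counit_l and h = homotopy_l and Cmap = "\<lambda>f. cocone_map (cone_map f)"])
  fix X Y :: "('k odd_poly, 'm) cpx" assume X: "is_cpx R X" and Y: "is_cpx R Y"
  note FX = F_cpx(1)[OF X] and FY = F_cpx(1)[OF Y]
  show "to_CC X \<in> chain_maps R (F' (F X)) (CC X)"
    by (rule chain_maps_comp[OF to_cocone_chain[OF FX] cocone_map_chain[OF FX cone_abelian[OF X] to_cone_chain[OF X]]])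
  show "from_CC X n \<in> gmod_hom R (ob (CC X) n) (ob (F' (F X)) n)" for n
    by (rule gmod_hom_comp[OF cocone_map_hom[OF chain_mapsD(1)[OF from_cone_chain[OF X]] cone_smult_closed(1)[OF X]]
          chain_mapsD(1)[OF from_cocone_chain[OF FX]]])
  show "unit_l X \<in> chain_maps R X (CC X)"
    by (rule chain_mapsI[OF unit_l_hom[OF X index_eqs] unit_l_chain[OF X index_eqs]])
  show "counit_l X \<in> chain_maps R (CC X) X"
    by (rule chain_mapsI[OF counit_l_hom[OF X index_eqs] counit_l_chain[OF X index_eqs]])
  show "counit_l X n (unit_l X n x) = x" if "x \<in> carrier (ob X n)" for n x
    by (rule counit_unit_l[OF X index_eqs that])
  show "counit_l Y n (cocone_map (cone_map f) n z) = f n (counit_l X n z)"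
    if "f \<in> chain_maps R X Y" "z \<in> carrier (ob (CC X) n)" for f n z
    by (rule counit_natural(1)[OF X Y that])
  show "homotopy_l X n \<in> gmod_hom R (ob (CC X) n) (ob (CC X) (n - 1))" for n
    by (rule homotopy_l_hom[OF X index_eqs])
  show "z = unit_l X n (counit_l X n z) \<oplus>\<^bsub>ob (CC X) n\<^esub>
     (diff (CC X) (n - 1) (homotopy_l X n z) \<oplus>\<^bsub>ob (CC X) n\<^esub> homotopy_l X (n + 1) (diff (CC X) n z))"
    if "z \<in> carrier (ob (CC X) n)" for n z
    by (rule homotopy_l[OF X index_eqs that])
  show "to_CC X n (from_CC X n z) = z" if "z \<in> carrier (ob (CC X) n)" for n z
  proof -
    have "cocone_map (to_cone X) n (cocone_map (from_cone X) n z) = z"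
      by (rule cone_map_inverse(2)[OF _ that]) (rule to_from_cone[OF X])
    thus ?thesis
      using gmod_homD(1)[OF cocone_map_hom[OF chain_mapsD(1)[OF from_cone_chain[OF X]] cone_smult_closed(1)[OF X]] that]
      by (simp add: to_from_cocone[OF FX])
  qed
  show "from_CC X n (to_CC X n z) = z" if "z \<in> carrier (ob (F' (F X)) n)" for n z
  proof -
    have "cocone_map (from_cone X) n (cocone_map (to_cone X) n (to_cocone (F X) n z)) = to_cocone (F X) n z"
      by (rule cone_map_inverse(2)[OF _ gmod_homD(1)[OF chain_mapsD(1)[OF to_cocone_chain[OF FX]] that]]) (rule from_to_cone[OF X])
    thus ?thesis by (simp add: from_to_cocone[OF FX that])
  qed
  show "to_CC Y n (tensor_chain_map R (rouquier' k) (F Y) (tensor_chain_map R (rouquier k) Y f) n z) =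
      cocone_map (cone_map f) n (to_CC X n z)"
    if f: "f \<in> chain_maps R X Y" and z: "z \<in> carrier (ob (F' (F X)) n)" for f n z
  proof -
    note Ff = strict_functor.map_chain[OF two_term_functor.strict[OF rouquier_functor] X Y f]
    have "cocone_map (to_cone Y) n (cocone_map (tensor_chain_map R (rouquier k) Y f) n (to_cocone (F X) n z)) =
        cocone_map (cone_map f) n (cocone_map (to_cone X) n (to_cocone (F X) n z))"
      by (rule cone_map_natural(2)[OF _ gmod_homD(1)[OF chain_mapsD(1)[OF to_cocone_chain[OF FX]] z]]) (rule to_cone_natural[OF X Y f])
    thus ?thesis by (simp add: to_cocone_natural[OF FX FY Ff z])
  qed
qed

lemma rouquier_rouquier':
  "kfunctors_isomorphic R (kfunctor_comp (tensor_functor R (rouquier k)) (tensor_functor R (rouquier' k)))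
    (kfunctor_id :: ('k odd_poly, 'm, 'm) kfunctor)"
  unfolding two_term_functor.tensor_functor_induced[OF rouquier_functor] two_term_functor.tensor_functor_induced[OF rouquier'_functor]
proof (rule inverse_kfunctor_retractI[OF two_term_functor.strict[OF rouquier'_functor] two_term_functor.strict[OF rouquier_functor],
      where C = KC and \<Phi> = to_KC and \<Psi> = from_KC and \<alpha> = unit_r and \<beta> = counit_r and h = homotopy_r and Cmap = "\<lambda>f. cone_map (cocone_map f)"])
  fix X Y :: "('k odd_poly, 'm) cpx" assume X: "is_cpx R X" and Y: "is_cpx R Y"
  note FX = F_cpx(2)[OF X] and FY = F_cpx(2)[OF Y]
  show "to_KC X \<in> chain_maps R (F (F' X)) (KC X)"
    by (rule chain_maps_comp[OF to_cone_chain[OF FX] cone_map_chain[OF FX cocone_abelian[OF X] to_cocone_chain[OF X]]])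
  show "from_KC X n \<in> gmod_hom R (ob (KC X) n) (ob (F (F' X)) n)" for n
    by (rule gmod_hom_comp[OF cone_map_hom[OF chain_mapsD(1)[OF from_cocone_chain[OF X]] cone_smult_closed(2)[OF X]]
          chain_mapsD(1)[OF from_cone_chain[OF FX]]])
  show "unit_r X \<in> chain_maps R X (KC X)"
    by (rule chain_mapsI[OF unit_r_hom[OF X index_eqs] unit_r_chain[OF X index_eqs]])
  show "counit_r X \<in> chain_maps R (KC X) X"
    by (rule chain_mapsI[OF counit_r_hom[OF X index_eqs] counit_r_chain[OF X index_eqs]])
  show "counit_r X n (unit_r X n x) = x" if "x \<in> carrier (ob X n)" for n x
    by (rule counit_unit_r[OF X index_eqs that])
  show "counit_r Y n (cone_map (cocone_map f) n z) = f n (counit_r X n z)"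
    if "f \<in> chain_maps R X Y" "z \<in> carrier (ob (KC X) n)" for f n z
    by (rule counit_natural(2)[OF X Y that])
  show "homotopy_r X n \<in> gmod_hom R (ob (KC X) n) (ob (KC X) (n - 1))" for n
    by (rule homotopy_r_hom[OF X index_eqs])
  show "z = unit_r X n (counit_r X n z) \<oplus>\<^bsub>ob (KC X) n\<^esub>
     (diff (KC X) (n - 1) (homotopy_r X n z) \<oplus>\<^bsub>ob (KC X) n\<^esub> homotopy_r X (n + 1) (diff (KC X) n z))"
    if "z \<in> carrier (ob (KC X) n)" for n z
    by (rule homotopy_r[OF X index_eqs that])
  show "to_KC X n (from_KC X n z) = z" if "z \<in> carrier (ob (KC X) n)" for n z
  proof -
    have "cone_map (to_cocone X) n (cone_map (from_cocone X) n z) = z"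
      by (rule cone_map_inverse(1)[OF _ that]) (rule to_from_cocone[OF X])
    thus ?thesis
      using gmod_homD(1)[OF cone_map_hom[OF chain_mapsD(1)[OF from_cocone_chain[OF X]] cone_smult_closed(2)[OF X]] that]
      by (simp add: to_from_cone[OF FX])
  qed
  show "from_KC X n (to_KC X n z) = z" if "z \<in> carrier (ob (F (F' X)) n)" for n z
  proof -
    have "cone_map (from_cocone X) n (cone_map (to_cocone X) n (to_cone (F' X) n z)) = to_cone (F' X) n z"
      by (rule cone_map_inverse(1)[OF _ gmod_homD(1)[OF chain_mapsD(1)[OF to_cone_chain[OF FX]] that]]) (rule from_to_cocone[OF X])
    thus ?thesis by (simp add: from_to_cone[OF FX that])
  qed
  show "to_KC Y n (tensor_chain_map R (rouquier k) (F' Y) (tensor_chain_map R (rouquier' k) Y f) n z) =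
      cone_map (cocone_map f) n (to_KC X n z)"
    if f: "f \<in> chain_maps R X Y" and z: "z \<in> carrier (ob (F (F' X)) n)" for f n z
  proof -
    note Ff = strict_functor.map_chain[OF two_term_functor.strict[OF rouquier'_functor] X Y f]
    have "cone_map (to_cocone Y) n (cone_map (tensor_chain_map R (rouquier' k) Y f) n (to_cone (F' X) n z)) =
        cone_map (cocone_map f) n (cone_map (to_cocone X) n (to_cone (F' X) n z))"
      by (rule cone_map_natural(1)[OF _ gmod_homD(1)[OF chain_mapsD(1)[OF to_cone_chain[OF FX]] z]]) (rule to_cocone_natural[OF X Y f])
    thus ?thesis by (simp add: to_cone_natural[OF FX FY Ff z])
  qed
qed

end

theorem corollary4p2:
  fixes k :: "('k, 'z) ring_scheme"
  assumes "cring k"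
  shows "is_kfunctor (odd_R k) (tensor_functor (odd_R k) (rouquier k) :: ('k odd_poly, 'm, _) kfunctor) \<and>
    is_kfunctor (odd_R k) (tensor_functor (odd_R k) (rouquier' k) :: ('k odd_poly, 'm, _) kfunctor) \<and>
    kfunctors_isomorphic (odd_R k)
      (kfunctor_comp (tensor_functor (odd_R k) (rouquier' k)) (tensor_functor (odd_R k) (rouquier k)))
      (kfunctor_id :: ('k odd_poly, 'm, 'm) kfunctor) \<and>
    kfunctors_isomorphic (odd_R k)
      (kfunctor_comp (tensor_functor (odd_R k) (rouquier k)) (tensor_functor (odd_R k) (rouquier' k)))
      (kfunctor_id :: ('k odd_poly, 'm, 'm) kfunctor)"
proof -
  interpret odd_poly k by (rule odd_poly.intro[OF assms])
  show ?thesis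
    using rouquier'_rouquier rouquier_rouquier'
      strict_functor.induced_kfunctor[OF two_term_functor.strict[OF rouquier_functor]]
      strict_functor.induced_kfunctor[OF two_term_functor.strict[OF rouquier'_functor]]
    unfolding two_term_functor.tensor_functor_induced[OF rouquier_functor] two_term_functor.tensor_functor_induced[OF rouquier'_functor]
    by blast
qed

end
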